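(* Let $H$ be a Hopf algebra with bijective antipode $S$ over a field $k$, let $A$ be a bialgebra over $k$, and suppose that $j : H \longrightarrow A$ and $\pi : A \longrightarrow H$ are bialgebra maps which satisfy $\pi\circ j = I_H$. Let $R = A^{co\,\pi}$ and let $(R, m, \eta, \Delta, \epsilon)$ be the bialgebra in ${}_H^H\mathcal{YD}$ associated to $(A, H, j, \pi)$. Then: (a) $j : H^{op} \longrightarrow A^{op}$ and $\pi : A^{op} \longrightarrow H^{op}$ are bialgebra maps which satisfy $\pi\circ j = I_{H^{op}}$, $R^{\underline{op}} = R$ as a vector space, and the bialgebra in ${}_{H^{op}}^{H^{op}}\mathcal{YD}$ associated to $(A^{op}, H^{op}, j, \pi)$ is $(R^{\underline{op}}, m^{\underline{op}}, \eta, \Delta^{\underline{op}}, \epsilon)$. (b) The map $\varphi : R^{\underline{op}}\# H^{op} \longrightarrow (R\# H)^{op}$ given by $\varphi(r\# h) = (1\# h)(r\# 1)$ (product taken in $R\# H$) for all $r \in R$ and $h \in H$ is an isomorphism of bialgebras. Furthermore $f\circ\varphi = g$, where $f : R\# H \longrightarrow A$ (regarded as a map $(R\# H)^{op} \longrightarrow A^{op}$) and $g : R^{\underline{op}}\# H^{op} \longrightarrow A^{op}$ are the canonical isomorphisms.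
   Context: Everything is over a field $k$. For an ordinary coalgebra write $\Delta(c) = c_{(1)}\otimes c_{(2)}$; for a left comodule write $\delta(m) = m_{(-1)}\otimes m_{(0)}$. $A^{op}$ denotes $A$ with opposite multiplication (same coalgebra structure); if $H$ has bijective antipode $S$, then $H^{op}$ is a Hopf algebra with antipode $S^{-1}$. Yetter–Drinfel'd modules. For a Hopf algebra $H$, ${}_H^H\mathcal{YD}$ is the category whose objects are left $H$-modules and left $H$-comodules $M$ with $h_{(1)}m_{(-1)}\otimes h_{(2)}\cdot m_{(0)} = (h_{(1)}\cdot m)_{(-1)}h_{(2)}\otimes (h_{(1)}\cdot m)_{(0)}$, and whose morphisms are module and comodule maps. It is monoidal with diagonal action and codiagonal coaction, with braiding $m\otimes n \mapsto m_{(-1)}\cdot n\otimes m_{(0)}$. Algebras and coalgebras in the category are those whose structure maps are morphisms; the coproduct of a coalgebra in the category is written $\Delta(c) = c^{(1)}\otimes c^{(2)}$. A bialgebra in the category is an algebra and coalgebra $R$ in the category such that $\epsilon$ and $\Delta: R\to R\otimes R$ are algebra maps, where $(a\otimes b)(a'\otimes b') = a(b_{(-1)}\cdot a')\otimes b_{(0)}b'$. Bi-product. For a bialgebra $R$ in ${}_H^H\mathcal{YD}$, $R\# H$ is the $k$-bialgebra $R\otimes H$ (with $r\# h = r\otimes h$) with unit $1\#1$, product $(r\# h)(r'\# h') = r(h_{(1)}\cdot r')\# h_{(2)}h'$, coproduct $\Delta(r\# h) = (r^{(1)}\# r^{(2)}_{\ (-1)}h_{(1)})\otimes(r^{(2)}_{\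 (0)}\# h_{(2)})$ and counit $\epsilon(r\# h) = \epsilon(r)\epsilon(h)$. Associated bialgebra. Given bialgebra maps $j : H\to A$, $\pi : A\to H$ with $\pi\circ j = I_H$ ($H$ a Hopf algebra with antipode $S$), let $\Pi(a) = a_{(1)}j(S(\pi(a_{(2)})))$. Then $A^{co\,\pi} = \{a\in A \mid a_{(1)}\otimes\pi(a_{(2)}) = a\otimes 1\} = \mathrm{Im}\,\Pi$. The bialgebra $R$ in ${}_H^H\mathcal{YD}$ associated to $(A,H,j,\pi)$ is $R = A^{co\,\pi}$ as a subalgebra of $A$, with coproduct $\Delta_R(r) = \Pi(r_{(1)})\otimes r_{(2)}$, counit $\epsilon|_R$, action $h\cdot r = j(h_{(1)})\,r\,j(S(h_{(2)}))$ and coaction $\delta(r) = \pi(r_{(1)})\otimes r_{(2)}$. The canonical isomorphism $R\# H\to A$ is the $k$-bialgebra isomorphism $r\# h\mapsto r j(h)$ (for $A^{op}$ the product is taken in $A^{op}$). The construction $R^{\underline{op}}$. For a bialgebra $(R,m,\eta,\Delta,\epsilon)$ in ${}_H^H\mathcal{YD}$ ($S$ bijective), $R^{\underline{op}}$ is the bialgebra in ${}_{H^{op}}^{H^{op}}\mathcal{YD}$ with underlying vector space $R$, action $h\cdot_{op}r = S^{-1}(h)\cdot r$, the same coaction $\delta$, product $m^{\underline{op}}(a\otimes b) = ba$, unit $\eta$, coproduct $\Delta^{\underline{op}}(r) = r^{(2)}_{\ (-1)}\cdot_{op} r^{(1)}\otimes r^{(2)}_{\ (0)}$ and counit $\epsilon$.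 *)

theory Defs
  imports "HOL-Algebra.Module" "HOL-Algebra.AbelCoset"
begin

text \<open>
  The base field is a field \<open>K\<close> of HOL-Algebra and a vector space is a module over \<open>K\<close>; the
  multiplicative part of the record of a module is ignored unless an algebra structure is assumed.
\<close>

section \<open>Linear maps and the tensor product\<close>

definition linear_hom ::
    "('k, 'x) ring_scheme \<Rightarrow> ('k, 'v, 'y) module_scheme \<Rightarrow> ('k, 'w, 'z) module_scheme \<Rightarrow> ('v \<Rightarrow> 'w) set"
  where "linear_hom K V W =
    {f \<in> carrier V \<rightarrow> carrier W.
      (\<forall>x\<in>carrier V. \<forall>y\<in>carrier V. f (x \<oplus>\<^bsub>V\<^esub> y) = f x \<oplus>\<^bsub>W\<^esub> f y) \<and>
      (\<forall>c\<in>carrier K. \<forall>x\<in>carrier V. f (c \<odot>\<^bsub>V\<^esub> x) = c \<odot>\<^bsub>W\<^esub> f x)}"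

text \<open>\<open>K\<close> as a module (and algebra) over itself.\<close>

definition self_module :: "('k, 'x) ring_scheme \<Rightarrow> ('k, 'k) module"
  where "self_module K =
    \<lparr>carrier = carrier K, mult = mult K, one = \<one>\<^bsub>K\<^esub>, zero = \<zero>\<^bsub>K\<^esub>, add = add K, smult = mult K\<rparr>"

definition free_module :: "('k, 'x) ring_scheme \<Rightarrow> 'b set \<Rightarrow> ('k, 'b \<Rightarrow> 'k) module"
  where "free_module K B =
    \<lparr>carrier = {x. (\<forall>b. x b \<in> carrier K) \<and> finite {b. x b \<noteq> \<zero>\<^bsub>K\<^esub>} \<and> {b. x b \<noteq> \<zero>\<^bsub>K\<^esub>} \<subseteq> B},
     mult = undefined, one = undefined,
     zero = (\<lambda>b. \<zero>\<^bsub>K\<^esub>),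
     add = (\<lambda>x y b. x b \<oplus>\<^bsub>K\<^esub> y b),
     smult = (\<lambda>c x b. c \<otimes>\<^bsub>K\<^esub> x b)\<rparr>"

definition free_gen :: "('k, 'x) ring_scheme \<Rightarrow> 'b \<Rightarrow> 'b \<Rightarrow> 'k"
  where "free_gen K b = (\<lambda>b'. if b' = b then \<one>\<^bsub>K\<^esub> else \<zero>\<^bsub>K\<^esub>)"

definition tensor_free ::
    "('k, 'x) ring_scheme \<Rightarrow> ('k, 'v, 'y) module_scheme \<Rightarrow> ('k, 'w, 'z) module_scheme
      \<Rightarrow> ('k, 'v \<times> 'w \<Rightarrow> 'k) module"
  where "tensor_free K V W = free_module K (carrier V \<times> carrier W)"

text \<open>The submodule generated by the relations expressing that \<open>(v, w) \<mapsto> v \<otimes> w\<close> is bilinear.\<close>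

definition tensor_rel ::
    "('k, 'x) ring_scheme \<Rightarrow> ('k, 'v, 'y) module_scheme \<Rightarrow> ('k, 'w, 'z) module_scheme
      \<Rightarrow> ('v \<times> 'w \<Rightarrow> 'k) set"
  where "tensor_rel K V W = (let F = tensor_free K V W in
    \<Inter>{U. submodule U K F \<and>
      (\<forall>v\<in>carrier V. \<forall>v'\<in>carrier V. \<forall>w\<in>carrier W.
        free_gen K (v \<oplus>\<^bsub>V\<^esub> v', w) \<ominus>\<^bsub>F\<^esub> (free_gen K (v, w) \<oplus>\<^bsub>F\<^esub> free_gen K (v', w)) \<in> U) \<and>
      (\<forall>v\<in>carrier V. \<forall>w\<in>carrier W. \<forall>w'\<in>carrier W.
        free_gen K (v, w \<oplus>\<^bsub>W\<^esub> w') \<ominus>\<^bsub>F\<^esub> (free_gen K (v, w) \<oplus>\<^bsub>F\<^esub> free_gen K (v, w')) \<in> U) \<and>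
      (\<forall>c\<in>carrier K. \<forall>v\<in>carrier V. \<forall>w\<in>carrier W.
        free_gen K (c \<odot>\<^bsub>V\<^esub> v, w) \<ominus>\<^bsub>F\<^esub> (c \<odot>\<^bsub>F\<^esub> free_gen K (v, w)) \<in> U) \<and>
      (\<forall>c\<in>carrier K. \<forall>v\<in>carrier V. \<forall>w\<in>carrier W.
        free_gen K (v, c \<odot>\<^bsub>W\<^esub> w) \<ominus>\<^bsub>F\<^esub> (c \<odot>\<^bsub>F\<^esub> free_gen K (v, w)) \<in> U)})"

type_synonym ('k, 'v, 'w) tensor = "('v \<times> 'w \<Rightarrow> 'k) set"

definition tensor_space ::
    "('k, 'x) ring_scheme \<Rightarrow> ('k, 'v, 'y) module_scheme \<Rightarrow> ('k, 'w, 'z) module_scheme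
      \<Rightarrow> ('k, ('k, 'v, 'w) tensor) module"
  where "tensor_space K V W = (let F = tensor_free K V W; U = tensor_rel K V W in
    \<lparr>carrier = a_rcosets\<^bsub>F\<^esub> U,
     mult = undefined, one = undefined,
     zero = U,
     add = set_add F,
     smult = (\<lambda>c X. \<Union>x\<in>X. U +>\<^bsub>F\<^esub> (c \<odot>\<^bsub>F\<^esub> x))\<rparr>)"

definition tens ::
    "('k, 'x) ring_scheme \<Rightarrow> ('k, 'v, 'y) module_scheme \<Rightarrow> ('k, 'w, 'z) module_scheme
      \<Rightarrow> 'v \<Rightarrow> 'w \<Rightarrow> ('k, 'v, 'w) tensor"
  where "tens K V W v w = tensor_rel K V W +>\<^bsub>tensor_free K V W\<^esub> free_gen K (v, w)"

text \<open>
  The linear map into \<open>X\<close> that sends \<open>v \<otimes> w\<close> to \<open>f v w\<close>, for bilinear \<open>f\<close>; only then is the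
  value independent of the representative. It also renders Sweedler notation: if \<open>t\<close> is written
  \<open>t\<^sub>1 \<otimes> t\<^sub>2\<close>, then \<open>tlift K X f t\<close> is \<open>f t\<^sub>1 t\<^sub>2\<close>.
\<close>

definition tlift ::
    "('k, 'x) ring_scheme \<Rightarrow> ('k, 'u, 'y) module_scheme \<Rightarrow> ('v \<Rightarrow> 'w \<Rightarrow> 'u)
      \<Rightarrow> ('k, 'v, 'w) tensor \<Rightarrow> 'u"
  where "tlift K X f t = (let x = (SOME x. x \<in> t) in
    \<Oplus>\<^bsub>X\<^esub>p\<in>{p. x p \<noteq> \<zero>\<^bsub>K\<^esub>}. x p \<odot>\<^bsub>X\<^esub> f (fst p) (snd p))"

text \<open>
  For subspaces \<open>V'\<close> of \<open>V\<close> and \<open>W'\<close> of \<open>W\<close> the canonical map from \<open>V' \<otimes> W'\<close> to \<open>V \<otimes> W\<close> is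
  injective, but not an inclusion of sets; \<open>tensor_restrict\<close> is its inverse on its image.
\<close>

definition tensor_restrict ::
    "('k, 'x) ring_scheme \<Rightarrow> ('k, 'v, 'y) module_scheme \<Rightarrow> ('k, 'w, 'z) module_scheme
      \<Rightarrow> ('k, 'v, 'y) module_scheme \<Rightarrow> ('k, 'w, 'z) module_scheme
      \<Rightarrow> ('k, 'v, 'w) tensor \<Rightarrow> ('k, 'v, 'w) tensor"
  where "tensor_restrict K V W V' W' =
    inv_into (carrier (tensor_space K V' W')) (tlift K (tensor_space K V W) (tens K V W))"


section \<open>Algebras, coalgebras, bialgebras and Hopf algebras\<close>

locale k_algebra = field K + module K A + ring A
  for K :: "('k, 'x) ring_scheme" and A :: "('k, 'a, 'y) module_scheme" +
  assumes smult_mult_left: "\<lbrakk>c \<in> carrier K; x \<in> carrier A; y \<in> carrier A\<rbrakk>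
      \<Longrightarrow> (c \<odot>\<^bsub>A\<^esub> x) \<otimes>\<^bsub>A\<^esub> y = c \<odot>\<^bsub>A\<^esub> (x \<otimes>\<^bsub>A\<^esub> y)"
    and smult_mult_right: "\<lbrakk>c \<in> carrier K; x \<in> carrier A; y \<in> carrier A\<rbrakk>
      \<Longrightarrow> x \<otimes>\<^bsub>A\<^esub> (c \<odot>\<^bsub>A\<^esub> y) = c \<odot>\<^bsub>A\<^esub> (x \<otimes>\<^bsub>A\<^esub> y)"

definition algebra_hom ::
    "('k, 'x) ring_scheme \<Rightarrow> ('k, 'a, 'y) module_scheme \<Rightarrow> ('k, 'b, 'z) module_scheme \<Rightarrow> ('a \<Rightarrow> 'b) set"
  where "algebra_hom K A B =
    {f \<in> linear_hom K A B. f \<one>\<^bsub>A\<^esub> = \<one>\<^bsub>B\<^esub> \<and>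
      (\<forall>x\<in>carrier A. \<forall>y\<in>carrier A. f (x \<otimes>\<^bsub>A\<^esub> y) = f x \<otimes>\<^bsub>B\<^esub> f y)}"

definition tensor_algebra ::
    "('k, 'x) ring_scheme \<Rightarrow> ('k, 'a, 'y) module_scheme \<Rightarrow> ('k, 'b, 'z) module_scheme
      \<Rightarrow> ('k, ('k, 'a, 'b) tensor) module"
  where "tensor_algebra K A B = (let T = tensor_space K A B in
    T\<lparr>mult := (\<lambda>t u. tlift K T (\<lambda>a b. tlift K T (\<lambda>a' b'.
                tens K A B (a \<otimes>\<^bsub>A\<^esub> a') (b \<otimes>\<^bsub>B\<^esub> b')) u) t),
      one := tens K A B \<one>\<^bsub>A\<^esub> \<one>\<^bsub>B\<^esub>\<rparr>)"

locale k_coalgebra = field K + module K C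
  for K :: "('k, 'x) ring_scheme" and C :: "('k, 'c, 'y) module_scheme"
    and \<Delta> :: "'c \<Rightarrow> ('k, 'c, 'c) tensor" and \<epsilon> :: "'c \<Rightarrow> 'k" +
  assumes comult_linear: "\<Delta> \<in> linear_hom K C (tensor_space K C C)"
    and counit_linear: "\<epsilon> \<in> linear_hom K C (self_module K)"
    and coassoc: "c \<in> carrier C \<Longrightarrow>
      tlift K (tensor_space K C (tensor_space K C C)) (\<lambda>x c3.
        tlift K (tensor_space K C (tensor_space K C C)) (\<lambda>c1 c2.
          tens K C (tensor_space K C C) c1 (tens K C C c2 c3)) (\<Delta> x)) (\<Delta> c) =
      tlift K (tensor_space K C (tensor_space K C C)) (\<lambda>c1 x.
        tlift K (tensor_space K C (tensor_space K C C)) (\<lambda>c2 c3.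
          tens K C (tensor_space K C C) c1 (tens K C C c2 c3)) (\<Delta> x)) (\<Delta> c)"
    and counit_left: "c \<in> carrier C \<Longrightarrow> tlift K C (\<lambda>c1 c2. \<epsilon> c1 \<odot>\<^bsub>C\<^esub> c2) (\<Delta> c) = c"
    and counit_right: "c \<in> carrier C \<Longrightarrow> tlift K C (\<lambda>c1 c2. \<epsilon> c2 \<odot>\<^bsub>C\<^esub> c1) (\<Delta> c) = c"

record ('k, 'a) bialg = "('k, 'a) module" +
  comult :: "'a \<Rightarrow> ('k, 'a, 'a) tensor"
  counit :: "'a \<Rightarrow> 'k"

locale bialgebra = k_algebra K A + k_coalgebra K A "comult A" "counit A"
  for K :: "('k, 'x) ring_scheme" and A :: "('k, 'a, 'y) bialg_scheme" +
  assumes comult_hom: "comult A \<in> algebra_hom K A (tensor_algebra K A A)"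
    and counit_hom: "counit A \<in> algebra_hom K A (self_module K)"

locale hopf_algebra = bialgebra K H
  for K :: "('k, 'x) ring_scheme" and H :: "('k, 'h, 'y) bialg_scheme" and S :: "'h \<Rightarrow> 'h" +
  assumes antipode_linear: "S \<in> linear_hom K H H"
    and antipode_left: "h \<in> carrier H \<Longrightarrow>
      tlift K H (\<lambda>h1 h2. S h1 \<otimes>\<^bsub>H\<^esub> h2) (comult H h) = counit H h \<odot>\<^bsub>H\<^esub> \<one>\<^bsub>H\<^esub>"
    and antipode_right: "h \<in> carrier H \<Longrightarrow>
      tlift K H (\<lambda>h1 h2. h1 \<otimes>\<^bsub>H\<^esub> S h2) (comult H h) = counit H h \<odot>\<^bsub>H\<^esub> \<one>\<^bsub>H\<^esub>"

definition bialgebra_hom ::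
    "('k, 'x) ring_scheme \<Rightarrow> ('k, 'a, 'y) bialg_scheme \<Rightarrow> ('k, 'b, 'z) bialg_scheme \<Rightarrow> ('a \<Rightarrow> 'b) set"
  where "bialgebra_hom K A B =
    {f \<in> algebra_hom K A B. bialgebra K A \<and> bialgebra K B \<and>
      (\<forall>a\<in>carrier A. comult B (f a) =
        tlift K (tensor_space K B B) (\<lambda>a1 a2. tens K B B (f a1) (f a2)) (comult A a)) \<and>
      (\<forall>a\<in>carrier A. counit B (f a) = counit A a)}"

definition bialgebra_iso ::
    "('k, 'x) ring_scheme \<Rightarrow> ('k, 'a, 'y) bialg_scheme \<Rightarrow> ('k, 'b, 'z) bialg_scheme \<Rightarrow> ('a \<Rightarrow> 'b) set"
  where "bialgebra_iso K A B = {f \<in> bialgebra_hom K A B. bij_betw f (carrier A) (carrier B)}"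

definition op_alg :: "('k, 'a, 'y) bialg_scheme \<Rightarrow> ('k, 'a, 'y) bialg_scheme"
  where "op_alg A = A\<lparr>mult := (\<lambda>x y. y \<otimes>\<^bsub>A\<^esub> x)\<rparr>"


section \<open>Yetter--Drinfel'd modules and bialgebras\<close>

record ('k, 'h, 'm) yd = "('k, 'm) module" +
  act :: "'h \<Rightarrow> 'm \<Rightarrow> 'm"
  coact :: "'m \<Rightarrow> ('k, 'h, 'm) tensor"

locale yd_module = hopf_algebra K H S + M: module K M
  for K :: "('k, 'x) ring_scheme" and H :: "('k, 'h, 'y) bialg_scheme" and S :: "'h \<Rightarrow> 'h"
    and M :: "('k, 'h, 'm, 'z) yd_scheme" +
  assumes act_linear: "h \<in> carrier H \<Longrightarrow> act M h \<in> linear_hom K M M"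
    and act_linear_left: "m \<in> carrier M \<Longrightarrow> (\<lambda>h. act M h m) \<in> linear_hom K H M"
    and act_one: "m \<in> carrier M \<Longrightarrow> act M \<one>\<^bsub>H\<^esub> m = m"
    and act_mult: "\<lbrakk>h \<in> carrier H; h' \<in> carrier H; m \<in> carrier M\<rbrakk>
      \<Longrightarrow> act M (h \<otimes>\<^bsub>H\<^esub> h') m = act M h (act M h' m)"
    and coact_linear: "coact M \<in> linear_hom K M (tensor_space K H M)"
    and coact_counit: "m \<in> carrier M \<Longrightarrow>
      tlift K M (\<lambda>m1 m0. counit H m1 \<odot>\<^bsub>M\<^esub> m0) (coact M m) = m"
    and coact_coassoc: "m \<in> carrier M \<Longrightarrow>
      tlift K (tensor_space K H (tensor_space K H M)) (\<lambda>x m0.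
        tlift K (tensor_space K H (tensor_space K H M)) (\<lambda>x1 x2.
          tens K H (tensor_space K H M) x1 (tens K H M x2 m0)) (comult H x)) (coact M m) =
      tlift K (tensor_space K H (tensor_space K H M)) (\<lambda>x n.
        tlift K (tensor_space K H (tensor_space K H M)) (\<lambda>n1 n0.
          tens K H (tensor_space K H M) x (tens K H M n1 n0)) (coact M n)) (coact M m)"
    and yd_compat: "\<lbrakk>h \<in> carrier H; m \<in> carrier M\<rbrakk> \<Longrightarrow>
      tlift K (tensor_space K H M) (\<lambda>h1 h2.
        tlift K (tensor_space K H M) (\<lambda>m1 m0.
          tens K H M (h1 \<otimes>\<^bsub>H\<^esub> m1) (act M h2 m0)) (coact M m)) (comult H h) =
      tlift K (tensor_space K H M) (\<lambda>h1 h2.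
        tlift K (tensor_space K H M) (\<lambda>n1 n0.
          tens K H M (n1 \<otimes>\<^bsub>H\<^esub> h2) n0) (coact M (act M h1 m))) (comult H h)"

definition yd_hom ::
    "('k, 'x) ring_scheme \<Rightarrow> ('k, 'h, 'y) bialg_scheme \<Rightarrow> ('k, 'h, 'm, 'z) yd_scheme
      \<Rightarrow> ('k, 'h, 'n, 'w) yd_scheme \<Rightarrow> ('m \<Rightarrow> 'n) set"
  where "yd_hom K H M N =
    {f \<in> linear_hom K M N.
      (\<forall>h\<in>carrier H. \<forall>m\<in>carrier M. f (act M h m) = act N h (f m)) \<and>
      (\<forall>m\<in>carrier M. coact N (f m) =
        tlift K (tensor_space K H N) (\<lambda>m1 m0. tens K H N m1 (f m0)) (coact M m))}"

text \<open>The unit object of the monoidal category.\<close>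

definition yd_unit :: "('k, 'x) ring_scheme \<Rightarrow> ('k, 'h, 'y) bialg_scheme \<Rightarrow> ('k, 'h, 'k) yd"
  where "yd_unit K H = module.extend (self_module K)
    \<lparr>act = (\<lambda>h c. counit H h \<otimes>\<^bsub>K\<^esub> c), coact = (\<lambda>c. tens K H (self_module K) \<one>\<^bsub>H\<^esub> c)\<rparr>"

text \<open>
  Diagonal action, codiagonal coaction; the product is the braided one,
  \<open>(a \<otimes> b)(a' \<otimes> b') = a (b\<^sub>(\<^sub>-\<^sub>1\<^sub>) \<cdot> a') \<otimes> b\<^sub>(\<^sub>0\<^sub>) b'\<close>.
\<close>

definition yd_tensor ::
    "('k, 'x) ring_scheme \<Rightarrow> ('k, 'h, 'y) bialg_scheme \<Rightarrow> ('k, 'h, 'm, 'z) yd_scheme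
      \<Rightarrow> ('k, 'h, 'n, 'w) yd_scheme \<Rightarrow> ('k, 'h, ('k, 'm, 'n) tensor) yd"
  where "yd_tensor K H M N = (let T = tensor_space K M N; HT = tensor_space K H T in
    module.extend
      (T\<lparr>mult := (\<lambda>t u. tlift K T (\<lambda>a b. tlift K T (\<lambda>a' b'. tlift K T (\<lambda>b1 b0.
                  tens K M N (a \<otimes>\<^bsub>M\<^esub> act M b1 a') (b0 \<otimes>\<^bsub>N\<^esub> b')) (coact N b)) u) t),
         one := tens K M N \<one>\<^bsub>M\<^esub> \<one>\<^bsub>N\<^esub>\<rparr>)
      \<lparr>act = (\<lambda>h t. tlift K T (\<lambda>m n. tlift K T (\<lambda>h1 h2.
                tens K M N (act M h1 m) (act N h2 n)) (comult H h)) t),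
       coact = (\<lambda>t. tlift K HT (\<lambda>m n. tlift K HT (\<lambda>m1 m0. tlift K HT (\<lambda>n1 n0.
                tens K H T (m1 \<otimes>\<^bsub>H\<^esub> n1) (tens K M N m0 n0)) (coact N n)) (coact M m)) t)\<rparr>)"

record ('k, 'h, 'r) yd_bialg = "('k, 'h, 'r) yd" +
  yd_comult :: "'r \<Rightarrow> ('k, 'r, 'r) tensor"
  yd_counit :: "'r \<Rightarrow> 'k"

locale yd_algebra = yd_module K H S R + k_algebra K R
  for K :: "('k, 'x) ring_scheme" and H :: "('k, 'h, 'y) bialg_scheme" and S :: "'h \<Rightarrow> 'h"
    and R :: "('k, 'h, 'r, 'z) yd_scheme" +
  assumes mult_yd_hom: "tlift K R (mult R) \<in> yd_hom K H (yd_tensor K H R R) R"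
    and unit_yd_hom: "(\<lambda>c. c \<odot>\<^bsub>R\<^esub> \<one>\<^bsub>R\<^esub>) \<in> yd_hom K H (yd_unit K H) R"

locale yd_coalgebra = yd_module K H S R + k_coalgebra K R "yd_comult R" "yd_counit R"
  for K :: "('k, 'x) ring_scheme" and H :: "('k, 'h, 'y) bialg_scheme" and S :: "'h \<Rightarrow> 'h"
    and R :: "('k, 'h, 'r, 'z) yd_bialg_scheme" +
  assumes comult_yd_hom: "yd_comult R \<in> yd_hom K H R (yd_tensor K H R R)"
    and counit_yd_hom: "yd_counit R \<in> yd_hom K H R (yd_unit K H)"

locale yd_bialgebra = yd_algebra K H S R + yd_coalgebra K H S R
  for K :: "('k, 'x) ring_scheme" and H :: "('k, 'h, 'y) bialg_scheme" and S :: "'h \<Rightarrow> 'h"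
    and R :: "('k, 'h, 'r, 'z) yd_bialg_scheme" +
  assumes comult_algebra_hom: "yd_comult R \<in> algebra_hom K R (yd_tensor K H R R)"
    and counit_algebra_hom: "yd_counit R \<in> algebra_hom K R (yd_unit K H)"

text \<open>Equality of structures, disregarding the values of the operations outside the carriers.\<close>

definition same_vector_space ::
    "('k, 'x) ring_scheme \<Rightarrow> ('k, 'v, 'y) module_scheme \<Rightarrow> ('k, 'v, 'z) module_scheme \<Rightarrow> bool"
  where "same_vector_space K V W \<longleftrightarrow>
    carrier V = carrier W \<and> \<zero>\<^bsub>V\<^esub> = \<zero>\<^bsub>W\<^esub> \<and>
    (\<forall>x\<in>carrier V. \<forall>y\<in>carrier V. x \<oplus>\<^bsub>V\<^esub> y = x \<oplus>\<^bsub>W\<^esub> y) \<and>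
    (\<forall>c\<in>carrier K. \<forall>x\<in>carrier V. c \<odot>\<^bsub>V\<^esub> x = c \<odot>\<^bsub>W\<^esub> x)"

definition same_yd_bialgebra ::
    "('k, 'x) ring_scheme \<Rightarrow> ('k, 'h, 'y) bialg_scheme \<Rightarrow> ('k, 'h, 'r, 'z) yd_bialg_scheme
      \<Rightarrow> ('k, 'h, 'r, 'w) yd_bialg_scheme \<Rightarrow> bool"
  where "same_yd_bialgebra K H R R' \<longleftrightarrow>
    same_vector_space K R R' \<and> \<one>\<^bsub>R\<^esub> = \<one>\<^bsub>R'\<^esub> \<and>
    (\<forall>x\<in>carrier R. \<forall>y\<in>carrier R. x \<otimes>\<^bsub>R\<^esub> y = x \<otimes>\<^bsub>R'\<^esub> y) \<and>
    (\<forall>h\<in>carrier H. \<forall>x\<in>carrier R. act R h x = act R' h x) \<and>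
    (\<forall>x\<in>carrier R. coact R x = coact R' x \<and>
      yd_comult R x = yd_comult R' x \<and> yd_counit R x = yd_counit R' x)"


section \<open>The constructions\<close>

definition biproduct ::
    "('k, 'x) ring_scheme \<Rightarrow> ('k, 'h, 'r, 'z) yd_bialg_scheme \<Rightarrow> ('k, 'h, 'y) bialg_scheme
      \<Rightarrow> ('k, ('k, 'r, 'h) tensor) bialg"
  where "biproduct K R H = (let T = tensor_space K R H; TT = tensor_space K T T in
    module.extend
      (T\<lparr>mult := (\<lambda>t u. tlift K T (\<lambda>r h. tlift K T (\<lambda>r' h'. tlift K T (\<lambda>h1 h2.
                  tens K R H (r \<otimes>\<^bsub>R\<^esub> act R h1 r') (h2 \<otimes>\<^bsub>H\<^esub> h')) (comult H h)) u) t),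
         one := tens K R H \<one>\<^bsub>R\<^esub> \<one>\<^bsub>H\<^esub>\<rparr>)
      \<lparr>comult = (\<lambda>t. tlift K TT (\<lambda>r h. tlift K TT (\<lambda>r1 r2. tlift K TT (\<lambda>x y. tlift K TT (\<lambda>h1 h2.
                  tens K T T (tens K R H r1 (x \<otimes>\<^bsub>H\<^esub> h1)) (tens K R H y h2))
                  (comult H h)) (coact R r2)) (yd_comult R r)) t),
       counit = tlift K (self_module K) (\<lambda>r h. yd_counit R r \<otimes>\<^bsub>K\<^esub> counit H h)\<rparr>)"

text \<open>The projection \<open>\<Pi>\<close> of \<open>A\<close> onto its coinvariants.\<close>

definition assoc_proj ::
    "('k, 'x) ring_scheme \<Rightarrow> ('k, 'a, 'y) bialg_scheme \<Rightarrow> ('h \<Rightarrow> 'h) \<Rightarrow> ('h \<Rightarrow> 'a) \<Rightarrow> ('a \<Rightarrow> 'h)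
      \<Rightarrow> 'a \<Rightarrow> 'a"
  where "assoc_proj K A S j \<pi> a = tlift K A (\<lambda>a1 a2. a1 \<otimes>\<^bsub>A\<^esub> j (S (\<pi> a2))) (comult A a)"

definition coinvariants ::
    "('k, 'x) ring_scheme \<Rightarrow> ('k, 'a, 'y) bialg_scheme \<Rightarrow> ('k, 'h, 'z) bialg_scheme
      \<Rightarrow> ('a \<Rightarrow> 'h) \<Rightarrow> 'a set"
  where "coinvariants K A H \<pi> = {a \<in> carrier A.
    tlift K (tensor_space K A H) (\<lambda>a1 a2. tens K A H a1 (\<pi> a2)) (comult A a) = tens K A H a \<one>\<^bsub>H\<^esub>}"

definition assoc_bialgebra ::
    "('k, 'x) ring_scheme \<Rightarrow> ('k, 'a, 'y) bialg_scheme \<Rightarrow> ('k, 'h, 'z) bialg_scheme \<Rightarrow> ('h \<Rightarrow> 'h)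
      \<Rightarrow> ('h \<Rightarrow> 'a) \<Rightarrow> ('a \<Rightarrow> 'h) \<Rightarrow> ('k, 'h, 'a) yd_bialg"
  where "assoc_bialgebra K A H S j \<pi> =
    (let R = A\<lparr>carrier := coinvariants K A H \<pi>\<rparr> in
      \<lparr>carrier = carrier R, mult = mult A, one = \<one>\<^bsub>A\<^esub>, zero = \<zero>\<^bsub>A\<^esub>, add = add A, smult = smult A,
       act = (\<lambda>h r. tlift K A (\<lambda>h1 h2. j h1 \<otimes>\<^bsub>A\<^esub> r \<otimes>\<^bsub>A\<^esub> j (S h2)) (comult H h)),
       coact = (\<lambda>r. tensor_restrict K H A H R
         (tlift K (tensor_space K H A) (\<lambda>r1 r2. tens K H A (\<pi> r1) r2) (comult A r))),
       yd_comult = (\<lambda>r. tensor_restrict K A A R R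
         (tlift K (tensor_space K A A) (\<lambda>r1 r2. tens K A A (assoc_proj K A S j \<pi> r1) r2) (comult A r))),
       yd_counit = counit A\<rparr>)"

text \<open>The canonical map \<open>R # H \<rightarrow> A\<close>, \<open>r # h \<mapsto> r j(h)\<close>.\<close>

definition canonical_map ::
    "('k, 'x) ring_scheme \<Rightarrow> ('k, 'a, 'y) bialg_scheme \<Rightarrow> ('h \<Rightarrow> 'a) \<Rightarrow> ('k, 'a, 'h) tensor \<Rightarrow> 'a"
  where "canonical_map K A j = tlift K A (\<lambda>r h. r \<otimes>\<^bsub>A\<^esub> j h)"

text \<open>
  \<open>R\<close> with the opposite structures, an object over \<open>op_alg H\<close>. The coproduct is
  \<open>r\<^sup>2\<^sub>(\<^sub>-\<^sub>1\<^sub>) \<cdot>' r\<^sup>1 \<otimes> r\<^sup>2\<^sub>(\<^sub>0\<^sub>)\<close> with the new action \<open>h \<cdot>' r = S\<inverse>(h) \<cdot> r\<close>.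
\<close>

definition op_yd ::
    "('k, 'x) ring_scheme \<Rightarrow> ('k, 'h, 'y) bialg_scheme \<Rightarrow> ('h \<Rightarrow> 'h)
      \<Rightarrow> ('k, 'h, 'r, 'z) yd_bialg_scheme \<Rightarrow> ('k, 'h, 'r, 'z) yd_bialg_scheme"
  where "op_yd K H S R = (let S' = inv_into (carrier H) S; act' = (\<lambda>h r. act R (S' h) r) in
    R\<lparr>mult := (\<lambda>a b. b \<otimes>\<^bsub>R\<^esub> a),
      act := act',
      yd_comult := (\<lambda>r. tlift K (tensor_space K R R) (\<lambda>r1 r2.
        tlift K (tensor_space K R R) (\<lambda>x y. tens K R R (act' x r1) y) (coact R r2)) (yd_comult R r))\<rparr>)"

end

theory Submission
  imports Defs
begin

text \<open>
  For an algebra \<open>B\<close> and a coalgebra \<open>C\<close>, the linear maps \<open>C \<rightarrow> B\<close> form an algebra under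
  convolution, and the comultiplication of \<open>A\<close> is the convolution of the two inclusions
  \<open>A \<rightarrow> A \<otimes> A\<close>. An identity between elements of tensor products of copies of \<open>H\<close> and \<open>R\<close> is
  therefore checked after the injection induced by \<open>R \<subseteq> A\<close> into a tensor product of copies of
  \<open>H\<close> and \<open>A\<close>, where both sides become convolutions; the map \<open>\<Pi>\<close> splits \<open>R \<subseteq> A\<close>. This shows that
  \<open>R\<close> is a bialgebra in the Yetter-Drinfel'd category and that \<open>r # h \<mapsto> r j(h)\<close> is an isomorphism
  of bialgebras with inverse \<open>a \<mapsto> \<Pi>(a\<^sub>1) # \<pi>(a\<^sub>2)\<close>.

  The hypotheses are inherited by \<open>(A\<^sup>o\<^sup>p, H\<^sup>o\<^sup>p, S\<inverse>, j, \<pi>)\<close>. The coinvariants are the same, and the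
  structure maps of \<open>R\<^sup>o\<^sup>p\<close> are those of the bialgebra associated to the opposite data:
  \<open>S\<inverse>(h) \<cdot> a = j(S\<inverse>(h\<^sub>2)) a j(h\<^sub>1)\<close>, and \<open>S\<inverse>(\<pi>(a\<^sub>2)) \<cdot> \<Pi>(a\<^sub>1) = j(S\<inverse>(\<pi>(a\<^sub>2))) a\<^sub>1\<close> is the projection
  of the opposite data. So everything above applies to \<open>R\<^sup>o\<^sup>p\<close> as well, and \<open>\<phi> = f\<inverse> \<circ> g\<close>
  because \<open>f((1 # h)(r # 1)) = j(h) r\<close>.
\<close>

section \<open>Linear maps\<close>

text \<open>The difficulty is Sweedler notation: \<open>tlift\<close> evaluates a chosen
  representative, so an expression can be rearranged only while it is known to be multilinear, and
  nested sums would have to be regrouped by coassociativity at every step. In a convolution algebra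
  regrouping is associativity, and an antipode axiom is the cancellation of two adjacent factors.
  Tensor factors enter through algebra maps with commuting images, so factors from different tensor
  positions can be moved past each other. The map that resists is \<open>\<Pi>\<close>, which is in
  general not multiplicative. It is expanded as the convolution of the identity with
  \<open>j \<circ> S \<circ> \<pi>\<close>, and a trailing factor from \<open>j\<close> is removed
  by \<open>\<Pi>(x j(h)) = \<epsilon>(h) \<Pi>(x)\<close>. On a coinvariant, \<open>r\<^sub>1
  \<otimes> r\<^sub>2 = r\<^sub>1 \<otimes> \<Pi>(r\<^sub>2)\<close>, which makes the second leg an
  element of \<open>R\<close>. That the bi-product is a bialgebra is carried over from
  \<open>A\<close> along the canonical bijection.\<close>

lemma linear_homI:
  assumes "\<And>x. x \<in> carrier V \<Longrightarrow> f x \<in> carrier W"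
    and "\<And>x y. \<lbrakk>x \<in> carrier V; y \<in> carrier V\<rbrakk> \<Longrightarrow> f (x \<oplus>\<^bsub>V\<^esub> y) = f x \<oplus>\<^bsub>W\<^esub> f y"
    and "\<And>c x. \<lbrakk>c \<in> carrier K; x \<in> carrier V\<rbrakk> \<Longrightarrow> f (c \<odot>\<^bsub>V\<^esub> x) = c \<odot>\<^bsub>W\<^esub> f x"
  shows "f \<in> linear_hom K V W"
  using assms by (auto simp: linear_hom_def)

lemma linear_closed: "\<lbrakk>f \<in> linear_hom K V W; x \<in> carrier V\<rbrakk> \<Longrightarrow> f x \<in> carrier W"
  and linear_add: "\<lbrakk>f \<in> linear_hom K V W; x \<in> carrier V; y \<in> carrier V\<rbrakk>
    \<Longrightarrow> f (x \<oplus>\<^bsub>V\<^esub> y) = f x \<oplus>\<^bsub>W\<^esub> f y"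
  and linear_smult: "\<lbrakk>f \<in> linear_hom K V W; c \<in> carrier K; x \<in> carrier V\<rbrakk>
    \<Longrightarrow> f (c \<odot>\<^bsub>V\<^esub> x) = c \<odot>\<^bsub>W\<^esub> f x"
  by (auto simp: linear_hom_def)

lemma linear_id: "(\<lambda>x. x) \<in> linear_hom K V V"
  by (rule linear_homI) auto

lemma linear_comp:
  "\<lbrakk>f \<in> linear_hom K V W; p \<in> linear_hom K U V\<rbrakk> \<Longrightarrow> (\<lambda>x. f (p x)) \<in> linear_hom K U W"
  by (auto simp: linear_hom_def Pi_iff)

text \<open>\<open>linear_hom\<close> asks only for additivity and homogeneity; zero is reached as a
  scalar multiple by 0.\<close>

lemma linear_zero:
  assumes "module K V" "module K W" "f \<in> linear_hom K V W"
  shows "f \<zero>\<^bsub>V\<^esub> = \<zero>\<^bsub>W\<^esub>"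
proof -
  interpret V: module K V by fact
  interpret W: module K W by fact
  have "f \<zero>\<^bsub>V\<^esub> = f (\<zero>\<^bsub>K\<^esub> \<odot>\<^bsub>V\<^esub> \<zero>\<^bsub>V\<^esub>)" by simp
  also have "\<dots> = \<zero>\<^bsub>K\<^esub> \<odot>\<^bsub>W\<^esub> f \<zero>\<^bsub>V\<^esub>" by (rule linear_smult[OF assms(3)]) auto
  also have "\<dots> = \<zero>\<^bsub>W\<^esub>" using linear_closed[OF assms(3)] by simp
  finally show ?thesis .
qed

lemma linear_finsum:
  assumes "module K V" "module K W" "f \<in> linear_hom K V W" "g \<in> I \<rightarrow> carrier V"
  shows "f (\<Oplus>\<^bsub>V\<^esub>i\<in>I. g i) = (\<Oplus>\<^bsub>W\<^esub>i\<in>I. f (g i))"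
proof -
  interpret V: module K V by fact
  interpret W: module K W by fact
  note z = linear_zero[OF assms(1-3)]
  show ?thesis
  proof (cases "finite I")
    case True
    then show ?thesis using assms(4)
    proof (induction I)
      case (insert i I)
      have "f (\<Oplus>\<^bsub>V\<^esub>i\<in>insert i I. g i) = f (g i \<oplus>\<^bsub>V\<^esub> (\<Oplus>\<^bsub>V\<^esub>i\<in>I. g i))"
        using insert by (subst V.finsum_insert) (auto simp: Pi_iff)
      also have "\<dots> = f (g i) \<oplus>\<^bsub>W\<^esub> f (\<Oplus>\<^bsub>V\<^esub>i\<in>I. g i)"
        using insert by (intro linear_add[OF assms(3)] V.finsum_closed) auto
      also have "\<dots> = (\<Oplus>\<^bsub>W\<^esub>i\<in>insert i I. f (g i))"
        using insert by (subst W.finsum_insert) (auto intro: linear_closed[OF assms(3)])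
      finally show ?case .
    qed (simp add: z)
  \<comment> \<open>Over an infinite index set \<open>finsum\<close> is zero by convention, so the
    identity reduces to preservation of zero.\<close>
  qed (simp add: z V.finsum_infinite W.finsum_infinite)
qed

lemma self_module_simps [simp]:
  "carrier (self_module K) = carrier K" "mult (self_module K) = mult K"
  "one (self_module K) = one K" "zero (self_module K) = zero K" "add (self_module K) = add K"
  "smult (self_module K) = mult K"
  by (auto simp: self_module_def)

lemma (in field) module_self: "module R (self_module R)"
proof (rule moduleI)
  show "abelian_group (self_module R)"
    by (rule abelian_groupI) (auto simp: a_ac intro!: bexI[of _ "\<ominus> _"] l_neg)
qed (auto intro: is_cring simp: l_distr r_distr m_assoc)

section \<open>The free module\<close>

text \<open>The sum inside \<open>tlift\<close>, separated from the choice of a representative; it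
  is the linear extension of \<open>\<phi>\<close> to formal combinations.\<close>

definition free_lift :: "('k, 'x) ring_scheme \<Rightarrow> ('k, 'u, 'y) module_scheme \<Rightarrow> ('b \<Rightarrow> 'u)
    \<Rightarrow> ('b \<Rightarrow> 'k) \<Rightarrow> 'u"
  where "free_lift K X \<phi> x = (\<Oplus>\<^bsub>X\<^esub>p\<in>{p. x p \<noteq> \<zero>\<^bsub>K\<^esub>}. x p \<odot>\<^bsub>X\<^esub> \<phi> p)"

lemma free_module_simps [simp]:
  "x \<in> carrier (free_module K B) \<longleftrightarrow>
    (\<forall>b. x b \<in> carrier K) \<and> finite {b. x b \<noteq> \<zero>\<^bsub>K\<^esub>} \<and> {b. x b \<noteq> \<zero>\<^bsub>K\<^esub>} \<subseteq> B"
  "zero (free_module K B) = (\<lambda>b. \<zero>\<^bsub>K\<^esub>)"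
  "add (free_module K B) = (\<lambda>x y b. x b \<oplus>\<^bsub>K\<^esub> y b)"
  "smult (free_module K B) = (\<lambda>c x b. c \<otimes>\<^bsub>K\<^esub> x b)"
  by (simp_all add: free_module_def)

context field
begin

lemma free_module: "module R (free_module R B)"
proof (rule moduleI)
  show "abelian_group (free_module R B)"
  proof (rule abelian_groupI)
    fix x y assume x: "x \<in> carrier (free_module R B)" and y: "y \<in> carrier (free_module R B)"
    have "{b. x b \<oplus> y b \<noteq> \<zero>} \<subseteq> {b. x b \<noteq> \<zero>} \<union> {b. y b \<noteq> \<zero>}" by auto
    moreover from this have "finite {b. x b \<oplus> y b \<noteq> \<zero>}"
      by (rule finite_subset) (use x y in auto)
    ultimately show "x \<oplus>\<^bsub>free_module R B\<^esub> y \<in> carrier (free_module R B)"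
      using x y by auto
  next
    fix x assume x: "x \<in> carrier (free_module R B)"
    have "(\<lambda>b. \<ominus> x b) \<in> carrier (free_module R B)"
    proof -
      have "{b. \<ominus> x b \<noteq> \<zero>} = {b. x b \<noteq> \<zero>}" using x by auto
      then show ?thesis using x by simp
    qed
    then show "\<exists>y\<in>carrier (free_module R B). y \<oplus>\<^bsub>free_module R B\<^esub> x = \<zero>\<^bsub>free_module R B\<^esub>"
      using x by (intro bexI[of _ "\<lambda>b. \<ominus> x b"]) (auto simp: l_neg)
  qed (auto simp: a_ac)
next
  fix a x assume a: "a \<in> carrier R" and x: "x \<in> carrier (free_module R B)"
  have "{b. a \<otimes> x b \<noteq> \<zero>} \<subseteq> {b. x b \<noteq> \<zero>}" using a by auto
  moreover from this have "finite {b. a \<otimes> x b \<noteq> \<zero>}"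
    by (rule finite_subset) (use x in auto)
  ultimately show "a \<odot>\<^bsub>free_module R B\<^esub> x \<in> carrier (free_module R B)" using a x by auto
qed (auto intro: is_cring simp: l_distr r_distr m_assoc)

lemma free_gen_closed: "b \<in> B \<Longrightarrow> free_gen R b \<in> carrier (free_module R B)"
  by (auto simp: free_gen_def split: if_splits)

text \<open>Terms outside the support vanish. Two vectors have different supports, so linearity is
  checked over one finite set \<open>J\<close> that contains both.\<close>

lemma free_lift_superset:
  assumes "module R X" "\<phi> \<in> B \<rightarrow> carrier X" "x \<in> carrier (free_module R B)"
    "{p. x p \<noteq> \<zero>} \<subseteq> J" "J \<subseteq> B" "finite J"
  shows "free_lift R X \<phi> x = (\<Oplus>\<^bsub>X\<^esub>p\<in>J. x p \<odot>\<^bsub>X\<^esub> \<phi> p)"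
proof -
  interpret X: module R X by fact
  show ?thesis unfolding free_lift_def
    using assms by (intro X.add.finprod_mono_neutral_cong_left) (auto simp: Pi_iff subset_iff)
qed

lemma free_lift_linear:
  assumes X: "module R X" and \<phi>: "\<phi> \<in> B \<rightarrow> carrier X"
  shows "free_lift R X \<phi> \<in> linear_hom R (free_module R B) X"
proof -
  interpret X: module R X by fact
  interpret F: module R "free_module R B" by (rule free_module)
  note sup = free_lift_superset[OF X \<phi>]
  show ?thesis
  proof (rule linear_homI)
    fix x assume x: "x \<in> carrier (free_module R B)"
    show "free_lift R X \<phi> x \<in> carrier X"
      unfolding free_lift_def using x \<phi> by (intro X.finsum_closed) (auto simp: Pi_iff subset_iff)
  next
    fix x y assume x: "x \<in> carrier (free_module R B)" and y: "y \<in> carrier (free_module R B)"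
    define J where "J = {p. x p \<noteq> \<zero>} \<union> {p. y p \<noteq> \<zero>}"
    have J: "{p. x p \<noteq> \<zero>} \<subseteq> J" "{p. y p \<noteq> \<zero>} \<subseteq> J" "{p. (x p \<oplus> y p) \<noteq> \<zero>} \<subseteq> J" "J \<subseteq> B" "finite J"
      using x y by (auto simp: J_def)
    have xy: "x \<oplus>\<^bsub>free_module R B\<^esub> y \<in> carrier (free_module R B)" using F.add.m_closed[OF x y] .
    have f1: "(\<lambda>p. x p \<odot>\<^bsub>X\<^esub> \<phi> p) \<in> J \<rightarrow> carrier X" "(\<lambda>p. y p \<odot>\<^bsub>X\<^esub> \<phi> p) \<in> J \<rightarrow> carrier X"
      using x y \<phi> J by (auto simp: Pi_iff subset_iff)
    have "free_lift R X \<phi> (x \<oplus>\<^bsub>free_module R B\<^esub> y) = (\<Oplus>\<^bsub>X\<^esub>p\<in>J. (x p \<oplus> y p) \<odot>\<^bsub>X\<^esub> \<phi> p)"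
      using sup[OF xy, of J] J by simp
    also have "\<dots> = (\<Oplus>\<^bsub>X\<^esub>p\<in>J. x p \<odot>\<^bsub>X\<^esub> \<phi> p \<oplus>\<^bsub>X\<^esub> y p \<odot>\<^bsub>X\<^esub> \<phi> p)"
      using x y \<phi> J f1 by (intro X.finsum_cong') (auto intro!: X.smult_l_distr simp: Pi_iff subset_iff)
    also have "\<dots> = free_lift R X \<phi> x \<oplus>\<^bsub>X\<^esub> free_lift R X \<phi> y"
      using sup[OF x, of J] sup[OF y, of J] J f1 by (simp add: X.finsum_addf)
    finally show "free_lift R X \<phi> (x \<oplus>\<^bsub>free_module R B\<^esub> y)
      = free_lift R X \<phi> x \<oplus>\<^bsub>X\<^esub> free_lift R X \<phi> y" .
  next
    fix c x assume c: "c \<in> carrier R" and x: "x \<in> carrier (free_module R B)"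
    define J where "J = {p. x p \<noteq> \<zero>}"
    have J: "{p. x p \<noteq> \<zero>} \<subseteq> J" "{p. c \<otimes> x p \<noteq> \<zero>} \<subseteq> J" "J \<subseteq> B" "finite J"
      using x c by (auto simp: J_def)
    have cx: "c \<odot>\<^bsub>free_module R B\<^esub> x \<in> carrier (free_module R B)" using F.smult_closed[OF c x] .
    have f1: "(\<lambda>p. x p \<odot>\<^bsub>X\<^esub> \<phi> p) \<in> J \<rightarrow> carrier X"
      using x \<phi> J by (auto simp: Pi_iff subset_iff)
    have "free_lift R X \<phi> (c \<odot>\<^bsub>free_module R B\<^esub> x) = (\<Oplus>\<^bsub>X\<^esub>p\<in>J. (c \<otimes> x p) \<odot>\<^bsub>X\<^esub> \<phi> p)"
      using sup[OF cx, of J] J by simp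
    also have "\<dots> = (\<Oplus>\<^bsub>X\<^esub>p\<in>J. c \<odot>\<^bsub>X\<^esub> (x p \<odot>\<^bsub>X\<^esub> \<phi> p))"
      using x c \<phi> J f1 by (intro X.finsum_cong') (auto intro!: X.smult_assoc1 simp: Pi_iff subset_iff)
    also have "\<dots> = c \<odot>\<^bsub>X\<^esub> free_lift R X \<phi> x"
      using sup[OF x, of J] J f1 c by (simp add: X.finsum_smult_ldistr)
    finally show "free_lift R X \<phi> (c \<odot>\<^bsub>free_module R B\<^esub> x) = c \<odot>\<^bsub>X\<^esub> free_lift R X \<phi> x" .
  qed
qed

lemma free_lift_gen:
  assumes "module R X" "\<phi> \<in> B \<rightarrow> carrier X" "b \<in> B"
  shows "free_lift R X \<phi> (free_gen R b) = \<phi> b"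
proof -
  interpret X: module R X by fact
  have "free_lift R X \<phi> (free_gen R b) = (\<Oplus>\<^bsub>X\<^esub>p\<in>{b}. free_gen R b p \<odot>\<^bsub>X\<^esub> \<phi> p)"
    using assms by (intro free_lift_superset[where B=B] free_gen_closed) (auto simp: free_gen_def)
  also have "\<dots> = \<phi> b" using assms by (auto simp: free_gen_def Pi_iff)
  finally show ?thesis .
qed

text \<open>Induction on a finite set that contains the support, splitting off one coefficient at a
  time. The case named \<open>smult\<close> is the zero vector; scalar multiples of generators
  belong to \<open>gen\<close>.\<close>

lemma free_module_induct [consumes 1, case_names gen smult add]:
  assumes x: "x \<in> carrier (free_module R B)"
    and gen: "\<And>b c. b \<in> B \<Longrightarrow> c \<in> carrier R \<Longrightarrow> P (\<lambda>b'. c \<otimes> free_gen R b b')"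
    and zero: "P (\<lambda>b. \<zero>)"
    and add: "\<And>x y. \<lbrakk>x \<in> carrier (free_module R B); y \<in> carrier (free_module R B); P x; P y\<rbrakk>
      \<Longrightarrow> P (\<lambda>b. x b \<oplus> y b)"
  shows "P x"
proof -
  interpret F: module R "free_module R B" by (rule free_module)
  have "finite J \<Longrightarrow> \<forall>x\<in>carrier (free_module R B). {p. x p \<noteq> \<zero>} \<subseteq> J \<longrightarrow> P x" for J
  proof (induction J rule: finite_induct)
    case empty
    have "P x" if "{p. x p \<noteq> \<zero>} \<subseteq> {}" for x
    proof -
      have "x = (\<lambda>b. \<zero>)" using that by auto
      then show ?thesis using zero by simp
    qed
    then show ?case by blast
  next
    case (insert b J)
    show ?case
    proof (intro ballI impI)
      fix x assume x: "x \<in> carrier (free_module R B)" and sub: "{p. x p \<noteq> \<zero>} \<subseteq> insert b J"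
      show "P x"
      proof (cases "x b = \<zero>")
        case True
        then have "{p. x p \<noteq> \<zero>} \<subseteq> J" using sub by auto
        then show ?thesis using insert x by auto
      next
        case False
        then have b: "b \<in> B" using x by auto
        define y where "y = x(b := \<zero>)"
        have y: "y \<in> carrier (free_module R B)"
        proof -
          have "{p. y p \<noteq> \<zero>} \<subseteq> {p. x p \<noteq> \<zero>}" by (auto simp: y_def)
          moreover from this have "finite {p. y p \<noteq> \<zero>}"
            by (rule finite_subset) (use x in auto)
          ultimately show ?thesis using x by (auto simp: y_def)
        qed
        have "{p. y p \<noteq> \<zero>} \<subseteq> J" using sub by (auto simp: y_def)
        then have "P y" using insert y by auto
        have g: "(\<lambda>b'. x b \<otimes> free_gen R b b') \<in> carrier (free_module R B)"
          using F.smult_closed[OF _ free_gen_closed[OF b], of "x b"] x by simp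
        have "P (\<lambda>b'. (x b \<otimes> free_gen R b b') \<oplus> y b')"
          using x b g y \<open>P y\<close> by (intro add gen) auto
        moreover have "(\<lambda>b'. (x b \<otimes> free_gen R b b') \<oplus> y b') = x"
          using x by (auto simp: y_def free_gen_def fun_eq_iff)
        ultimately show "P x" by simp
      qed
    qed
  qed
  from this[of "{p. x p \<noteq> \<zero>}"] x show ?thesis by auto
qed

end

section \<open>The tensor product\<close>

definition bilinear ::
    "('k, 'x) ring_scheme \<Rightarrow> ('k, 'v, 'y) module_scheme \<Rightarrow> ('k, 'w, 'z) module_scheme
      \<Rightarrow> ('k, 'u, 't) module_scheme \<Rightarrow> ('v \<Rightarrow> 'w \<Rightarrow> 'u) \<Rightarrow> bool"
  where "bilinear K V W X f \<longleftrightarrow>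
    (\<forall>w\<in>carrier W. (\<lambda>v. f v w) \<in> linear_hom K V X) \<and> (\<forall>v\<in>carrier V. f v \<in> linear_hom K W X)"

lemma bilinearI:
  assumes "\<And>w. w \<in> carrier W \<Longrightarrow> (\<lambda>v. f v w) \<in> linear_hom K V X"
    and "\<And>v. v \<in> carrier V \<Longrightarrow> (\<lambda>w. f v w) \<in> linear_hom K W X"
  shows "bilinear K V W X f"
  using assms by (auto simp: bilinear_def)

lemma bilinear_left: "\<lbrakk>bilinear K V W X f; w \<in> carrier W\<rbrakk> \<Longrightarrow> (\<lambda>v. f v w) \<in> linear_hom K V X"
  and bilinear_right: "\<lbrakk>bilinear K V W X f; v \<in> carrier V\<rbrakk> \<Longrightarrow> f v \<in> linear_hom K W X"
  and bilinear_closed: "\<lbrakk>bilinear K V W X f; v \<in> carrier V; w \<in> carrier W\<rbrakk> \<Longrightarrow> f v w \<in> carrier X"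
  by (auto simp: bilinear_def linear_closed)

locale tensor_product = field K + V: module K V + W: module K W
  for K :: "('k, 'x) ring_scheme" and V :: "('k, 'v, 'y) module_scheme"
    and W :: "('k, 'w, 'z) module_scheme"
begin

abbreviation "F \<equiv> tensor_free K V W"
abbreviation "U \<equiv> tensor_rel K V W"
abbreviation "T \<equiv> tensor_space K V W"

lemma F_module: "module K F"
  unfolding tensor_free_def by (rule free_module)

sublocale F: module K F by (rule F_module)

lemma F_gen: "\<lbrakk>v \<in> carrier V; w \<in> carrier W\<rbrakk> \<Longrightarrow> free_gen K (v, w) \<in> carrier F"
  unfolding tensor_free_def by (rule free_gen_closed) auto

text \<open>The four families of relations in \<open>tensor_rel\<close>, with the containing set as
  a parameter, so that kernels can be tested against the intersection that defines
  \<open>U\<close>.\<close>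

definition is_rel where "is_rel D \<longleftrightarrow> 
      (\<forall>v\<in>carrier V. \<forall>v'\<in>carrier V. \<forall>w\<in>carrier W.
        free_gen K (v \<oplus>\<^bsub>V\<^esub> v', w) \<ominus>\<^bsub>F\<^esub> (free_gen K (v, w) \<oplus>\<^bsub>F\<^esub> free_gen K (v', w)) \<in> D) \<and>
      (\<forall>v\<in>carrier V. \<forall>w\<in>carrier W. \<forall>w'\<in>carrier W.
        free_gen K (v, w \<oplus>\<^bsub>W\<^esub> w') \<ominus>\<^bsub>F\<^esub> (free_gen K (v, w) \<oplus>\<^bsub>F\<^esub> free_gen K (v, w')) \<in> D) \<and>
      (\<forall>c\<in>carrier K. \<forall>v\<in>carrier V. \<forall>w\<in>carrier W.
        free_gen K (c \<odot>\<^bsub>V\<^esub> v, w) \<ominus>\<^bsub>F\<^esub> (c \<odot>\<^bsub>F\<^esub> free_gen K (v, w)) \<in> D) \<and>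
      (\<forall>c\<in>carrier K. \<forall>v\<in>carrier V. \<forall>w\<in>carrier W.
        free_gen K (v, c \<odot>\<^bsub>W\<^esub> w) \<ominus>\<^bsub>F\<^esub> (c \<odot>\<^bsub>F\<^esub> free_gen K (v, w)) \<in> D)"

lemma U_eq: "U = \<Inter>{D. submodule D K F \<and> is_rel D}"
  by (simp add: tensor_rel_def Let_def is_rel_def)

lemma U_rel: "is_rel U"
  unfolding U_eq by (auto simp: is_rel_def)

lemma U_least: "\<lbrakk>submodule D K F; is_rel D\<rbrakk> \<Longrightarrow> U \<subseteq> D"
  unfolding U_eq by auto

lemma U_submodule: "submodule U K F"
proof (rule F.submoduleI)
  \<comment> \<open>The whole module contains the relations, so the intersection defining
    \<open>U\<close> runs over a nonempty family and stays inside the carrier.\<close>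
  have "is_rel (carrier F)"
    unfolding is_rel_def by (intro conjI ballI F.minus_closed F.a_closed F.smult_closed F_gen) auto
  then show "U \<subseteq> carrier F"
    using U_least F.carrier_is_submodule by auto
  show "\<zero>\<^bsub>F\<^esub> \<in> U" unfolding U_eq
    using submodule.axioms(1)[THEN subgroup.one_closed] by fastforce
qed (auto simp: U_eq dest: F.submoduleE)

lemma U_subset: "U \<subseteq> carrier F"
  using F.submoduleE(1)[OF U_submodule] .

sublocale U: abelian_subgroup U F
proof (rule abelian_subgroupI3)
  show "additive_subgroup U F"
    by (rule additive_subgroup.intro) (rule submodule.axioms(1)[OF U_submodule])
qed (rule F.abelian_group_axioms)

definition cls where "cls x = U +>\<^bsub>F\<^esub> x"

lemma carrier_T: "carrier T = cls ` carrier F"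
  by (auto simp: tensor_space_def Let_def cls_def A_RCOSETS_def' a_r_coset_def')

lemma cls_self: "x \<in> carrier F \<Longrightarrow> x \<in> cls x"
  unfolding cls_def using U.a_rcos_self by auto

lemma cls_eq_iff:
  assumes "x \<in> carrier F" "y \<in> carrier F"
  shows "cls x = cls y \<longleftrightarrow> x \<ominus>\<^bsub>F\<^esub> y \<in> U"
proof
  assume "cls x = cls y"
  then have "x \<in> U +>\<^bsub>F\<^esub> y" using cls_self[OF assms(1)] by (simp add: cls_def)
  then show "x \<ominus>\<^bsub>F\<^esub> y \<in> U" using U.a_rcos_module[OF assms(2,1)] by (simp add: a_minus_def)
next
  assume "x \<ominus>\<^bsub>F\<^esub> y \<in> U"
  then have "x \<in> U +>\<^bsub>F\<^esub> y"
    using U.a_rcos_module[OF assms(2,1)] by (simp add: a_minus_def)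
  then show "cls x = cls y" unfolding cls_def
    using U.a_repr_independence'[OF _ assms(2)] by simp
qed

lemma cls_mem:
  assumes "x \<in> carrier F" "y \<in> cls x"
  shows "y \<in> carrier F" "cls y = cls x"
proof -
  show y: "y \<in> carrier F" using assms U.a_elemrcos_carrier[OF assms(1)] by (simp add: cls_def)
  show "cls y = cls x"
    using assms U.a_repr_independence'[OF _ assms(1)] by (simp add: cls_def)
qed

lemma cls_add: "\<lbrakk>x \<in> carrier F; y \<in> carrier F\<rbrakk> \<Longrightarrow> cls x \<oplus>\<^bsub>T\<^esub> cls y = cls (x \<oplus>\<^bsub>F\<^esub> y)"
  using U.a_rcos_sum by (simp add: tensor_space_def Let_def cls_def)

text \<open>In \<open>tensor_space\<close> a multiple of a coset is a union over its members. All
  members contribute the same coset, because \<open>U\<close> is closed under scalars.\<close>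

lemma cls_smult:
  assumes c: "c \<in> carrier K" and x: "x \<in> carrier F"
  shows "c \<odot>\<^bsub>T\<^esub> cls x = cls (c \<odot>\<^bsub>F\<^esub> x)"
proof -
  have "cls (c \<odot>\<^bsub>F\<^esub> y) = cls (c \<odot>\<^bsub>F\<^esub> x)" if "y \<in> cls x" for y
  proof -
    have y: "y \<in> carrier F" "cls y = cls x" using cls_mem[OF x that] by auto
    then have "y \<ominus>\<^bsub>F\<^esub> x \<in> U" using x by (simp add: cls_eq_iff)
    then have "c \<odot>\<^bsub>F\<^esub> (y \<ominus>\<^bsub>F\<^esub> x) \<in> U" using F.submoduleE(4)[OF U_submodule] c by blast
    also have "c \<odot>\<^bsub>F\<^esub> (y \<ominus>\<^bsub>F\<^esub> x) = (c \<odot>\<^bsub>F\<^esub> y) \<ominus>\<^bsub>F\<^esub> (c \<odot>\<^bsub>F\<^esub> x)"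
      using c x y by (simp add: a_minus_def F.smult_r_distr F.smult_r_minus)
    finally show ?thesis using c x y by (simp add: cls_eq_iff)
  qed
  then have "(\<Union>y\<in>cls x. cls (c \<odot>\<^bsub>F\<^esub> y)) = cls (c \<odot>\<^bsub>F\<^esub> x)"
    using cls_self[OF x] by blast
  then show ?thesis by (simp add: tensor_space_def Let_def cls_def)
qed

lemma cls_zero: "\<zero>\<^bsub>T\<^esub> = cls \<zero>\<^bsub>F\<^esub>"
  using F.a_coset_add_zero[OF U_subset] by (simp add: tensor_space_def Let_def cls_def)

lemma T_module: "module K T"
proof (rule moduleI)
  show "abelian_group T"
  proof (rule abelian_groupI)
    show "\<exists>y\<in>carrier T. y \<oplus>\<^bsub>T\<^esub> x = \<zero>\<^bsub>T\<^esub>" if "x \<in> carrier T" for x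
    proof -
      from that obtain x' where "x' \<in> carrier F" "x = cls x'" by (auto simp: carrier_T)
      then show ?thesis
        by (intro bexI[of _ "cls (\<ominus>\<^bsub>F\<^esub> x')"]) (auto simp: carrier_T cls_add cls_zero F.l_neg)
    qed
  qed (auto simp: carrier_T cls_add cls_zero F.a_ac)
qed (auto intro: is_cring simp: carrier_T cls_add cls_smult F.smult_l_distr F.smult_r_distr F.smult_assoc1)

lemma tens_eq: "tens K V W v w = cls (free_gen K (v, w))"
  by (simp add: tens_def cls_def)

lemma tens_closed: "\<lbrakk>v \<in> carrier V; w \<in> carrier W\<rbrakk> \<Longrightarrow> tens K V W v w \<in> carrier T"
  by (auto simp: tens_eq carrier_T F_gen)

lemma tens_bilinear: "bilinear K V W T (tens K V W)"
proof (intro bilinearI linear_homI)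
  note r = U_rel[unfolded is_rel_def]
  fix v v' w assume "v \<in> carrier V" "v' \<in> carrier V" "w \<in> carrier W"
  then show "tens K V W (v \<oplus>\<^bsub>V\<^esub> v') w = tens K V W v w \<oplus>\<^bsub>T\<^esub> tens K V W v' w"
    using r by (simp add: tens_eq cls_add cls_eq_iff F_gen)
next
  note r = U_rel[unfolded is_rel_def]
  fix v w c assume "v \<in> carrier V" "w \<in> carrier W" "c \<in> carrier K"
  then show "tens K V W (c \<odot>\<^bsub>V\<^esub> v) w = c \<odot>\<^bsub>T\<^esub> tens K V W v w"
    using r by (simp add: tens_eq cls_smult cls_eq_iff F_gen)
next
  note r = U_rel[unfolded is_rel_def]
  fix v w w' assume "v \<in> carrier V" "w \<in> carrier W" "w' \<in> carrier W"
  then show "tens K V W v (w \<oplus>\<^bsub>W\<^esub> w') = tens K V W v w \<oplus>\<^bsub>T\<^esub> tens K V W v w'"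
    using r by (simp add: tens_eq cls_add cls_eq_iff F_gen)
next
  note r = U_rel[unfolded is_rel_def]
  fix v w c assume "v \<in> carrier V" "w \<in> carrier W" "c \<in> carrier K"
  then show "tens K V W v (c \<odot>\<^bsub>W\<^esub> w) = c \<odot>\<^bsub>T\<^esub> tens K V W v w"
    using r by (simp add: tens_eq cls_smult cls_eq_iff F_gen)
qed (auto simp: tens_closed)

text \<open>Scalars are absorbed into the first factor, so sums of pure tensors exhaust the space.\<close>

lemma tensor_induct [consumes 1, case_names tens add]:
  assumes t: "t \<in> carrier T"
    and tens: "\<And>v w. \<lbrakk>v \<in> carrier V; w \<in> carrier W\<rbrakk> \<Longrightarrow> P (tens K V W v w)"
    and add: "\<And>t u. \<lbrakk>t \<in> carrier T; u \<in> carrier T; P t; P u\<rbrakk> \<Longrightarrow> P (t \<oplus>\<^bsub>T\<^esub> u)"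
  shows "P t"
proof -
  have sm: "cls (\<lambda>b. c \<otimes>\<^bsub>K\<^esub> free_gen K (v, w) b) = tens K V W (c \<odot>\<^bsub>V\<^esub> v) w"
    if "v \<in> carrier V" "w \<in> carrier W" "c \<in> carrier K" for v w c
  proof -
    have "cls (c \<odot>\<^bsub>F\<^esub> free_gen K (v, w)) = c \<odot>\<^bsub>T\<^esub> tens K V W v w"
      using that by (simp add: tens_eq cls_smult F_gen)
    also have "\<dots> = tens K V W (c \<odot>\<^bsub>V\<^esub> v) w"
      using linear_smult[OF bilinear_left[OF tens_bilinear]] that by simp
    finally show ?thesis by (simp add: tensor_free_def)
  qed
  have "P (cls x)" if "x \<in> carrier F" for x
    using that[unfolded tensor_free_def]
  proof (induction x rule: free_module_induct)
    case (gen b c)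
    then show ?case using tens[of "c \<odot>\<^bsub>V\<^esub> fst b" "snd b"] by (cases b) (auto simp: sm)
  next
    case smult
    have "P (tens K V W \<zero>\<^bsub>V\<^esub> \<zero>\<^bsub>W\<^esub>)" by (rule tens) auto
    moreover have "tens K V W \<zero>\<^bsub>V\<^esub> \<zero>\<^bsub>W\<^esub> = \<zero>\<^bsub>T\<^esub>"
      by (rule linear_zero[OF V.module_axioms T_module bilinear_left[OF tens_bilinear]]) auto
    ultimately show ?case by (simp add: cls_zero tensor_free_def)
  next
    case (add x y)
    then have xy: "x \<in> carrier F" "y \<in> carrier F" by (simp_all add: tensor_free_def)
    have "P (cls x \<oplus>\<^bsub>T\<^esub> cls y)" using xy add by (intro assms(3)) (auto simp: carrier_T)
    then show ?case using xy by (simp add: cls_add) (simp add: tensor_free_def)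
  qed
  then show ?thesis using t by (auto simp: carrier_T)
qed

lemma linear_ext_tensor:
  assumes f: "f \<in> linear_hom K T X" and g: "g \<in> linear_hom K T X"
    and eq: "\<And>v w. \<lbrakk>v \<in> carrier V; w \<in> carrier W\<rbrakk> \<Longrightarrow> f (tens K V W v w) = g (tens K V W v w)"
    and t: "t \<in> carrier T"
  shows "f t = g t"
  using t by (induction rule: tensor_induct) (auto simp: eq linear_add[OF f] linear_add[OF g])

lemma representative:
  assumes "t \<in> carrier T"
  shows "(SOME x. x \<in> t) \<in> carrier F" "cls (SOME x. x \<in> t) = t"
proof -
  from assms obtain x where x: "x \<in> carrier F" "t = cls x" by (auto simp: carrier_T)
  then have "(SOME x. x \<in> t) \<in> t" using cls_self someI by metis
  then show "(SOME x. x \<in> t) \<in> carrier F" "cls (SOME x. x \<in> t) = t"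
    using cls_mem[OF x(1)] x(2) by auto
qed

lemma tlift_free_lift: "tlift K X f t = free_lift K X (\<lambda>p. f (fst p) (snd p)) (SOME x. x \<in> t)"
  by (simp add: tlift_def Let_def free_lift_def)

text \<open>The kernel of the linear extension of a bilinear map is a submodule that contains the
  relations, hence contains \<open>U\<close>; so the representative picked by \<open>tlift\<close>
  does not matter.\<close>

lemma tlift_cls:
  assumes X: "module K X" and f: "bilinear K V W X f" and x: "x \<in> carrier F"
  shows "tlift K X f (cls x) = free_lift K X (\<lambda>p. f (fst p) (snd p)) x"
proof -
  interpret X: module K X by fact
  define \<phi> where "\<phi> = (\<lambda>p. f (fst p) (snd p))"
  have \<phi>: "\<phi> \<in> carrier V \<times> carrier W \<rightarrow> carrier X"
    using f by (auto simp: \<phi>_def bilinear_closed)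
  define L where "L = free_lift K X \<phi>"
  have L: "L \<in> linear_hom K F X"
    unfolding L_def tensor_free_def by (rule free_lift_linear[OF X \<phi>])
  have Lm: "L (y \<ominus>\<^bsub>F\<^esub> z) = L y \<ominus>\<^bsub>X\<^esub> L z" if "y \<in> carrier F" "z \<in> carrier F" for y z
  proof -
    have "L (y \<ominus>\<^bsub>F\<^esub> z) \<oplus>\<^bsub>X\<^esub> L z = L (y \<ominus>\<^bsub>F\<^esub> z \<oplus>\<^bsub>F\<^esub> z)"
      using linear_add[OF L] that by simp
    also have "y \<ominus>\<^bsub>F\<^esub> z \<oplus>\<^bsub>F\<^esub> z = y" using that by (simp add: a_minus_def F.a_assoc F.l_neg)
    finally show ?thesis using linear_closed[OF L] that
      by (metis F.minus_closed X.add.inv_solve_right a_minus_def)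
  qed
  have Lg: "L (free_gen K (v, w)) = f v w" if "v \<in> carrier V" "w \<in> carrier W" for v w
    unfolding L_def using free_lift_gen[OF X \<phi>] that by (simp add: \<phi>_def)
  define D where "D = {y \<in> carrier F. L y = \<zero>\<^bsub>X\<^esub>}"
  have "submodule D K F"
  proof (rule F.submoduleI)
    show "\<zero>\<^bsub>F\<^esub> \<in> D" by (simp add: D_def linear_zero[OF F_module X L])
    show "\<ominus>\<^bsub>F\<^esub> a \<in> D" if "a \<in> D" for a
      using Lm[of "\<zero>\<^bsub>F\<^esub>" a] that
      by (simp add: D_def linear_zero[OF F_module X L] a_minus_def X.add.inv_one)
  qed (auto simp: D_def linear_add[OF L] linear_smult[OF L])
  moreover have "is_rel D"
  proof -
    have XX: "x \<ominus>\<^bsub>X\<^esub> x = \<zero>\<^bsub>X\<^esub>" if "x \<in> carrier X" for x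
      using that by (simp add: a_minus_def X.r_neg)
    show ?thesis unfolding is_rel_def D_def
      using linear_add[OF bilinear_left[OF f]] linear_add[OF bilinear_right[OF f]]
        linear_smult[OF bilinear_left[OF f]] linear_smult[OF bilinear_right[OF f]]
      by (simp add: Lm linear_add[OF L] linear_smult[OF L] Lg F_gen bilinear_closed[OF f] XX)
  qed
  ultimately have UD: "U \<subseteq> D" by (rule U_least)
  define y where "y = (SOME y. y \<in> cls x)"
  have "cls x \<in> carrier T" using x by (auto simp: carrier_T)
  then have y: "y \<in> carrier F" "cls y = cls x" using representative by (auto simp: y_def)
  then have "y \<ominus>\<^bsub>F\<^esub> x \<in> D" using UD x by (auto simp: cls_eq_iff)
  then have "L y \<ominus>\<^bsub>X\<^esub> L x = \<zero>\<^bsub>X\<^esub>" using x y by (simp add: D_def Lm)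
  then have "L y = L x"
    using x y linear_closed[OF L] X.add.inv_solve_right[of "\<zero>\<^bsub>X\<^esub>" "L y" "L x"] by (simp add: a_minus_def)
  then show ?thesis unfolding tlift_free_lift by (simp add: L_def \<phi>_def y_def)
qed

lemma tlift_linear:
  assumes X: "module K X" and f: "bilinear K V W X f"
  shows "tlift K X f \<in> linear_hom K T X"
proof -
  have L: "free_lift K X (\<lambda>p. f (fst p) (snd p)) \<in> linear_hom K F X"
    unfolding tensor_free_def by (rule free_lift_linear[OF X]) (auto simp: bilinear_closed[OF f])
  show ?thesis
    by (rule linear_homI)
      (auto simp: carrier_T cls_add cls_smult tlift_cls[OF X f] linear_closed[OF L]
        linear_add[OF L] linear_smult[OF L])
qed

lemma tlift_tens:
  assumes X: "module K X" and f: "bilinear K V W X f" and "v \<in> carrier V" "w \<in> carrier W"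
  shows "tlift K X f (tens K V W v w) = f v w"
proof -
  have "tlift K X f (tens K V W v w) = free_lift K X (\<lambda>p. f (fst p) (snd p)) (free_gen K (v, w))"
    using assms by (simp add: tens_eq tlift_cls F_gen)
  also have "\<dots> = f v w"
    using assms by (subst free_lift_gen[OF X, where B = "carrier V \<times> carrier W"]) (auto simp: bilinear_closed)
  finally show ?thesis .
qed

lemma representative_support:
  assumes "t \<in> carrier T" "p \<in> {p. (SOME x. x \<in> t) p \<noteq> \<zero>\<^bsub>K\<^esub>}"
  shows "fst p \<in> carrier V" "snd p \<in> carrier W"
  using representative(1)[OF assms(1)] assms(2) unfolding tensor_free_def by auto

lemma representative_coeff:
  assumes "t \<in> carrier T"
  shows "(SOME x. x \<in> t) p \<in> carrier K"
  using representative(1)[OF assms] unfolding tensor_free_def by (cases p) auto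

text \<open>Both sides sum over the same chosen representative of \<open>t\<close>, whose support
  lies in \<open>carrier V \<times> carrier W\<close>; the summands agree one by one.\<close>

lemma tlift_cong:
  assumes "module K X" "t \<in> carrier T"
    and "\<And>v w. \<lbrakk>v \<in> carrier V; w \<in> carrier W\<rbrakk> \<Longrightarrow> f v w \<in> carrier X"
    and "\<And>v w. \<lbrakk>v \<in> carrier V; w \<in> carrier W\<rbrakk> \<Longrightarrow> f v w = g v w"
  shows "tlift K X f t = tlift K X g t"
proof -
  interpret X: module K X by fact
  have "g v w \<in> carrier X" if "v \<in> carrier V" "w \<in> carrier W" for v w
    using assms(3,4)[OF that] by simp
  then show ?thesis unfolding tlift_def Let_def
    using representative_support[OF assms(2)] representative_coeff[OF assms(2)] assms(4)
    by (intro X.finsum_cong') auto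
qed

lemma tlift_closed:
  assumes "module K X" "t \<in> carrier T"
    and "\<And>v w. \<lbrakk>v \<in> carrier V; w \<in> carrier W\<rbrakk> \<Longrightarrow> f v w \<in> carrier X"
  shows "tlift K X f t \<in> carrier X"
proof -
  interpret X: module K X by fact
  show ?thesis unfolding tlift_def Let_def
    using representative_support[OF assms(2)] representative_coeff[OF assms(2)] assms(3)
    by (intro X.finsum_closed) auto
qed

lemma linear_tlift:
  assumes X: "module K X" and Y: "module K Y" and h: "h \<in> linear_hom K X Y" and t: "t \<in> carrier T"
    and f: "\<And>v w. \<lbrakk>v \<in> carrier V; w \<in> carrier W\<rbrakk> \<Longrightarrow> f v w \<in> carrier X"
  shows "h (tlift K X f t) = tlift K Y (\<lambda>v w. h (f v w)) t"
proof -
  interpret X: module K X by fact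
  interpret Y: module K Y by fact
  note r = representative_support[OF t] representative_coeff[OF t]
  show ?thesis unfolding tlift_def Let_def
    using r f linear_closed[OF h]
    by (subst linear_finsum[OF X Y h])
      (auto intro!: Y.finsum_cong' linear_smult[OF h] Y.smult_closed)
qed

text \<open>The representative of \<open>t\<close> is fixed while \<open>y\<close> varies, so
  linearity in \<open>y\<close> holds termwise. This gives linearity of a nested Sweedler sum in its
  outer variables.\<close>

lemma tlift_linear_param:
  assumes X: "module K X" and Y: "module K Y" and t: "t \<in> carrier T"
    and f: "\<And>v w. \<lbrakk>v \<in> carrier V; w \<in> carrier W\<rbrakk> \<Longrightarrow> (\<lambda>y. f y v w) \<in> linear_hom K Y X"
  shows "(\<lambda>y. tlift K X (f y) t) \<in> linear_hom K Y X"
proof -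
  interpret X: module K X by fact
  interpret Y: module K Y by fact
  define J where "J = {p. (SOME x. x \<in> t) p \<noteq> \<zero>\<^bsub>K\<^esub>}"
  define x where "x = (SOME x. x \<in> t)"
  have r: "fst p \<in> carrier V" "snd p \<in> carrier W" if "p \<in> J" for p
    using representative_support[OF t] that by (auto simp: J_def)
  have x: "x p \<in> carrier K" for p using representative_coeff[OF t] by (simp add: x_def)
  have fin: "finite J"
    using representative(1)[OF t] by (simp add: J_def tensor_free_def)
  have e: "tlift K X (f y) t = (\<Oplus>\<^bsub>X\<^esub>p\<in>J. x p \<odot>\<^bsub>X\<^esub> f y (fst p) (snd p))" for y
    by (simp add: tlift_def Let_def J_def x_def)
  have c: "(\<lambda>p. x p \<odot>\<^bsub>X\<^esub> f y (fst p) (snd p)) \<in> J \<rightarrow> carrier X" if "y \<in> carrier Y" for y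
    using r x linear_closed[OF f] that by auto
  show ?thesis
  proof (rule linear_homI)
    fix y assume "y \<in> carrier Y"
    then show "tlift K X (f y) t \<in> carrier X" unfolding e by (intro X.finsum_closed c)
  next
    fix y z assume yz: "y \<in> carrier Y" "z \<in> carrier Y"
    have "tlift K X (f (y \<oplus>\<^bsub>Y\<^esub> z)) t
      = (\<Oplus>\<^bsub>X\<^esub>p\<in>J. x p \<odot>\<^bsub>X\<^esub> f y (fst p) (snd p) \<oplus>\<^bsub>X\<^esub> x p \<odot>\<^bsub>X\<^esub> f z (fst p) (snd p))"
      unfolding e using yz r x linear_closed[OF f]
      by (intro X.finsum_cong') (auto simp: linear_add[OF f] X.smult_r_distr)
    also have "\<dots> = tlift K X (f y) t \<oplus>\<^bsub>X\<^esub> tlift K X (f z) t"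
      unfolding e by (rule X.finsum_addf) (use c yz in auto)
    finally show "tlift K X (f (y \<oplus>\<^bsub>Y\<^esub> z)) t = tlift K X (f y) t \<oplus>\<^bsub>X\<^esub> tlift K X (f z) t" .
  next
    fix a y assume ay: "a \<in> carrier K" "y \<in> carrier Y"
    have "tlift K X (f (a \<odot>\<^bsub>Y\<^esub> y)) t = (\<Oplus>\<^bsub>X\<^esub>p\<in>J. a \<odot>\<^bsub>X\<^esub> (x p \<odot>\<^bsub>X\<^esub> f y (fst p) (snd p)))"
      unfolding e using ay r x linear_closed[OF f]
      by (intro X.finsum_cong') (auto simp: linear_smult[OF f] m_comm simp flip: X.smult_assoc1)
    also have "\<dots> = a \<odot>\<^bsub>X\<^esub> tlift K X (f y) t"
      unfolding e by (rule X.finsum_smult_ldistr[symmetric]) (use fin c ay in auto)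
    finally show "tlift K X (f (a \<odot>\<^bsub>Y\<^esub> y)) t = a \<odot>\<^bsub>X\<^esub> tlift K X (f y) t" .
  qed
qed

end

section \<open>Multilinear maps\<close>

lemma finsum_codomain_cong:
  assumes "carrier X = carrier X'" "add X = add X'" "zero X = zero X'"
  shows "finsum X = finsum X'"
  using assms by (intro ext) (simp add: finsum_def finprod_def)

text \<open>\<open>finsum\<close> reads only the carrier, zero and addition. A record with a
  different product therefore has the same sums, and \<open>tensor_algebra\<close> can be exchanged
  for \<open>tensor_space\<close>.\<close>

lemma tlift_codomain_cong:
  assumes "carrier X = carrier X'" "add X = add X'" "zero X = zero X'" "smult X = smult X'"
  shows "tlift K X = tlift K X'"
  using assms by (intro ext) (simp add: tlift_def finsum_codomain_cong[OF assms(1-3)])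

lemma linear_hom_cong:
  assumes "carrier V = carrier V'" "add V = add V'" "smult V = smult V'"
    "carrier W = carrier W'" "add W = add W'" "smult W = smult W'"
  shows "linear_hom K V W = linear_hom K V' W'"
  using assms by (simp add: linear_hom_def)

lemma module_cong:
  fixes V :: "('k, 'v, 'y) module_scheme" and V' :: "('k, 'v, 'z) module_scheme"
  assumes "carrier V = carrier V'" "add V = add V'" "zero V = zero V'" "smult V = smult V'"
    and "module K V"
  shows "module K V'"
proof -
  interpret V: module K V by fact
  note e [simp] = assms(1-4)[symmetric]
  show ?thesis
  proof (rule moduleI)
    show "abelian_group V'"
    proof (rule abelian_groupI)
      show "\<exists>y\<in>carrier V'. y \<oplus>\<^bsub>V'\<^esub> x = \<zero>\<^bsub>V'\<^esub>" if "x \<in> carrier V'" for x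
        using that V.l_neg[of x] by (intro bexI[of _ "\<ominus>\<^bsub>V\<^esub> x"]) simp_all
    qed (simp_all add: V.a_ac)
  qed (simp_all add: V.smult_l_distr V.smult_r_distr V.smult_assoc1 V.is_cring)
qed

text \<open>An equality of sets and not merely an isomorphism: the construction reads only carriers,
  additions and scalars. This identifies the tensors over \<open>op_alg A\<close> with those over
  \<open>A\<close>.\<close>

lemma tensor_cong:
  fixes V :: "('k, 'v, 'y) module_scheme" and V' :: "('k, 'v, 'y') module_scheme"
    and W :: "('k, 'w, 'z) module_scheme" and W' :: "('k, 'w, 'z') module_scheme"
  assumes "carrier V = carrier V'" "add V = add V'" "smult V = smult V'"
    "carrier W = carrier W'" "add W = add W'" "smult W = smult W'"
  shows "tensor_space K V W = tensor_space K V' W'" "tens K V W = tens K V' W'"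
proof -
  have F: "tensor_free K V W = tensor_free K V' W'"
    by (simp add: tensor_free_def assms)
  have U: "tensor_rel K V W = tensor_rel K V' W'"
    by (simp add: tensor_rel_def F assms)
  show "tensor_space K V W = tensor_space K V' W'" "tens K V W = tens K V' W'"
    by (simp_all add: tensor_space_def tens_def F U fun_eq_iff)
qed

context field
begin

lemma tensor_productI: "\<lbrakk>module R V; module R W\<rbrakk> \<Longrightarrow> tensor_product R V W"
  by (simp add: tensor_product_def field_axioms)

lemmas tensor_module [simp, intro] = tensor_product.T_module[OF tensor_productI]
  and tens_closed [simp, intro] = tensor_product.tens_closed[OF tensor_productI]
  and tens_bilinear = tensor_product.tens_bilinear[OF tensor_productI]
  and tensor_induct [consumes 3, case_names tens add] = tensor_product.tensor_induct[OF tensor_productI]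
  and linear_ext_tensor = tensor_product.linear_ext_tensor[OF tensor_productI]
  and tlift_linear = tensor_product.tlift_linear[OF tensor_productI]
  and tlift_tens = tensor_product.tlift_tens[OF tensor_productI]
  and tlift_cong = tensor_product.tlift_cong[OF tensor_productI]
  and tlift_closed = tensor_product.tlift_closed[OF tensor_productI]
  and linear_tlift = tensor_product.linear_tlift[OF tensor_productI]
  and linear_tlift_param = tensor_product.tlift_linear_param[OF tensor_productI]

lemma linear_tens_left:
  "\<lbrakk>module R V; module R W; p \<in> linear_hom R U V; w \<in> carrier W\<rbrakk>
    \<Longrightarrow> (\<lambda>x. tens R V W (p x) w) \<in> linear_hom R U (tensor_space R V W)"
  by (rule linear_comp[OF bilinear_left[OF tens_bilinear]])

lemma linear_tens_right:
  "\<lbrakk>module R V; module R W; p \<in> linear_hom R U W; v \<in> carrier V\<rbrakk>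
    \<Longrightarrow> (\<lambda>x. tens R V W v (p x)) \<in> linear_hom R U (tensor_space R V W)"
  by (rule linear_comp[OF bilinear_right[OF tens_bilinear]])

lemma linear_tlift_arg:
  "\<lbrakk>module R V; module R W; module R X; bilinear R V W X f; p \<in> linear_hom R U (tensor_space R V W)\<rbrakk>
    \<Longrightarrow> (\<lambda>x. tlift R X f (p x)) \<in> linear_hom R U X"
  by (rule linear_comp[OF tlift_linear])

lemma bilinear_comp:
  assumes f: "bilinear R V W X f" and p: "p \<in> linear_hom R V' V" and q: "q \<in> linear_hom R W' W"
  shows "bilinear R V' W' X (\<lambda>x y. f (p x) (q y))"
proof (rule bilinearI)
  show "(\<lambda>v. f (p v) (q w)) \<in> linear_hom R V' X" if "w \<in> carrier W'" for w
    using linear_comp[OF bilinear_left[OF f linear_closed[OF q that]] p] .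
  show "(\<lambda>w. f (p v) (q w)) \<in> linear_hom R W' X" if "v \<in> carrier V'" for v
    using linear_comp[OF bilinear_right[OF f linear_closed[OF p that]] q] .
qed

lemma linear_bilinear:
  assumes "bilinear R V W X f" "h \<in> linear_hom R X Y"
  shows "bilinear R V W Y (\<lambda>x y. h (f x y))"
  by (rule bilinearI)
    (rule linear_comp[OF assms(2)], erule bilinear_left[OF assms(1)] bilinear_right[OF assms(1)])+

lemma tlift_tlift:
  assumes V: "module R V" "module R W" "module R V'" "module R W'" "module R X"
    and f: "bilinear R V W X f"
    and g: "\<And>v w. \<lbrakk>v \<in> carrier V'; w \<in> carrier W'\<rbrakk> \<Longrightarrow> g v w \<in> carrier (tensor_space R V W)"
    and t: "t \<in> carrier (tensor_space R V' W')"
  shows "tlift R X f (tlift R (tensor_space R V W) g t) = tlift R X (\<lambda>v w. tlift R X f (g v w)) t"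
  by (rule linear_tlift[OF V(3,4) tensor_module[OF V(1,2)] V(5) tlift_linear[OF V(1,2,5) f] t])
    (rule g)

lemma tlift_tlift_tens:
  assumes V: "module R V" "module R W" "module R V'" "module R W'" "module R X"
    and f: "bilinear R V W X f"
    and p: "p \<in> linear_hom R V' V" and q: "q \<in> linear_hom R W' W"
    and t: "t \<in> carrier (tensor_space R V' W')"
  shows "tlift R X f (tlift R (tensor_space R V W) (\<lambda>v w. tens R V W (p v) (q w)) t)
    = tlift R X (\<lambda>v w. f (p v) (q w)) t"
proof -
  have pq: "p v \<in> carrier V" "q w \<in> carrier W" if "v \<in> carrier V'" "w \<in> carrier W'" for v w
    using linear_closed[OF p] linear_closed[OF q] that by auto
  have "tlift R X f (tlift R (tensor_space R V W) (\<lambda>v w. tens R V W (p v) (q w)) t)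
    = tlift R X (\<lambda>v w. tlift R X f (tens R V W (p v) (q w))) t"
    by (rule tlift_tlift[OF V f _ t]) (simp add: V pq)
  also have "\<dots> = tlift R X (\<lambda>v w. f (p v) (q w)) t"
    by (rule tlift_cong[OF V(3,4,5) t]) (simp_all add: tlift_tens[OF V(1,2,5) f] bilinear_closed[OF f] pq)
  finally show ?thesis .
qed

lemma tlift_self:
  assumes V: "module R V" "module R W" and t: "t \<in> carrier (tensor_space R V W)"
  shows "tlift R (tensor_space R V W) (tens R V W) t = t"
proof -
  note T = tensor_module[OF V]
  show ?thesis
    by (rule linear_ext_tensor[OF V tlift_linear[OF V T tens_bilinear[OF V]] linear_id _ t])
      (rule tlift_tens[OF V T tens_bilinear[OF V]])
qed

text \<open>Independent Sweedler sums commute. Both sides are linear in \<open>t\<close>, and on a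
  pure tensor the sum over \<open>t\<close> is a single term.\<close>

lemma tlift_swap:
  assumes V: "module R V" "module R W" "module R V'" "module R W'" "module R X"
    and f1: "\<And>v w. \<lbrakk>v \<in> carrier V; w \<in> carrier W\<rbrakk> \<Longrightarrow> bilinear R V' W' X (f v w)"
    and f: "\<And>v' w'. \<lbrakk>v' \<in> carrier V'; w' \<in> carrier W'\<rbrakk> \<Longrightarrow> bilinear R V W X (\<lambda>v w. f v w v' w')"
    and t: "t \<in> carrier (tensor_space R V W)" and u: "u \<in> carrier (tensor_space R V' W')"
  shows "tlift R X (\<lambda>v w. tlift R X (\<lambda>v' w'. f v w v' w') u) t
    = tlift R X (\<lambda>v' w'. tlift R X (\<lambda>v w. f v w v' w') t) u"
proof (rule linear_ext_tensor[OF V(1,2) _ _ _ t])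
  have b: "bilinear R V W X (\<lambda>v w. tlift R X (f v w) u)"
    by (rule bilinearI; rule linear_tlift_param[OF V(3,4,5) _ u])
      (auto intro: V bilinear_left[OF f] bilinear_right[OF f])
  show "tlift R X (\<lambda>v w. tlift R X (f v w) u) \<in> linear_hom R (tensor_space R V W) X"
    by (rule tlift_linear[OF V(1,2,5) b])
  show "(\<lambda>t. tlift R X (\<lambda>v' w'. tlift R X (\<lambda>v w. f v w v' w') t) u)
    \<in> linear_hom R (tensor_space R V W) X"
    by (rule linear_tlift_param[OF V(3,4,5) tensor_module[OF V(1,2)] u])
      (rule tlift_linear[OF V(1,2,5) f])
  fix v w assume vw: "v \<in> carrier V" "w \<in> carrier W"
  have "tlift R X (\<lambda>v w. tlift R X (f v w) u) (tens R V W v w) = tlift R X (f v w) u"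
    by (rule tlift_tens[OF V(1,2,5) b vw])
  also have "\<dots> = tlift R X (\<lambda>v' w'. tlift R X (\<lambda>v w. f v w v' w') (tens R V W v w)) u"
    by (rule tlift_cong[OF V(3,4,5) u])
      (simp_all add: tlift_tens[OF V(1,2,5) f] vw bilinear_closed[OF f1])
  finally show "tlift R X (\<lambda>v w. tlift R X (f v w) u) (tens R V W v w)
    = tlift R X (\<lambda>v' w'. tlift R X (\<lambda>v w. f v w v' w') (tens R V W v w)) u" .
qed

end

section \<open>Tensor products of algebras\<close>

lemma tensor_algebra_simps [simp]:
  "carrier (tensor_algebra K A B) = carrier (tensor_space K A B)"
  "add (tensor_algebra K A B) = add (tensor_space K A B)"
  "zero (tensor_algebra K A B) = zero (tensor_space K A B)"
  "smult (tensor_algebra K A B) = smult (tensor_space K A B)"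
  "one (tensor_algebra K A B) = tens K A B \<one>\<^bsub>A\<^esub> \<one>\<^bsub>B\<^esub>"
  by (simp_all add: tensor_algebra_def Let_def)

text \<open>As simplification rules these drop the product wherever only the linear structure is
  read, so that linear goals are always about \<open>tensor_space\<close>.\<close>

lemma tensor_algebra_normalize [simp]:
  "tlift K (tensor_algebra K' A B) = tlift K (tensor_space K' A B)"
  "linear_hom K V (tensor_algebra K' A B) = linear_hom K V (tensor_space K' A B)"
  "linear_hom K (tensor_algebra K' A B) V = linear_hom K (tensor_space K' A B) V"
  "bilinear K V W (tensor_algebra K' A B) = bilinear K V W (tensor_space K' A B)"
  "bilinear K V (tensor_algebra K' A B) X = bilinear K V (tensor_space K' A B) X"
  "tensor_space K V (tensor_algebra K' A B) = tensor_space K V (tensor_space K' A B)"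
  "tens K V (tensor_algebra K' A B) = tens K V (tensor_space K' A B)"
  "module K (tensor_algebra K' A B) \<longleftrightarrow> module K (tensor_space K' A B)"
proof -
  show "tlift K (tensor_algebra K' A B) = tlift K (tensor_space K' A B)"
    by (rule tlift_codomain_cong) auto
  show l1: "linear_hom K V (tensor_algebra K' A B) = linear_hom K V (tensor_space K' A B)"
    by (rule linear_hom_cong) auto
  show "linear_hom K (tensor_algebra K' A B) V = linear_hom K (tensor_space K' A B) V"
    by (rule linear_hom_cong) auto
  show "bilinear K V W (tensor_algebra K' A B) = bilinear K V W (tensor_space K' A B)"
    by (simp add: bilinear_def linear_hom_def fun_eq_iff)
  show "bilinear K V (tensor_algebra K' A B) X = bilinear K V (tensor_space K' A B) X"
    by (simp add: bilinear_def linear_hom_def fun_eq_iff)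
  show "tensor_space K V (tensor_algebra K' A B) = tensor_space K V (tensor_space K' A B)"
    by (rule tensor_cong) auto
  show "tens K V (tensor_algebra K' A B) = tens K V (tensor_space K' A B)"
    by (rule tensor_cong) auto
  show "module K (tensor_algebra K' A B) \<longleftrightarrow> module K (tensor_space K' A B)"
    using module_cong[of "tensor_algebra K' A B" "tensor_space K' A B" K]
      module_cong[of "tensor_space K' A B" "tensor_algebra K' A B" K] by auto
qed

lemma k_algebraD:
  assumes "k_algebra K A"
  shows "field K" "module K A" "ring A"
  using assms by (auto simp: k_algebra_def)

lemma mult_bilinear:
  assumes "k_algebra K A"
  shows "bilinear K A A A (mult A)"
proof -
  interpret k_algebra K A by fact
  show ?thesis
    by (intro bilinearI linear_homI) (auto simp: l_distr r_distr smult_mult_left smult_mult_right)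
qed

lemma linear_mult_left:
  "\<lbrakk>k_algebra K A; p \<in> linear_hom K V A; a \<in> carrier A\<rbrakk> \<Longrightarrow> (\<lambda>x. p x \<otimes>\<^bsub>A\<^esub> a) \<in> linear_hom K V A"
  and linear_mult_right:
  "\<lbrakk>k_algebra K A; p \<in> linear_hom K V A; a \<in> carrier A\<rbrakk> \<Longrightarrow> (\<lambda>x. a \<otimes>\<^bsub>A\<^esub> p x) \<in> linear_hom K V A"
  by (rule linear_comp[OF bilinear_left[OF mult_bilinear]] linear_comp[OF bilinear_right[OF mult_bilinear]];
    assumption)+

lemma (in field) bilinear_mult:
  assumes "k_algebra R A" "p \<in> linear_hom R V A" "q \<in> linear_hom R W A"
  shows "bilinear R V W A (\<lambda>x y. p x \<otimes>\<^bsub>A\<^esub> q y)"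
  by (rule bilinear_comp[OF mult_bilinear[OF assms(1)] assms(2,3)])

lemma (in field) bilinear_tens:
  assumes "module R V" "module R W" "p \<in> linear_hom R V' V" "q \<in> linear_hom R W' W"
  shows "bilinear R V' W' (tensor_space R V W) (\<lambda>x y. tens R V W (p x) (q y))"
  by (rule bilinear_comp[OF tens_bilinear[OF assms(1,2)] assms(3,4)])

lemma (in field) tensor_mult_bilinear:
  assumes A: "k_algebra R A" and B: "k_algebra R B"
  shows "bilinear R (tensor_space R A B) (tensor_space R A B) (tensor_space R A B) (mult (tensor_algebra R A B))"
    and "\<lbrakk>a \<in> carrier A; b \<in> carrier B; a' \<in> carrier A; b' \<in> carrier B\<rbrakk>
      \<Longrightarrow> tens R A B a b \<otimes>\<^bsub>tensor_algebra R A B\<^esub> tens R A B a' b' = tens R A B (a \<otimes>\<^bsub>A\<^esub> a') (b \<otimes>\<^bsub>B\<^esub> b')"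
proof -
  note m [simp] = k_algebraD(2)[OF A] k_algebraD(2)[OF B]
  interpret A: ring A using k_algebraD[OF A] by simp
  interpret B: ring B using k_algebraD[OF B] by simp
  let ?T = "tensor_space R A B"
  define G where "G = (\<lambda>a b. tlift R ?T (\<lambda>a' b'. tens R A B (a \<otimes>\<^bsub>A\<^esub> a') (b \<otimes>\<^bsub>B\<^esub> b')))"
  have b1: "bilinear R A B ?T (\<lambda>a' b'. tens R A B (a \<otimes>\<^bsub>A\<^esub> a') (b \<otimes>\<^bsub>B\<^esub> b'))"
    if "a \<in> carrier A" "b \<in> carrier B" for a b
    using that by (intro bilinear_tens linear_mult_right linear_id A B) auto
  have b2: "bilinear R A B ?T (\<lambda>a b. G a b u)" if u: "u \<in> carrier ?T" for u
    unfolding G_def using u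
    by (intro bilinearI linear_tlift_param[where V=A and W=B] linear_tens_left linear_tens_right
          linear_mult_left linear_id A B) auto
  have e: "mult (tensor_algebra R A B) = (\<lambda>t u. tlift R ?T (\<lambda>a b. G a b u) t)"
    by (simp add: tensor_algebra_def Let_def G_def)
  show "bilinear R ?T ?T ?T (mult (tensor_algebra R A B))"
    unfolding e
  proof (rule bilinearI)
    fix u assume "u \<in> carrier ?T"
    then show "(\<lambda>t. tlift R ?T (\<lambda>a b. G a b u) t) \<in> linear_hom R ?T ?T"
      by (intro tlift_linear b2) auto
  next
    fix t assume t: "t \<in> carrier ?T"
    show "(\<lambda>u. tlift R ?T (\<lambda>a b. G a b u) t) \<in> linear_hom R ?T ?T"
      using t by (intro linear_tlift_param[where V=A and W=B]) (auto simp: G_def intro!: tlift_linear b1)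
  qed
  show "tens R A B a b \<otimes>\<^bsub>tensor_algebra R A B\<^esub> tens R A B a' b' = tens R A B (a \<otimes>\<^bsub>A\<^esub> a') (b \<otimes>\<^bsub>B\<^esub> b')"
    if "a \<in> carrier A" "b \<in> carrier B" "a' \<in> carrier A" "b' \<in> carrier B"
    using that b1 b2 by (simp add: e tlift_tens) (simp add: G_def tlift_tens)
qed

lemmas (in field) tensor_mult_tens [simp] = tensor_mult_bilinear(2)

text \<open>The product is biadditive, so associativity and the unit laws are seen on pure tensors,
  where they hold in each factor.\<close>

lemma (in field) tensor_k_algebra [simp, intro]:
  assumes A: "k_algebra R A" and B: "k_algebra R B"
  shows "k_algebra R (tensor_algebra R A B)"
proof -
  note m [simp] = k_algebraD(2)[OF A] k_algebraD(2)[OF B]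
  interpret A: ring A using k_algebraD[OF A] by simp
  interpret B: ring B using k_algebraD[OF B] by simp
  let ?TA = "tensor_algebra R A B" and ?T = "tensor_space R A B"
  note b = tensor_mult_bilinear(1)[OF A B]
  note l = bilinear_left[OF b] and r = bilinear_right[OF b]
  note addl = linear_add[OF l, simplified] and addr = linear_add[OF r, simplified]
  interpret T: module R ?T by (intro tensor_module) auto
  have cl: "t \<otimes>\<^bsub>?TA\<^esub> u \<in> carrier ?T" if "t \<in> carrier ?T" "u \<in> carrier ?T" for t u
    using bilinear_closed[OF b] that by simp
  have assoc: "t \<otimes>\<^bsub>?TA\<^esub> u \<otimes>\<^bsub>?TA\<^esub> w = t \<otimes>\<^bsub>?TA\<^esub> (u \<otimes>\<^bsub>?TA\<^esub> w)"
    if t: "t \<in> carrier ?T" and u: "u \<in> carrier ?T" and w: "w \<in> carrier ?T" for t u w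
    using m t
  proof (induction t rule: tensor_induct)
    case (tens a b)
    show ?case using m u
    proof (induction u rule: tensor_induct)
      case (tens a' b')
      show ?case using m w
      proof (induction w rule: tensor_induct)
        case (tens a'' b'')
        then show ?case
          using \<open>a \<in> carrier A\<close> \<open>b \<in> carrier B\<close> \<open>a' \<in> carrier A\<close> \<open>b' \<in> carrier B\<close>
          by (simp add: A B A.m_assoc B.m_assoc)
      next
        case (add x y)
        then show ?case
          using \<open>a \<in> carrier A\<close> \<open>b \<in> carrier B\<close> \<open>a' \<in> carrier A\<close> \<open>b' \<in> carrier B\<close>
          by (simp add: addr cl del: tensor_mult_tens)
      qed
    next
      case (add x y)
      then show ?case
        using \<open>a \<in> carrier A\<close> \<open>b \<in> carrier B\<close> w by (simp add: addr addl cl)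
    qed
  next
    case (add x y)
    then show ?case using u w by (simp add: addl cl)
  qed
  have one: "\<one>\<^bsub>?TA\<^esub> \<otimes>\<^bsub>?TA\<^esub> t = t" "t \<otimes>\<^bsub>?TA\<^esub> \<one>\<^bsub>?TA\<^esub> = t" if t: "t \<in> carrier ?T" for t
    using m t by (induction rule: tensor_induct) (simp_all add: A B addl addr)
  have "ring ?TA"
  proof (rule ringI)
    show "abelian_group ?TA"
    proof (rule abelian_groupI)
      show "\<exists>y\<in>carrier ?TA. y \<oplus>\<^bsub>?TA\<^esub> x = \<zero>\<^bsub>?TA\<^esub>" if "x \<in> carrier ?TA" for x
        using that by (intro bexI[of _ "\<ominus>\<^bsub>?T\<^esub> x"]) (auto simp: T.l_neg)
    qed (auto simp: T.a_ac)
    show "monoid ?TA"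
      by (rule monoidI) (use assoc one cl in auto)
  qed (use addl addr in auto)
  then show ?thesis
    by (intro k_algebra.intro k_algebra_axioms.intro field_axioms)
      (use linear_smult[OF l] linear_smult[OF r] in auto)
qed

lemma (in field) tlift_tensor_mult:
  assumes A: "k_algebra R A" and B: "k_algebra R B" and X: "module R X" and f: "bilinear R A B X f"
    and t: "t \<in> carrier (tensor_space R A B)" and u: "u \<in> carrier (tensor_space R A B)"
  shows "tlift R X f (t \<otimes>\<^bsub>tensor_algebra R A B\<^esub> u)
    = tlift R X (\<lambda>a b. tlift R X (\<lambda>a' b'. f (a \<otimes>\<^bsub>A\<^esub> a') (b \<otimes>\<^bsub>B\<^esub> b')) u) t"
proof -
  note m [simp] = k_algebraD(2)[OF A] k_algebraD(2)[OF B]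
  interpret A: ring A using k_algebraD[OF A] by simp
  interpret B: ring B using k_algebraD[OF B] by simp
  let ?T = "tensor_space R A B"
  have g: "tlift R ?T (\<lambda>a' b'. tens R A B (a \<otimes>\<^bsub>A\<^esub> a') (b \<otimes>\<^bsub>B\<^esub> b')) u \<in> carrier ?T"
    if "a \<in> carrier A" "b \<in> carrier B" for a b
    by (rule tlift_closed[OF m(1,2) _ u]) (auto simp: that)
  have e: "tlift R X f (tlift R ?T (\<lambda>a' b'. tens R A B (a \<otimes>\<^bsub>A\<^esub> a') (b \<otimes>\<^bsub>B\<^esub> b')) u)
    = tlift R X (\<lambda>a' b'. f (a \<otimes>\<^bsub>A\<^esub> a') (b \<otimes>\<^bsub>B\<^esub> b')) u" if "a \<in> carrier A" "b \<in> carrier B" for a b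
    by (rule tlift_tlift_tens[OF m(1,2,1,2) X f])
      (auto intro!: linear_mult_right linear_id simp: A B that u)
  have "tlift R X f (t \<otimes>\<^bsub>tensor_algebra R A B\<^esub> u) = tlift R X (\<lambda>a b. tlift R X f
    (tlift R ?T (\<lambda>a' b'. tens R A B (a \<otimes>\<^bsub>A\<^esub> a') (b \<otimes>\<^bsub>B\<^esub> b')) u)) t"
    using tlift_tlift[OF m(1,2,1,2) X f g t] by (simp add: tensor_algebra_def Let_def)
  also have "\<dots> = tlift R X (\<lambda>a b. tlift R X (\<lambda>a' b'. f (a \<otimes>\<^bsub>A\<^esub> a') (b \<otimes>\<^bsub>B\<^esub> b')) u) t"
    by (rule tlift_cong[OF m(1,2) X t], rule linear_closed[OF tlift_linear[OF m(1,2) X f] g])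
      (simp_all add: e)
  finally show ?thesis .
qed

lemma algebra_homD:
  assumes "f \<in> algebra_hom K A B"
  shows "f \<in> linear_hom K A B" "f \<one>\<^bsub>A\<^esub> = \<one>\<^bsub>B\<^esub>"
    "\<lbrakk>x \<in> carrier A; y \<in> carrier A\<rbrakk> \<Longrightarrow> f (x \<otimes>\<^bsub>A\<^esub> y) = f x \<otimes>\<^bsub>B\<^esub> f y"
    "x \<in> carrier A \<Longrightarrow> f x \<in> carrier B"
  using assms by (auto simp: algebra_hom_def linear_closed)

lemma algebra_homI:
  assumes "f \<in> linear_hom K A B" "f \<one>\<^bsub>A\<^esub> = \<one>\<^bsub>B\<^esub>"
    "\<And>x y. \<lbrakk>x \<in> carrier A; y \<in> carrier A\<rbrakk> \<Longrightarrow> f (x \<otimes>\<^bsub>A\<^esub> y) = f x \<otimes>\<^bsub>B\<^esub> f y"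
  shows "f \<in> algebra_hom K A B"
  using assms by (auto simp: algebra_hom_def)

lemma algebra_hom_comp:
  "\<lbrakk>f \<in> algebra_hom K B C; g \<in> algebra_hom K A B\<rbrakk> \<Longrightarrow> (\<lambda>x. f (g x)) \<in> algebra_hom K A C"
  by (auto simp: algebra_hom_def intro: linear_comp linear_closed)

text \<open>In \<open>(a \<otimes> b)(a' \<otimes> b')\<close> the image of \<open>b\<close> has to
  pass the image of \<open>a'\<close>; this is where the images must commute.\<close>

lemma (in field) tlift_algebra_hom:
  assumes A: "k_algebra R A" and B: "k_algebra R B" and X: "k_algebra R X"
    and f: "f \<in> algebra_hom R A X" and g: "g \<in> algebra_hom R B X"
    and comm: "\<And>a b. \<lbrakk>a \<in> carrier A; b \<in> carrier B\<rbrakk> \<Longrightarrow> g b \<otimes>\<^bsub>X\<^esub> f a = f a \<otimes>\<^bsub>X\<^esub> g b"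
  shows "tlift R X (\<lambda>a b. f a \<otimes>\<^bsub>X\<^esub> g b) \<in> algebra_hom R (tensor_algebra R A B) X"
proof -
  note m [simp] = k_algebraD(2)[OF A] k_algebraD(2)[OF B] k_algebraD(2)[OF X]
  interpret A: ring A using k_algebraD[OF A] by simp
  interpret B: ring B using k_algebraD[OF B] by simp
  interpret X: ring X using k_algebraD[OF X] by simp
  note ff = algebra_homD[OF f] and gg = algebra_homD[OF g]
  let ?L = "tlift R X (\<lambda>a b. f a \<otimes>\<^bsub>X\<^esub> g b)" and ?T = "tensor_space R A B" and ?TA = "tensor_algebra R A B"
  have b: "bilinear R A B X (\<lambda>a b. f a \<otimes>\<^bsub>X\<^esub> g b)" by (rule bilinear_mult[OF X ff(1) gg(1)])
  have L: "?L \<in> linear_hom R ?T X" by (intro tlift_linear b) auto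
  have Lt: "?L (tens R A B a b) = f a \<otimes>\<^bsub>X\<^esub> g b" if "a \<in> carrier A" "b \<in> carrier B" for a b
    using that b by (simp add: tlift_tens)
  note bb = tensor_mult_bilinear(1)[OF A B]
  interpret TA: ring ?TA using k_algebraD(3)[OF tensor_k_algebra[OF A B]] .
  show ?thesis
  proof (rule algebra_homI)
    show "?L \<in> linear_hom R ?TA X" using L by simp
    show "?L \<one>\<^bsub>?TA\<^esub> = \<one>\<^bsub>X\<^esub>" by (simp add: Lt ff gg)
    fix t u assume t: "t \<in> carrier ?TA" and u: "u \<in> carrier ?TA"
    show "?L (t \<otimes>\<^bsub>?TA\<^esub> u) = ?L t \<otimes>\<^bsub>X\<^esub> ?L u"
      using m(1,2) t[simplified]
    proof (induction t rule: tensor_induct)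
      case (tens a b)
      show ?case using m(1,2) u[simplified]
      proof (induction u rule: tensor_induct)
        case (tens a' b')
        have "f a \<otimes>\<^bsub>X\<^esub> f a' \<otimes>\<^bsub>X\<^esub> (g b \<otimes>\<^bsub>X\<^esub> g b') = f a \<otimes>\<^bsub>X\<^esub> (f a' \<otimes>\<^bsub>X\<^esub> g b) \<otimes>\<^bsub>X\<^esub> g b'"
          using tens \<open>a \<in> carrier A\<close> \<open>b \<in> carrier B\<close> by (simp add: X.m_assoc ff(4) gg(4))
        also have "f a' \<otimes>\<^bsub>X\<^esub> g b = g b \<otimes>\<^bsub>X\<^esub> f a'" using comm tens \<open>b \<in> carrier B\<close> by simp
        finally show ?case
          using tens \<open>a \<in> carrier A\<close> \<open>b \<in> carrier B\<close>
          by (simp add: A B Lt ff gg X.m_assoc)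
      next
        case (add x y)
        then show ?case using \<open>a \<in> carrier A\<close> \<open>b \<in> carrier B\<close> linear_closed[OF L]
          linear_add[OF bilinear_right[OF bb, simplified]] TA.m_closed[simplified]
          by (simp add: linear_add[OF L] X.r_distr)
      qed
    next
      case (add x y)
      then show ?case using u linear_closed[OF L]
        linear_add[OF bilinear_left[OF bb, simplified]] TA.m_closed[simplified]
        by (simp add: linear_add[OF L] X.l_distr)
    qed
  qed
qed

text \<open>The two inclusions of the factors. Their images commute and a pure tensor is their
  product, so a tensor-valued Sweedler sum is a convolution.\<close>

definition inl where "inl K A B a = tens K A B a \<one>\<^bsub>B\<^esub>"
definition inr where "inr K A B b = tens K A B \<one>\<^bsub>A\<^esub> b"

context field
begin

lemma inl_algebra_hom: "\<lbrakk>k_algebra R A; k_algebra R B\<rbrakk> \<Longrightarrow> inl R A B \<in> algebra_hom R A (tensor_algebra R A B)"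
  and inr_algebra_hom: "\<lbrakk>k_algebra R A; k_algebra R B\<rbrakk> \<Longrightarrow> inr R A B \<in> algebra_hom R B (tensor_algebra R A B)"
proof -
  assume A: "k_algebra R A" and B: "k_algebra R B"
  note m [simp] = k_algebraD(2)[OF A] k_algebraD(2)[OF B]
  interpret A: ring A using k_algebraD[OF A] by simp
  interpret B: ring B using k_algebraD[OF B] by simp
  show "inl R A B \<in> algebra_hom R A (tensor_algebra R A B)"
    "inr R A B \<in> algebra_hom R B (tensor_algebra R A B)"
    unfolding inl_def[abs_def] inr_def[abs_def]
    by (auto intro!: algebra_homI linear_tens_left linear_tens_right linear_id simp: A B)
qed

lemma
  assumes A: "k_algebra R A" and B: "k_algebra R B" and a: "a \<in> carrier A" and b: "b \<in> carrier B"
  shows inl_inr: "inl R A B a \<otimes>\<^bsub>tensor_algebra R A B\<^esub> inr R A B b = tens R A B a b"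
    and inr_inl: "inr R A B b \<otimes>\<^bsub>tensor_algebra R A B\<^esub> inl R A B a = tens R A B a b"
proof -
  note m [simp] = k_algebraD(2)[OF A] k_algebraD(2)[OF B]
  interpret A: ring A using k_algebraD[OF A] by simp
  interpret B: ring B using k_algebraD[OF B] by simp
  show "inl R A B a \<otimes>\<^bsub>tensor_algebra R A B\<^esub> inr R A B b = tens R A B a b"
    "inr R A B b \<otimes>\<^bsub>tensor_algebra R A B\<^esub> inl R A B a = tens R A B a b"
    using a b by (simp_all add: inl_def inr_def A B)
qed

end

section \<open>Convolution\<close>

context bialgebra
begin

lemma A_algebra [simp]: "k_algebra K A" by (rule k_algebra_axioms)
lemma A_module [simp]: "module K A" by (rule k_algebraD(2)[OF A_algebra])
lemma comult_closed [simp]: "c \<in> carrier A \<Longrightarrow> comult A c \<in> carrier (tensor_space K A A)"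
  by (rule linear_closed[OF comult_linear])
lemma counit_closed [simp]: "c \<in> carrier A \<Longrightarrow> counit A c \<in> carrier K"
  using linear_closed[OF counit_linear] by simp

text \<open>The axiom \<open>coassoc\<close> is the universal case with values in
  \<open>A \<otimes> (A \<otimes> A)\<close>; the linear map \<open>L\<close> induced by
  \<open>f\<close> carries it to any trilinear expression.\<close>

lemma coassoc_trilinear:
  assumes X: "module K X"
    and f23: "\<And>c1. c1 \<in> carrier A \<Longrightarrow> bilinear K A A X (f c1)"
    and f1: "\<And>c2 c3. \<lbrakk>c2 \<in> carrier A; c3 \<in> carrier A\<rbrakk> \<Longrightarrow> (\<lambda>c1. f c1 c2 c3) \<in> linear_hom K A X"
    and c: "c \<in> carrier A"
  shows "tlift K X (\<lambda>x c3. tlift K X (\<lambda>c1 c2. f c1 c2 c3) (comult A x)) (comult A c)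
    = tlift K X (\<lambda>c1 x. tlift K X (\<lambda>c2 c3. f c1 c2 c3) (comult A x)) (comult A c)"
proof -
  let ?A2 = "tensor_space K A A" and ?A3 = "tensor_space K A (tensor_space K A A)"
  let ?g = "\<lambda>c1 y. tlift K X (f c1) y"
  have m: "module K ?A2" "module K ?A3" by simp_all
  have g: "bilinear K A ?A2 X ?g"
    by (rule bilinearI)
      (auto intro!: linear_tlift_param[OF A_module A_module X A_module] f1 tlift_linear X f23)
  define L where "L = tlift K X ?g"
  have L: "L \<in> linear_hom K ?A3 X" unfolding L_def by (rule tlift_linear[OF A_module m(1) X g])
  have Lt: "L (tens K A ?A2 c1 (tens K A A c2 c3)) = f c1 c2 c3"
    if "c1 \<in> carrier A" "c2 \<in> carrier A" "c3 \<in> carrier A" for c1 c2 c3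
    unfolding L_def using that by (simp add: tlift_tens[OF A_module m(1) X g] tlift_tens X f23)
  have cl: "tens K A ?A2 c1 (tens K A A c2 c3) \<in> carrier ?A3"
    if "c1 \<in> carrier A" "c2 \<in> carrier A" "c3 \<in> carrier A" for c1 c2 c3
    using that by simp
  have fc: "f c1 c2 c3 \<in> carrier X" if "c1 \<in> carrier A" "c2 \<in> carrier A" "c3 \<in> carrier A" for c1 c2 c3
    using that bilinear_closed[OF f23] by simp
  note mm = A_module A_module
  have 1: "L (tlift K ?A3 (\<lambda>c1 c2. tens K A ?A2 c1 (tens K A A c2 c3)) (comult A x))
    = tlift K X (\<lambda>c1 c2. f c1 c2 c3) (comult A x)" if "x \<in> carrier A" "c3 \<in> carrier A" for x c3
    by (subst linear_tlift[OF mm m(2) X L])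
      (auto intro!: tlift_cong[OF mm X] simp: Lt fc that)
  have 2: "L (tlift K ?A3 (\<lambda>c2 c3. tens K A ?A2 c1 (tens K A A c2 c3)) (comult A x))
    = tlift K X (\<lambda>c2 c3. f c1 c2 c3) (comult A x)" if "x \<in> carrier A" "c1 \<in> carrier A" for x c1
    by (subst linear_tlift[OF mm m(2) X L])
      (auto intro!: tlift_cong[OF mm X] simp: Lt fc that)
  have "tlift K X (\<lambda>x c3. tlift K X (\<lambda>c1 c2. f c1 c2 c3) (comult A x)) (comult A c)
    = L (tlift K ?A3 (\<lambda>x c3. tlift K ?A3 (\<lambda>c1 c2.
        tens K A ?A2 c1 (tens K A A c2 c3)) (comult A x)) (comult A c))"
    by (subst linear_tlift[OF mm m(2) X L])
      (auto intro!: tlift_cong[OF mm X] tlift_closed[OF mm m(2)] tlift_closed[OF mm X] simp: 1 fc c)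
  also have "\<dots> = L (tlift K ?A3 (\<lambda>c1 x. tlift K ?A3 (\<lambda>c2 c3.
        tens K A ?A2 c1 (tens K A A c2 c3)) (comult A x)) (comult A c))"
    using coassoc[OF c] by simp
  also have "\<dots> = tlift K X (\<lambda>c1 x. tlift K X (\<lambda>c2 c3. f c1 c2 c3) (comult A x)) (comult A c)"
    by (subst linear_tlift[OF mm m(2) X L])
      (auto intro!: tlift_cong[OF mm X] tlift_closed[OF mm m(2)] tlift_closed[OF mm X] simp: 2 fc c)
  finally show ?thesis .
qed

lemma counit_left_linear:
  assumes X: "module K X" and f: "f \<in> linear_hom K A X" and c: "c \<in> carrier A"
  shows "tlift K X (\<lambda>c1 c2. counit A c1 \<odot>\<^bsub>X\<^esub> f c2) (comult A c) = f c"
proof -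
  interpret X: module K X by fact
  have "f (tlift K A (\<lambda>c1 c2. counit A c1 \<odot>\<^bsub>A\<^esub> c2) (comult A c))
    = tlift K X (\<lambda>c1 c2. counit A c1 \<odot>\<^bsub>X\<^esub> f c2) (comult A c)"
    by (subst linear_tlift[OF A_module A_module A_module X f])
      (auto intro!: tlift_cong[OF A_module A_module X] simp: c linear_closed[OF f] linear_smult[OF f])
  then show ?thesis using counit_left[OF c] by simp
qed

lemma counit_right_linear:
  assumes X: "module K X" and f: "f \<in> linear_hom K A X" and c: "c \<in> carrier A"
  shows "tlift K X (\<lambda>c1 c2. counit A c2 \<odot>\<^bsub>X\<^esub> f c1) (comult A c) = f c"
proof -
  interpret X: module K X by fact
  have "f (tlift K A (\<lambda>c1 c2. counit A c2 \<odot>\<^bsub>A\<^esub> c1) (comult A c))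
    = tlift K X (\<lambda>c1 c2. counit A c2 \<odot>\<^bsub>X\<^esub> f c1) (comult A c)"
    by (subst linear_tlift[OF A_module A_module A_module X f])
      (auto intro!: tlift_cong[OF A_module A_module X] simp: c linear_closed[OF f] linear_smult[OF f])
  then show ?thesis using counit_right[OF c] by simp
qed

lemma counit_mult:
  "\<lbrakk>x \<in> carrier A; y \<in> carrier A\<rbrakk> \<Longrightarrow> counit A (x \<otimes>\<^bsub>A\<^esub> y) = counit A x \<otimes>\<^bsub>K\<^esub> counit A y"
  and counit_one: "counit A \<one>\<^bsub>A\<^esub> = \<one>\<^bsub>K\<^esub>"
  using algebra_homD[OF counit_hom] by simp_all

lemma comult_mult:
  "\<lbrakk>x \<in> carrier A; y \<in> carrier A\<rbrakk>
    \<Longrightarrow> comult A (x \<otimes>\<^bsub>A\<^esub> y) = comult A x \<otimes>\<^bsub>tensor_algebra K A A\<^esub> comult A y"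
  and comult_one: "comult A \<one>\<^bsub>A\<^esub> = tens K A A \<one>\<^bsub>A\<^esub> \<one>\<^bsub>A\<^esub>"
  using algebra_homD[OF comult_hom] by simp_all

lemma tlift_comult_mult:
  assumes "module K X" "bilinear K A A X f" "x \<in> carrier A" "y \<in> carrier A"
  shows "tlift K X f (comult A (x \<otimes>\<^bsub>A\<^esub> y))
    = tlift K X (\<lambda>x1 x2. tlift K X (\<lambda>y1 y2. f (x1 \<otimes>\<^bsub>A\<^esub> y1) (x2 \<otimes>\<^bsub>A\<^esub> y2)) (comult A y)) (comult A x)"
  using assms by (simp add: comult_mult tlift_tensor_mult)

end

text \<open>Restricted to the carrier, so that identities of convolutions are equalities of functions.\<close>

definition conv ::
    "('k, 'x) ring_scheme \<Rightarrow> ('k, 'c, 'y) bialg_scheme \<Rightarrow> ('k, 'b, 'z) module_scheme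
      \<Rightarrow> ('c \<Rightarrow> 'b) \<Rightarrow> ('c \<Rightarrow> 'b) \<Rightarrow> 'c \<Rightarrow> 'b"
  where "conv K C B f g = (\<lambda>c\<in>carrier C. tlift K B (\<lambda>x y. f x \<otimes>\<^bsub>B\<^esub> g y) (comult C c))"

text \<open>The unit of convolution is the case \<open>b = 1\<close>.\<close>

definition cunit ::
    "('k, 'x) ring_scheme \<Rightarrow> ('k, 'c, 'y) bialg_scheme \<Rightarrow> ('k, 'b, 'z) module_scheme
      \<Rightarrow> 'b \<Rightarrow> 'c \<Rightarrow> 'b"
  where "cunit K C B b = (\<lambda>c\<in>carrier C. counit C c \<odot>\<^bsub>B\<^esub> b)"

lemma linear_restrict [simp]:
  assumes "module K V"
  shows "restrict f (carrier V) \<in> linear_hom K V W \<longleftrightarrow> f \<in> linear_hom K V W"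
proof -
  interpret module K V by fact
  show ?thesis by (auto simp: linear_hom_def Pi_iff)
qed

locale convolution = C: bialgebra K C + B: k_algebra K B
  for K :: "('k, 'x) ring_scheme" and C :: "('k, 'c, 'y) bialg_scheme"
    and B :: "('k, 'b, 'z) module_scheme"
begin

lemma B_algebra: "k_algebra K B" by (rule B.k_algebra_axioms)
lemma B_module: "module K B" by (rule k_algebraD(2)[OF B_algebra])

lemma conv_apply: "c \<in> carrier C \<Longrightarrow> conv K C B f g c = tlift K B (\<lambda>x y. f x \<otimes>\<^bsub>B\<^esub> g y) (comult C c)"
  by (simp add: conv_def)

lemma cunit_apply: "c \<in> carrier C \<Longrightarrow> cunit K C B b c = counit C c \<odot>\<^bsub>B\<^esub> b"
  by (simp add: cunit_def)

lemma conv_linear: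
  assumes f: "f \<in> linear_hom K C B" and g: "g \<in> linear_hom K C B"
  shows "conv K C B f g \<in> linear_hom K C B"
  unfolding conv_def linear_restrict[OF C.A_module]
  by (rule C.linear_tlift_arg[OF C.A_module C.A_module B_module C.bilinear_mult[OF B_algebra f g] C.comult_linear])

lemma cunit_linear:
  assumes b: "b \<in> carrier B"
  shows "cunit K C B b \<in> linear_hom K C B"
  unfolding cunit_def linear_restrict[OF C.A_module]
  by (rule linear_homI)
    (use b linear_add[OF C.counit_linear] linear_smult[OF C.counit_linear] in
      \<open>simp_all add: B.smult_l_distr B.smult_assoc1\<close>)

lemma conv_cong:
  assumes f: "f \<in> linear_hom K C B" and g: "g \<in> linear_hom K C B"
    and "\<And>c. c \<in> carrier C \<Longrightarrow> f c = f' c" "\<And>c. c \<in> carrier C \<Longrightarrow> g c = g' c"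
  shows "conv K C B f g = conv K C B f' g'"
proof -
  have "tlift K B (\<lambda>x y. f x \<otimes>\<^bsub>B\<^esub> g y) (comult C c) = tlift K B (\<lambda>x y. f' x \<otimes>\<^bsub>B\<^esub> g' y) (comult C c)"
    if "c \<in> carrier C" for c
    by (rule C.tlift_cong[OF C.A_module C.A_module B_module])
      (simp_all add: that B.m_closed linear_closed[OF f] linear_closed[OF g] flip: assms(3,4))
  then show ?thesis by (auto simp: conv_def)
qed

text \<open>\<open>conv_one\<close> leaves functions restricted to the carrier; these rules remove
  the restriction once such a function stands inside another convolution.\<close>

lemma conv_restrict:
  assumes f: "f \<in> linear_hom K C B" and g: "g \<in> linear_hom K C B"
  shows "conv K C B (restrict f (carrier C)) g = conv K C B f g"
    and "conv K C B f (restrict g (carrier C)) = conv K C B f g"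
  using conv_cong[OF f g, of "restrict f (carrier C)" g] conv_cong[OF f g, of f "restrict g (carrier C)"]
  by simp_all

text \<open>Each bracketing expands to a sum of products of \<open>f c1\<close>, \<open>g c2\<close>
  and \<open>h c3\<close> over an iterated coproduct, and \<open>coassoc_trilinear\<close>
  identifies the two iterations.\<close>

lemma conv_assoc:
  assumes f: "f \<in> linear_hom K C B" and g: "g \<in> linear_hom K C B" and h: "h \<in> linear_hom K C B"
  shows "conv K C B (conv K C B f g) h = conv K C B f (conv K C B g h)"
proof
  fix c show "conv K C B (conv K C B f g) h c = conv K C B f (conv K C B g h) c"
  proof (cases "c \<in> carrier C")
    case c: True
    note cl = linear_closed[OF f] linear_closed[OF g] linear_closed[OF h]
    note m = C.A_module
    have 1: "conv K C B f g x \<otimes>\<^bsub>B\<^esub> h c3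
      = tlift K B (\<lambda>c1 c2. f c1 \<otimes>\<^bsub>B\<^esub> (g c2 \<otimes>\<^bsub>B\<^esub> h c3)) (comult C x)"
      if "x \<in> carrier C" "c3 \<in> carrier C" for x c3
    proof -
      have "conv K C B f g x \<otimes>\<^bsub>B\<^esub> h c3 = tlift K B (\<lambda>c1 c2. f c1 \<otimes>\<^bsub>B\<^esub> g c2 \<otimes>\<^bsub>B\<^esub> h c3) (comult C x)"
        unfolding conv_apply[OF that(1)]
        by (rule C.linear_tlift[OF m m B_module B_module])
          (use that cl in \<open>auto intro: linear_mult_left[OF B_algebra linear_id]\<close>)
      also have "\<dots> = tlift K B (\<lambda>c1 c2. f c1 \<otimes>\<^bsub>B\<^esub> (g c2 \<otimes>\<^bsub>B\<^esub> h c3)) (comult C x)"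
        by (rule C.tlift_cong[OF m m B_module]) (use that cl in \<open>auto simp: B.m_assoc\<close>)
      finally show ?thesis .
    qed
    have 2: "f c1 \<otimes>\<^bsub>B\<^esub> conv K C B g h x
      = tlift K B (\<lambda>c2 c3. f c1 \<otimes>\<^bsub>B\<^esub> (g c2 \<otimes>\<^bsub>B\<^esub> h c3)) (comult C x)"
      if "x \<in> carrier C" "c1 \<in> carrier C" for x c1
      unfolding conv_apply[OF that(1)]
      by (rule C.linear_tlift[OF m m B_module B_module])
        (use that cl in \<open>auto intro: linear_mult_right[OF B_algebra linear_id]\<close>)
    note cl' = cl linear_closed[OF conv_linear[OF f g]] linear_closed[OF conv_linear[OF g h]]
    have "conv K C B (conv K C B f g) h c = tlift K B (\<lambda>x c3.
        tlift K B (\<lambda>c1 c2. f c1 \<otimes>\<^bsub>B\<^esub> (g c2 \<otimes>\<^bsub>B\<^esub> h c3)) (comult C x)) (comult C c)"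
      unfolding conv_apply[OF c]
      by (rule C.tlift_cong[OF m m B_module], (use c in simp), (use cl' in simp), (simp add: 1))
    also have "\<dots> = tlift K B (\<lambda>c1 x.
        tlift K B (\<lambda>c2 c3. f c1 \<otimes>\<^bsub>B\<^esub> (g c2 \<otimes>\<^bsub>B\<^esub> h c3)) (comult C x)) (comult C c)"
      by (rule C.coassoc_trilinear[OF B_module _ _ c])
        (use cl in \<open>auto intro!: C.bilinear_mult linear_mult_right linear_mult_left f g h B_algebra
          C.linear_bilinear[OF C.bilinear_mult[OF B_algebra g h]] linear_id\<close>)
    also have "\<dots> = conv K C B f (conv K C B g h) c"
      unfolding conv_apply[OF c]
      by (rule C.tlift_cong[OF m m B_module, symmetric], (use c in simp), (use cl' in simp), (simp add: 2))
    finally show ?thesis .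
  qed (simp add: conv_def)
qed

text \<open>The counit axiom removes the leg on which the constant map is evaluated. Constants can
  thus stand inside a chain of convolutions, where they act as multiplication by
  \<open>b\<close>.\<close>

lemma conv_cunit_left:
  assumes f: "f \<in> linear_hom K C B" and b: "b \<in> carrier B"
  shows "conv K C B (cunit K C B b) f = (\<lambda>c\<in>carrier C. b \<otimes>\<^bsub>B\<^esub> f c)"
proof -
  note cl = linear_closed[OF f]
  have "tlift K B (\<lambda>x y. cunit K C B b x \<otimes>\<^bsub>B\<^esub> f y) (comult C c) = b \<otimes>\<^bsub>B\<^esub> f c" if c: "c \<in> carrier C" for c
  proof -
    have "tlift K B (\<lambda>x y. cunit K C B b x \<otimes>\<^bsub>B\<^esub> f y) (comult C c)
      = tlift K B (\<lambda>x y. counit C x \<odot>\<^bsub>B\<^esub> (b \<otimes>\<^bsub>B\<^esub> f y)) (comult C c)"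
      by (rule C.tlift_cong[OF C.A_module C.A_module B_module])
        (use b cl c in \<open>simp_all add: cunit_apply B.smult_mult_left\<close>)
    also have "\<dots> = b \<otimes>\<^bsub>B\<^esub> f c"
      by (rule C.counit_left_linear[OF B_module linear_mult_right[OF B_algebra f b] c])
    finally show ?thesis .
  qed
  then show ?thesis by (auto simp: conv_def)
qed

lemma conv_cunit_right:
  assumes f: "f \<in> linear_hom K C B" and b: "b \<in> carrier B"
  shows "conv K C B f (cunit K C B b) = (\<lambda>c\<in>carrier C. f c \<otimes>\<^bsub>B\<^esub> b)"
proof -
  note cl = linear_closed[OF f]
  have "tlift K B (\<lambda>x y. f x \<otimes>\<^bsub>B\<^esub> cunit K C B b y) (comult C c) = f c \<otimes>\<^bsub>B\<^esub> b" if c: "c \<in> carrier C" for c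
  proof -
    have "tlift K B (\<lambda>x y. f x \<otimes>\<^bsub>B\<^esub> cunit K C B b y) (comult C c)
      = tlift K B (\<lambda>x y. counit C y \<odot>\<^bsub>B\<^esub> (f x \<otimes>\<^bsub>B\<^esub> b)) (comult C c)"
      by (rule C.tlift_cong[OF C.A_module C.A_module B_module])
        (use b cl c in \<open>simp_all add: cunit_apply B.smult_mult_right\<close>)
    also have "\<dots> = f c \<otimes>\<^bsub>B\<^esub> b"
      by (rule C.counit_right_linear[OF B_module linear_mult_left[OF B_algebra f b] c])
    finally show ?thesis .
  qed
  then show ?thesis by (auto simp: conv_def)
qed

lemma conv_one:
  assumes f: "f \<in> linear_hom K C B"
  shows "conv K C B (cunit K C B \<one>\<^bsub>B\<^esub>) f = restrict f (carrier C)"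
    and "conv K C B f (cunit K C B \<one>\<^bsub>B\<^esub>) = restrict f (carrier C)"
  using linear_closed[OF f] by (auto simp: conv_cunit_left conv_cunit_right f)

lemma cunit_mult:
  assumes "b \<in> carrier B" "b' \<in> carrier B"
  shows "conv K C B (cunit K C B b) (cunit K C B b') = cunit K C B (b \<otimes>\<^bsub>B\<^esub> b')"
  unfolding conv_cunit_left[OF cunit_linear[OF assms(2)] assms(1)]
  using assms by (auto simp: cunit_def B.smult_mult_right)

text \<open>A constant uses only the counit of its leg, so it can be moved along a chain as soon as
  \<open>b\<close> commutes with the values of \<open>f\<close>.\<close>

lemma cunit_commute:
  assumes f: "f \<in> linear_hom K C B" and b: "b \<in> carrier B"
    and "\<And>c. c \<in> carrier C \<Longrightarrow> f c \<otimes>\<^bsub>B\<^esub> b = b \<otimes>\<^bsub>B\<^esub> f c"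
  shows "conv K C B f (cunit K C B b) = conv K C B (cunit K C B b) f"
  using assms(3) by (auto simp: conv_cunit_left conv_cunit_right f b)

lemma conv_inverse_unique:
  assumes f: "f \<in> linear_hom K C B" and g: "g \<in> linear_hom K C B" and h: "h \<in> linear_hom K C B"
    and gf: "conv K C B g f = cunit K C B \<one>\<^bsub>B\<^esub>" and fh: "conv K C B f h = cunit K C B \<one>\<^bsub>B\<^esub>"
    and c: "c \<in> carrier C"
  shows "g c = h c"
proof -
  have "conv K C B g (cunit K C B \<one>\<^bsub>B\<^esub>) = conv K C B (cunit K C B \<one>\<^bsub>B\<^esub>) h"
    using conv_assoc[OF g f h] by (simp add: gf fh)
  then have "restrict g (carrier C) = restrict h (carrier C)" by (simp add: conv_one g h)
  then show ?thesis using c by (metis restrict_apply')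
qed

text \<open>The convolution is the coproduct of \<open>C\<close>, an algebra map, followed by the
  algebra map out of \<open>tensor_algebra K C C\<close> that \<open>f\<close> and \<open>g\<close>
  define.\<close>

lemma conv_algebra_hom:
  assumes f: "f \<in> algebra_hom K C B" and g: "g \<in> algebra_hom K C B"
    and comm: "\<And>x y. \<lbrakk>x \<in> carrier C; y \<in> carrier C\<rbrakk> \<Longrightarrow> g y \<otimes>\<^bsub>B\<^esub> f x = f x \<otimes>\<^bsub>B\<^esub> g y"
  shows "conv K C B f g \<in> algebra_hom K C B"
proof -
  interpret R: ring C using k_algebraD(3)[OF C.A_algebra] .
  have 1: "(\<lambda>c. tlift K B (\<lambda>x y. f x \<otimes>\<^bsub>B\<^esub> g y) (comult C c)) \<in> algebra_hom K C B"
    by (rule algebra_hom_comp[OF C.tlift_algebra_hom[OF C.A_algebra C.A_algebra B_algebra f g comm] C.comult_hom])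
  show ?thesis
    by (rule algebra_homI) (use algebra_homD[OF 1] in \<open>simp_all add: conv_linear
      algebra_homD(1)[OF f] algebra_homD(1)[OF g] conv_apply\<close>)
qed

lemma conv_hom:
  assumes B': "k_algebra K B'" and \<phi>: "\<phi> \<in> algebra_hom K B B'"
    and f: "f \<in> linear_hom K C B" and g: "g \<in> linear_hom K C B" and c: "c \<in> carrier C"
  shows "\<phi> (conv K C B f g c) = conv K C B' (\<lambda>x. \<phi> (f x)) (\<lambda>x. \<phi> (g x)) c"
proof -
  interpret B': k_algebra K B' by fact
  note cl = linear_closed[OF f] linear_closed[OF g]
  have m': "module K B'" by (rule k_algebraD(2)[OF B'])
  have "\<phi> (tlift K B (\<lambda>x y. f x \<otimes>\<^bsub>B\<^esub> g y) (comult C c))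
    = tlift K B' (\<lambda>x y. \<phi> (f x \<otimes>\<^bsub>B\<^esub> g y)) (comult C c)"
    by (rule C.linear_tlift[OF C.A_module C.A_module B_module m' algebra_homD(1)[OF \<phi>]])
      (use c cl in auto)
  also have "\<dots> = tlift K B' (\<lambda>x y. \<phi> (f x) \<otimes>\<^bsub>B'\<^esub> \<phi> (g y)) (comult C c)"
    by (rule C.tlift_cong[OF C.A_module C.A_module m'])
      (use c cl algebra_homD(3,4)[OF \<phi>] in auto)
  finally show ?thesis using c by (simp add: conv_def)
qed

lemma cunit_hom:
  assumes "\<phi> \<in> algebra_hom K B B'" "b \<in> carrier B" "c \<in> carrier C"
  shows "\<phi> (cunit K C B b c) = cunit K C B' (\<phi> b) c"
  using assms linear_smult[OF algebra_homD(1)[OF assms(1)]] by (simp add: cunit_def)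

end

lemma bialgebra_homD:
  assumes "f \<in> bialgebra_hom K A B"
  shows "f \<in> algebra_hom K A B" "f \<in> linear_hom K A B" "bialgebra K A" "bialgebra K B"
    "a \<in> carrier A \<Longrightarrow> comult B (f a) =
        tlift K (tensor_space K B B) (\<lambda>a1 a2. tens K B B (f a1) (f a2)) (comult A a)"
    "a \<in> carrier A \<Longrightarrow> counit B (f a) = counit A a"
    "a \<in> carrier A \<Longrightarrow> f a \<in> carrier B"
  using assms algebra_homD[of f K A B] by (auto simp: bialgebra_hom_def)

lemma tlift_comult_hom:
  assumes \<pi>: "\<pi> \<in> bialgebra_hom K D C" and X: "module K X" and f: "bilinear K C C X f"
    and d: "d \<in> carrier D"
  shows "tlift K X f (comult C (\<pi> d)) = tlift K X (\<lambda>x y. f (\<pi> x) (\<pi> y)) (comult D d)"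
proof -
  interpret D: bialgebra K D by (rule bialgebra_homD(3)[OF \<pi>])
  interpret C: bialgebra K C by (rule bialgebra_homD(4)[OF \<pi>])
  show ?thesis unfolding bialgebra_homD(5)[OF \<pi> d]
    by (rule D.tlift_tlift_tens) (use X f d bialgebra_homD(2)[OF \<pi>] in auto)
qed

text \<open>A bialgebra map commutes with coproducts, so the legs of \<open>\<pi> d\<close> are the
  images of the legs of \<open>d\<close>. With the projection this moves convolutions from
  \<open>H\<close> to \<open>A\<close>, with \<open>j\<close> from \<open>A\<close> to
  \<open>H\<close>.\<close>

lemma conv_precomp:
  assumes \<pi>: "\<pi> \<in> bialgebra_hom K D C" and B: "k_algebra K B"
    and f: "f \<in> linear_hom K C B" and g: "g \<in> linear_hom K C B" and d: "d \<in> carrier D"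
  shows "conv K C B f g (\<pi> d) = conv K D B (\<lambda>x. f (\<pi> x)) (\<lambda>x. g (\<pi> x)) d"
proof -
  interpret D: bialgebra K D by (rule bialgebra_homD(3)[OF \<pi>])
  interpret C: bialgebra K C by (rule bialgebra_homD(4)[OF \<pi>])
  show ?thesis
    using tlift_comult_hom[OF \<pi> k_algebraD(2)[OF B] D.bilinear_mult[OF B f g] d] d
      bialgebra_homD(7)[OF \<pi> d] by (simp add: conv_def)
qed

lemma cunit_precomp:
  assumes "\<pi> \<in> bialgebra_hom K D C" "d \<in> carrier D"
  shows "cunit K C B b (\<pi> d) = cunit K D B b d"
  using bialgebra_homD(6,7)[OF assms(1,2)] assms(2) by (simp add: cunit_def)

section \<open>The antipode\<close>

text \<open>\<open>tlift_swap\<close> exchanges the sum over \<open>t\<close> with the one over the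
  coproduct of \<open>c\<close>. In \<open>antipode_mult\<close> this evaluates a sum over one
  variable inside a convolution in the other.\<close>

lemma (in convolution) tlift_conv_left:
  assumes V: "module K V" and W: "module K W" and t: "t \<in> carrier (tensor_space K V W)"
    and F1: "\<And>v w. \<lbrakk>v \<in> carrier V; w \<in> carrier W\<rbrakk> \<Longrightarrow> F v w \<in> linear_hom K C B"
    and F2: "\<And>a. a \<in> carrier C \<Longrightarrow> bilinear K V W B (\<lambda>v w. F v w a)"
    and g: "g \<in> linear_hom K C B" and c: "c \<in> carrier C"
  shows "tlift K B (\<lambda>v w. conv K C B (F v w) g c) t = conv K C B (\<lambda>a. tlift K B (\<lambda>v w. F v w a) t) g c"
proof -
  note m = C.A_module
  note cl = linear_closed[OF g] linear_closed[OF F1]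
  have "tlift K B (\<lambda>v w. conv K C B (F v w) g c) t
    = tlift K B (\<lambda>x y. tlift K B (\<lambda>v w. F v w x \<otimes>\<^bsub>B\<^esub> g y) t) (comult C c)"
    unfolding conv_apply[OF c]
    by (rule C.tlift_swap[OF V W m m B_module _ _ t])
      (auto intro!: C.bilinear_mult[OF B_algebra F1 g] C.linear_bilinear[OF F2] linear_mult_left[OF B_algebra]
        linear_id simp: cl c)
  also have "\<dots> = tlift K B (\<lambda>x y. tlift K B (\<lambda>v w. F v w x) t \<otimes>\<^bsub>B\<^esub> g y) (comult C c)"
  proof (rule C.tlift_cong[OF m m B_module])
    fix x y assume xy: "x \<in> carrier C" "y \<in> carrier C"
    show "tlift K B (\<lambda>v w. F v w x \<otimes>\<^bsub>B\<^esub> g y) t \<in> carrier B"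
      by (rule C.tlift_closed[OF V W B_module t]) (use xy cl in simp)
    show "tlift K B (\<lambda>v w. F v w x \<otimes>\<^bsub>B\<^esub> g y) t = tlift K B (\<lambda>v w. F v w x) t \<otimes>\<^bsub>B\<^esub> g y"
      by (rule C.linear_tlift[OF V W B_module B_module linear_mult_left[OF B_algebra linear_id] t, symmetric])
        (use xy cl in auto)
  qed (use c in simp)
  finally show ?thesis using c by (simp add: conv_apply)
qed

lemma (in convolution) tlift_conv_right:
  assumes V: "module K V" and W: "module K W" and t: "t \<in> carrier (tensor_space K V W)"
    and F1: "\<And>v w. \<lbrakk>v \<in> carrier V; w \<in> carrier W\<rbrakk> \<Longrightarrow> F v w \<in> linear_hom K C B"
    and F2: "\<And>a. a \<in> carrier C \<Longrightarrow> bilinear K V W B (\<lambda>v w. F v w a)"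
    and g: "g \<in> linear_hom K C B" and c: "c \<in> carrier C"
  shows "tlift K B (\<lambda>v w. conv K C B g (F v w) c) t = conv K C B g (\<lambda>a. tlift K B (\<lambda>v w. F v w a) t) c"
proof -
  note m = C.A_module
  note cl = linear_closed[OF g] linear_closed[OF F1]
  have "tlift K B (\<lambda>v w. conv K C B g (F v w) c) t
    = tlift K B (\<lambda>x y. tlift K B (\<lambda>v w. g x \<otimes>\<^bsub>B\<^esub> F v w y) t) (comult C c)"
    unfolding conv_apply[OF c]
    by (rule C.tlift_swap[OF V W m m B_module _ _ t])
      (auto intro!: C.bilinear_mult[OF B_algebra g F1] C.linear_bilinear[OF F2] linear_mult_right[OF B_algebra]
        linear_id simp: cl c)
  also have "\<dots> = tlift K B (\<lambda>x y. g x \<otimes>\<^bsub>B\<^esub> tlift K B (\<lambda>v w. F v w y) t) (comult C c)"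
  proof (rule C.tlift_cong[OF m m B_module])
    fix x y assume xy: "x \<in> carrier C" "y \<in> carrier C"
    show "tlift K B (\<lambda>v w. g x \<otimes>\<^bsub>B\<^esub> F v w y) t \<in> carrier B"
      by (rule C.tlift_closed[OF V W B_module t]) (use xy cl in simp)
    show "tlift K B (\<lambda>v w. g x \<otimes>\<^bsub>B\<^esub> F v w y) t = g x \<otimes>\<^bsub>B\<^esub> tlift K B (\<lambda>v w. F v w y) t"
      by (rule C.linear_tlift[OF V W B_module B_module linear_mult_right[OF B_algebra linear_id] t, symmetric])
        (use xy cl in auto)
  qed (use c in simp)
  finally show ?thesis using c by (simp add: conv_apply)
qed

lemma (in field) self_k_algebra: "k_algebra R (self_module R)"
proof (intro k_algebra.intro k_algebra_axioms.intro field_axioms module_self)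
  interpret S: module R "self_module R" by (rule module_self)
  show "ring (self_module R)"
    by (rule ringI) (auto intro!: S.abelian_group_axioms monoidI simp: m_assoc l_distr r_distr)
qed (auto simp: m_ac)

lemma (in bialgebra) comult_conv:
  assumes h: "h \<in> carrier A"
  shows "comult A h = conv K A (tensor_algebra K A A) (inl K A A) (inr K A A) h"
proof -
  have "comult A h = tlift K (tensor_space K A A) (tens K A A) (comult A h)"
    by (rule tlift_self[OF A_module A_module comult_closed[OF h], symmetric])
  also have "\<dots> = tlift K (tensor_space K A A)
      (\<lambda>x y. inl K A A x \<otimes>\<^bsub>tensor_algebra K A A\<^esub> inr K A A y) (comult A h)"
    by (rule tlift_cong[OF A_module A_module tensor_module[OF A_module A_module] comult_closed[OF h]])
      (simp_all add: inl_inr)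
  finally show ?thesis using h by (simp add: conv_def)
qed

context hopf_algebra
begin

lemma S_closed [simp]: "h \<in> carrier H \<Longrightarrow> S h \<in> carrier H"
  by (rule linear_closed[OF antipode_linear])

lemma convolutionI: "k_algebra K B \<Longrightarrow> convolution K H B"
  by (simp add: convolution_def bialgebra_axioms)

lemma conv_S:
  shows "conv K H H (\<lambda>x. x) S = cunit K H H \<one>\<^bsub>H\<^esub>" "conv K H H S (\<lambda>x. x) = cunit K H H \<one>\<^bsub>H\<^esub>"
  by (auto simp: conv_def cunit_def antipode_left antipode_right)

text \<open>Apply \<open>\<phi>\<close> to the two antipode axioms; an algebra map respects
  convolution and its unit.\<close>

lemma antipode_hom:
  assumes B: "k_algebra K B" and \<phi>: "\<phi> \<in> algebra_hom K H B"
  shows "conv K H B \<phi> (\<lambda>x. \<phi> (S x)) = cunit K H B \<one>\<^bsub>B\<^esub>"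
    and "conv K H B (\<lambda>x. \<phi> (S x)) \<phi> = cunit K H B \<one>\<^bsub>B\<^esub>"
proof -
  interpret HH: convolution K H H by (rule convolutionI) simp
  have "conv K H B \<phi> (\<lambda>x. \<phi> (S x)) h = cunit K H B \<one>\<^bsub>B\<^esub> h" if "h \<in> carrier H" for h
    using HH.conv_hom[OF B \<phi> linear_id antipode_linear that] that algebra_homD(2)[OF \<phi>]
    by (simp add: conv_S HH.cunit_hom[OF \<phi>])
  then show "conv K H B \<phi> (\<lambda>x. \<phi> (S x)) = cunit K H B \<one>\<^bsub>B\<^esub>" by (auto simp: conv_def cunit_def)
  have "conv K H B (\<lambda>x. \<phi> (S x)) \<phi> h = cunit K H B \<one>\<^bsub>B\<^esub> h" if "h \<in> carrier H" for h
    using HH.conv_hom[OF B \<phi> antipode_linear linear_id that] that algebra_homD(2)[OF \<phi>]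
    by (simp add: conv_S HH.cunit_hom[OF \<phi>])
  then show "conv K H B (\<lambda>x. \<phi> (S x)) \<phi> = cunit K H B \<one>\<^bsub>B\<^esub>" by (auto simp: conv_def cunit_def)
qed

text \<open>Both sides are convolution inverse to \<open>\<phi>\<close>. For \<open>\<phi> = comult H\<close>, the convolution of the two
  inclusions, this says that the antipode reverses the coproduct.\<close>

lemma antipode_conv:
  assumes B: "k_algebra K B" and \<phi>: "\<phi> \<in> algebra_hom K H B"
    and u: "u \<in> algebra_hom K H B" and v: "v \<in> algebra_hom K H B"
    and eq: "\<And>h. h \<in> carrier H \<Longrightarrow> \<phi> h = conv K H B u v h" and h: "h \<in> carrier H"
  shows "\<phi> (S h) = conv K H B (\<lambda>x. v (S x)) (\<lambda>x. u (S x)) h"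
proof -
  interpret HB: convolution K H B by (rule convolutionI[OF B])
  have l: "u \<in> linear_hom K H B" "v \<in> linear_hom K H B" "\<phi> \<in> linear_hom K H B"
    using algebra_homD(1) u v \<phi> by blast+
  have lS: "(\<lambda>x. u (S x)) \<in> linear_hom K H B" "(\<lambda>x. v (S x)) \<in> linear_hom K H B"
    "(\<lambda>x. \<phi> (S x)) \<in> linear_hom K H B"
    using l antipode_linear by (auto intro: linear_comp)
  have "conv K H B \<phi> (conv K H B (\<lambda>x. v (S x)) (\<lambda>x. u (S x)))
    = conv K H B (conv K H B u v) (conv K H B (\<lambda>x. v (S x)) (\<lambda>x. u (S x)))"
    by (rule HB.conv_cong) (use l lS eq HB.conv_linear in auto)
  also have "\<dots> = conv K H B u (conv K H B (conv K H B v (\<lambda>x. v (S x))) (\<lambda>x. u (S x)))"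
    using l lS by (simp add: HB.conv_assoc HB.conv_linear)
  also have "\<dots> = cunit K H B \<one>\<^bsub>B\<^esub>"
    using l lS by (simp add: antipode_hom[OF B v] HB.conv_one HB.conv_restrict antipode_hom[OF B u])
  finally show ?thesis
    by (intro HB.conv_inverse_unique[OF l(3) lS(3) HB.conv_linear[OF lS(2,1)] antipode_hom(2)[OF B \<phi>] _ h])
qed

lemma antipode_one: "S \<one>\<^bsub>H\<^esub> = \<one>\<^bsub>H\<^esub>"
proof -
  have "tlift K H (\<lambda>h1 h2. h1 \<otimes>\<^bsub>H\<^esub> S h2) (tens K H H \<one>\<^bsub>H\<^esub> \<one>\<^bsub>H\<^esub>) = \<one>\<^bsub>H\<^esub> \<otimes>\<^bsub>H\<^esub> S \<one>\<^bsub>H\<^esub>"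
    by (rule tlift_tens[OF A_module A_module A_module bilinear_mult[OF A_algebra linear_id antipode_linear]])
      auto
  then show ?thesis using antipode_right[of "\<one>\<^bsub>H\<^esub>"] by (simp add: comult_one counit_one)
qed

text \<open>The counit is the unit of the convolution algebra of \<open>K\<close>-valued maps, so
  its inverse, the composite of the counit with \<open>S\<close>, is that unit too.\<close>

lemma antipode_counit: "h \<in> carrier H \<Longrightarrow> counit H (S h) = counit H h"
proof -
  assume h: "h \<in> carrier H"
  interpret HK: convolution K H "self_module K" by (rule convolutionI[OF self_k_algebra])
  have l: "(\<lambda>x. counit H (S x)) \<in> linear_hom K H (self_module K)"
    by (rule linear_comp[OF counit_linear antipode_linear])
  have "conv K H (self_module K) (\<lambda>x. counit H (S x)) (counit H)
    = conv K H (self_module K) (\<lambda>x. counit H (S x)) (cunit K H (self_module K) \<one>\<^bsub>self_module K\<^esub>)"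
    by (rule HK.conv_cong[OF l counit_linear]) (simp_all add: cunit_def)
  also have "\<dots> = restrict (\<lambda>x. counit H (S x)) (carrier H)" by (rule HK.conv_one[OF l])
  finally have "restrict (\<lambda>x. counit H (S x)) (carrier H) h = cunit K H (self_module K) \<one>\<^bsub>self_module K\<^esub> h"
    by (simp add: antipode_hom[OF self_k_algebra counit_hom])
  then show ?thesis using h by (simp add: cunit_def)
qed

lemma antipode_comult:
  assumes h: "h \<in> carrier H"
  shows "comult H (S h) = tlift K (tensor_space K H H) (\<lambda>h1 h2. tens K H H (S h2) (S h1)) (comult H h)"
proof -
  have "comult H (S h) = conv K H (tensor_algebra K H H) (\<lambda>x. inr K H H (S x)) (\<lambda>x. inl K H H (S x)) h"
    by (rule antipode_conv[OF tensor_k_algebra[OF A_algebra A_algebra] comult_hom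
          inl_algebra_hom[OF A_algebra A_algebra] inr_algebra_hom[OF A_algebra A_algebra] comult_conv h])
  also have "\<dots> = tlift K (tensor_space K H H)
      (\<lambda>x y. inr K H H (S x) \<otimes>\<^bsub>tensor_algebra K H H\<^esub> inl K H H (S y)) (comult H h)"
    using h by (simp add: conv_def)
  also have "\<dots> = tlift K (tensor_space K H H) (\<lambda>h1 h2. tens K H H (S h2) (S h1)) (comult H h)"
    by (rule tlift_cong[OF A_module A_module tensor_module[OF A_module A_module] comult_closed[OF h]])
      (simp_all add: inr_inl)
  finally show ?thesis .
qed

text \<open>Both sides are computed from \<open>S(x\<^sub>1y\<^sub>1) x\<^sub>2y\<^sub>2 S(y\<^sub>3)S(x\<^sub>3)\<close>.\<close>

lemma antipode_mult:
  assumes x: "x \<in> carrier H" and y: "y \<in> carrier H"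
  shows "S (x \<otimes>\<^bsub>H\<^esub> y) = S y \<otimes>\<^bsub>H\<^esub> S x"
proof -
  interpret HH: convolution K H H by (rule convolutionI) simp
  note m = A_module
  \<comment> \<open>In the convolution algebra of bilinear maps on \<open>H\<close>,
    \<open>N\<close> is a left and \<open>P\<close> a right inverse of the multiplication
    \<open>M\<close>. That convolution is written with \<open>conv\<close> in the second argument
    and \<open>tlift\<close> over the coproduct of the first.\<close>
  define M where "M = (\<lambda>a b. a \<otimes>\<^bsub>H\<^esub> b)"
  define N where "N = (\<lambda>a b. S (a \<otimes>\<^bsub>H\<^esub> b))"
  define P where "P = (\<lambda>a b. S b \<otimes>\<^bsub>H\<^esub> S a)"
  have Mb: "bilinear K H H H M" unfolding M_def by (rule mult_bilinear[OF A_algebra])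
  have Nb: "bilinear K H H H N"
    using linear_bilinear[OF Mb antipode_linear] by (simp add: N_def M_def)
  have Pb: "bilinear K H H H P"
    unfolding P_def
    by (rule bilinearI) (auto intro!: linear_mult_left[OF A_algebra] linear_mult_right[OF A_algebra] antipode_linear)
  note bl = bilinear_left[OF Mb] bilinear_left[OF Nb] bilinear_left[OF Pb]
    bilinear_right[OF Mb] bilinear_right[OF Nb] bilinear_right[OF Pb]
  note cl = bilinear_closed[OF Mb] bilinear_closed[OF Nb] bilinear_closed[OF Pb]
  have conv_bil: "bilinear K H H H (\<lambda>a b. conv K H H (F a) (G b) z)"
    if F: "bilinear K H H H F" and G: "bilinear K H H H G" and z: "z \<in> carrier H" for F G z
    unfolding HH.conv_apply[OF z]
    by (rule bilinearI; rule linear_tlift_param[OF m m m m comult_closed[OF z]])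
      (auto intro!: linear_mult_left[OF A_algebra] linear_mult_right[OF A_algebra] bilinear_left[OF F]
        bilinear_left[OF G] bilinear_closed[OF F] bilinear_closed[OF G])
  have NM: "tlift K H (\<lambda>a b. conv K H H (N a) (M b) z) (comult H w)
    = counit H w \<odot>\<^bsub>H\<^esub> cunit K H H \<one>\<^bsub>H\<^esub> z" if w: "w \<in> carrier H" and z: "z \<in> carrier H" for w z
    using tlift_comult_mult[OF m bilinear_mult[OF A_algebra antipode_linear linear_id] w z]
      antipode_left[of "w \<otimes>\<^bsub>H\<^esub> z"] w z
    by (simp add: HH.conv_apply N_def M_def counit_mult cunit_def smult_assoc1)
  \<comment> \<open>The inner pair \<open>z1\<close>, \<open>S z2\<close> collapses first, and the
    product of \<open>a\<close> and \<open>S b\<close> is left for the sum over the coproduct of the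
    first argument.\<close>
  have MP1: "conv K H H (M a) (P b) z = counit H z \<odot>\<^bsub>H\<^esub> (a \<otimes>\<^bsub>H\<^esub> S b)"
    if a: "a \<in> carrier H" and b: "b \<in> carrier H" and z: "z \<in> carrier H" for a b z
  proof -
    have l: "(\<lambda>u. a \<otimes>\<^bsub>H\<^esub> u \<otimes>\<^bsub>H\<^esub> S b) \<in> linear_hom K H H"
      by (intro linear_mult_left[OF A_algebra] linear_mult_right[OF A_algebra] linear_id) (use a b in auto)
    have "conv K H H (M a) (P b) z
      = tlift K H (\<lambda>z1 z2. a \<otimes>\<^bsub>H\<^esub> (z1 \<otimes>\<^bsub>H\<^esub> S z2) \<otimes>\<^bsub>H\<^esub> S b) (comult H z)"
      unfolding HH.conv_apply[OF z]
      by (rule tlift_cong[OF m m m]) (use a b z in \<open>simp_all add: M_def P_def m_assoc\<close>)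
    also have "\<dots> = a \<otimes>\<^bsub>H\<^esub> (tlift K H (\<lambda>z1 z2. z1 \<otimes>\<^bsub>H\<^esub> S z2) (comult H z)) \<otimes>\<^bsub>H\<^esub> S b"
      by (rule linear_tlift[OF m m m m l, symmetric]) (use z in auto)
    also have "\<dots> = counit H z \<odot>\<^bsub>H\<^esub> (a \<otimes>\<^bsub>H\<^esub> S b)"
      using a b z by (simp add: antipode_right smult_mult_right smult_mult_left)
    finally show ?thesis .
  qed
  have MP: "tlift K H (\<lambda>a b. conv K H H (M a) (P b) z) (comult H w)
    = counit H w \<odot>\<^bsub>H\<^esub> cunit K H H \<one>\<^bsub>H\<^esub> z" if w: "w \<in> carrier H" and z: "z \<in> carrier H" for w z
  proof -
    have l: "(\<lambda>u. counit H z \<odot>\<^bsub>H\<^esub> u) \<in> linear_hom K H H"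
      by (rule linear_homI)
        (use z in \<open>simp_all add: smult_r_distr m_comm flip: smult_assoc1\<close>)
    have "tlift K H (\<lambda>a b. conv K H H (M a) (P b) z) (comult H w)
      = tlift K H (\<lambda>a b. counit H z \<odot>\<^bsub>H\<^esub> (a \<otimes>\<^bsub>H\<^esub> S b)) (comult H w)"
      by (rule tlift_cong[OF m m m]) (use w z in \<open>simp_all add: MP1\<close>)
    also have "\<dots> = counit H z \<odot>\<^bsub>H\<^esub> (counit H w \<odot>\<^bsub>H\<^esub> \<one>\<^bsub>H\<^esub>)"
      using linear_tlift[OF m m m m l comult_closed[OF w], of "\<lambda>a b. a \<otimes>\<^bsub>H\<^esub> S b"] w
      by (simp add: antipode_right)
    finally show ?thesis using w z by (simp add: cunit_def m_comm flip: smult_assoc1)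
  qed
  have lin: "conv K H H (N a) (M b) \<in> linear_hom K H H" "conv K H H (M a) (P b) \<in> linear_hom K H H"
    if "a \<in> carrier H" "b \<in> carrier H" for a b
    using that bl by (auto intro!: HH.conv_linear)
  have smult_cunit: "conv K H H (\<lambda>z. c \<odot>\<^bsub>H\<^esub> cunit K H H \<one>\<^bsub>H\<^esub> z) f y = c \<odot>\<^bsub>H\<^esub> f y"
    "conv K H H f (\<lambda>z. c \<odot>\<^bsub>H\<^esub> cunit K H H \<one>\<^bsub>H\<^esub> z) y = c \<odot>\<^bsub>H\<^esub> f y"
    if c: "c \<in> carrier K" and f: "f \<in> linear_hom K H H" for c f
  proof -
    have e: "c \<odot>\<^bsub>H\<^esub> cunit K H H \<one>\<^bsub>H\<^esub> z = cunit K H H (c \<odot>\<^bsub>H\<^esub> \<one>\<^bsub>H\<^esub>) z" if "z \<in> carrier H" for z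
      using that c by (simp add: cunit_def m_comm flip: smult_assoc1)
    have l: "cunit K H H (c \<odot>\<^bsub>H\<^esub> \<one>\<^bsub>H\<^esub>) \<in> linear_hom K H H" using c by (intro HH.cunit_linear) auto
    have q1: "conv K H H (cunit K H H (c \<odot>\<^bsub>H\<^esub> \<one>\<^bsub>H\<^esub>)) f = conv K H H (\<lambda>z. c \<odot>\<^bsub>H\<^esub> cunit K H H \<one>\<^bsub>H\<^esub> z) f"
      by (rule HH.conv_cong[OF l f]) (simp_all add: e)
    show "conv K H H (\<lambda>z. c \<odot>\<^bsub>H\<^esub> cunit K H H \<one>\<^bsub>H\<^esub> z) f y = c \<odot>\<^bsub>H\<^esub> f y"
      using HH.conv_cunit_left[OF f, of "c \<odot>\<^bsub>H\<^esub> \<one>\<^bsub>H\<^esub>"] c y linear_closed[OF f]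
      unfolding q1[symmetric] by (simp add: smult_mult_left)
    have q2: "conv K H H f (cunit K H H (c \<odot>\<^bsub>H\<^esub> \<one>\<^bsub>H\<^esub>)) = conv K H H f (\<lambda>z. c \<odot>\<^bsub>H\<^esub> cunit K H H \<one>\<^bsub>H\<^esub> z)"
      by (rule HH.conv_cong[OF f l]) (simp_all add: e)
    show "conv K H H f (\<lambda>z. c \<odot>\<^bsub>H\<^esub> cunit K H H \<one>\<^bsub>H\<^esub> z) y = c \<odot>\<^bsub>H\<^esub> f y"
      using HH.conv_cunit_right[OF f, of "c \<odot>\<^bsub>H\<^esub> \<one>\<^bsub>H\<^esub>"] c y linear_closed[OF f]
      unfolding q2[symmetric] by (simp add: smult_mult_right)
  qed
  have 1: "tlift K H (\<lambda>a b. conv K H H (conv K H H (N a) (M b)) (P c) y) (comult H w)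
    = counit H w \<odot>\<^bsub>H\<^esub> P c y" if w: "w \<in> carrier H" and c: "c \<in> carrier H" for w c
  proof -
    have "tlift K H (\<lambda>a b. conv K H H (conv K H H (N a) (M b)) (P c) y) (comult H w)
      = conv K H H (\<lambda>z. tlift K H (\<lambda>a b. conv K H H (N a) (M b) z) (comult H w)) (P c) y"
      by (rule HH.tlift_conv_left[OF m m comult_closed[OF w] lin(1) conv_bil[OF Nb Mb] bl(6)[OF c] y])
    also have "\<dots> = conv K H H (\<lambda>z. counit H w \<odot>\<^bsub>H\<^esub> cunit K H H \<one>\<^bsub>H\<^esub> z) (P c) y"
      using HH.conv_cong[of "\<lambda>z. tlift K H (\<lambda>a b. conv K H H (N a) (M b) z) (comult H w)" "P c"
          "\<lambda>z. counit H w \<odot>\<^bsub>H\<^esub> cunit K H H \<one>\<^bsub>H\<^esub> z" "P c"]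
        linear_tlift_param[OF m m m m comult_closed[OF w] lin(1)] bl(6)[OF c] NM[OF w]
      by simp
    finally show ?thesis using smult_cunit(1)[OF counit_closed[OF w] bl(6)[OF c]] by simp
  qed
  have 2: "tlift K H (\<lambda>b c. conv K H H (N a) (conv K H H (M b) (P c)) y) (comult H w)
    = counit H w \<odot>\<^bsub>H\<^esub> N a y" if w: "w \<in> carrier H" and a: "a \<in> carrier H" for w a
  proof -
    have "tlift K H (\<lambda>b c. conv K H H (N a) (conv K H H (M b) (P c)) y) (comult H w)
      = conv K H H (N a) (\<lambda>z. tlift K H (\<lambda>b c. conv K H H (M b) (P c) z) (comult H w)) y"
      by (rule HH.tlift_conv_right[OF m m comult_closed[OF w] lin(2) conv_bil[OF Mb Pb] bl(5)[OF a] y])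
    also have "\<dots> = conv K H H (N a) (\<lambda>z. counit H w \<odot>\<^bsub>H\<^esub> cunit K H H \<one>\<^bsub>H\<^esub> z) y"
      using HH.conv_cong[of "N a" "\<lambda>z. tlift K H (\<lambda>b c. conv K H H (M b) (P c) z) (comult H w)" "N a"
          "\<lambda>z. counit H w \<odot>\<^bsub>H\<^esub> cunit K H H \<one>\<^bsub>H\<^esub> z"]
        linear_tlift_param[OF m m m m comult_closed[OF w] lin(2)] bl(5)[OF a] MP[OF w]
      by simp
    finally show ?thesis using smult_cunit(2)[OF counit_closed[OF w] bl(5)[OF a]] by simp
  qed
  have cc: "conv K H H (conv K H H (N a) (M b)) (P c) y = conv K H H (N a) (conv K H H (M b) (P c)) y"
    if "a \<in> carrier H" "b \<in> carrier H" "c \<in> carrier H" for a b c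
    using HH.conv_assoc[OF bl(5,4,6)] that by simp
  have cc_closed: "conv K H H (N a) (conv K H H (M b) (P c)) y \<in> carrier H"
    if "a \<in> carrier H" "b \<in> carrier H" "c \<in> carrier H" for a b c
    by (rule linear_closed[OF HH.conv_linear[OF bl(5) lin(2)] y]) (use that in auto)
  have tri: "bilinear K H H H (\<lambda>b c. conv K H H (N a) (conv K H H (M b) (P c)) y)" if a: "a \<in> carrier H" for a
    unfolding HH.conv_apply[OF y]
    by (rule bilinearI; rule linear_tlift_param[OF m m m m comult_closed[OF y]])
      (auto intro!: linear_mult_right[OF A_algebra] bilinear_left[OF conv_bil[OF Mb Pb]]
        bilinear_right[OF conv_bil[OF Mb Pb]] cl a)
  have tri1: "(\<lambda>a. conv K H H (N a) (conv K H H (M b) (P c)) y) \<in> linear_hom K H H"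
    if bc: "b \<in> carrier H" "c \<in> carrier H" for b c
    unfolding HH.conv_apply[OF y]
    by (rule linear_tlift_param[OF m m m m comult_closed[OF y]])
      (auto intro!: linear_mult_left[OF A_algebra] bl linear_closed[OF lin(2)] bc)
  \<comment> \<open>The product of \<open>N\<close>, \<open>M\<close> and \<open>P\<close> is
    evaluated twice: cancelling \<open>N\<close> with \<open>M\<close> leaves \<open>P\<close>;
    after rebracketing in both arguments, cancelling \<open>M\<close> with \<open>P\<close> leaves
    \<open>N\<close>.\<close>
  have "S y \<otimes>\<^bsub>H\<^esub> S x = tlift K H (\<lambda>w c. counit H w \<odot>\<^bsub>H\<^esub> P c y) (comult H x)"
    using counit_left_linear[OF m bl(3)[OF y] x] by (simp add: P_def)
  also have "\<dots> = tlift K H (\<lambda>w c. tlift K H (\<lambda>a b. conv K H H (N a) (conv K H H (M b) (P c)) y) (comult H w)) (comult H x)"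
  proof (rule tlift_cong[OF m m m comult_closed[OF x]])
    fix w c assume wc: "w \<in> carrier H" "c \<in> carrier H"
    show "counit H w \<odot>\<^bsub>H\<^esub> P c y \<in> carrier H" using wc cl y by simp
    have "tlift K H (\<lambda>a b. conv K H H (N a) (conv K H H (M b) (P c)) y) (comult H w)
      = tlift K H (\<lambda>a b. conv K H H (conv K H H (N a) (M b)) (P c) y) (comult H w)"
      by (rule tlift_cong[OF m m m comult_closed]) (use wc in \<open>simp_all add: cc cc_closed\<close>)
    then show "counit H w \<odot>\<^bsub>H\<^esub> P c y
      = tlift K H (\<lambda>a b. conv K H H (N a) (conv K H H (M b) (P c)) y) (comult H w)"
      using 1 wc by simp
  qed
  also have "\<dots> = tlift K H (\<lambda>a w. tlift K H (\<lambda>b c. conv K H H (N a) (conv K H H (M b) (P c)) y) (comult H w)) (comult H x)"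
    by (rule coassoc_trilinear[OF m tri tri1 x])
  also have "\<dots> = tlift K H (\<lambda>a w. counit H w \<odot>\<^bsub>H\<^esub> N a y) (comult H x)"
    by (rule tlift_cong[OF m m m comult_closed[OF x], symmetric]) (use cl y in \<open>simp_all add: 2\<close>)
  also have "\<dots> = S (x \<otimes>\<^bsub>H\<^esub> y)"
    using counit_right_linear[OF m bl(2)[OF y] x] by (simp add: N_def)
  finally show ?thesis by simp
qed

end

section \<open>Opposite bialgebras\<close>

lemma op_alg_simps [simp]:
  "carrier (op_alg A) = carrier A" "zero (op_alg A) = zero A" "add (op_alg A) = add A"
  "smult (op_alg A) = smult A" "one (op_alg A) = one A" "comult (op_alg A) = comult A"
  "counit (op_alg A) = counit A" "mult (op_alg A) = (\<lambda>x y. y \<otimes>\<^bsub>A\<^esub> x)"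
  by (simp_all add: op_alg_def)

lemma op_alg_normalize [simp]:
  "tlift K (op_alg A) = tlift K A"
  "linear_hom K V (op_alg A) = linear_hom K V A"
  "linear_hom K (op_alg A) V = linear_hom K A V"
  "tensor_space K V (op_alg A) = tensor_space K V A"
  "tensor_space K (op_alg A) V = tensor_space K A V"
  "tens K V (op_alg A) = tens K V A"
  "tens K (op_alg A) V = tens K A V"
proof -
  show "tlift K (op_alg A) = tlift K A" by (rule tlift_codomain_cong) auto
  show "linear_hom K V (op_alg A) = linear_hom K V A" by (rule linear_hom_cong) auto
  show "linear_hom K (op_alg A) V = linear_hom K A V" by (rule linear_hom_cong) auto
  show "tensor_space K V (op_alg A) = tensor_space K V A" by (rule tensor_cong) auto
  show "tensor_space K (op_alg A) V = tensor_space K A V" by (rule tensor_cong) auto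
  show "tens K V (op_alg A) = tens K V A" by (rule tensor_cong) auto
  show "tens K (op_alg A) V = tens K A V" by (rule tensor_cong) auto
qed

lemma op_module: "module K A \<Longrightarrow> module K (op_alg A)"
  by (rule module_cong[of A]) auto

lemma op_k_algebra:
  assumes "k_algebra K A"
  shows "k_algebra K (op_alg A)"
proof -
  interpret k_algebra K A by fact
  have m: "module K (op_alg A)" by (rule op_module[OF k_algebraD(2)[OF assms]])
  show ?thesis
  proof (intro k_algebra.intro k_algebra_axioms.intro field_axioms m)
    show "ring (op_alg A)"
      by (rule ringI)
        (use module.axioms(2)[OF m] in \<open>auto intro!: monoidI simp: m_assoc l_distr r_distr\<close>)
  qed (auto simp: smult_mult_left smult_mult_right)
qed

text \<open>Reversing both products exchanges the two nested sums of \<open>tensor_algebra\<close>,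
  and \<open>tlift_swap\<close> restores their order.\<close>

lemma op_tensor_mult:
  assumes A: "k_algebra K A" and B: "k_algebra K B"
    and t: "t \<in> carrier (tensor_space K A B)" and u: "u \<in> carrier (tensor_space K A B)"
  shows "t \<otimes>\<^bsub>tensor_algebra K (op_alg A) (op_alg B)\<^esub> u = u \<otimes>\<^bsub>tensor_algebra K A B\<^esub> t"
proof -
  interpret field K by (rule k_algebraD(1)[OF A])
  note m [simp] = k_algebraD(2)[OF A] k_algebraD(2)[OF B]
  have T: "module K (tensor_space K A B)" by simp
  show ?thesis unfolding tensor_algebra_def Let_def
    by simp (rule tlift_swap[OF m m T _ _ t u];
      rule bilinear_tens[OF m linear_mult_left[OF A linear_id] linear_mult_left[OF B linear_id]]
        bilinear_tens[OF m linear_mult_right[OF A linear_id] linear_mult_right[OF B linear_id]];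
      assumption)
qed

text \<open>The coproduct stays multiplicative because the products of both its source and its
  target are reversed.\<close>

lemma op_bialgebra:
  assumes "bialgebra K A"
  shows "bialgebra K (op_alg A)"
proof -
  interpret bialgebra K A by fact
  have A: "k_algebra K A" by (rule A_algebra)
  have m: "module K (op_alg A)" by (rule op_module[OF A_module])
  have 1: "k_coalgebra K (op_alg A) (comult A) (counit A)"
    by (intro k_coalgebra.intro k_coalgebra_axioms.intro field_axioms m)
      (simp_all add: comult_linear counit_linear coassoc counit_left counit_right)
  have 2: "comult A \<in> algebra_hom K (op_alg A) (tensor_algebra K (op_alg A) (op_alg A))"
    by (rule algebra_homI) (simp_all add: comult_linear comult_one comult_mult op_tensor_mult A)
  have 3: "counit A \<in> algebra_hom K (op_alg A) (self_module K)"
    by (rule algebra_homI) (simp_all add: counit_linear counit_one counit_mult m_comm)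
  show ?thesis
    by (intro bialgebra.intro bialgebra_axioms.intro op_k_algebra A) (simp_all add: 1 2 3)
qed

lemma op_bialgebra_hom:
  assumes "f \<in> bialgebra_hom K A B"
  shows "f \<in> bialgebra_hom K (op_alg A) (op_alg B)"
  using bialgebra_homD[OF assms] algebra_homD[of f K A B] op_bialgebra[OF bialgebra_homD(3)[OF assms]]
    op_bialgebra[OF bialgebra_homD(4)[OF assms]]
  by (auto simp: bialgebra_hom_def intro!: algebra_homI)

lemma op_bialgebra_iso:
  "f \<in> bialgebra_iso K A B \<Longrightarrow> f \<in> bialgebra_iso K (op_alg A) (op_alg B)"
  by (auto simp: bialgebra_iso_def op_bialgebra_hom)

lemma linear_inv_into:
  assumes V: "module K V" and f: "f \<in> linear_hom K V W" and bij: "bij_betw f (carrier V) (carrier W)"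
  shows "inv_into (carrier V) f \<in> linear_hom K W V"
proof -
  interpret V: module K V by fact
  let ?g = "inv_into (carrier V) f"
  have g: "?g y \<in> carrier V" "f (?g y) = y" if "y \<in> carrier W" for y
    using bij that by (auto simp: bij_betw_def inv_into_into f_inv_into_f)
  have gf: "?g (f x) = x" if "x \<in> carrier V" for x
    using bij that by (simp add: bij_betw_def)
  show ?thesis
  proof (rule linear_homI)
    show "?g (x \<oplus>\<^bsub>W\<^esub> y) = ?g x \<oplus>\<^bsub>V\<^esub> ?g y" if "x \<in> carrier W" "y \<in> carrier W" for x y
      using gf[of "?g x \<oplus>\<^bsub>V\<^esub> ?g y"] g that by (simp add: linear_add[OF f])
    show "?g (c \<odot>\<^bsub>W\<^esub> x) = c \<odot>\<^bsub>V\<^esub> ?g x" if "c \<in> carrier K" "x \<in> carrier W" for c x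
      using gf[of "c \<odot>\<^bsub>V\<^esub> ?g x"] g that by (simp add: linear_smult[OF f])
  qed (use g in auto)
qed

text \<open>Apply the injective map \<open>S\<close> to the antipode identities claimed for its
  inverse. As \<open>S\<close> reverses products, they become the antipode identities of
  \<open>S\<close> itself.\<close>

lemma op_hopf_algebra:
  assumes H: "hopf_algebra K H S" and bij: "bij_betw S (carrier H) (carrier H)"
  shows "hopf_algebra K (op_alg H) (inv_into (carrier H) S)"
proof -
  interpret hopf_algebra K H S by fact
  let ?T = "inv_into (carrier H) S"
  have lin: "?T \<in> linear_hom K H H" by (rule linear_inv_into[OF A_module antipode_linear bij])
  have T: "?T h \<in> carrier H" "S (?T h) = h" if "h \<in> carrier H" for h
    using bij that by (auto simp: bij_betw_def inv_into_into f_inv_into_f)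
  have inj: "inj_on S (carrier H)" using bij by (simp add: bij_betw_def)
  note mm = A_module A_module A_module
  note bl = bilinear_mult[OF A_algebra linear_id lin]
  have b1: "bilinear K H H H (\<lambda>h1 h2. h2 \<otimes>\<^bsub>H\<^esub> ?T h1)" "bilinear K H H H (\<lambda>h1 h2. ?T h2 \<otimes>\<^bsub>H\<^esub> h1)"
    by (rule bilinearI; intro linear_mult_left[OF A_algebra] linear_mult_right[OF A_algebra] lin linear_id;
      use T in simp)+
  have S1: "S (counit H h \<odot>\<^bsub>H\<^esub> \<one>\<^bsub>H\<^esub>) = counit H h \<odot>\<^bsub>H\<^esub> \<one>\<^bsub>H\<^esub>" if "h \<in> carrier H" for h
    using that by (simp add: linear_smult[OF antipode_linear] antipode_one)
  have L: "tlift K H (\<lambda>h1 h2. h2 \<otimes>\<^bsub>H\<^esub> ?T h1) (comult H h) = counit H h \<odot>\<^bsub>H\<^esub> \<one>\<^bsub>H\<^esub>"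
    (is "?l = ?r") if h: "h \<in> carrier H" for h
  proof -
    have "S ?l = tlift K H (\<lambda>h1 h2. S (h2 \<otimes>\<^bsub>H\<^esub> ?T h1)) (comult H h)"
      by (rule linear_tlift[OF mm A_module antipode_linear]) (use T h in auto)
    also have "\<dots> = tlift K H (\<lambda>h1 h2. h1 \<otimes>\<^bsub>H\<^esub> S h2) (comult H h)"
      by (rule tlift_cong[OF mm]) (use T h in \<open>auto simp: antipode_mult\<close>)
    also have "\<dots> = S ?r" using h by (simp add: antipode_right S1)
    finally show ?thesis
      using inj_onD[OF inj, of ?l ?r] h bilinear_closed[OF b1(1)] tlift_closed[OF mm comult_closed[OF h], of "\<lambda>h1 h2. h2 \<otimes>\<^bsub>H\<^esub> ?T h1"]
      by simp
  qed
  have R: "tlift K H (\<lambda>h1 h2. ?T h2 \<otimes>\<^bsub>H\<^esub> h1) (comult H h) = counit H h \<odot>\<^bsub>H\<^esub> \<one>\<^bsub>H\<^esub>"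
    (is "?l = ?r") if h: "h \<in> carrier H" for h
  proof -
    have "S ?l = tlift K H (\<lambda>h1 h2. S (?T h2 \<otimes>\<^bsub>H\<^esub> h1)) (comult H h)"
      by (rule linear_tlift[OF mm A_module antipode_linear]) (use T h in auto)
    also have "\<dots> = tlift K H (\<lambda>h1 h2. S h1 \<otimes>\<^bsub>H\<^esub> h2) (comult H h)"
      by (rule tlift_cong[OF mm]) (use T h in \<open>auto simp: antipode_mult\<close>)
    also have "\<dots> = S ?r" using h by (simp add: antipode_left S1)
    finally show ?thesis
      using inj_onD[OF inj, of ?l ?r] h bilinear_closed[OF b1(2)] tlift_closed[OF mm comult_closed[OF h], of "\<lambda>h1 h2. ?T h2 \<otimes>\<^bsub>H\<^esub> h1"]
      by simp
  qed
  show ?thesis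
    by (intro hopf_algebra.intro hopf_algebra_axioms.intro op_bialgebra bialgebra_axioms)
      (simp_all add: lin L R)
qed

section \<open>Hopf algebras with a projection\<close>

text \<open>The tensor product of the two retractions is a retraction of \<open>E\<close>, so
  \<open>E\<close> is injective. Returning \<open>P\<close> as well lets the result be fed into the
  next tensor factor.\<close>

lemma (in field) split_tensor:
  assumes B1: "k_algebra R B1" and B2: "k_algebra R B2" and V: "module R V" and W: "module R W"
    and E1: "E1 \<in> linear_hom R V B1" and P1: "P1 \<in> linear_hom R B1 V" and PE1: "\<And>v. v \<in> carrier V \<Longrightarrow> P1 (E1 v) = v"
    and E2: "E2 \<in> linear_hom R W B2" and P2: "P2 \<in> linear_hom R B2 W" and PE2: "\<And>w. w \<in> carrier W \<Longrightarrow> P2 (E2 w) = w"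
  obtains E P where "E \<in> linear_hom R (tensor_space R V W) (tensor_algebra R B1 B2)"
    "P \<in> linear_hom R (tensor_algebra R B1 B2) (tensor_space R V W)"
    "\<And>t. t \<in> carrier (tensor_space R V W) \<Longrightarrow> P (E t) = t"
    "\<And>v w. \<lbrakk>v \<in> carrier V; w \<in> carrier W\<rbrakk>
      \<Longrightarrow> E (tens R V W v w) = inl R B1 B2 (E1 v) \<otimes>\<^bsub>tensor_algebra R B1 B2\<^esub> inr R B1 B2 (E2 w)"
proof -
  note m = V W k_algebraD(2)[OF B1] k_algebraD(2)[OF B2]
  have TV: "module R (tensor_space R V W)" and TB: "module R (tensor_space R B1 B2)"
    using m by simp_all
  note bE = bilinear_tens[OF m(3,4) E1 E2] and bP = bilinear_tens[OF m(1,2) P1 P2]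
  let ?E = "tlift R (tensor_space R B1 B2) (\<lambda>v w. tens R B1 B2 (E1 v) (E2 w))"
  let ?P = "tlift R (tensor_space R V W) (\<lambda>v w. tens R V W (P1 v) (P2 w))"
  have E: "?E \<in> linear_hom R (tensor_space R V W) (tensor_space R B1 B2)"
    by (rule tlift_linear[OF V W TB bE])
  have P: "?P \<in> linear_hom R (tensor_space R B1 B2) (tensor_space R V W)"
    by (rule tlift_linear[OF m(3,4) TV bP])
  show ?thesis
  proof (rule that[of ?E ?P])
    show "?P (?E t) = t" if t: "t \<in> carrier (tensor_space R V W)" for t
      by (rule linear_ext_tensor[OF V W linear_comp[OF P E] linear_id _ t])
        (simp add: tlift_tens[OF V W TB bE] tlift_tens[OF m(3,4) TV bP] linear_closed[OF E1] linear_closed[OF E2] PE1 PE2)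
  qed (use E P in \<open>simp_all add: tlift_tens[OF V W TB bE] inl_inr[OF B1 B2] linear_closed[OF E1] linear_closed[OF E2]\<close>)
qed

text \<open>The form of a conjugation: the constant \<open>b\<close> stands between the two legs of
  \<open>c\<close>. The adjoint action and the product rule of \<open>proj\<close> are of this
  kind.\<close>

lemma (in convolution) conv_cunit_mid:
  assumes f: "f \<in> linear_hom K C B" and g: "g \<in> linear_hom K C B" and b: "b \<in> carrier B" and c: "c \<in> carrier C"
  shows "conv K C B f (conv K C B (cunit K C B b) g) c
    = tlift K B (\<lambda>x y. f x \<otimes>\<^bsub>B\<^esub> (b \<otimes>\<^bsub>B\<^esub> g y)) (comult C c)"
  using c b linear_closed[OF f] linear_closed[OF g] unfolding conv_cunit_left[OF g b] conv_apply[OF c]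
  by (intro C.tlift_cong[OF C.A_module C.A_module B_module]) auto

lemma (in convolution) conv_cunit_linear:
  assumes f: "f \<in> linear_hom K C B" and g: "g \<in> linear_hom K C B" and c: "c \<in> carrier C"
  shows "(\<lambda>b. conv K C B f (conv K C B (cunit K C B b) g) c) \<in> linear_hom K B B"
proof -
  note cl = linear_closed[OF f] linear_closed[OF g]
  let ?L = "\<lambda>b. tlift K B (\<lambda>x y. f x \<otimes>\<^bsub>B\<^esub> (b \<otimes>\<^bsub>B\<^esub> g y)) (comult C c)"
  have L: "?L \<in> linear_hom K B B"
    by (rule C.linear_tlift_param[OF C.A_module C.A_module B_module B_module C.comult_closed[OF c]])
      (auto intro!: linear_mult_right[OF B_algebra] linear_mult_left[OF B_algebra] linear_id cl)
  show ?thesis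
    by (rule linear_homI)
      (simp_all add: conv_cunit_mid[OF f g _ c] linear_closed[OF L] linear_add[OF L] linear_smult[OF L] B.smult_closed)
qed

text \<open>The fixed factor is a convolution with \<open>cunit K C B b\<close>, and associativity
  moves it outside.\<close>

lemma (in convolution) conv_left:
  assumes f: "f \<in> linear_hom K C B" and g: "g \<in> linear_hom K C B" and b: "b \<in> carrier B" and c: "c \<in> carrier C"
  shows "conv K C B (\<lambda>x. b \<otimes>\<^bsub>B\<^esub> f x) g c = b \<otimes>\<^bsub>B\<^esub> conv K C B f g c"
proof -
  have "conv K C B (restrict (\<lambda>x. b \<otimes>\<^bsub>B\<^esub> f x) (carrier C)) g = (\<lambda>c\<in>carrier C. b \<otimes>\<^bsub>B\<^esub> conv K C B f g c)"
    using conv_assoc[OF cunit_linear[OF b] f g] by (simp add: conv_cunit_left b f g conv_linear)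
  moreover have "conv K C B (restrict (\<lambda>x. b \<otimes>\<^bsub>B\<^esub> f x) (carrier C)) g = conv K C B (\<lambda>x. b \<otimes>\<^bsub>B\<^esub> f x) g"
    by (rule conv_restrict[OF linear_mult_right[OF B_algebra f b] g])
  ultimately show ?thesis using c by (metis (no_types, lifting) restrict_apply')
qed

lemma (in convolution) conv_right:
  assumes f: "f \<in> linear_hom K C B" and g: "g \<in> linear_hom K C B" and b: "b \<in> carrier B" and c: "c \<in> carrier C"
  shows "conv K C B f (\<lambda>x. g x \<otimes>\<^bsub>B\<^esub> b) c = conv K C B f g c \<otimes>\<^bsub>B\<^esub> b"
proof -
  have "conv K C B f (restrict (\<lambda>x. g x \<otimes>\<^bsub>B\<^esub> b) (carrier C)) = (\<lambda>c\<in>carrier C. conv K C B f g c \<otimes>\<^bsub>B\<^esub> b)"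
    using conv_assoc[OF f g cunit_linear[OF b]] by (simp add: conv_cunit_right b f g conv_linear)
  moreover have "conv K C B f (restrict (\<lambda>x. g x \<otimes>\<^bsub>B\<^esub> b) (carrier C)) = conv K C B f (\<lambda>x. g x \<otimes>\<^bsub>B\<^esub> b)"
    by (rule conv_restrict[OF f linear_mult_left[OF B_algebra g b]])
  ultimately show ?thesis using c by (metis (no_types, lifting) restrict_apply')
qed

lemma (in convolution) embed_tlift:
  assumes X: "module K X" and V: "module K V" and W: "module K W"
    and E: "E \<in> linear_hom K X B" and t: "t \<in> carrier (tensor_space K V W)"
    and F: "\<And>v w. \<lbrakk>v \<in> carrier V; w \<in> carrier W\<rbrakk> \<Longrightarrow> F v w \<in> carrier X"
    and eq: "\<And>v w. \<lbrakk>v \<in> carrier V; w \<in> carrier W\<rbrakk> \<Longrightarrow> E (F v w) = G v w"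
  shows "E (tlift K X F t) = tlift K B G t"
proof -
  have "E (tlift K X F t) = tlift K B (\<lambda>v w. E (F v w)) t"
    by (rule C.linear_tlift[OF V W X B_module E t F])
  also have "\<dots> = tlift K B G t"
    by (rule C.tlift_cong[OF V W B_module t linear_closed[OF E F] eq])
  finally show ?thesis .
qed

lemma (in convolution) embed_comult:
  assumes X: "module K X" and E: "E \<in> linear_hom K X B" and c: "c \<in> carrier C"
    and F: "\<And>v w. \<lbrakk>v \<in> carrier C; w \<in> carrier C\<rbrakk> \<Longrightarrow> F v w \<in> carrier X"
    and eq: "\<And>v w. \<lbrakk>v \<in> carrier C; w \<in> carrier C\<rbrakk> \<Longrightarrow> E (F v w) = f v \<otimes>\<^bsub>B\<^esub> g w"
  shows "E (tlift K X F (comult C c)) = conv K C B f g c"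
  using embed_tlift[OF X C.A_module C.A_module E C.comult_closed[OF c] F eq] c by (simp add: conv_apply)

locale hopf_projection = field K + H: hopf_algebra K H S + A: bialgebra K A
  for K :: "('k, 'x) ring_scheme" and H :: "('k, 'h, 'y) bialg_scheme" and S :: "'h \<Rightarrow> 'h"
    and A :: "('k, 'a, 'z) bialg_scheme" +
  fixes j :: "'h \<Rightarrow> 'a" and \<pi> :: "'a \<Rightarrow> 'h"
  assumes j_hom: "j \<in> bialgebra_hom K H A" and \<pi>_hom: "\<pi> \<in> bialgebra_hom K A H"
    and \<pi>_j [simp]: "h \<in> carrier H \<Longrightarrow> \<pi> (j h) = h"
begin

sublocale HA: convolution K H A by unfold_locales
sublocale AA: convolution K A A by unfold_locales

lemma convolution_HI: "k_algebra K B \<Longrightarrow> convolution K H B"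
  and convolution_AI: "k_algebra K B \<Longrightarrow> convolution K A B"
  by (simp_all add: convolution_def H.bialgebra_axioms A.bialgebra_axioms)

lemmas j_algebra_hom = bialgebra_homD(1)[OF j_hom] and \<pi>_algebra_hom = bialgebra_homD(1)[OF \<pi>_hom]
  and j_linear = bialgebra_homD(2)[OF j_hom] and \<pi>_linear = bialgebra_homD(2)[OF \<pi>_hom]
lemmas j_simps [simp] = algebra_homD(2,3,4)[OF j_algebra_hom]
lemmas \<pi>_simps [simp] = algebra_homD(2,3,4)[OF \<pi>_algebra_hom]
lemmas counit_j [simp] = bialgebra_homD(6)[OF j_hom] and counit_\<pi> [simp] = bialgebra_homD(6)[OF \<pi>_hom]

lemma jS_linear: "(\<lambda>h. j (S h)) \<in> linear_hom K H A"
  by (rule linear_comp[OF j_linear H.antipode_linear])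
lemma S\<pi>_linear: "(\<lambda>a. S (\<pi> a)) \<in> linear_hom K A H"
  by (rule linear_comp[OF H.antipode_linear \<pi>_linear])
lemma jS\<pi>_linear: "(\<lambda>a. j (S (\<pi> a))) \<in> linear_hom K A A"
  by (rule linear_comp[OF j_linear S\<pi>_linear])
lemma j\<pi>_linear: "(\<lambda>a. j (\<pi> a)) \<in> linear_hom K A A"
  by (rule linear_comp[OF j_linear \<pi>_linear])

lemma conv_\<pi>_inverse:
  assumes B: "k_algebra K B" and \<phi>: "\<phi> \<in> algebra_hom K H B"
  shows "conv K A B (\<lambda>a. \<phi> (\<pi> a)) (\<lambda>a. \<phi> (S (\<pi> a))) = cunit K A B \<one>\<^bsub>B\<^esub>"
    and "conv K A B (\<lambda>a. \<phi> (S (\<pi> a))) (\<lambda>a. \<phi> (\<pi> a)) = cunit K A B \<one>\<^bsub>B\<^esub>"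
proof -
  note l = algebra_homD(1)[OF \<phi>] linear_comp[OF algebra_homD(1)[OF \<phi>] H.antipode_linear]
  have "conv K A B (\<lambda>a. \<phi> (\<pi> a)) (\<lambda>a. \<phi> (S (\<pi> a))) a = cunit K A B \<one>\<^bsub>B\<^esub> a" if "a \<in> carrier A" for a
    using conv_precomp[OF \<pi>_hom B l that] H.antipode_hom[OF B \<phi>] cunit_precomp[OF \<pi>_hom that, of B "\<one>\<^bsub>B\<^esub>"] by simp
  then show "conv K A B (\<lambda>a. \<phi> (\<pi> a)) (\<lambda>a. \<phi> (S (\<pi> a))) = cunit K A B \<one>\<^bsub>B\<^esub>"
    by (auto simp: conv_def cunit_def)
  have "conv K A B (\<lambda>a. \<phi> (S (\<pi> a))) (\<lambda>a. \<phi> (\<pi> a)) a = cunit K A B \<one>\<^bsub>B\<^esub> a" if "a \<in> carrier A" for a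
    using conv_precomp[OF \<pi>_hom B l(2,1) that] H.antipode_hom[OF B \<phi>] cunit_precomp[OF \<pi>_hom that, of B "\<one>\<^bsub>B\<^esub>"] by simp
  then show "conv K A B (\<lambda>a. \<phi> (S (\<pi> a))) (\<lambda>a. \<phi> (\<pi> a)) = cunit K A B \<one>\<^bsub>B\<^esub>"
    by (auto simp: conv_def cunit_def)
qed

section \<open>The projection onto the coinvariants\<close>

definition "proj = assoc_proj K A S j \<pi>"
definition "coinv = coinvariants K A H \<pi>"

lemma proj_conv: "a \<in> carrier A \<Longrightarrow> proj a = conv K A A (\<lambda>x. x) (\<lambda>a. j (S (\<pi> a))) a"
  by (simp add: proj_def assoc_proj_def conv_def)

lemma proj_linear: "proj \<in> linear_hom K A A"
  unfolding proj_def assoc_proj_def[abs_def]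
  by (rule linear_tlift_arg[OF A.A_module A.A_module A.A_module bilinear_mult[OF A.A_algebra linear_id jS\<pi>_linear] A.comult_linear])

lemma proj_closed [simp]: "a \<in> carrier A \<Longrightarrow> proj a \<in> carrier A"
  by (rule linear_closed[OF proj_linear])

text \<open>\<open>proj\<close> is in general not an algebra map, so its composite with an algebra
  map is handled through this expansion as a convolution.\<close>

lemma hom_proj:
  assumes B: "k_algebra K B" and \<phi>: "\<phi> \<in> algebra_hom K A B" and a: "a \<in> carrier A"
  shows "\<phi> (proj a) = conv K A B \<phi> (\<lambda>a. \<phi> (j (S (\<pi> a)))) a"
  using AA.conv_hom[OF B \<phi> linear_id jS\<pi>_linear a] a by (simp add: proj_conv)

abbreviation "AH \<equiv> tensor_algebra K A H"
abbreviation "iA \<equiv> inl K A H"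
abbreviation "iH \<equiv> inr K A H"

lemma AH_algebra: "k_algebra K AH" by simp

lemmas iA_hom = inl_algebra_hom[OF A.A_algebra H.A_algebra]
  and iH_hom = inr_algebra_hom[OF A.A_algebra H.A_algebra]

lemma iH_iA: "\<lbrakk>a \<in> carrier A; h \<in> carrier H\<rbrakk> \<Longrightarrow> iH h \<otimes>\<^bsub>AH\<^esub> iA a = iA a \<otimes>\<^bsub>AH\<^esub> iH h"
  by (simp add: inl_inr inr_inl)

text \<open>The coinvariants are the equaliser of the algebra maps \<open>\<rho>\<close> and \<open>iA\<close>.\<close>

definition "\<rho> = conv K A AH iA (\<lambda>a. iH (\<pi> a))"

lemma \<rho>_hom: "\<rho> \<in> algebra_hom K A AH"
  unfolding \<rho>_def
  by (rule convolution.conv_algebra_hom[OF convolution_AI[OF AH_algebra] iA_hom algebra_hom_comp[OF iH_hom \<pi>_algebra_hom]])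
    (simp add: iH_iA)

lemma coinv_iff: "r \<in> coinv \<longleftrightarrow> r \<in> carrier A \<and> \<rho> r = iA r"
proof -
  have "tlift K (tensor_space K A H) (\<lambda>a1 a2. tens K A H a1 (\<pi> a2)) (comult A r) = \<rho> r" if r: "r \<in> carrier A"
  proof -
    have "tlift K (tensor_space K A H) (\<lambda>a1 a2. tens K A H a1 (\<pi> a2)) (comult A r)
      = tlift K (tensor_space K A H) (\<lambda>a1 a2. iA a1 \<otimes>\<^bsub>AH\<^esub> iH (\<pi> a2)) (comult A r)"
      by (rule tlift_cong[OF A.A_module A.A_module]) (use r in \<open>simp_all add: inl_inr\<close>)
    then show ?thesis using r by (simp add: \<rho>_def conv_def)
  qed
  then show ?thesis by (auto simp: coinv_def coinvariants_def inl_def)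
qed

lemma coinv_closed [simp]: "r \<in> coinv \<Longrightarrow> r \<in> carrier A"
  by (simp add: coinv_iff)

text \<open>For a coinvariant \<open>r\<close> the map \<open>\<rho>\<close> gives
  \<open>r \<otimes> 1\<close>, so whatever follows \<open>\<pi>\<close> in the last leg is
  evaluated at 1. Here \<open>L\<close> is the linear map sending \<open>a \<otimes> h\<close> to
  \<open>F a\<close> times \<open>G h\<close>.\<close>

lemma conv_coinv:
  assumes r: "r \<in> coinv" and B: "k_algebra K B" and F: "F \<in> linear_hom K A B" and G: "G \<in> linear_hom K H B"
  shows "conv K A B F (\<lambda>a. G (\<pi> a)) r = F r \<otimes>\<^bsub>B\<^esub> G \<one>\<^bsub>H\<^esub>"
proof -
  interpret AB: convolution K A B by (rule convolution_AI[OF B])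
  note b = bilinear_mult[OF B F G]
  define L where "L = tlift K B (\<lambda>a h. F a \<otimes>\<^bsub>B\<^esub> G h)"
  have L: "L \<in> linear_hom K (tensor_space K A H) B"
    unfolding L_def by (rule tlift_linear[OF A.A_module H.A_module AB.B_module b])
  have Lt: "L (iA a \<otimes>\<^bsub>AH\<^esub> iH h) = F a \<otimes>\<^bsub>B\<^esub> G h" if "a \<in> carrier A" "h \<in> carrier H" for a h
    using that by (simp add: inl_inr L_def tlift_tens[OF A.A_module H.A_module AB.B_module b])
  have "L (\<rho> r) = conv K A B F (\<lambda>a. G (\<pi> a)) r"
    unfolding \<rho>_def conv_def using r
    by (simp, intro AB.embed_tlift[OF _ A.A_module A.A_module L])
      (simp_all add: Lt, simp add: inl_inr)
  moreover have "L (\<rho> r) = L (iA r \<otimes>\<^bsub>AH\<^esub> iH \<one>\<^bsub>H\<^esub>)"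
    using r by (simp add: coinv_iff inl_inr) (simp add: inl_def)
  ultimately show ?thesis using r by (simp add: Lt)
qed

lemma proj_coinv_id: "r \<in> coinv \<Longrightarrow> proj r = r"
  using conv_coinv[OF _ A.A_algebra linear_id jS_linear, of r] by (simp add: proj_conv H.antipode_one)

lemma \<rho>_j: "h \<in> carrier H \<Longrightarrow> \<rho> (j h) = conv K H AH (\<lambda>h. iA (j h)) iH h"
proof -
  assume h: "h \<in> carrier H"
  interpret HB: convolution K H AH by (rule convolution_HI[OF AH_algebra])
  have l: "iA \<in> linear_hom K A AH" "(\<lambda>a. iH (\<pi> a)) \<in> linear_hom K A AH"
    by (rule algebra_homD(1)[OF iA_hom], rule linear_comp[OF algebra_homD(1)[OF iH_hom] \<pi>_linear])
  have "\<rho> (j h) = conv K H AH (\<lambda>h. iA (j h)) (\<lambda>h. iH (\<pi> (j h))) h"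
    unfolding \<rho>_def by (rule conv_precomp[OF j_hom AH_algebra l h])
  also have "conv K H AH (\<lambda>h. iA (j h)) (\<lambda>h. iH (\<pi> (j h))) = conv K H AH (\<lambda>h. iA (j h)) iH"
    by (rule HB.conv_cong[OF linear_comp[OF l(1) j_linear] linear_comp[OF l(2) j_linear]]) simp_all
  finally show ?thesis .
qed

text \<open>\<open>antipode_conv\<close> for the algebra map \<open>\<rho> \<circ> j\<close>, which
  by \<open>\<rho>_j\<close> is a convolution of two algebra maps; the antipode reverses their
  order.\<close>

lemma \<rho>_jS: "h \<in> carrier H \<Longrightarrow> \<rho> (j (S h)) = conv K H AH (\<lambda>h. iH (S h)) (\<lambda>h. iA (j (S h))) h"
  using H.antipode_conv[OF AH_algebra algebra_hom_comp[OF \<rho>_hom j_algebra_hom]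
      algebra_hom_comp[OF iA_hom j_algebra_hom] iH_hom \<rho>_j] .

text \<open>Since the antipode reverses the coproduct, applying \<open>\<rho>\<close> to
  \<open>a\<^sub>1 j(S(\<pi>(a\<^sub>2)))\<close> puts \<open>\<pi>(a\<^sub>2)\<close> next to
  \<open>S(\<pi>(a\<^sub>3))\<close> in the factor \<open>H\<close>. They cancel, and only the
  factor in \<open>A\<close> remains.\<close>

lemma proj_mem: assumes a: "a \<in> carrier A" shows "proj a \<in> coinv"
proof -
  interpret AB: convolution K A AH by (rule convolution_AI[OF AH_algebra])
  have iA: "iA \<in> linear_hom K A AH" and iH: "iH \<in> linear_hom K H AH"
    by (rule algebra_homD(1)[OF iA_hom], rule algebra_homD(1)[OF iH_hom])
  have l: "(\<lambda>a. iH (\<pi> a)) \<in> linear_hom K A AH" "(\<lambda>a. iH (S (\<pi> a))) \<in> linear_hom K A AH"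
    "(\<lambda>a. iA (j (S (\<pi> a)))) \<in> linear_hom K A AH" "\<rho> \<in> linear_hom K A AH" "(\<lambda>a. \<rho> (j (S (\<pi> a)))) \<in> linear_hom K A AH"
    by (rule linear_comp[OF iH \<pi>_linear] linear_comp[OF iH S\<pi>_linear] linear_comp[OF iA jS\<pi>_linear]
      algebra_homD(1)[OF \<rho>_hom] linear_comp[OF algebra_homD(1)[OF \<rho>_hom] jS\<pi>_linear])+
  have "conv K A AH \<rho> (\<lambda>a. \<rho> (j (S (\<pi> a))))
    = conv K A AH (conv K A AH iA (\<lambda>a. iH (\<pi> a))) (conv K A AH (\<lambda>a. iH (S (\<pi> a))) (\<lambda>a. iA (j (S (\<pi> a)))))"
    by (rule AB.conv_cong[OF l(4,5)])
      (simp_all add: \<rho>_def[symmetric] \<rho>_jS conv_precomp[OF \<pi>_hom AH_algebra linear_comp[OF iH H.antipode_linear] linear_comp[OF iA jS_linear]])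
  also have "\<dots> = conv K A AH iA (conv K A AH (conv K A AH (\<lambda>a. iH (\<pi> a)) (\<lambda>a. iH (S (\<pi> a)))) (\<lambda>a. iA (j (S (\<pi> a)))))"
    by (simp only: AB.conv_assoc AB.conv_linear iA l)
  also have "\<dots> = conv K A AH iA (\<lambda>a. iA (j (S (\<pi> a))))"
    by (simp only: conv_\<pi>_inverse[OF AH_algebra iH_hom] AB.conv_one AB.conv_restrict iA l)
  finally have "\<rho> (proj a) = iA (proj a)"
    by (simp only: hom_proj[OF AH_algebra \<rho>_hom a] hom_proj[OF AH_algebra iA_hom a])
  then show ?thesis using a by (simp add: coinv_iff)
qed

text \<open>Expanding \<open>proj\<close> in the second leg adds a third leg
  \<open>j(S(\<pi>(r\<^sub>3)))\<close>, which \<open>conv_coinv\<close> evaluates at 1. So the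
  second leg of a coinvariant may be taken inside the coinvariants.\<close>

lemma tlift_comult_coinv:
  assumes r: "r \<in> coinv" and X: "module K X" and F: "bilinear K A A X F"
  shows "tlift K X F (comult A r) = tlift K X (\<lambda>x y. F x (proj y)) (comult A r)"
proof -
  let ?T = "tensor_algebra K A A" and ?l = "inl K A A" and ?r = "inr K A A"
  have T: "k_algebra K ?T" by simp
  interpret AB: convolution K A ?T by (rule convolution_AI[OF T])
  note lh = inl_algebra_hom[OF A.A_algebra A.A_algebra] and rh = inr_algebra_hom[OF A.A_algebra A.A_algebra]
  have l: "?l \<in> linear_hom K A ?T" and r': "?r \<in> linear_hom K A ?T"
    by (rule algebra_homD(1)[OF lh], rule algebra_homD(1)[OF rh])
  note ll = linear_comp[OF r' proj_linear] linear_comp[OF r' jS\<pi>_linear] linear_comp[OF r' jS_linear]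
  have rc: "r \<in> carrier A" using r by simp
  have e: "conv K A ?T ?l (\<lambda>y. ?r (f y)) r = tlift K (tensor_space K A A) (\<lambda>x y. tens K A A x (f y)) (comult A r)"
    if f: "\<And>y. y \<in> carrier A \<Longrightarrow> f y \<in> carrier A" for f
  proof -
    have "tlift K (tensor_space K A A) (\<lambda>x y. tens K A A x (f y)) (comult A r)
      = tlift K (tensor_space K A A) (\<lambda>x y. ?l x \<otimes>\<^bsub>?T\<^esub> ?r (f y)) (comult A r)"
      by (rule tlift_cong[OF A.A_module A.A_module]) (use rc f in \<open>simp_all add: inl_inr\<close>)
    then show ?thesis using rc by (simp add: conv_def)
  qed
  have i1: "?r (j (S \<one>\<^bsub>H\<^esub>)) = \<one>\<^bsub>?T\<^esub>"
    by (simp add: H.antipode_one inr_def)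
  have "conv K A ?T ?l (\<lambda>y. ?r (proj y)) = conv K A ?T ?l (conv K A ?T ?r (\<lambda>y. ?r (j (S (\<pi> y)))))"
    by (rule AB.conv_cong[OF l ll(1)]) (simp_all add: hom_proj[OF T rh])
  also have "\<dots> = conv K A ?T (conv K A ?T ?l ?r) (\<lambda>y. ?r (j (S (\<pi> y))))"
    by (rule AB.conv_assoc[OF l r' ll(2), symmetric])
  finally have "conv K A ?T ?l (\<lambda>y. ?r (proj y)) r = conv K A ?T (conv K A ?T ?l ?r) (\<lambda>y. ?r (j (S (\<pi> y)))) r"
    by (rule fun_cong)
  also have "\<dots> = conv K A ?T ?l ?r r \<otimes>\<^bsub>?T\<^esub> ?r (j (S \<one>\<^bsub>H\<^esub>))"
    by (rule conv_coinv[OF r T AB.conv_linear[OF l r'] ll(3)])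
  also have "\<dots> = conv K A ?T ?l ?r r"
    unfolding i1 by (rule AB.B.r_one[OF linear_closed[OF AB.conv_linear[OF l r'] rc]])
  also have "\<dots> = comult A r"
    by (rule trans[OF e[of "\<lambda>y. y"] tlift_self[OF A.A_module A.A_module A.comult_closed[OF rc]]])
  finally have "conv K A ?T ?l (\<lambda>y. ?r (proj y)) r = comult A r" .
  then have "tlift K (tensor_space K A A) (\<lambda>x y. tens K A A x (proj y)) (comult A r) = comult A r"
    using e[of proj] by (simp only: proj_closed simp_thms)
  then have "tlift K X F (comult A r)
    = tlift K X F (tlift K (tensor_space K A A) (\<lambda>x y. tens K A A x (proj y)) (comult A r))" by simp
  also have "\<dots> = tlift K X (\<lambda>x y. F x (proj y)) (comult A r)"
    by (rule tlift_tlift_tens[OF A.A_module A.A_module A.A_module A.A_module X F linear_id proj_linear A.comult_closed[OF rc]])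
  finally show ?thesis .
qed


section \<open>The adjoint action and the projection of products\<close>

definition "ad h a = tlift K A (\<lambda>h1 h2. j h1 \<otimes>\<^bsub>A\<^esub> a \<otimes>\<^bsub>A\<^esub> j (S h2)) (comult H h)"

lemma ad_conv:
  assumes h: "h \<in> carrier H" and a: "a \<in> carrier A"
  shows "ad h a = conv K H A j (conv K H A (cunit K H A a) (\<lambda>h. j (S h))) h"
  unfolding HA.conv_cunit_mid[OF j_linear jS_linear a h] ad_def
  by (rule tlift_cong[OF H.A_module H.A_module A.A_module]) (use h a in \<open>simp_all add: A.m_assoc\<close>)

lemma ad_closed [simp]: "\<lbrakk>h \<in> carrier H; a \<in> carrier A\<rbrakk> \<Longrightarrow> ad h a \<in> carrier A"
  unfolding ad_def by (rule tlift_closed[OF H.A_module H.A_module A.A_module]) simp_all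

lemma ad_linear: "h \<in> carrier H \<Longrightarrow> (\<lambda>a. ad h a) \<in> linear_hom K A A"
  unfolding ad_def
  by (rule linear_tlift_param[OF H.A_module H.A_module A.A_module A.A_module])
    (auto intro!: linear_mult_left[OF A.A_algebra] linear_mult_right[OF A.A_algebra] linear_id)

lemma ad_linear_left:
  assumes a: "a \<in> carrier A"
  shows "(\<lambda>h. ad h a) \<in> linear_hom K H A"
  unfolding ad_def
  by (rule linear_tlift_arg[OF H.A_module H.A_module A.A_module _ H.comult_linear])
    (rule bilinear_mult[OF A.A_algebra linear_mult_left[OF A.A_algebra j_linear a] jS_linear])

text \<open>Applied to \<open>\<rho>\<close>, to the coproduct and to the coaction map, this shows
  how each of them acts on the adjoint action: as a conjugation of the image of
  \<open>a\<close>.\<close>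

lemma hom_ad:
  assumes B: "k_algebra K B" and \<phi>: "\<phi> \<in> algebra_hom K A B"
    and h: "h \<in> carrier H" and a: "a \<in> carrier A"
  shows "\<phi> (ad h a)
    = conv K H B (\<lambda>h. \<phi> (j h)) (conv K H B (cunit K H B (\<phi> a)) (\<lambda>h. \<phi> (j (S h)))) h"
proof -
  interpret HB: convolution K H B by (rule convolution_HI[OF B])
  note l = algebra_homD(1)[OF \<phi>] and cu = HA.cunit_linear[OF a]
  have "\<phi> (ad h a) = conv K H B (\<lambda>h. \<phi> (j h))
      (\<lambda>h. \<phi> (conv K H A (cunit K H A a) (\<lambda>h. j (S h)) h)) h"
    unfolding ad_conv[OF h a] by (rule HA.conv_hom[OF B \<phi> j_linear HA.conv_linear[OF cu jS_linear] h])
  also have "conv K H B (\<lambda>h. \<phi> (j h)) (\<lambda>h. \<phi> (conv K H A (cunit K H A a) (\<lambda>h. j (S h)) h))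
    = conv K H B (\<lambda>h. \<phi> (j h)) (conv K H B (\<lambda>h. \<phi> (cunit K H A a h)) (\<lambda>h. \<phi> (j (S h))))"
    by (rule HB.conv_cong[OF linear_comp[OF l j_linear] linear_comp[OF l HA.conv_linear[OF cu jS_linear]]])
      (simp_all add: HA.conv_hom[OF B \<phi> cu jS_linear])
  also have "conv K H B (\<lambda>h. \<phi> (cunit K H A a h)) (\<lambda>h. \<phi> (j (S h)))
    = conv K H B (cunit K H B (\<phi> a)) (\<lambda>h. \<phi> (j (S h)))"
    by (rule HB.conv_cong[OF linear_comp[OF l cu] linear_comp[OF l jS_linear]])
      (simp_all add: HA.cunit_hom[OF \<phi> a])
  finally show ?thesis .
qed

text \<open>Applying \<open>\<rho>\<close> puts \<open>h\<^sub>2\<close> and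
  \<open>S(h\<^sub>3)\<close> into the factor \<open>H\<close>, separated only by
  \<open>r \<otimes> 1\<close>, which commutes with that factor. They cancel.\<close>

lemma ad_coinv:
  assumes h: "h \<in> carrier H" and r: "r \<in> coinv"
  shows "ad h r \<in> coinv"
proof -
  interpret HB: convolution K H AH by (rule convolution_HI[OF AH_algebra])
  have rc: "r \<in> carrier A" and rr: "\<rho> r = iA r" using r by (simp_all add: coinv_iff)
  have iA: "iA \<in> linear_hom K A AH" and iH: "iH \<in> linear_hom K H AH"
    by (rule algebra_homD(1)[OF iA_hom], rule algebra_homD(1)[OF iH_hom])
  have c: "iA r \<in> carrier AH" by (rule linear_closed[OF iA rc])
  note l = linear_comp[OF iA j_linear] linear_comp[OF iA jS_linear] linear_comp[OF iH H.antipode_linear]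
    linear_comp[OF algebra_homD(1)[OF \<rho>_hom] j_linear] linear_comp[OF algebra_homD(1)[OF \<rho>_hom] jS_linear]
  note cu = HB.cunit_linear[OF c]
  have com: "conv K H AH iH (cunit K H AH (iA r)) = conv K H AH (cunit K H AH (iA r)) iH"
    by (rule HB.cunit_commute[OF iH c]) (simp add: iH_iA rc)
  have q: "conv K H AH (cunit K H AH (iA r)) (\<lambda>h. \<rho> (j (S h)))
    = conv K H AH (cunit K H AH (iA r)) (conv K H AH (\<lambda>h. iH (S h)) (\<lambda>h. iA (j (S h))))"
    by (rule HB.conv_cong[OF cu l(5)]) (simp_all add: \<rho>_jS)
  have "conv K H AH (\<lambda>h. \<rho> (j h)) (conv K H AH (cunit K H AH (iA r)) (\<lambda>h. \<rho> (j (S h))))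
    = conv K H AH (conv K H AH (\<lambda>h. iA (j h)) iH)
      (conv K H AH (cunit K H AH (iA r)) (conv K H AH (\<lambda>h. iH (S h)) (\<lambda>h. iA (j (S h)))))"
    unfolding q[symmetric] by (rule HB.conv_cong[OF l(4) HB.conv_linear[OF cu l(5)]]) (simp_all add: \<rho>_j)
  also have "\<dots> = conv K H AH (\<lambda>h. iA (j h)) (conv K H AH (conv K H AH iH (cunit K H AH (iA r)))
     (conv K H AH (\<lambda>h. iH (S h)) (\<lambda>h. iA (j (S h)))))"
    by (simp only: HB.conv_assoc HB.conv_linear l cu iH)
  also have "\<dots> = conv K H AH (\<lambda>h. iA (j h)) (conv K H AH (cunit K H AH (iA r))
     (conv K H AH (conv K H AH iH (\<lambda>h. iH (S h))) (\<lambda>h. iA (j (S h)))))"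
    unfolding com by (simp only: HB.conv_assoc HB.conv_linear l cu iH)
  also have "\<dots> = conv K H AH (\<lambda>h. iA (j h)) (conv K H AH (cunit K H AH (iA r)) (\<lambda>h. iA (j (S h))))"
    by (simp only: H.antipode_hom[OF AH_algebra iH_hom] HB.conv_one HB.conv_restrict l cu)
  finally have "\<rho> (ad h r) = iA (ad h r)"
    by (simp only: hom_ad[OF AH_algebra \<rho>_hom h rc] hom_ad[OF AH_algebra iA_hom h rc] rr)
  then show ?thesis using h rc by (simp add: coinv_iff)
qed

lemma ad_one_left: "a \<in> carrier A \<Longrightarrow> ad \<one>\<^bsub>H\<^esub> a = a"
  unfolding ad_def H.comult_one
  by (subst tlift_tens[OF H.A_module H.A_module A.A_module bilinear_mult[OF A.A_algebra linear_mult_left[OF A.A_algebra j_linear] jS_linear]])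
    (simp_all add: H.antipode_one)

lemma ad_mult:
  assumes h: "h \<in> carrier H" and h': "h' \<in> carrier H" and a: "a \<in> carrier A"
  shows "ad (h \<otimes>\<^bsub>H\<^esub> h') a = ad h (ad h' a)"
proof -
  note m = H.A_module H.A_module A.A_module
  note b = bilinear_mult[OF A.A_algebra linear_mult_left[OF A.A_algebra j_linear a] jS_linear]
  have "ad (h \<otimes>\<^bsub>H\<^esub> h') a = tlift K A (\<lambda>x1 x2. tlift K A (\<lambda>y1 y2.
      j (x1 \<otimes>\<^bsub>H\<^esub> y1) \<otimes>\<^bsub>A\<^esub> a \<otimes>\<^bsub>A\<^esub> j (S (x2 \<otimes>\<^bsub>H\<^esub> y2))) (comult H h')) (comult H h)"
    unfolding ad_def by (rule H.tlift_comult_mult[OF A.A_module b h h'])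
  also have "\<dots> = ad h (ad h' a)"
    unfolding ad_def[of h]
  proof (rule tlift_cong[OF m H.comult_closed[OF h], symmetric])
    fix x1 x2 assume x: "x1 \<in> carrier H" "x2 \<in> carrier H"
    show "j x1 \<otimes>\<^bsub>A\<^esub> ad h' a \<otimes>\<^bsub>A\<^esub> j (S x2) \<in> carrier A" using x h' a by simp
    have L: "(\<lambda>u. j x1 \<otimes>\<^bsub>A\<^esub> u \<otimes>\<^bsub>A\<^esub> j (S x2)) \<in> linear_hom K A A"
      by (intro linear_mult_left[OF A.A_algebra] linear_mult_right[OF A.A_algebra] linear_id) (use x in simp_all)
    show "j x1 \<otimes>\<^bsub>A\<^esub> ad h' a \<otimes>\<^bsub>A\<^esub> j (S x2) = tlift K A (\<lambda>y1 y2.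
      j (x1 \<otimes>\<^bsub>H\<^esub> y1) \<otimes>\<^bsub>A\<^esub> a \<otimes>\<^bsub>A\<^esub> j (S (x2 \<otimes>\<^bsub>H\<^esub> y2))) (comult H h')"
      unfolding ad_def[of h']
      by (rule AA.embed_tlift[OF A.A_module H.A_module H.A_module L H.comult_closed[OF h']])
        (use x a in \<open>simp_all add: H.antipode_mult A.m_assoc\<close>)
  qed
  finally show ?thesis .
qed

lemma conv_jS: "conv K H A j (\<lambda>h. j (S h)) = cunit K H A \<one>\<^bsub>A\<^esub>" "conv K H A (\<lambda>h. j (S h)) j = cunit K H A \<one>\<^bsub>A\<^esub>"
  by (rule H.antipode_hom[OF A.A_algebra j_algebra_hom])+

lemma ad_unit: "h \<in> carrier H \<Longrightarrow> ad h \<one>\<^bsub>A\<^esub> = counit H h \<odot>\<^bsub>A\<^esub> \<one>\<^bsub>A\<^esub>"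
  by (simp add: ad_conv HA.conv_one jS_linear j_linear HA.conv_restrict conv_jS HA.cunit_apply)

text \<open>Between \<open>a\<close> and \<open>b\<close> the chain contains
  \<open>j \<circ> S\<close> convolved with \<open>j\<close>, which is the unit.\<close>

lemma ad_prod:
  assumes h: "h \<in> carrier H" and a: "a \<in> carrier A" and b: "b \<in> carrier A"
  shows "conv K H A (\<lambda>h. ad h a) (\<lambda>h. ad h b) h = ad h (a \<otimes>\<^bsub>A\<^esub> b)"
proof -
  note l = j_linear jS_linear HA.cunit_linear[OF a] HA.cunit_linear[OF b]
  have "conv K H A (\<lambda>h. ad h a) (\<lambda>h. ad h b)
    = conv K H A (conv K H A j (conv K H A (cunit K H A a) (\<lambda>h. j (S h))))
      (conv K H A j (conv K H A (cunit K H A b) (\<lambda>h. j (S h))))"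
    by (rule HA.conv_cong[OF ad_linear_left[OF a] ad_linear_left[OF b]]) (simp_all add: ad_conv a b)
  also have "\<dots> = conv K H A j (conv K H A (cunit K H A a) (conv K H A (conv K H A (\<lambda>h. j (S h)) j)
      (conv K H A (cunit K H A b) (\<lambda>h. j (S h)))))"
    by (simp only: HA.conv_assoc HA.conv_linear l)
  also have "\<dots> = conv K H A j (conv K H A (conv K H A (cunit K H A a) (cunit K H A b)) (\<lambda>h. j (S h)))"
    by (simp only: conv_jS HA.conv_one HA.conv_restrict HA.conv_assoc HA.conv_linear l)
  finally show ?thesis using h a b by (simp add: ad_conv HA.cunit_mult)
qed

text \<open>The factor \<open>j(S(h\<^sub>2))\<close> of the adjoint action cancels against
  \<open>j(h\<^sub>3)\<close>. The resulting rule for moving \<open>j h\<close> past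
  \<open>a\<close> is the product rule of the bi-product.\<close>

lemma conv_ad_j:
  assumes h: "h \<in> carrier H" and a: "a \<in> carrier A"
  shows "conv K H A (\<lambda>h. ad h a) j h = j h \<otimes>\<^bsub>A\<^esub> a"
proof -
  note l = j_linear jS_linear HA.cunit_linear[OF a]
  have "conv K H A (\<lambda>h. ad h a) j
    = conv K H A (conv K H A j (conv K H A (cunit K H A a) (\<lambda>h. j (S h)))) j"
    by (rule HA.conv_cong[OF ad_linear_left[OF a] j_linear]) (simp_all add: ad_conv a)
  also have "\<dots> = conv K H A j (conv K H A (cunit K H A a) (conv K H A (\<lambda>h. j (S h)) j))"
    by (simp only: HA.conv_assoc HA.conv_linear l)
  also have "\<dots> = conv K H A j (cunit K H A a)"
    by (simp only: conv_jS HA.conv_one HA.conv_restrict l)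
  finally show ?thesis using h by (simp add: HA.conv_cunit_right j_linear a)
qed

text \<open>The antipode reverses products, so the legs of \<open>y\<close> are enclosed by those of
  \<open>x\<close> and combine to \<open>proj y\<close>.\<close>

lemma proj_mult:
  assumes x: "x \<in> carrier A" and y: "y \<in> carrier A"
  shows "proj (x \<otimes>\<^bsub>A\<^esub> y)
    = conv K A A (\<lambda>a. a) (conv K A A (cunit K A A (proj y)) (\<lambda>a. j (S (\<pi> a)))) x"
proof -
  note m = A.A_module A.A_module A.A_module
  note b = bilinear_mult[OF A.A_algebra linear_id jS\<pi>_linear]
  have "proj (x \<otimes>\<^bsub>A\<^esub> y) = tlift K A (\<lambda>x1 x2. tlift K A (\<lambda>y1 y2.
      x1 \<otimes>\<^bsub>A\<^esub> y1 \<otimes>\<^bsub>A\<^esub> j (S (\<pi> (x2 \<otimes>\<^bsub>A\<^esub> y2)))) (comult A y)) (comult A x)"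
    unfolding proj_def assoc_proj_def by (rule A.tlift_comult_mult[OF A.A_module b x y])
  also have "\<dots> = tlift K A (\<lambda>x1 x2. x1 \<otimes>\<^bsub>A\<^esub> (proj y \<otimes>\<^bsub>A\<^esub> j (S (\<pi> x2)))) (comult A x)"
  proof (rule tlift_cong[OF m A.comult_closed[OF x], symmetric])
    fix x1 x2 assume xx: "x1 \<in> carrier A" "x2 \<in> carrier A"
    show "x1 \<otimes>\<^bsub>A\<^esub> (proj y \<otimes>\<^bsub>A\<^esub> j (S (\<pi> x2))) \<in> carrier A" using xx y by simp
    have L: "(\<lambda>u. x1 \<otimes>\<^bsub>A\<^esub> (u \<otimes>\<^bsub>A\<^esub> j (S (\<pi> x2)))) \<in> linear_hom K A A"
      by (intro linear_mult_left[OF A.A_algebra] linear_mult_right[OF A.A_algebra] linear_id) (use xx in simp_all)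
    show "x1 \<otimes>\<^bsub>A\<^esub> (proj y \<otimes>\<^bsub>A\<^esub> j (S (\<pi> x2))) = tlift K A (\<lambda>y1 y2.
      x1 \<otimes>\<^bsub>A\<^esub> y1 \<otimes>\<^bsub>A\<^esub> j (S (\<pi> (x2 \<otimes>\<^bsub>A\<^esub> y2)))) (comult A y)"
      unfolding proj_def assoc_proj_def
      by (rule AA.embed_tlift[OF A.A_module A.A_module A.A_module L A.comult_closed[OF y]])
        (use xx in \<open>simp_all add: H.antipode_mult A.m_assoc\<close>)
  qed
  finally show ?thesis by (simp only: AA.conv_cunit_mid[OF linear_id jS\<pi>_linear proj_closed[OF y] x])
qed

text \<open>On the legs of \<open>j h\<close> the composite \<open>\<pi> \<circ> j\<close> is the
  identity, and the conjugation in \<open>proj_mult\<close> becomes the adjoint action.\<close>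

lemma proj_j_mult:
  assumes h: "h \<in> carrier H" and a: "a \<in> carrier A"
  shows "proj (j h \<otimes>\<^bsub>A\<^esub> a) = ad h (proj a)"
proof -
  note pa = proj_closed[OF a]
  have "proj (j h \<otimes>\<^bsub>A\<^esub> a) = tlift K A (\<lambda>x1 x2. x1 \<otimes>\<^bsub>A\<^esub> (proj a \<otimes>\<^bsub>A\<^esub> j (S (\<pi> x2)))) (comult A (j h))"
    by (simp only: proj_mult j_simps h a AA.conv_cunit_mid[OF linear_id jS\<pi>_linear pa])
  also have "\<dots> = tlift K A (\<lambda>x1 x2. j x1 \<otimes>\<^bsub>A\<^esub> (proj a \<otimes>\<^bsub>A\<^esub> j (S (\<pi> (j x2))))) (comult H h)"
    by (rule tlift_comult_hom[OF j_hom A.A_module bilinear_mult[OF A.A_algebra linear_id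
          linear_mult_right[OF A.A_algebra jS\<pi>_linear pa]] h])
  also have "\<dots> = tlift K A (\<lambda>x1 x2. j x1 \<otimes>\<^bsub>A\<^esub> (proj a \<otimes>\<^bsub>A\<^esub> j (S x2))) (comult H h)"
    by (rule tlift_cong[OF H.A_module H.A_module A.A_module]) (use h a in simp_all)
  finally show ?thesis by (simp only: ad_conv[OF h pa] HA.conv_cunit_mid[OF j_linear jS_linear pa h])
qed

lemma proj_j: "h \<in> carrier H \<Longrightarrow> proj (j h) = counit H h \<odot>\<^bsub>A\<^esub> \<one>\<^bsub>A\<^esub>"
proof -
  have "\<one>\<^bsub>A\<^esub> \<in> coinv" 
    using algebra_homD(2)[OF \<rho>_hom] algebra_homD(2)[OF iA_hom] by (simp only: coinv_iff A.one_closed) 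
  then have "proj \<one>\<^bsub>A\<^esub> = \<one>\<^bsub>A\<^esub>" by (rule proj_coinv_id)
  then show "proj (j h) = counit H h \<odot>\<^bsub>A\<^esub> \<one>\<^bsub>A\<^esub>" if "h \<in> carrier H"
    using proj_j_mult[OF that A.one_closed] that by (simp add: ad_unit)
qed

text \<open>By \<open>proj_mult\<close> the inner factor is \<open>proj (j h)\<close>, a scalar.
  This is what lets \<open>proj\<close> absorb a trailing factor from \<open>j\<close>.\<close>

lemma proj_mult_j:
  assumes h: "h \<in> carrier H" and x: "x \<in> carrier A"
  shows "proj (x \<otimes>\<^bsub>A\<^esub> j h) = counit H h \<odot>\<^bsub>A\<^esub> proj x"
proof -
  note pj = proj_closed[OF algebra_homD(4)[OF j_algebra_hom h]]
  have "proj (x \<otimes>\<^bsub>A\<^esub> j h) = tlift K A (\<lambda>x1 x2. x1 \<otimes>\<^bsub>A\<^esub> (proj (j h) \<otimes>\<^bsub>A\<^esub> j (S (\<pi> x2)))) (comult A x)"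
    by (simp only: proj_mult j_simps h x AA.conv_cunit_mid[OF linear_id jS\<pi>_linear pj])
  also have "\<dots> = counit H h \<odot>\<^bsub>A\<^esub> proj x"
  proof -
    have L: "(\<lambda>u. counit H h \<odot>\<^bsub>A\<^esub> u) \<in> linear_hom K A A"
      by (rule linear_homI) (use h in \<open>simp_all add: A.smult_r_distr m_comm flip: A.smult_assoc1\<close>)
    have px: "proj x = tlift K A (\<lambda>x1 x2. x1 \<otimes>\<^bsub>A\<^esub> j (S (\<pi> x2))) (comult A x)"
      by (simp add: proj_def assoc_proj_def)
    show ?thesis unfolding px
      by (rule AA.embed_tlift[OF A.A_module A.A_module A.A_module L A.comult_closed[OF x], symmetric])
        (use h in \<open>simp_all add: proj_j A.smult_mult_left A.smult_mult_right\<close>)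
  qed
  finally show ?thesis .
qed

text \<open>The factors \<open>j \<circ> S \<circ> \<pi>\<close> and \<open>j \<circ> \<pi>\<close>
  cancel. Every element is thus recovered from projected first legs and the images of second legs in
  \<open>H\<close>, which yields the inverse of the canonical map.\<close>

lemma proj_j\<pi>: "a \<in> carrier A \<Longrightarrow> conv K A A proj (\<lambda>a. j (\<pi> a)) a = a"
proof -
  assume a: "a \<in> carrier A"
  note l = linear_id[of K A] jS\<pi>_linear j\<pi>_linear
  have "conv K A A proj (\<lambda>a. j (\<pi> a)) = conv K A A (conv K A A (\<lambda>x. x) (\<lambda>a. j (S (\<pi> a)))) (\<lambda>a. j (\<pi> a))"
    by (rule AA.conv_cong[OF proj_linear j\<pi>_linear]) (simp_all add: proj_conv)
  also have "\<dots> = conv K A A (\<lambda>x. x) (conv K A A (\<lambda>a. j (S (\<pi> a))) (\<lambda>a. j (\<pi> a)))"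
    by (rule AA.conv_assoc[OF l])
  also have "\<dots> = restrict (\<lambda>x. x) (carrier A)"
    by (simp only: conv_\<pi>_inverse[OF A.A_algebra j_algebra_hom] AA.conv_one l)
  finally show ?thesis using a by simp
qed

text \<open>Write \<open>\<pi>\<close> as the convolution of the unit with \<open>\<pi>\<close>;
  then \<open>conv_coinv\<close> evaluates the second factor at 1.\<close>

lemma \<pi>_coinv:
  assumes r: "r \<in> coinv"
  shows "\<pi> r = counit A r \<odot>\<^bsub>H\<^esub> \<one>\<^bsub>H\<^esub>"
proof -
  interpret AB: convolution K A H by (rule convolution_AI[OF H.A_algebra])
  have "conv K A H (cunit K A H \<one>\<^bsub>H\<^esub>) (\<lambda>a. \<pi> a) r = cunit K A H \<one>\<^bsub>H\<^esub> r \<otimes>\<^bsub>H\<^esub> \<one>\<^bsub>H\<^esub>"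
    by (rule conv_coinv[OF r H.A_algebra AB.cunit_linear[OF H.one_closed] linear_id])
  then show ?thesis using r by (simp add: AB.conv_one \<pi>_linear AB.cunit_apply)
qed

text \<open>The antipode, \<open>\<pi>\<close> and \<open>j\<close> preserve counits, so the second
  factor of \<open>proj\<close> becomes the unit of the convolution algebra of
  \<open>K\<close>-valued maps.\<close>

lemma counit_proj:
  assumes a: "a \<in> carrier A"
  shows "counit A (proj a) = counit A a"
proof -
  interpret AK: convolution K A "self_module K" by (rule convolution_AI[OF self_k_algebra])
  note cl = A.counit_linear
  have l: "(\<lambda>a. counit A (j (S (\<pi> a)))) \<in> linear_hom K A (self_module K)"
    by (rule linear_comp[OF cl jS\<pi>_linear])
  have "conv K A (self_module K) (counit A) (\<lambda>a. counit A (j (S (\<pi> a))))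
    = conv K A (self_module K) (counit A) (cunit K A (self_module K) \<one>\<^bsub>self_module K\<^esub>)"
    by (rule AK.conv_cong[OF cl l]) (simp_all add: H.antipode_counit AK.cunit_apply)
  also have "\<dots> = restrict (counit A) (carrier A)" by (rule AK.conv_one[OF cl])
  finally show ?thesis using hom_proj[OF self_k_algebra A.counit_hom a] a by simp
qed

lemma counit_ad:
  assumes h: "h \<in> carrier H" and a: "a \<in> carrier A"
  shows "counit A (ad h a) = counit H h \<otimes>\<^bsub>K\<^esub> counit A a"
proof -
  interpret HK: convolution K H "self_module K" by (rule convolution_HI[OF self_k_algebra])
  let ?f = "\<lambda>h. counit A a \<otimes>\<^bsub>K\<^esub> counit H h"
  have l: "?f \<in> linear_hom K H (self_module K)"
    using linear_mult_right[OF self_k_algebra H.counit_linear, of "counit A a"] a by simp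
  have "counit A (ad h a)
    = tlift K (self_module K) (\<lambda>h1 h2. counit H h1 \<odot>\<^bsub>self_module K\<^esub> ?f h2) (comult H h)"
    unfolding ad_def
    by (rule HK.embed_tlift[OF A.A_module H.A_module H.A_module A.counit_linear H.comult_closed[OF h]])
      (use a in \<open>simp_all add: A.counit_mult H.antipode_counit m_assoc\<close>)
  also have "\<dots> = ?f h" by (rule H.counit_left_linear[OF HK.B_module l h])
  finally show ?thesis using h a by (simp add: m_comm)
qed


section \<open>The coproduct of the coinvariants inside the tensor square of A\<close>

lemma AxA_algebra: "k_algebra K (tensor_algebra K A A)" by simp
lemma AxA_module: "module K (tensor_space K A A)" by simp

text \<open>On the coinvariants, \<open>Q \<circ> comult A\<close> is the coproduct of \<open>R\<close> seen in \<open>A \<otimes> A\<close>.\<close>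

definition "Q = tlift K (tensor_space K A A) (\<lambda>x y. tens K A A (proj x) y)"

lemma Q_linear: "Q \<in> linear_hom K (tensor_space K A A) (tensor_space K A A)"
  unfolding Q_def
  by (rule tlift_linear[OF A.A_module A.A_module AxA_module bilinear_tens[OF A.A_module A.A_module proj_linear linear_id]])

lemma Q_tens: "\<lbrakk>x \<in> carrier A; y \<in> carrier A\<rbrakk> \<Longrightarrow> Q (tens K A A x y) = tens K A A (proj x) y"
  unfolding Q_def
  by (rule tlift_tens[OF A.A_module A.A_module AxA_module bilinear_tens[OF A.A_module A.A_module proj_linear linear_id]])

lemma tlift_Q:
  assumes "module K X" "bilinear K A A X F" "t \<in> carrier (tensor_space K A A)"
  shows "tlift K X F (Q t) = tlift K X (\<lambda>x y. F (proj x) y) t"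
  unfolding Q_def
  by (rule tlift_tlift_tens[OF A.A_module A.A_module A.A_module A.A_module assms(1,2) proj_linear linear_id assms(3)])

lemma Q_mult_inl_j:
  assumes t: "t \<in> carrier (tensor_space K A A)" and h: "h \<in> carrier H"
  shows "Q (t \<otimes>\<^bsub>tensor_algebra K A A\<^esub> inl K A A (j h)) = counit H h \<odot>\<^bsub>tensor_space K A A\<^esub> Q t"
proof -
  interpret T: module K "tensor_space K A A" by (rule AxA_module)
  have u: "inl K A A (j h) \<in> carrier (tensor_space K A A)" using h by (simp add: inl_def)
  have 1: "(\<lambda>t. Q (t \<otimes>\<^bsub>tensor_algebra K A A\<^esub> inl K A A (j h)))
    \<in> linear_hom K (tensor_space K A A) (tensor_space K A A)"
    by (rule linear_comp[OF Q_linear bilinear_left[OF tensor_mult_bilinear(1)[OF A.A_algebra A.A_algebra] u]])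
  have 2: "(\<lambda>t. counit H h \<odot>\<^bsub>tensor_space K A A\<^esub> Q t) \<in> linear_hom K (tensor_space K A A) (tensor_space K A A)"
    by (rule linear_homI)
      (use h in \<open>simp_all add: linear_closed[OF Q_linear] linear_add[OF Q_linear] linear_smult[OF Q_linear]
        T.smult_r_distr m_comm flip: T.smult_assoc1\<close>)
  show ?thesis
  proof (rule linear_ext_tensor[OF A.A_module A.A_module 1 2 _ t])
    fix x y assume "x \<in> carrier A" "y \<in> carrier A"
    then show "Q (tens K A A x y \<otimes>\<^bsub>tensor_algebra K A A\<^esub> inl K A A (j h))
      = counit H h \<odot>\<^bsub>tensor_space K A A\<^esub> Q (tens K A A x y)"
      using h linear_smult[OF bilinear_left[OF tens_bilinear[OF A.A_module A.A_module]]]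
      by (simp add: inl_def Q_tens proj_mult_j)
  qed
qed

text \<open>Each term loses its trailing factor to \<open>Q_mult_inl_j\<close> at the cost of a
  counit, and the counit axiom of \<open>C\<close> removes the leg.\<close>

lemma Q_conv:
  assumes C: "bialgebra K C" and F: "F \<in> linear_hom K C (tensor_algebra K A A)"
    and G: "G \<in> linear_hom K C H" and \<epsilon>: "\<And>c. c \<in> carrier C \<Longrightarrow> counit H (G c) = counit C c"
    and c: "c \<in> carrier C"
  shows "Q (conv K C (tensor_algebra K A A) F (\<lambda>c. inl K A A (j (G c))) c) = Q (F c)"
proof -
  interpret C: bialgebra K C by fact
  interpret CB: convolution K C "tensor_algebra K A A"
    using C by (simp add: convolution_def)
  have Fl: "F \<in> linear_hom K C (tensor_space K A A)" using F by simp
  note cl = linear_closed[OF Fl] linear_closed[OF G]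
  have i: "inl K A A (j (G c)) \<in> carrier (tensor_space K A A)" if "c \<in> carrier C" for c
    using cl that by (simp add: inl_def)
  have m: "F x \<otimes>\<^bsub>tensor_algebra K A A\<^esub> inl K A A (j (G y)) \<in> carrier (tensor_space K A A)"
    if "x \<in> carrier C" "y \<in> carrier C" for x y
    using CB.B.m_closed[of "F x" "inl K A A (j (G y))"] cl i that by simp
  have "Q (conv K C (tensor_algebra K A A) F (\<lambda>c. inl K A A (j (G c))) c)
    = Q (tlift K (tensor_space K A A) (\<lambda>x y. F x \<otimes>\<^bsub>tensor_algebra K A A\<^esub> inl K A A (j (G y))) (comult C c))"
    using c by (simp add: conv_def)
  also have "\<dots> = tlift K (tensor_space K A A)
      (\<lambda>x y. Q (F x \<otimes>\<^bsub>tensor_algebra K A A\<^esub> inl K A A (j (G y)))) (comult C c)"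
    by (rule linear_tlift[OF C.A_module C.A_module AxA_module AxA_module Q_linear C.comult_closed[OF c] m])
  also have "\<dots> = tlift K (tensor_space K A A) (\<lambda>x y. counit C y \<odot>\<^bsub>tensor_space K A A\<^esub> Q (F x)) (comult C c)"
    by (rule tlift_cong[OF C.A_module C.A_module AxA_module C.comult_closed[OF c] linear_closed[OF Q_linear m]])
      (simp_all add: Q_mult_inl_j cl \<epsilon>)
  also have "\<dots> = Q (F c)"
    by (rule C.counit_right_linear[OF AxA_module linear_comp[OF Q_linear Fl] c])
  finally show ?thesis .
qed

text \<open>In other words, \<open>proj\<close> is a coalgebra map onto the coinvariants.\<close>

lemma proj_comult:
  assumes X: "module K X" and F: "bilinear K A A X F" and a: "a \<in> carrier A"
  shows "tlift K X (\<lambda>x y. F (proj x) y) (comult A (proj a))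
    = tlift K X (\<lambda>x y. F (proj x) (proj y)) (comult A a)"
proof -
  let ?T = "tensor_algebra K A A" and ?l = "inl K A A" and ?r = "inr K A A"
  interpret AB: convolution K A ?T by (rule convolution_AI[OF AxA_algebra])
  note lh = inl_algebra_hom[OF A.A_algebra A.A_algebra] and rh = inr_algebra_hom[OF A.A_algebra A.A_algebra]
  note l = algebra_homD(1)[OF lh] and r = algebra_homD(1)[OF rh]
  note \<Delta> = algebra_homD(1)[OF A.comult_hom]
  note ll = l r linear_comp[OF r proj_linear] linear_comp[OF l jS\<pi>_linear] linear_comp[OF r jS\<pi>_linear]
    linear_comp[OF \<Delta> jS\<pi>_linear]
  \<comment> \<open>\<open>antipode_conv\<close> for \<open>comult A \<circ> j\<close>: the two legs
    come out in reversed order, the right inclusion first.\<close>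
  have jS: "comult A (j (S (\<pi> b))) = conv K A ?T (\<lambda>a. ?r (j (S (\<pi> a)))) (\<lambda>a. ?l (j (S (\<pi> a)))) b"
    if b: "b \<in> carrier A" for b
  proof -
    have \<pi>b: "\<pi> b \<in> carrier H" using b by simp
    have "comult A (j (S (\<pi> b))) = conv K H ?T (\<lambda>h. ?r (j (S h))) (\<lambda>h. ?l (j (S h))) (\<pi> b)"
      by (rule H.antipode_conv[OF AxA_algebra algebra_hom_comp[OF A.comult_hom j_algebra_hom]
            algebra_hom_comp[OF lh j_algebra_hom] algebra_hom_comp[OF rh j_algebra_hom] _ \<pi>b])
        (simp only: A.comult_conv j_simps conv_precomp[OF j_hom AxA_algebra l r])
    also have "\<dots> = conv K A ?T (\<lambda>a. ?r (j (S (\<pi> a)))) (\<lambda>a. ?l (j (S (\<pi> a)))) b"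
      by (rule conv_precomp[OF \<pi>_hom AxA_algebra linear_comp[OF r jS_linear] linear_comp[OF l jS_linear] b])
    finally show ?thesis .
  qed
  have rp: "conv K A ?T ?r (\<lambda>a. ?r (j (S (\<pi> a)))) = restrict (\<lambda>a. ?r (proj a)) (carrier A)"
  proof
    show "conv K A ?T ?r (\<lambda>a. ?r (j (S (\<pi> a)))) a = restrict (\<lambda>a. ?r (proj a)) (carrier A) a" for a
      by (cases "a \<in> carrier A") (simp only: hom_proj[OF AxA_algebra rh] restrict_apply', simp add: conv_def)
  qed
  have "conv K A ?T (comult A) (\<lambda>a. comult A (j (S (\<pi> a))))
    = conv K A ?T (conv K A ?T ?l ?r) (conv K A ?T (\<lambda>a. ?r (j (S (\<pi> a)))) (\<lambda>a. ?l (j (S (\<pi> a)))))"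
    by (rule AB.conv_cong[OF \<Delta> ll(6)]) (simp_all only: A.comult_conv jS)
  also have "\<dots> = conv K A ?T (conv K A ?T ?l (conv K A ?T ?r (\<lambda>a. ?r (j (S (\<pi> a)))))) (\<lambda>a. ?l (j (S (\<pi> a))))"
    by (simp only: AB.conv_assoc AB.conv_linear ll)
  also have "\<dots> = conv K A ?T (conv K A ?T ?l (\<lambda>a. ?r (proj a))) (\<lambda>a. ?l (j (S (\<pi> a))))"
    by (simp only: rp AB.conv_restrict ll)
  finally have e: "comult A (proj a)
    = conv K A ?T (conv K A ?T ?l (\<lambda>a. ?r (proj a))) (\<lambda>a. ?l (j (S (\<pi> a)))) a"
    by (simp only: hom_proj[OF AxA_algebra A.comult_hom a])
  \<comment> \<open>The two factors in the second leg have combined to \<open>proj\<close>; the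
    trailing factor in the first leg comes from \<open>j\<close>, and \<open>Q_conv\<close> removes
    it.\<close>
  have "Q (comult A (proj a)) = Q (conv K A ?T ?l (\<lambda>a. ?r (proj a)) a)"
    unfolding e
    by (rule Q_conv[OF A.bialgebra_axioms AB.conv_linear[OF ll(1,3)] S\<pi>_linear _ a])
      (simp add: H.antipode_counit)
  also have "conv K A ?T ?l (\<lambda>a. ?r (proj a)) a = tlift K (tensor_space K A A) (\<lambda>x y. tens K A A x (proj y)) (comult A a)"
    using a by (simp add: conv_def)
      (rule tlift_cong[OF A.A_module A.A_module AxA_module A.comult_closed[OF a]], simp_all add: inl_inr)
  finally have Qe: "Q (comult A (proj a))
    = Q (tlift K (tensor_space K A A) (\<lambda>x y. tens K A A x (proj y)) (comult A a))" .
  have bb: "bilinear K A A X (\<lambda>x y. F (proj x) y)" by (rule bilinear_comp[OF F proj_linear linear_id])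
  have "tlift K X (\<lambda>x y. F (proj x) y) (comult A (proj a)) = tlift K X F (Q (comult A (proj a)))"
    by (rule tlift_Q[OF X F A.comult_closed[OF proj_closed[OF a]], symmetric])
  also have "\<dots> = tlift K X (\<lambda>x y. F (proj x) y)
      (tlift K (tensor_space K A A) (\<lambda>x y. tens K A A x (proj y)) (comult A a))"
    unfolding Qe
    by (rule tlift_Q[OF X F tlift_closed[OF A.A_module A.A_module AxA_module A.comult_closed[OF a]]]) simp
  also have "\<dots> = tlift K X (\<lambda>x y. F (proj x) (proj y)) (comult A a)"
    by (rule tlift_tlift_tens[OF A.A_module A.A_module A.A_module A.A_module X bb linear_id proj_linear A.comult_closed[OF a]])
  finally show ?thesis .
qed

lemma coinv_one: "\<one>\<^bsub>A\<^esub> \<in> coinv"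
  using algebra_homD(2)[OF \<rho>_hom] algebra_homD(2)[OF iA_hom] by (simp only: coinv_iff A.one_closed)

lemma coinv_mult: "\<lbrakk>x \<in> coinv; y \<in> coinv\<rbrakk> \<Longrightarrow> x \<otimes>\<^bsub>A\<^esub> y \<in> coinv"
  using algebra_homD(3)[OF \<rho>_hom] algebra_homD(3)[OF iA_hom] by (simp only: coinv_iff A.m_closed)

lemma coinv_add: "\<lbrakk>x \<in> coinv; y \<in> coinv\<rbrakk> \<Longrightarrow> x \<oplus>\<^bsub>A\<^esub> y \<in> coinv"
  using linear_add[OF algebra_homD(1)[OF \<rho>_hom]] linear_add[OF algebra_homD(1)[OF iA_hom]]
  by (simp only: coinv_iff A.a_closed)

lemma coinv_smult: "\<lbrakk>c \<in> carrier K; x \<in> coinv\<rbrakk> \<Longrightarrow> c \<odot>\<^bsub>A\<^esub> x \<in> coinv"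
  using linear_smult[OF algebra_homD(1)[OF \<rho>_hom]] linear_smult[OF algebra_homD(1)[OF iA_hom]]
  by (simp only: coinv_iff A.smult_closed)

end

section \<open>The associated structure on the coinvariants\<close>

lemma (in field) tensor_restrict_eq:
  assumes V: "module R V" and W: "module R W" and V': "module R V'" and W': "module R W'"
    and i: "(\<lambda>x. x) \<in> linear_hom R V' V" "(\<lambda>x. x) \<in> linear_hom R W' W"
    and p: "p \<in> linear_hom R V V'" "\<And>v. v \<in> carrier V' \<Longrightarrow> p v = v"
    and q: "q \<in> linear_hom R W W'" "\<And>w. w \<in> carrier W' \<Longrightarrow> q w = w"
    and s: "s \<in> carrier (tensor_space R V' W')" and t: "tlift R (tensor_space R V W) (tens R V W) s = t"
  shows "tensor_restrict R V W V' W' t = s"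
proof -
  have T: "module R (tensor_space R V W)" and T': "module R (tensor_space R V' W')" using assms by simp_all
  have b: "bilinear R V' W' (tensor_space R V W) (tens R V W)"
    using bilinear_tens[OF V W i] .
  let ?E = "tlift R (tensor_space R V W) (tens R V W)"
  have E: "?E \<in> linear_hom R (tensor_space R V' W') (tensor_space R V W)"
    by (rule tlift_linear[OF V' W' T b])
  note bP = bilinear_tens[OF V' W' p(1) q(1)]
  let ?P = "tlift R (tensor_space R V' W') (\<lambda>v w. tens R V' W' (p v) (q w))"
  have P: "?P \<in> linear_hom R (tensor_space R V W) (tensor_space R V' W')"
    by (rule tlift_linear[OF V W T' bP])
  \<comment> \<open>The tensor product of the retractions is a left inverse of the canonical map, so
    \<open>inv_into\<close> recovers \<open>s\<close>.\<close>
  have PE: "?P (?E u) = u" if u: "u \<in> carrier (tensor_space R V' W')" for u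
    by (rule linear_ext_tensor[OF V' W' linear_comp[OF P E] linear_id _ u])
      (simp add: tlift_tens[OF V' W' T b] tlift_tens[OF V W T' bP] linear_closed[OF i(1)] linear_closed[OF i(2)] p(2) q(2))
  have "inj_on ?E (carrier (tensor_space R V' W'))"
    by (rule inj_on_inverseI[where g = ?P]) (rule PE)
  then show ?thesis unfolding tensor_restrict_def using s t by (rule inv_into_f_eq)
qed

text \<open>The operations are fixed on the coinvariants by equations instead of setting
  \<open>R\<close> to \<open>assoc_bialgebra\<close>. Both the associated bialgebra and, over the
  opposite data, \<open>op_yd\<close> are then instances, and every result applies to each.\<close>

locale hopf_projection_yd = hopf_projection K H S A j \<pi>
  for K :: "('k, 'x) ring_scheme" and H :: "('k, 'h, 'y) bialg_scheme" and S :: "'h \<Rightarrow> 'h"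
    and A :: "('k, 'a, 'z) bialg_scheme" and j :: "'h \<Rightarrow> 'a" and \<pi> :: "'a \<Rightarrow> 'h" +
  fixes R :: "('k, 'h, 'a, 'w) yd_bialg_scheme"
  assumes R_simps [simp]: "carrier R = coinv" "mult R = mult A" "one R = one A" "zero R = zero A"
      "add R = add A" "smult R = smult A" "yd_counit R = counit A"
    and R_act [simp]: "\<lbrakk>h \<in> carrier H; r \<in> coinv\<rbrakk> \<Longrightarrow> act R h r = ad h r"
    and R_coact: "r \<in> coinv \<Longrightarrow> coact R r = tensor_restrict K H A H (A\<lparr>carrier := coinv\<rparr>)
         (tlift K (tensor_space K H A) (\<lambda>r1 r2. tens K H A (\<pi> r1) r2) (comult A r))"
    and R_comult: "r \<in> coinv \<Longrightarrow> yd_comult R r = tensor_restrict K A A (A\<lparr>carrier := coinv\<rparr>) (A\<lparr>carrier := coinv\<rparr>)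
         (tlift K (tensor_space K A A) (\<lambda>r1 r2. tens K A A (proj r1) r2) (comult A r))"
begin

lemma R_module [simp]: "module K R"
proof (rule moduleI)
  show "abelian_group R"
  proof (rule abelian_groupI)
    have "\<zero>\<^bsub>K\<^esub> \<odot>\<^bsub>A\<^esub> \<one>\<^bsub>A\<^esub> \<in> coinv" by (rule coinv_smult) (simp_all add: coinv_one)
    then show "\<zero>\<^bsub>R\<^esub> \<in> carrier R" by simp
    \<comment> \<open>Negatives come from the scalar -1, since closure under scalars is already
      known.\<close>
    show "\<exists>y\<in>carrier R. y \<oplus>\<^bsub>R\<^esub> x = \<zero>\<^bsub>R\<^esub>" if "x \<in> carrier R" for x
    proof (rule bexI)
      show "(\<ominus>\<^bsub>K\<^esub> \<one>\<^bsub>K\<^esub>) \<odot>\<^bsub>A\<^esub> x \<oplus>\<^bsub>R\<^esub> x = \<zero>\<^bsub>R\<^esub>"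
        using that by (simp add: A.smult_l_minus A.l_neg)
      show "(\<ominus>\<^bsub>K\<^esub> \<one>\<^bsub>K\<^esub>) \<odot>\<^bsub>A\<^esub> x \<in> carrier R"
        using that by (simp add: coinv_smult)
    qed
  qed (auto simp: coinv_add A.a_ac)
qed (auto simp: is_cring coinv_smult A.smult_l_distr A.smult_r_distr A.smult_assoc1)

lemma R_algebra [simp]: "k_algebra K R"
proof (intro k_algebra.intro k_algebra_axioms.intro field_axioms R_module)
  show "ring R"
    by (rule ringI)
      (use module.axioms(2)[OF R_module] in \<open>auto intro!: monoidI simp: coinv_mult coinv_one A.m_assoc A.l_distr A.r_distr\<close>)
qed (auto simp: A.smult_mult_left A.smult_mult_right)

lemma incl_linear: "(\<lambda>x. x) \<in> linear_hom K R A"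
  by (rule linear_homI) simp_all

lemma linear_from_R: "f \<in> linear_hom K A X \<Longrightarrow> f \<in> linear_hom K R X"
  by (rule linear_comp[OF _ incl_linear])

lemma linear_into_R:
  assumes "f \<in> linear_hom K X A" "\<And>x. x \<in> carrier X \<Longrightarrow> f x \<in> coinv"
  shows "f \<in> linear_hom K X R"
  by (rule linear_homI) (use linear_add[OF assms(1)] linear_smult[OF assms(1)] assms(2) in simp_all)

lemma proj_linear_R: "proj \<in> linear_hom K A R"
  by (rule linear_into_R[OF proj_linear proj_mem])

text \<open>\<open>R_coact\<close> and \<open>R_comult\<close> are stated over \<open>A\<close> with
  a smaller carrier, which is the same vector space as \<open>R\<close>.\<close>

lemma restricted [simp]:
  "tensor_space K V (A\<lparr>carrier := coinv\<rparr>) = tensor_space K V R"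
  "tensor_space K (A\<lparr>carrier := coinv\<rparr>) V = tensor_space K R V"
  "linear_hom K V (A\<lparr>carrier := coinv\<rparr>) = linear_hom K V R"
  "linear_hom K (A\<lparr>carrier := coinv\<rparr>) V = linear_hom K R V"
  by (rule tensor_cong linear_hom_cong; simp)+

lemma restricted_module: "module K (A\<lparr>carrier := coinv\<rparr>)"
  by (rule module_cong[OF _ _ _ _ R_module]) simp_all

lemma HR_module: "module K (tensor_space K H R)" and RR_module: "module K (tensor_space K R R)"
  and HA_module: "module K (tensor_space K H A)"
  by simp_all

text \<open>Inserting \<open>proj\<close> into the second leg of the coproduct of \<open>r\<close>
  produces an element of \<open>H \<otimes> R\<close>. By \<open>tlift_comult_coinv\<close> its
  image in \<open>H \<otimes> A\<close> is the element that \<open>R_coact\<close>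
  restricts.\<close>

lemma coact_eq:
  assumes r: "r \<in> coinv"
  shows "coact R r = tlift K (tensor_space K H R) (\<lambda>a1 a2. tens K H R (\<pi> a1) (proj a2)) (comult A r)"
proof -
  have rc: "r \<in> carrier A" using r by simp
  have c: "tlift K (tensor_space K H R) (\<lambda>a1 a2. tens K H R (\<pi> a1) (proj a2)) (comult A r) \<in> carrier (tensor_space K H R)"
    by (rule tlift_closed[OF A.A_module A.A_module HR_module A.comult_closed[OF rc]]) (simp add: proj_mem)
  show ?thesis unfolding R_coact[OF r]
  proof (rule tensor_restrict_eq[where p = "\<lambda>x. x" and q = proj, OF H.A_module A.A_module H.A_module restricted_module])
    show "tlift K (tensor_space K H R) (\<lambda>a1 a2. tens K H R (\<pi> a1) (proj a2)) (comult A r)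
      \<in> carrier (tensor_space K H (A\<lparr>carrier := coinv\<rparr>))" using c by simp
    have "tlift K (tensor_space K H A) (tens K H A) (tlift K (tensor_space K H R) (\<lambda>a1 a2. tens K H R (\<pi> a1) (proj a2)) (comult A r))
      = tlift K (tensor_space K H A) (\<lambda>a1 a2. tens K H A (\<pi> a1) (proj a2)) (comult A r)"
      by (rule tlift_tlift_tens[OF H.A_module R_module A.A_module A.A_module HA_module
          bilinear_tens[OF H.A_module A.A_module linear_id incl_linear] \<pi>_linear proj_linear_R A.comult_closed[OF rc]])
    also have "\<dots> = tlift K (tensor_space K H A) (\<lambda>a1 a2. tens K H A (\<pi> a1) a2) (comult A r)"
      by (rule tlift_comult_coinv[OF r HA_module bilinear_tens[OF H.A_module A.A_module \<pi>_linear linear_id], symmetric])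
    finally show "tlift K (tensor_space K H A) (tens K H A)
        (tlift K (tensor_space K H R) (\<lambda>a1 a2. tens K H R (\<pi> a1) (proj a2)) (comult A r)) =
      tlift K (tensor_space K H A) (\<lambda>r1 r2. tens K H A (\<pi> r1) r2) (comult A r)" .
  qed (simp_all add: incl_linear proj_linear_R proj_coinv_id linear_id)
qed

lemma comultR_eq:
  assumes r: "r \<in> coinv"
  shows "yd_comult R r = tlift K (tensor_space K R R) (\<lambda>a1 a2. tens K R R (proj a1) (proj a2)) (comult A r)"
proof -
  have rc: "r \<in> carrier A" using r by simp
  have c: "tlift K (tensor_space K R R) (\<lambda>a1 a2. tens K R R (proj a1) (proj a2)) (comult A r) \<in> carrier (tensor_space K R R)"
    by (rule tlift_closed[OF A.A_module A.A_module RR_module A.comult_closed[OF rc]]) (simp add: proj_mem)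
  then have c': "tlift K (tensor_space K R R) (\<lambda>a1 a2. tens K R R (proj a1) (proj a2)) (comult A r)
    \<in> carrier (tensor_space K (A\<lparr>carrier := coinv\<rparr>) (A\<lparr>carrier := coinv\<rparr>))" by simp
  show ?thesis unfolding R_comult[OF r]
  proof (rule tensor_restrict_eq[where p = proj and q = proj, OF A.A_module A.A_module restricted_module restricted_module _ _ _ _ _ _ c'])
    have "tlift K (tensor_space K A A) (tens K A A) (tlift K (tensor_space K R R) (\<lambda>a1 a2. tens K R R (proj a1) (proj a2)) (comult A r))
      = tlift K (tensor_space K A A) (\<lambda>a1 a2. tens K A A (proj a1) (proj a2)) (comult A r)"
      by (rule tlift_tlift_tens[OF R_module R_module A.A_module A.A_module AxA_module
          bilinear_tens[OF A.A_module A.A_module incl_linear incl_linear] proj_linear_R proj_linear_R A.comult_closed[OF rc]])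
    also have "\<dots> = tlift K (tensor_space K A A) (\<lambda>a1 a2. tens K A A (proj a1) a2) (comult A r)"
      by (rule tlift_comult_coinv[OF r AxA_module bilinear_tens[OF A.A_module A.A_module proj_linear linear_id], symmetric])
    finally show "tlift K (tensor_space K A A) (tens K A A)
        (tlift K (tensor_space K R R) (\<lambda>a1 a2. tens K R R (proj a1) (proj a2)) (comult A r)) =
      tlift K (tensor_space K A A) (\<lambda>r1 r2. tens K A A (proj r1) r2) (comult A r)" .
  qed (simp_all add: incl_linear proj_linear_R proj_coinv_id)
qed

lemma coact_closed [simp]: "r \<in> coinv \<Longrightarrow> coact R r \<in> carrier (tensor_space K H R)"
  unfolding coact_eq by (rule tlift_closed[OF A.A_module A.A_module HR_module]) (simp_all add: proj_mem)

lemma comultR_closed [simp]: "r \<in> coinv \<Longrightarrow> yd_comult R r \<in> carrier (tensor_space K R R)"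
  unfolding comultR_eq by (rule tlift_closed[OF A.A_module A.A_module RR_module]) (simp_all add: proj_mem)

lemma linear_cong_R:
  assumes "f \<in> linear_hom K A X" "\<And>r. r \<in> coinv \<Longrightarrow> g r = f r"
  shows "g \<in> linear_hom K R X"
  using linear_from_R[OF assms(1)] assms(2) coinv_add coinv_smult
  by (auto simp: linear_hom_def Pi_iff)

lemma coact_linear_R: "coact R \<in> linear_hom K R (tensor_space K H R)"
  by (rule linear_cong_R[OF linear_tlift_arg[OF A.A_module A.A_module HR_module
        bilinear_tens[OF H.A_module R_module \<pi>_linear proj_linear_R] A.comult_linear]]) (rule coact_eq)

lemma comultR_linear: "yd_comult R \<in> linear_hom K R (tensor_space K R R)"
  by (rule linear_cong_R[OF linear_tlift_arg[OF A.A_module A.A_module RR_module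
        bilinear_tens[OF R_module R_module proj_linear_R proj_linear_R] A.comult_linear]]) (rule comultR_eq)

text \<open>An integrand defined on all of \<open>A\<close> does not see the inserted
  \<open>proj\<close>, by \<open>tlift_comult_coinv\<close>. Sums over the coaction thus become sums
  over the coproduct of \<open>A\<close>.\<close>

lemma coact_tlift:
  assumes r: "r \<in> coinv" and X: "module K X" and F: "bilinear K H A X F"
  shows "tlift K X F (coact R r) = tlift K X (\<lambda>a1 a2. F (\<pi> a1) a2) (comult A r)"
proof -
  have rc: "r \<in> carrier A" using r by simp
  have "tlift K X F (coact R r) = tlift K X (\<lambda>a1 a2. F (\<pi> a1) (proj a2)) (comult A r)"
    unfolding coact_eq[OF r]
    by (rule tlift_tlift_tens[OF H.A_module R_module A.A_module A.A_module X
          bilinear_comp[OF F linear_id incl_linear] \<pi>_linear proj_linear_R A.comult_closed[OF rc]])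
  also have "\<dots> = tlift K X (\<lambda>a1 a2. F (\<pi> a1) a2) (comult A r)"
    by (rule tlift_comult_coinv[OF r X bilinear_comp[OF F \<pi>_linear linear_id], symmetric])
  finally show ?thesis .
qed

lemma comultR_tlift:
  assumes r: "r \<in> coinv" and X: "module K X" and F: "bilinear K A A X F"
  shows "tlift K X F (yd_comult R r) = tlift K X (\<lambda>a1 a2. F (proj a1) a2) (comult A r)"
proof -
  have rc: "r \<in> carrier A" using r by simp
  have "tlift K X F (yd_comult R r) = tlift K X (\<lambda>a1 a2. F (proj a1) (proj a2)) (comult A r)"
    unfolding comultR_eq[OF r]
    by (rule tlift_tlift_tens[OF R_module R_module A.A_module A.A_module X
          bilinear_comp[OF F incl_linear incl_linear] proj_linear_R proj_linear_R A.comult_closed[OF rc]])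
  also have "\<dots> = tlift K X (\<lambda>a1 a2. F (proj a1) a2) (comult A r)"
    by (rule tlift_comult_coinv[OF r X bilinear_comp[OF F proj_linear linear_id], symmetric])
  finally show ?thesis .
qed

lemma coact_tlift_closed:
  assumes "r \<in> coinv" "module K X" "\<And>h s. \<lbrakk>h \<in> carrier H; s \<in> coinv\<rbrakk> \<Longrightarrow> F h s \<in> carrier X"
  shows "tlift K X F (coact R r) \<in> carrier X"
  by (rule tlift_closed[OF H.A_module R_module assms(2) coact_closed[OF assms(1)]]) (use assms(3) in simp)

lemma comultR_tlift_closed:
  assumes "r \<in> coinv" "module K X" "\<And>h s. \<lbrakk>h \<in> coinv; s \<in> coinv\<rbrakk> \<Longrightarrow> F h s \<in> carrier X"
  shows "tlift K X F (yd_comult R r) \<in> carrier X"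
  by (rule tlift_closed[OF R_module R_module assms(2) comultR_closed[OF assms(1)]]) (use assms(3) in simp)

lemma comultH_tlift_closed:
  assumes "h \<in> carrier H" "module K X" "\<And>h s. \<lbrakk>h \<in> carrier H; s \<in> carrier H\<rbrakk> \<Longrightarrow> F h s \<in> carrier X"
  shows "tlift K X F (comult H h) \<in> carrier X"
  by (rule tlift_closed[OF H.A_module H.A_module assms(2) H.comult_closed[OF assms(1)]]) (use assms(3) in simp)

text \<open>The working form of the reduction to convolutions: \<open>E\<close> splits the integrand
  into a product, and \<open>coact_tlift\<close> replaces the coaction by the coproduct of
  \<open>A\<close>.\<close>

lemma embed_coact:
  assumes B: "k_algebra K B" and X: "module K X" and E: "E \<in> linear_hom K X B" and r: "r \<in> coinv"
    and f: "f \<in> linear_hom K H B" and g: "g \<in> linear_hom K A B"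
    and F: "\<And>h s. \<lbrakk>h \<in> carrier H; s \<in> coinv\<rbrakk> \<Longrightarrow> F h s \<in> carrier X"
    and eq: "\<And>h s. \<lbrakk>h \<in> carrier H; s \<in> coinv\<rbrakk> \<Longrightarrow> E (F h s) = f h \<otimes>\<^bsub>B\<^esub> g s"
  shows "E (tlift K X F (coact R r)) = conv K A B (\<lambda>a. f (\<pi> a)) g r"
proof -
  interpret AB: convolution K A B by (rule convolution_AI[OF B])
  have "E (tlift K X F (coact R r)) = tlift K B (\<lambda>h s. f h \<otimes>\<^bsub>B\<^esub> g s) (coact R r)"
    by (rule AB.embed_tlift[OF X H.A_module R_module E coact_closed[OF r]]) (use F eq in simp_all)
  also have "\<dots> = tlift K B (\<lambda>a1 a2. f (\<pi> a1) \<otimes>\<^bsub>B\<^esub> g a2) (comult A r)"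
    by (rule coact_tlift[OF r AB.B_module bilinear_mult[OF B f g]])
  finally show ?thesis using r by (simp add: conv_def)
qed

text \<open>For integrands that do not split into a product of two maps in one variable each, such
  as the diagonal action.\<close>

lemma embed_comultR_bilinear:
  assumes B: "k_algebra K B" and X: "module K X" and E: "E \<in> linear_hom K X B" and r: "r \<in> coinv"
    and G: "bilinear K A A B G"
    and F: "\<And>h s. \<lbrakk>h \<in> coinv; s \<in> coinv\<rbrakk> \<Longrightarrow> F h s \<in> carrier X"
    and eq: "\<And>h s. \<lbrakk>h \<in> coinv; s \<in> coinv\<rbrakk> \<Longrightarrow> E (F h s) = G h s"
  shows "E (tlift K X F (yd_comult R r)) = tlift K B (\<lambda>a1 a2. G (proj a1) a2) (comult A r)"
proof -
  interpret AB: convolution K A B by (rule convolution_AI[OF B])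
  have "E (tlift K X F (yd_comult R r)) = tlift K B G (yd_comult R r)"
    by (rule AB.embed_tlift[OF X R_module R_module E comultR_closed[OF r]]) (use F eq in simp_all)
  also have "\<dots> = tlift K B (\<lambda>a1 a2. G (proj a1) a2) (comult A r)"
    by (rule comultR_tlift[OF r AB.B_module G])
  finally show ?thesis .
qed

lemma embed_comultR:
  assumes B: "k_algebra K B" and X: "module K X" and E: "E \<in> linear_hom K X B" and r: "r \<in> coinv"
    and f: "f \<in> linear_hom K A B" and g: "g \<in> linear_hom K A B"
    and F: "\<And>h s. \<lbrakk>h \<in> coinv; s \<in> coinv\<rbrakk> \<Longrightarrow> F h s \<in> carrier X"
    and eq: "\<And>h s. \<lbrakk>h \<in> coinv; s \<in> coinv\<rbrakk> \<Longrightarrow> E (F h s) = f h \<otimes>\<^bsub>B\<^esub> g s"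
  shows "E (tlift K X F (yd_comult R r)) = conv K A B (\<lambda>a. f (proj a)) g r"
  using embed_comultR_bilinear[OF B X E r bilinear_mult[OF B f g] F eq] r by (simp add: conv_def)

end

section \<open>The associated bialgebra: module and comodule structure\<close>

context hopf_projection_yd
begin

section \<open>Embeddings into algebras, and the Yetter-Drinfel'd module axioms\<close>

lemma inj_onI_retract:
  assumes "\<And>t. t \<in> C \<Longrightarrow> P (E t) = t"
  shows "inj_on E C"
  by (rule inj_on_inverseI[where g = P]) (rule assms)

text \<open>The target is \<open>H \<otimes> A\<close>. Only two algebra maps with commuting images
  and a retraction are handed out, so that later computations deal with products in \<open>B\<close>
  instead of tensors.\<close>

lemma embed_HR:
  obtains B :: "('k, ('k, 'h, 'a) tensor) module" and u v E P where
    "k_algebra K B" "u \<in> algebra_hom K H B" "v \<in> algebra_hom K A B"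
    "\<forall>h\<in>carrier H. \<forall>a\<in>carrier A. v a \<otimes>\<^bsub>B\<^esub> u h = u h \<otimes>\<^bsub>B\<^esub> v a"
    "E \<in> linear_hom K (tensor_space K H R) B" "inj_on E (carrier (tensor_space K H R))"
    "\<forall>h\<in>carrier H. \<forall>r\<in>coinv. E (tens K H R h r) = u h \<otimes>\<^bsub>B\<^esub> v r"
    "P \<in> linear_hom K B (tensor_space K H R)" "\<forall>t\<in>carrier (tensor_space K H R). P (E t) = t"
proof -
  obtain E P where E: "E \<in> linear_hom K (tensor_space K H R) (tensor_algebra K H A)"
    "P \<in> linear_hom K (tensor_algebra K H A) (tensor_space K H R)"
    "\<And>t. t \<in> carrier (tensor_space K H R) \<Longrightarrow> P (E t) = t"
    "\<And>v w. \<lbrakk>v \<in> carrier H; w \<in> carrier R\<rbrakk>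
      \<Longrightarrow> E (tens K H R v w) = inl K H A v \<otimes>\<^bsub>tensor_algebra K H A\<^esub> inr K H A w"
    by (rule split_tensor[OF H.A_algebra A.A_algebra H.A_module R_module linear_id linear_id _ incl_linear proj_linear_R])
      (simp_all add: proj_coinv_id)
  show ?thesis
    by (rule that[OF tensor_k_algebra[OF H.A_algebra A.A_algebra] inl_algebra_hom[OF H.A_algebra A.A_algebra]
          inr_algebra_hom[OF H.A_algebra A.A_algebra] _ E(1) inj_onI_retract[where P=P and E=E, OF E(3)] _ E(2)])
      (simp_all add: inl_inr inr_inl E(3,4))
qed

lemma embed_HHR:
  obtains B :: "('k, ('k, 'h, ('k, 'h, 'a) tensor) tensor) module" and u1 u2 v E where
    "k_algebra K B" "u1 \<in> algebra_hom K H B" "u2 \<in> algebra_hom K H B" "v \<in> algebra_hom K A B"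
    "E \<in> linear_hom K (tensor_space K H (tensor_space K H R)) B"
    "inj_on E (carrier (tensor_space K H (tensor_space K H R)))"
    "\<forall>h1\<in>carrier H. \<forall>h2\<in>carrier H. \<forall>r\<in>coinv.
      E (tens K H (tensor_space K H R) h1 (tens K H R h2 r)) = u1 h1 \<otimes>\<^bsub>B\<^esub> (u2 h2 \<otimes>\<^bsub>B\<^esub> v r)"
proof -
  obtain B1 :: "('k, ('k, 'h, 'a) tensor) module" and u v E1 P1 where 1:
    "k_algebra K B1" "u \<in> algebra_hom K H B1" "v \<in> algebra_hom K A B1"
    "\<forall>h\<in>carrier H. \<forall>a\<in>carrier A. v a \<otimes>\<^bsub>B1\<^esub> u h = u h \<otimes>\<^bsub>B1\<^esub> v a"
    "E1 \<in> linear_hom K (tensor_space K H R) B1" "inj_on E1 (carrier (tensor_space K H R))"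
    "\<forall>h\<in>carrier H. \<forall>r\<in>coinv. E1 (tens K H R h r) = u h \<otimes>\<^bsub>B1\<^esub> v r"
    "P1 \<in> linear_hom K B1 (tensor_space K H R)" "\<forall>t\<in>carrier (tensor_space K H R). P1 (E1 t) = t"
    by (rule embed_HR)
  let ?X = "tensor_space K H (tensor_space K H R)" and ?B = "tensor_algebra K H B1"
  obtain E P where E: "E \<in> linear_hom K ?X ?B"
    "P \<in> linear_hom K ?B ?X" "\<And>t. t \<in> carrier ?X \<Longrightarrow> P (E t) = t"
    "\<And>v w. \<lbrakk>v \<in> carrier H; w \<in> carrier (tensor_space K H R)\<rbrakk>
      \<Longrightarrow> E (tens K H (tensor_space K H R) v w) = inl K H B1 v \<otimes>\<^bsub>?B\<^esub> inr K H B1 (E1 w)"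
    by (rule split_tensor[OF H.A_algebra 1(1) H.A_module HR_module linear_id linear_id _ 1(5,8) bspec[OF 1(9)]]) simp_all
  note rh = inr_algebra_hom[OF H.A_algebra 1(1)]
  note cl = algebra_homD(4)[OF 1(2)] algebra_homD(4)[OF 1(3)]
  show ?thesis
    by (rule that[OF tensor_k_algebra[OF H.A_algebra 1(1)] inl_algebra_hom[OF H.A_algebra 1(1)]
          algebra_hom_comp[OF rh 1(2)] algebra_hom_comp[OF rh 1(3)] E(1) inj_onI_retract[where P=P and E=E, OF E(3)]])
      (simp_all add: E(4) 1(7) algebra_homD(3)[OF rh] cl)
qed

lemma embed_RR:
  obtains E P where "E \<in> linear_hom K (tensor_space K R R) (tensor_algebra K A A)"
    "inj_on E (carrier (tensor_space K R R))"
    "\<forall>r\<in>coinv. \<forall>s\<in>coinv. E (tens K R R r s) = inl K A A r \<otimes>\<^bsub>tensor_algebra K A A\<^esub> inr K A A s"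
    "P \<in> linear_hom K (tensor_algebra K A A) (tensor_space K R R)"
    "\<forall>t\<in>carrier (tensor_space K R R). P (E t) = t"
proof -
  obtain E P where E: "E \<in> linear_hom K (tensor_space K R R) (tensor_algebra K A A)"
    "P \<in> linear_hom K (tensor_algebra K A A) (tensor_space K R R)"
    "\<And>t. t \<in> carrier (tensor_space K R R) \<Longrightarrow> P (E t) = t"
    "\<And>v w. \<lbrakk>v \<in> carrier R; w \<in> carrier R\<rbrakk>
      \<Longrightarrow> E (tens K R R v w) = inl K A A v \<otimes>\<^bsub>tensor_algebra K A A\<^esub> inr K A A w"
    by (rule split_tensor[OF A.A_algebra A.A_algebra R_module R_module incl_linear proj_linear_R _ incl_linear proj_linear_R])
      (simp_all add: proj_coinv_id)
  show ?thesis
    by (rule that[OF E(1) inj_onI_retract[where P=P and E=E, OF E(3)] _ E(2)]) (simp_all add: E(3,4))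
qed

text \<open>Kept general in \<open>V\<close> for two uses: \<open>V = R\<close> for coassociativity
  of the coproduct and \<open>V = H\<close> for its compatibility with the coaction.\<close>

lemma embed_V_RR:
  fixes V :: "('k, 'v, 'y1) module_scheme" and BV :: "('k, 'b, 'y2) module_scheme"
  assumes V: "module K V" and BV: "k_algebra K BV"
    and EV: "EV \<in> linear_hom K V BV" and PV: "PV \<in> linear_hom K BV V" and PEV: "\<And>x. x \<in> carrier V \<Longrightarrow> PV (EV x) = x"
  obtains B :: "('k, ('k, 'b, ('k, 'a, 'a) tensor) tensor) module" and w v1 v2 E where
    "k_algebra K B" "w \<in> algebra_hom K BV B" "v1 \<in> algebra_hom K A B" "v2 \<in> algebra_hom K A B"
    "\<forall>h\<in>carrier BV. \<forall>a\<in>carrier A. v1 a \<otimes>\<^bsub>B\<^esub> w h = w h \<otimes>\<^bsub>B\<^esub> v1 a"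
    "\<forall>h\<in>carrier BV. \<forall>a\<in>carrier A. v2 a \<otimes>\<^bsub>B\<^esub> w h = w h \<otimes>\<^bsub>B\<^esub> v2 a"
    "\<forall>x\<in>carrier A. \<forall>y\<in>carrier A. v2 x \<otimes>\<^bsub>B\<^esub> v1 y = v1 y \<otimes>\<^bsub>B\<^esub> v2 x"
    "E \<in> linear_hom K (tensor_space K V (tensor_space K R R)) B"
    "inj_on E (carrier (tensor_space K V (tensor_space K R R)))"
    "\<forall>x\<in>carrier V. \<forall>r\<in>coinv. \<forall>s\<in>coinv.
      E (tens K V (tensor_space K R R) x (tens K R R r s)) = w (EV x) \<otimes>\<^bsub>B\<^esub> (v1 r \<otimes>\<^bsub>B\<^esub> v2 s)"
proof -
  obtain E1 P1 where 1: "E1 \<in> linear_hom K (tensor_space K R R) (tensor_algebra K A A)"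
    "inj_on E1 (carrier (tensor_space K R R))"
    "\<forall>r\<in>coinv. \<forall>s\<in>coinv. E1 (tens K R R r s) = inl K A A r \<otimes>\<^bsub>tensor_algebra K A A\<^esub> inr K A A s"
    "P1 \<in> linear_hom K (tensor_algebra K A A) (tensor_space K R R)"
    "\<forall>t\<in>carrier (tensor_space K R R). P1 (E1 t) = t"
    by (rule embed_RR)
  define B1 where "B1 = tensor_algebra K A A"
  have B1: "k_algebra K B1" by (simp add: B1_def)
  define v1 v2 where "v1 = inl K A A" and "v2 = inr K A A"
  have h1: "v1 \<in> algebra_hom K A B1" and h2: "v2 \<in> algebra_hom K A B1"
    unfolding v1_def v2_def B1_def by (simp_all add: inl_algebra_hom inr_algebra_hom)
  have c12: "v2 x \<otimes>\<^bsub>B1\<^esub> v1 y = v1 y \<otimes>\<^bsub>B1\<^esub> v2 x" if "x \<in> carrier A" "y \<in> carrier A" for x y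
    using that by (simp add: v1_def v2_def B1_def inl_inr inr_inl)
  let ?X = "tensor_space K V (tensor_space K R R)" and ?B = "tensor_algebra K BV B1"
  obtain E P where E: "E \<in> linear_hom K ?X ?B"
    "P \<in> linear_hom K ?B ?X" "\<And>t. t \<in> carrier ?X \<Longrightarrow> P (E t) = t"
    "\<And>v w. \<lbrakk>v \<in> carrier V; w \<in> carrier (tensor_space K R R)\<rbrakk>
      \<Longrightarrow> E (tens K V (tensor_space K R R) v w) = inl K BV B1 (EV v) \<otimes>\<^bsub>?B\<^esub> inr K BV B1 (E1 w)"
    by (rule split_tensor[OF BV B1 V RR_module EV PV PEV 1(1,4)[folded B1_def] bspec[OF 1(5)]]) simp_all
  note rh = inr_algebra_hom[OF BV B1]
  note cl = algebra_homD(4)[OF h1] algebra_homD(4)[OF h2]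
  show ?thesis
    by (rule that[OF tensor_k_algebra[OF BV B1] inl_algebra_hom[OF BV B1]
          algebra_hom_comp[OF rh h1] algebra_hom_comp[OF rh h2] _ _ _ E(1) inj_onI_retract[where P=P and E=E, OF E(3)]])
      (simp_all add: E(4) 1(3)[folded v1_def v2_def B1_def] inl_inr inr_inl BV B1 cl c12 V
        flip: algebra_homD(3)[OF rh])
qed

text \<open>On coinvariants \<open>\<delta>\<close> is the coaction seen in \<open>B\<close>, but it
  is defined on all of \<open>A\<close>. As \<open>u\<close> and \<open>v\<close> commute it is an
  algebra map there, so it can be evaluated on \<open>j h\<close> and on the adjoint action.\<close>

lemma coact_hom:
  assumes B: "k_algebra K B" and u: "u \<in> algebra_hom K H B" and v: "v \<in> algebra_hom K A B"
    and comm: "\<And>h a. \<lbrakk>h \<in> carrier H; a \<in> carrier A\<rbrakk> \<Longrightarrow> v a \<otimes>\<^bsub>B\<^esub> u h = u h \<otimes>\<^bsub>B\<^esub> v a"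
  defines "\<delta> \<equiv> conv K A B (\<lambda>a. u (\<pi> a)) v"
  shows "\<delta> \<in> algebra_hom K A B"
    and "h \<in> carrier H \<Longrightarrow> \<delta> (j h) = conv K H B u (\<lambda>h. v (j h)) h"
    and "h \<in> carrier H \<Longrightarrow> \<delta> (j (S h)) = conv K H B (\<lambda>h. v (j (S h))) (\<lambda>h. u (S h)) h"
proof -
  interpret AB: convolution K A B by (rule convolution_AI[OF B])
  interpret HB: convolution K H B by (rule convolution_HI[OF B])
  note ul = algebra_homD(1)[OF u] and vl = algebra_homD(1)[OF v]
  note l = linear_comp[OF ul \<pi>_linear] linear_comp[OF vl j_linear]
  show \<delta>: "\<delta> \<in> algebra_hom K A B"
    unfolding \<delta>_def by (rule AB.conv_algebra_hom[OF algebra_hom_comp[OF u \<pi>_algebra_hom] v]) (simp add: comm)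
  have j: "\<delta> (j h) = conv K H B u (\<lambda>h. v (j h)) h" if h: "h \<in> carrier H" for h
  proof -
    have "\<delta> (j h) = conv K H B (\<lambda>h. u (\<pi> (j h))) (\<lambda>h. v (j h)) h"
      unfolding \<delta>_def by (rule conv_precomp[OF j_hom B l(1) vl h])
    also have "conv K H B (\<lambda>h. u (\<pi> (j h))) (\<lambda>h. v (j h)) = conv K H B u (\<lambda>h. v (j h))"
      by (rule HB.conv_cong[OF linear_comp[OF l(1) j_linear] l(2)]) simp_all
    finally show ?thesis .
  qed
  then show "h \<in> carrier H \<Longrightarrow> \<delta> (j h) = conv K H B u (\<lambda>h. v (j h)) h" .
  show "h \<in> carrier H \<Longrightarrow> \<delta> (j (S h)) = conv K H B (\<lambda>h. v (j (S h))) (\<lambda>h. u (S h)) h"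
    by (rule H.antipode_conv[OF B algebra_hom_comp[OF \<delta> j_algebra_hom] u algebra_hom_comp[OF v j_algebra_hom] j])
qed

text \<open>Both sides become the convolution of \<open>u1 \<circ> \<pi>\<close>,
  \<open>u2 \<circ> \<pi>\<close> and \<open>v\<close>; the left one arises with the other
  bracketing, because \<open>\<pi>\<close> respects coproducts.\<close>

lemma R_coassoc:
  assumes m: "m \<in> coinv"
  shows "tlift K (tensor_space K H (tensor_space K H R)) (\<lambda>x m0.
        tlift K (tensor_space K H (tensor_space K H R)) (\<lambda>x1 x2.
          tens K H (tensor_space K H R) x1 (tens K H R x2 m0)) (comult H x)) (coact R m) =
      tlift K (tensor_space K H (tensor_space K H R)) (\<lambda>x n.
        tlift K (tensor_space K H (tensor_space K H R)) (\<lambda>n1 n0.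
          tens K H (tensor_space K H R) x (tens K H R n1 n0)) (coact R n)) (coact R m)"
    (is "?l = ?r")
proof -
  let ?X = "tensor_space K H (tensor_space K H R)"
  have X: "module K ?X" by simp
  obtain B :: "('k, ('k, 'h, ('k, 'h, 'a) tensor) tensor) module" and u1 u2 v E where e:
    "k_algebra K B" "u1 \<in> algebra_hom K H B" "u2 \<in> algebra_hom K H B" "v \<in> algebra_hom K A B"
    "E \<in> linear_hom K ?X B" "inj_on E (carrier ?X)"
    "\<forall>h1\<in>carrier H. \<forall>h2\<in>carrier H. \<forall>r\<in>coinv.
      E (tens K H (tensor_space K H R) h1 (tens K H R h2 r)) = u1 h1 \<otimes>\<^bsub>B\<^esub> (u2 h2 \<otimes>\<^bsub>B\<^esub> v r)"
    by (rule embed_HHR)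
  note B = e(1) and E = e(5)
  interpret AB: convolution K A B by (rule convolution_AI[OF B])
  interpret HB: convolution K H B by (rule convolution_HI[OF B])
  note l = algebra_homD(1)[OF e(2)] algebra_homD(1)[OF e(3)] algebra_homD(1)[OF e(4)]
  note cl = algebra_homD(4)[OF e(2)] algebra_homD(4)[OF e(3)] algebra_homD(4)[OF e(4)]
  note lp = linear_comp[OF l(1) \<pi>_linear] linear_comp[OF l(2) \<pi>_linear]
  have lc: "?l \<in> carrier ?X" "?r \<in> carrier ?X"
    by (intro coact_tlift_closed comultH_tlift_closed m X; simp)+
  have "E ?l = conv K A B (\<lambda>a. conv K H B u1 u2 (\<pi> a)) v m"
  proof (rule embed_coact[OF B X E m HB.conv_linear[OF l(1,2)] l(3)])
    fix x s assume xs: "x \<in> carrier H" "s \<in> coinv"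
    have "E (tlift K ?X (\<lambda>x1 x2. tens K H (tensor_space K H R) x1 (tens K H R x2 s)) (comult H x))
      = conv K H B u1 (\<lambda>x2. u2 x2 \<otimes>\<^bsub>B\<^esub> v s) x"
      by (rule HB.embed_comult[OF X E xs(1)]) (use xs in \<open>simp_all add: e(7)\<close>)
    also have "\<dots> = conv K H B u1 u2 x \<otimes>\<^bsub>B\<^esub> v s"
      by (rule HB.conv_right[OF l(1,2) _ xs(1)]) (use xs cl in simp)
    finally show "E (tlift K ?X (\<lambda>x1 x2. tens K H (tensor_space K H R) x1 (tens K H R x2 s)) (comult H x))
      = conv K H B u1 u2 x \<otimes>\<^bsub>B\<^esub> v s" .
    show "tlift K ?X (\<lambda>x1 x2. tens K H (tensor_space K H R) x1 (tens K H R x2 s)) (comult H x) \<in> carrier ?X"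
      using xs by (intro comultH_tlift_closed X) simp_all
  qed
  also have "conv K A B (\<lambda>a. conv K H B u1 u2 (\<pi> a)) v = conv K A B (conv K A B (\<lambda>a. u1 (\<pi> a)) (\<lambda>a. u2 (\<pi> a))) v"
    by (rule AB.conv_cong[OF linear_comp[OF HB.conv_linear[OF l(1,2)] \<pi>_linear] l(3)])
      (simp_all add: conv_precomp[OF \<pi>_hom B l(1,2)])
  also have "\<dots> = conv K A B (\<lambda>a. u1 (\<pi> a)) (conv K A B (\<lambda>a. u2 (\<pi> a)) v)"
    by (rule AB.conv_assoc[OF lp l(3)])
  finally have 1: "E ?l = conv K A B (\<lambda>a. u1 (\<pi> a)) (conv K A B (\<lambda>a. u2 (\<pi> a)) v) m" .
  have 2: "E ?r = conv K A B (\<lambda>a. u1 (\<pi> a)) (conv K A B (\<lambda>a. u2 (\<pi> a)) v) m"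
  proof (rule embed_coact[OF B X E m l(1) AB.conv_linear[OF lp(2) l(3)]])
    fix x s assume xs: "x \<in> carrier H" "s \<in> coinv"
    have "E (tlift K ?X (\<lambda>n1 n0. tens K H (tensor_space K H R) x (tens K H R n1 n0)) (coact R s))
      = conv K A B (\<lambda>a. u1 x \<otimes>\<^bsub>B\<^esub> u2 (\<pi> a)) v s"
      by (rule embed_coact[OF B X E xs(2) linear_mult_right[OF B l(2) cl(1)[OF xs(1)]] l(3)])
        (use xs cl in \<open>simp_all add: e(7) AB.B.m_assoc\<close>)
    also have "\<dots> = u1 x \<otimes>\<^bsub>B\<^esub> conv K A B (\<lambda>a. u2 (\<pi> a)) v s"
      by (rule AB.conv_left[OF lp(2) l(3)]) (use xs cl in simp_all)
    finally show "E (tlift K ?X (\<lambda>n1 n0. tens K H (tensor_space K H R) x (tens K H R n1 n0)) (coact R s))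
      = u1 x \<otimes>\<^bsub>B\<^esub> conv K A B (\<lambda>a. u2 (\<pi> a)) v s" .
    show "tlift K ?X (\<lambda>n1 n0. tens K H (tensor_space K H R) x (tens K H R n1 n0)) (coact R s) \<in> carrier ?X"
      using xs by (intro coact_tlift_closed X) simp_all
  qed
  show ?thesis using inj_onD[OF e(6) _ lc] 1 2 by simp
qed

text \<open>On the right side the algebra map \<open>\<delta>\<close> turns the adjoint action into
  the factors \<open>u\<close>, \<open>v \<circ> j\<close>, \<open>\<delta> m\<close>,
  \<open>v \<circ> j \<circ> S\<close> and \<open>u \<circ> S\<close>; the last cancels against the
  extra \<open>u\<close>. What remains is the left side.\<close>

lemma R_yd_compat:
  assumes h: "h \<in> carrier H" and m: "m \<in> coinv"
  shows "tlift K (tensor_space K H R) (\<lambda>h1 h2.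
        tlift K (tensor_space K H R) (\<lambda>m1 m0.
          tens K H R (h1 \<otimes>\<^bsub>H\<^esub> m1) (act R h2 m0)) (coact R m)) (comult H h) =
      tlift K (tensor_space K H R) (\<lambda>h1 h2.
        tlift K (tensor_space K H R) (\<lambda>n1 n0.
          tens K H R (n1 \<otimes>\<^bsub>H\<^esub> h2) n0) (coact R (act R h1 m))) (comult H h)"
    (is "?l = ?r")
proof -
  let ?X = "tensor_space K H R"
  note X = HR_module
  have mc: "m \<in> carrier A" using m by simp
  obtain B :: "('k, ('k, 'h, 'a) tensor) module" and u v E P where e:
    "k_algebra K B" "u \<in> algebra_hom K H B" "v \<in> algebra_hom K A B"
    "\<forall>h\<in>carrier H. \<forall>a\<in>carrier A. v a \<otimes>\<^bsub>B\<^esub> u h = u h \<otimes>\<^bsub>B\<^esub> v a"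
    "E \<in> linear_hom K ?X B" "inj_on E (carrier ?X)"
    "\<forall>h\<in>carrier H. \<forall>r\<in>coinv. E (tens K H R h r) = u h \<otimes>\<^bsub>B\<^esub> v r"
    "P \<in> linear_hom K B ?X" "\<forall>t\<in>carrier ?X. P (E t) = t"
    by (rule embed_HR)
  note B = e(1) and E = e(5)
  interpret AB: convolution K A B by (rule convolution_AI[OF B])
  interpret HB: convolution K H B by (rule convolution_HI[OF B])
  note ul = algebra_homD(1)[OF e(2)] and vl = algebra_homD(1)[OF e(3)]
  note u = algebra_homD(3,4)[OF e(2)] and v = algebra_homD(3,4)[OF e(3)]
  define \<delta> where "\<delta> = conv K A B (\<lambda>a. u (\<pi> a)) v"
  note \<delta> = coact_hom[OF e(1-3) e(4)[rule_format], folded \<delta>_def]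
  note \<delta>l = algebra_homD(1)[OF \<delta>(1)]
  have c: "\<delta> m \<in> carrier B" by (rule linear_closed[OF \<delta>l mc])
  note u\<pi> = linear_comp[OF ul \<pi>_linear] and vj = linear_comp[OF vl j_linear] and vjS = linear_comp[OF vl jS_linear]
    and uS = linear_comp[OF ul H.antipode_linear]
    and \<delta>j = linear_comp[OF \<delta>l j_linear] and \<delta>jS = linear_comp[OF \<delta>l jS_linear]
  note cu = HB.cunit_linear[OF c]
  let ?G = "conv K H B (\<lambda>h. v (j h)) (conv K H B (cunit K H B (\<delta> m)) (\<lambda>h. v (j (S h))))"
  have G: "?G \<in> linear_hom K H B" by (rule HB.conv_linear[OF vj HB.conv_linear[OF cu vjS]])
  have lc: "?l \<in> carrier ?X" "?r \<in> carrier ?X"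
    using h m by (intro coact_tlift_closed comultH_tlift_closed X; simp add: ad_coinv)+
  have 1: "E ?l = conv K H B u ?G h"
  proof (rule HB.embed_comult[OF X E h])
    fix h1 h2 assume hh: "h1 \<in> carrier H" "h2 \<in> carrier H"
    show "tlift K ?X (\<lambda>m1 m0. tens K H R (h1 \<otimes>\<^bsub>H\<^esub> m1) (act R h2 m0)) (coact R m) \<in> carrier ?X"
      using hh m by (intro coact_tlift_closed X) (simp_all add: ad_coinv)
    \<comment> \<open>Conjugation by the legs of \<open>h2\<close> in the factor \<open>A\<close>.
      It passes the factor from \<open>H\<close>, so as a linear map it can be taken out of the sum
      over the coaction of \<open>m\<close>.\<close>
    define M where "M = (\<lambda>b. conv K H B (\<lambda>h. v (j h)) (conv K H B (cunit K H B b) (\<lambda>h. v (j (S h)))) h2)"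
    have M: "M \<in> linear_hom K B B" unfolding M_def by (rule HB.conv_cunit_linear[OF vj vjS hh(2)])
    have Mu: "M (u x \<otimes>\<^bsub>B\<^esub> v a) = u x \<otimes>\<^bsub>B\<^esub> v (ad h2 a)" if xa: "x \<in> carrier H" "a \<in> carrier A" for x a
    proof -
      have L: "(\<lambda>b. u x \<otimes>\<^bsub>B\<^esub> b) \<in> linear_hom K B B" by (rule linear_mult_right[OF B linear_id u(2)[OF xa(1)]])
      have xv: "v b \<otimes>\<^bsub>B\<^esub> (u x \<otimes>\<^bsub>B\<^esub> w) = u x \<otimes>\<^bsub>B\<^esub> (v b \<otimes>\<^bsub>B\<^esub> w)" if "b \<in> carrier A" "w \<in> carrier B" for b w
        using that xa u v e(4)[rule_format, OF xa(1) that(1)] by (simp add: AB.B.m_assoc[symmetric])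
      have "M (u x \<otimes>\<^bsub>B\<^esub> v a) = tlift K B (\<lambda>y1 y2. v (j y1) \<otimes>\<^bsub>B\<^esub> ((u x \<otimes>\<^bsub>B\<^esub> v a) \<otimes>\<^bsub>B\<^esub> v (j (S y2)))) (comult H h2)"
        unfolding M_def by (rule HB.conv_cunit_mid[OF vj vjS _ hh(2)]) (use xa u v in simp)
      also have "\<dots> = u x \<otimes>\<^bsub>B\<^esub> tlift K B (\<lambda>y1 y2. v (j y1) \<otimes>\<^bsub>B\<^esub> (v a \<otimes>\<^bsub>B\<^esub> v (j (S y2)))) (comult H h2)"
        by (rule HB.embed_tlift[OF HB.B_module H.A_module H.A_module L H.comult_closed[OF hh(2)], symmetric])
          (use xa u v in \<open>simp_all add: xv AB.B.m_assoc\<close>)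
      also have "\<dots> = u x \<otimes>\<^bsub>B\<^esub> v (ad h2 a)"
        using xa hh v by (simp add: hom_ad[OF B e(3)] HB.conv_cunit_mid[OF vj vjS])
      finally show ?thesis .
    qed
    have "E (tlift K ?X (\<lambda>m1 m0. tens K H R (h1 \<otimes>\<^bsub>H\<^esub> m1) (act R h2 m0)) (coact R m))
      = conv K A B (\<lambda>a. u h1 \<otimes>\<^bsub>B\<^esub> u (\<pi> a)) (\<lambda>a. v (ad h2 a)) m"
      by (rule embed_coact[OF B X E m linear_mult_right[OF B ul u(2)[OF hh(1)]] linear_comp[OF vl ad_linear[OF hh(2)]]])
        (use hh in \<open>simp_all add: e(7) ad_coinv u\<close>)
    also have "\<dots> = u h1 \<otimes>\<^bsub>B\<^esub> conv K A B (\<lambda>a. u (\<pi> a)) (\<lambda>a. v (ad h2 a)) m"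
      by (rule AB.conv_left[OF u\<pi> linear_comp[OF vl ad_linear[OF hh(2)]] u(2)[OF hh(1)] mc])
    also have "conv K A B (\<lambda>a. u (\<pi> a)) (\<lambda>a. v (ad h2 a)) m = M (conv K A B (\<lambda>a. u (\<pi> a)) v m)"
      unfolding AB.conv_apply[OF mc]
      by (rule AB.embed_tlift[OF AB.B_module A.A_module A.A_module M A.comult_closed[OF mc], symmetric])
        (simp_all add: Mu u v)
    finally show "E (tlift K ?X (\<lambda>m1 m0. tens K H R (h1 \<otimes>\<^bsub>H\<^esub> m1) (act R h2 m0)) (coact R m))
      = u h1 \<otimes>\<^bsub>B\<^esub> ?G h2" by (simp only: M_def \<delta>_def)
  qed
  have 2: "E ?r = conv K H B (conv K H B (\<lambda>h. \<delta> (j h)) (conv K H B (cunit K H B (\<delta> m)) (\<lambda>h. \<delta> (j (S h))))) u h"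
  proof (rule HB.embed_comult[OF X E h])
    fix h1 h2 assume hh: "h1 \<in> carrier H" "h2 \<in> carrier H"
    have adm: "ad h1 m \<in> coinv" by (rule ad_coinv[OF hh(1) m])
    show "tlift K ?X (\<lambda>n1 n0. tens K H R (n1 \<otimes>\<^bsub>H\<^esub> h2) n0) (coact R (act R h1 m)) \<in> carrier ?X"
      using hh m by (intro coact_tlift_closed X) (simp_all add: adm)
    have uv: "u n1 \<otimes>\<^bsub>B\<^esub> u h2 \<otimes>\<^bsub>B\<^esub> v n0 = u n1 \<otimes>\<^bsub>B\<^esub> (v n0 \<otimes>\<^bsub>B\<^esub> u h2)" if "n1 \<in> carrier H" "n0 \<in> carrier A" for n1 n0
      using that hh u v e(4) by (simp add: AB.B.m_assoc)
    have "E (tlift K ?X (\<lambda>n1 n0. tens K H R (n1 \<otimes>\<^bsub>H\<^esub> h2) n0) (coact R (act R h1 m)))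
      = conv K A B (\<lambda>a. u (\<pi> a)) (\<lambda>a. v a \<otimes>\<^bsub>B\<^esub> u h2) (act R h1 m)"
      by (rule embed_coact[OF B X E _ ul linear_mult_left[OF B vl u(2)[OF hh(2)]]])
        (use hh m in \<open>simp_all add: e(7) adm u uv\<close>)
    also have "\<dots> = \<delta> (act R h1 m) \<otimes>\<^bsub>B\<^esub> u h2"
      unfolding \<delta>_def by (rule AB.conv_right[OF u\<pi> vl u(2)[OF hh(2)]]) (use hh m adm in simp)
    finally show "E (tlift K ?X (\<lambda>n1 n0. tens K H R (n1 \<otimes>\<^bsub>H\<^esub> h2) n0) (coact R (act R h1 m)))
      = conv K H B (\<lambda>h. \<delta> (j h)) (conv K H B (cunit K H B (\<delta> m)) (\<lambda>h. \<delta> (j (S h)))) h1 \<otimes>\<^bsub>B\<^esub> u h2"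
      by (simp only: R_act[OF hh(1) m] hom_ad[OF B \<delta>(1) hh(1) mc])
  qed
  have q: "conv K H B (cunit K H B (\<delta> m)) (\<lambda>h. \<delta> (j (S h)))
    = conv K H B (cunit K H B (\<delta> m)) (conv K H B (\<lambda>h. v (j (S h))) (\<lambda>h. u (S h)))"
    by (rule HB.conv_cong[OF cu \<delta>jS]) (simp_all only: \<delta>(3))
  have q2: "conv K H B (\<lambda>h. \<delta> (j h)) (conv K H B (cunit K H B (\<delta> m)) (\<lambda>h. \<delta> (j (S h))))
    = conv K H B (conv K H B u (\<lambda>h. v (j h))) (conv K H B (cunit K H B (\<delta> m)) (\<lambda>h. \<delta> (j (S h))))"
    by (rule HB.conv_cong[OF \<delta>j HB.conv_linear[OF cu \<delta>jS]]) (simp_all only: \<delta>(2))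
  have "conv K H B (conv K H B (\<lambda>h. \<delta> (j h)) (conv K H B (cunit K H B (\<delta> m)) (\<lambda>h. \<delta> (j (S h))))) u
    = conv K H B u (conv K H B (\<lambda>h. v (j h)) (conv K H B (cunit K H B (\<delta> m)) (conv K H B (\<lambda>h. v (j (S h)))
        (conv K H B (\<lambda>h. u (S h)) u))))"
    unfolding q q2[unfolded q] by (simp only: HB.conv_assoc HB.conv_linear ul vj vjS uS cu)
  also have "\<dots> = conv K H B u ?G"
    by (simp only: H.antipode_hom[OF B e(2)] HB.conv_one HB.conv_restrict cu vjS)
  finally show ?thesis using inj_onD[OF e(6) _ lc] 1 2 by simp
qed

lemma R_coact_counit:
  assumes m: "m \<in> coinv"
  shows "tlift K R (\<lambda>m1 m0. counit H m1 \<odot>\<^bsub>R\<^esub> m0) (coact R m) = m"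
proof -
  have mc: "m \<in> carrier A" using m by simp
  have b: "bilinear K H A A (\<lambda>x a. counit H x \<odot>\<^bsub>A\<^esub> a)"
    by (rule bilinearI; rule linear_homI)
      (simp_all add: linear_add[OF H.counit_linear, simplified] linear_smult[OF H.counit_linear, simplified]
        A.smult_l_distr A.smult_r_distr A.smult_assoc1[symmetric] m_comm)
  have "tlift K R (\<lambda>m1 m0. counit H m1 \<odot>\<^bsub>R\<^esub> m0) (coact R m)
    = tlift K A (\<lambda>m1 m0. counit H m1 \<odot>\<^bsub>A\<^esub> m0) (coact R m)"
    using AA.embed_tlift[OF R_module H.A_module R_module incl_linear coact_closed[OF m]]
    by (simp add: coinv_smult)
  also have "\<dots> = tlift K A (\<lambda>a1 a2. counit H (\<pi> a1) \<odot>\<^bsub>A\<^esub> a2) (comult A m)"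
    by (rule coact_tlift[OF m A.A_module b])
  also have "\<dots> = tlift K A (\<lambda>a1 a2. counit A a1 \<odot>\<^bsub>A\<^esub> a2) (comult A m)"
    by (rule tlift_cong[OF A.A_module A.A_module A.A_module A.comult_closed[OF mc]]) simp_all
  finally show ?thesis using A.counit_left[OF mc] by simp
qed

lemma act_bilinear: "bilinear K H R R (act R)"
proof (rule bilinearI)
  show "(\<lambda>h. act R h r) \<in> linear_hom K H R" if "r \<in> carrier R" for r
    using that linear_add[OF ad_linear_left] linear_smult[OF ad_linear_left]
    by (intro linear_homI) (simp_all add: ad_coinv)
  show "(\<lambda>r. act R h r) \<in> linear_hom K R R" if "h \<in> carrier H" for h
    using that linear_add[OF ad_linear] linear_smult[OF ad_linear]
    by (intro linear_homI) (simp_all add: ad_coinv coinv_add coinv_smult)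
qed

lemma R_yd_module: "yd_module K H S R"
proof (intro yd_module.intro yd_module_axioms.intro H.hopf_algebra_axioms R_module)
  show "act R h \<in> linear_hom K R R" if "h \<in> carrier H" for h
    using bilinear_right[OF act_bilinear that] .
  show "(\<lambda>h. act R h m) \<in> linear_hom K H R" if "m \<in> carrier R" for m
    using bilinear_left[OF act_bilinear that] .
  show "coact R \<in> linear_hom K R (tensor_space K H R)" by (rule coact_linear_R)
  show "tlift K R (\<lambda>m1 m0. counit H m1 \<odot>\<^bsub>R\<^esub> m0) (coact R m) = m" if "m \<in> carrier R" for m
    using R_coact_counit that by simp
qed (simp_all only: R_simps R_coassoc R_yd_compat R_act ad_one_left ad_mult ad_coinv
    H.one_closed H.m_closed coinv_closed)

end

section \<open>The associated bialgebra: product and coproduct\<close>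

lemma yd_tensor_simps [simp]:
  "carrier (yd_tensor K H M N) = carrier (tensor_space K M N)"
  "add (yd_tensor K H M N) = add (tensor_space K M N)"
  "zero (yd_tensor K H M N) = zero (tensor_space K M N)"
  "smult (yd_tensor K H M N) = smult (tensor_space K M N)"
  "one (yd_tensor K H M N) = tens K M N \<one>\<^bsub>M\<^esub> \<one>\<^bsub>N\<^esub>"
  by (simp_all add: yd_tensor_def Let_def module.defs)

lemma yd_tensor_normalize [simp]:
  "linear_hom K V (yd_tensor K H M N) = linear_hom K V (tensor_space K M N)"
  "linear_hom K (yd_tensor K H M N) V = linear_hom K (tensor_space K M N) V"
  "tensor_space K V (yd_tensor K H M N) = tensor_space K V (tensor_space K M N)"
  "tens K V (yd_tensor K H M N) = tens K V (tensor_space K M N)"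
  by (rule linear_hom_cong tensor_cong; simp)+

lemma yd_tensor_act:
  "act (yd_tensor K H M N) h t = tlift K (tensor_space K M N) (\<lambda>m n. tlift K (tensor_space K M N) (\<lambda>h1 h2.
      tens K M N (act M h1 m) (act N h2 n)) (comult H h)) t"
  by (simp add: yd_tensor_def Let_def module.defs)

lemma yd_tensor_coact:
  "coact (yd_tensor K H M N) t = tlift K (tensor_space K H (tensor_space K M N)) (\<lambda>m n.
    tlift K (tensor_space K H (tensor_space K M N)) (\<lambda>m1 m0. tlift K (tensor_space K H (tensor_space K M N)) (\<lambda>n1 n0.
      tens K H (tensor_space K M N) (m1 \<otimes>\<^bsub>H\<^esub> n1) (tens K M N m0 n0)) (coact N n)) (coact M m)) t"
  by (simp add: yd_tensor_def Let_def module.defs)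

lemma yd_tensor_mult:
  "t \<otimes>\<^bsub>yd_tensor K H M N\<^esub> u = tlift K (tensor_space K M N) (\<lambda>a b. tlift K (tensor_space K M N) (\<lambda>a' b'.
      tlift K (tensor_space K M N) (\<lambda>b1 b0. tens K M N (a \<otimes>\<^bsub>M\<^esub> act M b1 a') (b0 \<otimes>\<^bsub>N\<^esub> b')) (coact N b)) u) t"
  by (simp add: yd_tensor_def Let_def module.defs)

lemma yd_unit_simps [simp]:
  "carrier (yd_unit K H) = carrier K" "mult (yd_unit K H) = mult K" "one (yd_unit K H) = one K"
  "zero (yd_unit K H) = zero K" "add (yd_unit K H) = add K" "smult (yd_unit K H) = mult K"
  "act (yd_unit K H) h c = counit H h \<otimes>\<^bsub>K\<^esub> c" "coact (yd_unit K H) c = tens K H (self_module K) \<one>\<^bsub>H\<^esub> c"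
  by (simp_all add: yd_unit_def module.defs self_module_def)

lemma yd_unit_normalize [simp]:
  "linear_hom K V (yd_unit K H) = linear_hom K V (self_module K)"
  "linear_hom K (yd_unit K H) V = linear_hom K (self_module K) V"
  "tensor_space K V (yd_unit K H) = tensor_space K V (self_module K)"
  "tens K V (yd_unit K H) = tens K V (self_module K)"
  by (rule linear_hom_cong tensor_cong; simp)+

context hopf_projection_yd
begin

section \<open>Product and unit as morphisms\<close>

lemma mult_R_bilinear: "bilinear K R R R (mult A)"
  using mult_bilinear[OF R_algebra] by simp

lemma HRR_module: "module K (tensor_space K H (tensor_space K R R))" by simp

text \<open>Moving \<open>u n1\<close> past \<open>p m0\<close> separates the codiagonal coaction
  into a product of two coactions. With \<open>p = q\<close> it serves the product of
  \<open>R\<close>, with two different maps the coproduct.\<close>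

lemma codiag_embed:
  assumes B: "k_algebra K B" and u: "u \<in> algebra_hom K H B"
    and p: "p \<in> algebra_hom K A B" and q: "q \<in> algebra_hom K A B"
    and comm: "\<And>h a. \<lbrakk>h \<in> carrier H; a \<in> carrier A\<rbrakk> \<Longrightarrow> p a \<otimes>\<^bsub>B\<^esub> u h = u h \<otimes>\<^bsub>B\<^esub> p a"
    and E: "E \<in> linear_hom K (tensor_space K H (tensor_space K R R)) B"
    and Et: "\<And>h r s. \<lbrakk>h \<in> carrier H; r \<in> coinv; s \<in> coinv\<rbrakk>
      \<Longrightarrow> E (tens K H (tensor_space K R R) h (tens K R R r s)) = u h \<otimes>\<^bsub>B\<^esub> (p r \<otimes>\<^bsub>B\<^esub> q s)"
    and m: "m \<in> coinv" and n: "n \<in> coinv"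
  shows "E (tlift K (tensor_space K H (tensor_space K R R)) (\<lambda>m1 m0. tlift K (tensor_space K H (tensor_space K R R)) (\<lambda>n1 n0.
      tens K H (tensor_space K R R) (m1 \<otimes>\<^bsub>H\<^esub> n1) (tens K R R m0 n0)) (coact R n)) (coact R m))
    = conv K A B (\<lambda>a. u (\<pi> a)) p m \<otimes>\<^bsub>B\<^esub> conv K A B (\<lambda>a. u (\<pi> a)) q n"
proof -
  let ?X = "tensor_space K H (tensor_space K R R)"
  interpret AB: convolution K A B by (rule convolution_AI[OF B])
  note ul = algebra_homD(1)[OF u] and pl = algebra_homD(1)[OF p] and ql = algebra_homD(1)[OF q]
  note cl = algebra_homD(4)[OF u] algebra_homD(4)[OF p] algebra_homD(4)[OF q]
  note u\<pi> = linear_comp[OF ul \<pi>_linear]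
  have mc: "m \<in> carrier A" and nc: "n \<in> carrier A" using m n by simp_all
  define \<delta>n where "\<delta>n = conv K A B (\<lambda>a. u (\<pi> a)) q n"
  have \<delta>n: "\<delta>n \<in> carrier B" unfolding \<delta>n_def by (rule linear_closed[OF AB.conv_linear[OF u\<pi> ql] nc])
  have "E (tlift K ?X (\<lambda>m1 m0. tlift K ?X (\<lambda>n1 n0.
      tens K H (tensor_space K R R) (m1 \<otimes>\<^bsub>H\<^esub> n1) (tens K R R m0 n0)) (coact R n)) (coact R m))
    = conv K A B (\<lambda>a. u (\<pi> a)) (\<lambda>a. p a \<otimes>\<^bsub>B\<^esub> \<delta>n) m"
  proof (rule embed_coact[OF B HRR_module E m ul linear_mult_left[OF B pl \<delta>n]])
    fix x s assume xs: "x \<in> carrier H" "s \<in> coinv"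
    then have sc: "s \<in> carrier A" by simp
    have up: "u x \<otimes>\<^bsub>B\<^esub> p s \<in> carrier B" using xs cl by simp
    have e: "u x \<otimes>\<^bsub>B\<^esub> u y \<otimes>\<^bsub>B\<^esub> (p s \<otimes>\<^bsub>B\<^esub> z) = u x \<otimes>\<^bsub>B\<^esub> p s \<otimes>\<^bsub>B\<^esub> u y \<otimes>\<^bsub>B\<^esub> z"
      if "y \<in> carrier H" "z \<in> carrier B" for y z
    proof -
      have "u x \<otimes>\<^bsub>B\<^esub> u y \<otimes>\<^bsub>B\<^esub> (p s \<otimes>\<^bsub>B\<^esub> z) = u x \<otimes>\<^bsub>B\<^esub> (u y \<otimes>\<^bsub>B\<^esub> p s) \<otimes>\<^bsub>B\<^esub> z"
        using that xs sc cl by (simp add: AB.B.m_assoc)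
      also have "\<dots> = u x \<otimes>\<^bsub>B\<^esub> p s \<otimes>\<^bsub>B\<^esub> u y \<otimes>\<^bsub>B\<^esub> z"
        unfolding comm[OF that(1) sc, symmetric] using that xs sc cl by (simp add: AB.B.m_assoc)
      finally show ?thesis .
    qed
    have "E (tlift K ?X (\<lambda>n1 n0. tens K H (tensor_space K R R) (x \<otimes>\<^bsub>H\<^esub> n1) (tens K R R s n0)) (coact R n))
      = conv K A B (\<lambda>a. u x \<otimes>\<^bsub>B\<^esub> p s \<otimes>\<^bsub>B\<^esub> u (\<pi> a)) q n"
      by (rule embed_coact[OF B HRR_module E n linear_mult_right[OF B ul up] ql])
        (use xs cl in \<open>simp_all add: Et algebra_homD(3)[OF u] e\<close>)
    also have "\<dots> = u x \<otimes>\<^bsub>B\<^esub> p s \<otimes>\<^bsub>B\<^esub> \<delta>n"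
      unfolding \<delta>n_def by (rule AB.conv_left[OF u\<pi> ql up nc])
    also have "\<dots> = u x \<otimes>\<^bsub>B\<^esub> (p s \<otimes>\<^bsub>B\<^esub> \<delta>n)" using xs sc cl \<delta>n by (simp add: AB.B.m_assoc)
    finally show "E (tlift K ?X (\<lambda>n1 n0. tens K H (tensor_space K R R) (x \<otimes>\<^bsub>H\<^esub> n1) (tens K R R s n0)) (coact R n))
      = u x \<otimes>\<^bsub>B\<^esub> (p s \<otimes>\<^bsub>B\<^esub> \<delta>n)" .
    show "tlift K ?X (\<lambda>n1 n0. tens K H (tensor_space K R R) (x \<otimes>\<^bsub>H\<^esub> n1) (tens K R R s n0)) (coact R n) \<in> carrier ?X"
      using xs n by (intro coact_tlift_closed HRR_module) simp_all
  qed
  also have "\<dots> = conv K A B (\<lambda>a. u (\<pi> a)) p m \<otimes>\<^bsub>B\<^esub> \<delta>n" by (rule AB.conv_right[OF u\<pi> pl \<delta>n mc])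
  finally show ?thesis unfolding \<delta>n_def .
qed

lemma codiag_closed:
  "\<lbrakk>m \<in> coinv; n \<in> coinv\<rbrakk> \<Longrightarrow> tlift K (tensor_space K H (tensor_space K R R)) (\<lambda>m1 m0. tlift K (tensor_space K H (tensor_space K R R)) (\<lambda>n1 n0.
      tens K H (tensor_space K R R) (m1 \<otimes>\<^bsub>H\<^esub> n1) (tens K R R m0 n0)) (coact R n)) (coact R m)
    \<in> carrier (tensor_space K H (tensor_space K R R))"
  by (intro coact_tlift_closed HRR_module) simp_all

lemma embed_coact_self:
  assumes B: "k_algebra K B" and u: "u \<in> linear_hom K H B" and v: "v \<in> linear_hom K A B"
    and E: "E \<in> linear_hom K (tensor_space K H R) B"
    and Et: "\<forall>h\<in>carrier H. \<forall>r\<in>coinv. E (tens K H R h r) = u h \<otimes>\<^bsub>B\<^esub> v r" and r: "r \<in> coinv"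
  shows "E (coact R r) = conv K A B (\<lambda>a. u (\<pi> a)) v r"
  using embed_coact[OF B HR_module E r u v, of "tens K H R"] Et
    tlift_self[OF H.A_module R_module coact_closed[OF r]] by simp

text \<open>For the action this is \<open>ad_prod\<close>. For the coaction it is multiplicativity
  of the map in \<open>coact_hom\<close>, once \<open>codiag_embed\<close> has separated the
  factors.\<close>

lemma R_mult_yd_hom: "tlift K R (mult R) \<in> yd_hom K H (yd_tensor K H R R) R"
proof -
  let ?M = "tlift K R (mult A)" and ?T = "tensor_space K R R"
  let ?HT = "tensor_space K H ?T" and ?HR = "tensor_space K H R"
  have M: "?M \<in> linear_hom K ?T R" by (rule tlift_linear[OF R_module R_module R_module mult_R_bilinear])
  have Mt: "?M (tens K R R r s) = r \<otimes>\<^bsub>A\<^esub> s" if "r \<in> coinv" "s \<in> coinv" for r s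
    using tlift_tens[OF R_module R_module R_module mult_R_bilinear] that by simp
  have MA: "?M \<in> linear_hom K ?T A" by (rule linear_comp[OF incl_linear M])
  have act: "?M (act (yd_tensor K H R R) h t) = act R h (?M t)"
    if h: "h \<in> carrier H" and t: "t \<in> carrier ?T" for h t
  proof -
    have cl: "tlift K ?T (\<lambda>h1 h2. tens K R R (act R h1 m) (act R h2 n)) (comult H h) \<in> carrier ?T"
      if "m \<in> coinv" "n \<in> coinv" for m n
      using that h by (intro comultH_tlift_closed RR_module) (simp_all add: ad_coinv)
    have e: "?M (tlift K ?T (\<lambda>h1 h2. tens K R R (act R h1 m) (act R h2 n)) (comult H h)) = act R h (m \<otimes>\<^bsub>A\<^esub> n)"
      if mn: "m \<in> coinv" "n \<in> coinv" for m n
    proof -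
      have "?M (tlift K ?T (\<lambda>h1 h2. tens K R R (act R h1 m) (act R h2 n)) (comult H h))
        = conv K H A (\<lambda>h. ad h m) (\<lambda>h. ad h n) h"
        by (rule HA.embed_comult[OF RR_module MA h]) (use mn in \<open>simp_all add: ad_coinv Mt\<close>)
      then show ?thesis using h mn by (simp add: ad_prod coinv_mult)
    qed
    have "?M (act (yd_tensor K H R R) h t) = tlift K R (\<lambda>m n. act R h (m \<otimes>\<^bsub>A\<^esub> n)) t"
      unfolding yd_tensor_act
      by (subst linear_tlift[OF R_module R_module RR_module R_module M t])
        (use h in \<open>auto intro!: tlift_cong[OF R_module R_module R_module t] simp: cl e ad_coinv coinv_mult\<close>)
    also have "\<dots> = act R h (?M t)"
      using linear_tlift[OF R_module R_module R_module R_module bilinear_right[OF act_bilinear h] t, of "mult A"]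
      by (simp add: coinv_mult)
    finally show ?thesis .
  qed
  have coact: "coact R (?M t) = tlift K ?HR (\<lambda>m1 m0. tens K H R m1 (?M m0)) (coact (yd_tensor K H R R) t)"
    if t: "t \<in> carrier ?T" for t
  proof -
    define C where "C = (\<lambda>m n. tlift K ?HT (\<lambda>m1 m0. tlift K ?HT (\<lambda>n1 n0.
      tens K H ?T (m1 \<otimes>\<^bsub>H\<^esub> n1) (tens K R R m0 n0)) (coact R n)) (coact R m))"
    have C: "C m n \<in> carrier ?HT" if "m \<in> coinv" "n \<in> coinv" for m n
      unfolding C_def using that by (rule codiag_closed)
    have bL: "bilinear K H ?T ?HR (\<lambda>m1 m0. tens K H R m1 (?M m0))"
      by (rule bilinear_tens[OF H.A_module R_module linear_id M])
    define L where "L = tlift K ?HR (\<lambda>m1 m0. tens K H R m1 (?M m0))"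
    have L: "L \<in> linear_hom K ?HT ?HR"
      unfolding L_def by (rule tlift_linear[OF H.A_module RR_module HR_module bL])
    have Lt: "L (tens K H ?T x w) = tens K H R x (?M w)" if "x \<in> carrier H" "w \<in> carrier ?T" for x w
      unfolding L_def by (rule tlift_tens[OF H.A_module RR_module HR_module bL that])
    have LC: "L (C m n) = coact R (m \<otimes>\<^bsub>A\<^esub> n)" if mn: "m \<in> coinv" "n \<in> coinv" for m n
    proof -
      obtain B :: "('k, ('k, 'h, 'a) tensor) module" and u v E P where e:
        "k_algebra K B" "u \<in> algebra_hom K H B" "v \<in> algebra_hom K A B"
        "\<forall>h\<in>carrier H. \<forall>a\<in>carrier A. v a \<otimes>\<^bsub>B\<^esub> u h = u h \<otimes>\<^bsub>B\<^esub> v a"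
        "E \<in> linear_hom K ?HR B" "inj_on E (carrier ?HR)"
        "\<forall>h\<in>carrier H. \<forall>r\<in>coinv. E (tens K H R h r) = u h \<otimes>\<^bsub>B\<^esub> v r"
        "P \<in> linear_hom K B ?HR" "\<forall>t\<in>carrier ?HR. P (E t) = t"
        by (rule embed_HR)
      note ul = algebra_homD(1)[OF e(2)] and vl = algebra_homD(1)[OF e(3)]
      have \<delta>: "conv K A B (\<lambda>a. u (\<pi> a)) v \<in> algebra_hom K A B"
        by (rule coact_hom(1)[OF e(1-3) e(4)[rule_format]])
      have "E (L (C m n)) = conv K A B (\<lambda>a. u (\<pi> a)) v m \<otimes>\<^bsub>B\<^esub> conv K A B (\<lambda>a. u (\<pi> a)) v n"
        unfolding C_def
        by (rule codiag_embed[OF e(1-3,3) e(4)[rule_format] linear_comp[OF e(5) L] _ mn])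
          (simp_all add: Lt Mt e(7) coinv_mult algebra_homD(3)[OF e(3)])
      also have "\<dots> = conv K A B (\<lambda>a. u (\<pi> a)) v (m \<otimes>\<^bsub>A\<^esub> n)"
        using mn by (simp add: algebra_homD(3)[OF \<delta>])
      also have "\<dots> = E (coact R (m \<otimes>\<^bsub>A\<^esub> n))"
        by (rule embed_coact_self[OF e(1) ul vl e(5,7), symmetric]) (use mn in \<open>simp add: coinv_mult\<close>)
      finally show ?thesis
        using inj_onD[OF e(6)] linear_closed[OF L C[OF mn]] coact_closed[of "m \<otimes>\<^bsub>A\<^esub> n"] mn
        by (simp add: coinv_mult)
    qed
    have "coact R (?M t) = tlift K ?HR (\<lambda>m n. coact R (m \<otimes>\<^bsub>A\<^esub> n)) t"
      using linear_tlift[OF R_module R_module R_module HR_module coact_linear_R t, of "mult A"]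
      by (simp add: coinv_mult)
    also have "\<dots> = tlift K ?HR (\<lambda>m n. L (C m n)) t"
      by (rule tlift_cong[OF R_module R_module HR_module t]) (simp_all add: LC coinv_mult)
    also have "\<dots> = L (coact (yd_tensor K H R R) t)"
      unfolding yd_tensor_coact C_def[symmetric]
      by (rule linear_tlift[OF R_module R_module HRR_module HR_module L t, symmetric]) (simp add: C)
    finally show ?thesis unfolding L_def .
  qed
  show ?thesis using M act coact by (simp add: yd_hom_def)
qed

lemma coact_one: "coact R \<one>\<^bsub>A\<^esub> = tens K H R \<one>\<^bsub>H\<^esub> \<one>\<^bsub>A\<^esub>"
proof -
  obtain B :: "('k, ('k, 'h, 'a) tensor) module" and u v E P where e:
    "k_algebra K B" "u \<in> algebra_hom K H B" "v \<in> algebra_hom K A B"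
    "\<forall>h\<in>carrier H. \<forall>a\<in>carrier A. v a \<otimes>\<^bsub>B\<^esub> u h = u h \<otimes>\<^bsub>B\<^esub> v a"
    "E \<in> linear_hom K (tensor_space K H R) B" "inj_on E (carrier (tensor_space K H R))"
    "\<forall>h\<in>carrier H. \<forall>r\<in>coinv. E (tens K H R h r) = u h \<otimes>\<^bsub>B\<^esub> v r"
    "P \<in> linear_hom K B (tensor_space K H R)" "\<forall>t\<in>carrier (tensor_space K H R). P (E t) = t"
    by (rule embed_HR)
  interpret AB: convolution K A B by (rule convolution_AI[OF e(1)])
  have \<delta>: "conv K A B (\<lambda>a. u (\<pi> a)) v \<in> algebra_hom K A B"
    by (rule coact_hom(1)[OF e(1-3) e(4)[rule_format]])
  have "E (coact R \<one>\<^bsub>A\<^esub>) = \<one>\<^bsub>B\<^esub>"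
    unfolding embed_coact_self[OF e(1) algebra_homD(1)[OF e(2)] algebra_homD(1)[OF e(3)] e(5,7) coinv_one]
    by (rule algebra_homD(2)[OF \<delta>])
  also have "\<dots> = E (tens K H R \<one>\<^bsub>H\<^esub> \<one>\<^bsub>A\<^esub>)"
    using e(7) coinv_one algebra_homD(2)[OF e(2)] algebra_homD(2)[OF e(3)] by simp
  finally show ?thesis using inj_onD[OF e(6)] coact_closed[OF coinv_one] by (simp add: coinv_one)
qed

lemma R_unit_yd_hom: "(\<lambda>c. c \<odot>\<^bsub>R\<^esub> \<one>\<^bsub>R\<^esub>) \<in> yd_hom K H (yd_unit K H) R"
proof -
  note S = module_self
  have l: "(\<lambda>c. c \<odot>\<^bsub>R\<^esub> \<one>\<^bsub>R\<^esub>) \<in> linear_hom K (self_module K) R"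
    by (rule linear_homI) (simp_all add: coinv_smult coinv_one A.smult_l_distr A.smult_assoc1)
  have b: "bilinear K H (self_module K) (tensor_space K H R) (\<lambda>m1 m0. tens K H R m1 (m0 \<odot>\<^bsub>R\<^esub> \<one>\<^bsub>R\<^esub>))"
    by (rule bilinear_tens[OF H.A_module R_module linear_id l])
  have act: "c \<in> carrier K \<Longrightarrow> h \<in> carrier H \<Longrightarrow> (counit H h \<otimes>\<^bsub>K\<^esub> c) \<odot>\<^bsub>A\<^esub> \<one>\<^bsub>A\<^esub> = ad h (c \<odot>\<^bsub>A\<^esub> \<one>\<^bsub>A\<^esub>)" for c h
    by (simp add: linear_smult[OF ad_linear] ad_unit m_comm A.smult_assoc1[symmetric])
  have co: "c \<in> carrier K \<Longrightarrow> coact R (c \<odot>\<^bsub>A\<^esub> \<one>\<^bsub>A\<^esub>) = tens K H R \<one>\<^bsub>H\<^esub> (c \<odot>\<^bsub>A\<^esub> \<one>\<^bsub>A\<^esub>)" for c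
    using linear_smult[OF coact_linear_R, of c "\<one>\<^bsub>A\<^esub>"]
      linear_smult[OF bilinear_right[OF tens_bilinear[OF H.A_module R_module] H.one_closed], of c "\<one>\<^bsub>A\<^esub>"]
    by (simp add: coact_one coinv_one)
  have tl: "c \<in> carrier K \<Longrightarrow> tlift K (tensor_space K H R) (\<lambda>m1 m0. tens K H R m1 (m0 \<odot>\<^bsub>R\<^esub> \<one>\<^bsub>R\<^esub>))
      (tens K H (self_module K) \<one>\<^bsub>H\<^esub> c) = tens K H R \<one>\<^bsub>H\<^esub> (c \<odot>\<^bsub>A\<^esub> \<one>\<^bsub>A\<^esub>)" for c
    using tlift_tens[OF H.A_module S HR_module b, of "\<one>\<^bsub>H\<^esub>" c] by simp
  show ?thesis unfolding yd_hom_def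
    using l tl by (simp add: act co coinv_smult coinv_one)
qed

lemma R_yd_algebra: "yd_algebra K H S R"
  by (intro yd_algebra.intro yd_algebra_axioms.intro R_yd_module R_algebra R_mult_yd_hom R_unit_yd_hom)

section \<open>The coalgebra axioms of R\<close>

lemma counit_one_linear: "(\<lambda>a. counit A a \<odot>\<^bsub>A\<^esub> \<one>\<^bsub>A\<^esub>) \<in> linear_hom K A A"
  using AA.cunit_linear[OF A.one_closed] by (simp add: cunit_def)

lemma counit_one_proj_linear: "(\<lambda>a. counit A (proj a) \<odot>\<^bsub>A\<^esub> \<one>\<^bsub>A\<^esub>) \<in> linear_hom K A A"
  by (rule linear_comp[OF counit_one_linear proj_linear])

lemma R_counit_left:
  assumes c: "c \<in> coinv"
  shows "tlift K R (\<lambda>c1 c2. counit A c1 \<odot>\<^bsub>A\<^esub> c2) (yd_comult R c) = c"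
proof -
  have "tlift K R (\<lambda>c1 c2. counit A c1 \<odot>\<^bsub>A\<^esub> c2) (yd_comult R c)
    = conv K A A (\<lambda>a. counit A (proj a) \<odot>\<^bsub>A\<^esub> \<one>\<^bsub>A\<^esub>) (\<lambda>a. a) c"
    by (rule embed_comultR[OF A.A_algebra R_module incl_linear c counit_one_linear linear_id])
      (simp_all add: coinv_smult A.smult_mult_left)
  also have "conv K A A (\<lambda>a. counit A (proj a) \<odot>\<^bsub>A\<^esub> \<one>\<^bsub>A\<^esub>) (\<lambda>a. a) = conv K A A (cunit K A A \<one>\<^bsub>A\<^esub>) (\<lambda>a. a)"
    by (rule AA.conv_cong[OF counit_one_proj_linear linear_id]) (simp_all add: cunit_def counit_proj)
  finally show ?thesis using c by (simp add: AA.conv_one linear_id)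
qed

lemma R_counit_right:
  assumes c: "c \<in> coinv"
  shows "tlift K R (\<lambda>c1 c2. counit A c2 \<odot>\<^bsub>A\<^esub> c1) (yd_comult R c) = c"
proof -
  have "tlift K R (\<lambda>c1 c2. counit A c2 \<odot>\<^bsub>A\<^esub> c1) (yd_comult R c)
    = conv K A A (\<lambda>a. proj a) (\<lambda>a. counit A a \<odot>\<^bsub>A\<^esub> \<one>\<^bsub>A\<^esub>) c"
    by (rule embed_comultR[OF A.A_algebra R_module incl_linear c linear_id counit_one_linear])
      (simp_all add: coinv_smult A.smult_mult_right)
  also have "conv K A A (\<lambda>a. proj a) (\<lambda>a. counit A a \<odot>\<^bsub>A\<^esub> \<one>\<^bsub>A\<^esub>) = conv K A A proj (cunit K A A \<one>\<^bsub>A\<^esub>)"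
    by (rule AA.conv_cong[OF proj_linear counit_one_linear]) (simp_all add: cunit_def)
  finally show ?thesis using c by (simp add: AA.conv_one proj_linear proj_coinv_id)
qed

text \<open>The left side contains the coproduct of \<open>proj a\<close>;
  \<open>proj_comult\<close> replaces it by the projected legs of \<open>a\<close>, and both sides
  are one triple convolution.\<close>

lemma R_comult_coassoc:
  assumes c: "c \<in> coinv"
  shows "tlift K (tensor_space K R (tensor_space K R R)) (\<lambda>x c3.
        tlift K (tensor_space K R (tensor_space K R R)) (\<lambda>c1 c2.
          tens K R (tensor_space K R R) c1 (tens K R R c2 c3)) (yd_comult R x)) (yd_comult R c) =
      tlift K (tensor_space K R (tensor_space K R R)) (\<lambda>c1 x.
        tlift K (tensor_space K R (tensor_space K R R)) (\<lambda>c2 c3.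
          tens K R (tensor_space K R R) c1 (tens K R R c2 c3)) (yd_comult R x)) (yd_comult R c)"
    (is "?l = ?r")
proof -
  let ?X = "tensor_space K R (tensor_space K R R)"
  have X: "module K ?X" by simp
  obtain B :: "('k, ('k, 'a, ('k, 'a, 'a) tensor) tensor) module" and w v1 v2 E where e:
    "k_algebra K B" "w \<in> algebra_hom K A B" "v1 \<in> algebra_hom K A B" "v2 \<in> algebra_hom K A B"
    "\<forall>h\<in>carrier A. \<forall>a\<in>carrier A. v1 a \<otimes>\<^bsub>B\<^esub> w h = w h \<otimes>\<^bsub>B\<^esub> v1 a"
    "\<forall>h\<in>carrier A. \<forall>a\<in>carrier A. v2 a \<otimes>\<^bsub>B\<^esub> w h = w h \<otimes>\<^bsub>B\<^esub> v2 a"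
    "\<forall>x\<in>carrier A. \<forall>y\<in>carrier A. v2 x \<otimes>\<^bsub>B\<^esub> v1 y = v1 y \<otimes>\<^bsub>B\<^esub> v2 x"
    "E \<in> linear_hom K ?X B" "inj_on E (carrier ?X)"
    "\<forall>x\<in>carrier R. \<forall>r\<in>coinv. \<forall>s\<in>coinv.
      E (tens K R (tensor_space K R R) x (tens K R R r s)) = w x \<otimes>\<^bsub>B\<^esub> (v1 r \<otimes>\<^bsub>B\<^esub> v2 s)"
    by (rule embed_V_RR[OF R_module A.A_algebra incl_linear proj_linear_R]) (simp_all add: proj_coinv_id)
  note B = e(1) and E = e(8)
  interpret AB: convolution K A B by (rule convolution_AI[OF B])
  note l = algebra_homD(1)[OF e(2)] algebra_homD(1)[OF e(3)] algebra_homD(1)[OF e(4)]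
  note cl = algebra_homD(4)[OF e(2)] algebra_homD(4)[OF e(3)] algebra_homD(4)[OF e(4)]
  note lp = linear_comp[OF l(1) proj_linear] linear_comp[OF l(2) proj_linear]
  have lc: "?l \<in> carrier ?X" "?r \<in> carrier ?X"
    by (intro comultR_tlift_closed c X; simp)+
  have "E ?l = conv K A B (\<lambda>a. conv K A B (\<lambda>a. w (proj a)) v1 (proj a)) v2 c"
  proof (rule embed_comultR[OF B X E c AB.conv_linear[OF lp(1) l(2)] l(3)])
    fix x s assume xs: "x \<in> coinv" "s \<in> coinv"
    have v2s: "v2 s \<in> carrier B" using xs cl by simp
    have "E (tlift K ?X (\<lambda>c1 c2. tens K R (tensor_space K R R) c1 (tens K R R c2 s)) (yd_comult R x))
      = conv K A B (\<lambda>a. w (proj a)) (\<lambda>a. v1 a \<otimes>\<^bsub>B\<^esub> v2 s) x"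
      by (rule embed_comultR[OF B X E xs(1) l(1) linear_mult_left[OF B l(2) v2s]])
        (use xs e(10) in simp_all)
    also have "\<dots> = conv K A B (\<lambda>a. w (proj a)) v1 x \<otimes>\<^bsub>B\<^esub> v2 s"
      by (rule AB.conv_right[OF lp(1) l(2) v2s]) (use xs in simp)
    finally show "E (tlift K ?X (\<lambda>c1 c2. tens K R (tensor_space K R R) c1 (tens K R R c2 s)) (yd_comult R x))
      = conv K A B (\<lambda>a. w (proj a)) v1 x \<otimes>\<^bsub>B\<^esub> v2 s" .
    show "tlift K ?X (\<lambda>c1 c2. tens K R (tensor_space K R R) c1 (tens K R R c2 s)) (yd_comult R x) \<in> carrier ?X"
      using xs by (intro comultR_tlift_closed X) simp_all
  qed
  also have "conv K A B (\<lambda>a. conv K A B (\<lambda>a. w (proj a)) v1 (proj a)) v2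
    = conv K A B (conv K A B (\<lambda>a. w (proj a)) (\<lambda>a. v1 (proj a))) v2"
    by (rule AB.conv_cong[OF linear_comp[OF AB.conv_linear[OF lp(1) l(2)] proj_linear] l(3)])
      (simp_all add: AB.conv_apply proj_comult[OF AB.B_module bilinear_mult[OF B l(1,2)]])
  also have "\<dots> = conv K A B (\<lambda>a. w (proj a)) (conv K A B (\<lambda>a. v1 (proj a)) v2)"
    by (rule AB.conv_assoc[OF lp l(3)])
  finally have 1: "E ?l = conv K A B (\<lambda>a. w (proj a)) (conv K A B (\<lambda>a. v1 (proj a)) v2) c" .
  have 2: "E ?r = conv K A B (\<lambda>a. w (proj a)) (conv K A B (\<lambda>a. v1 (proj a)) v2) c"
  proof (rule embed_comultR[OF B X E c l(1) AB.conv_linear[OF lp(2) l(3)]])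
    fix x s assume xs: "x \<in> coinv" "s \<in> coinv"
    have wx: "w x \<in> carrier B" using xs cl by simp
    have "E (tlift K ?X (\<lambda>c2 c3. tens K R (tensor_space K R R) x (tens K R R c2 c3)) (yd_comult R s))
      = conv K A B (\<lambda>a. w x \<otimes>\<^bsub>B\<^esub> v1 (proj a)) v2 s"
      by (rule embed_comultR[OF B X E xs(2) linear_mult_right[OF B l(2) wx] l(3)])
        (use xs cl e(10) in \<open>simp_all add: AB.B.m_assoc\<close>)
    also have "\<dots> = w x \<otimes>\<^bsub>B\<^esub> conv K A B (\<lambda>a. v1 (proj a)) v2 s"
      by (rule AB.conv_left[OF lp(2) l(3) wx]) (use xs in simp)
    finally show "E (tlift K ?X (\<lambda>c2 c3. tens K R (tensor_space K R R) x (tens K R R c2 c3)) (yd_comult R s))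
      = w x \<otimes>\<^bsub>B\<^esub> conv K A B (\<lambda>a. v1 (proj a)) v2 s" .
    show "tlift K ?X (\<lambda>c2 c3. tens K R (tensor_space K R R) x (tens K R R c2 c3)) (yd_comult R s) \<in> carrier ?X"
      using xs by (intro comultR_tlift_closed X) simp_all
  qed
  show ?thesis using inj_onD[OF e(9) _ lc] 1 2 by simp
qed

lemma R_coalgebra: "k_coalgebra K R (yd_comult R) (yd_counit R)"
proof (intro k_coalgebra.intro k_coalgebra_axioms.intro field_axioms R_module comultR_linear)
  show "yd_counit R \<in> linear_hom K R (self_module K)"
    using linear_from_R[OF A.counit_linear] by simp
qed (use R_comult_coassoc R_counit_left R_counit_right in simp_all)

end

lemma (in convolution) conv_cancel_left:
  assumes f: "f \<in> linear_hom K C B" and g: "g \<in> linear_hom K C B" and h: "h \<in> linear_hom K C B"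
    and fg: "conv K C B f g = cunit K C B \<one>\<^bsub>B\<^esub>"
  shows "conv K C B f (conv K C B g h) = restrict h (carrier C)"
  unfolding conv_assoc[OF f g h, symmetric] fg by (rule conv_one[OF h])

section \<open>Coproducts of adjoint actions and of products\<close>

context hopf_projection
begin

text \<open>\<open>A \<otimes> A\<close> as an algebra, under a name that the simplifier does not
  unfold; \<open>tensor_algebra_normalize\<close> would otherwise rewrite terms out of the form that
  the convolution rules expect.\<close>

definition "T2 = tensor_algebra K A A"
definition "v1 = inl K A A"
definition "v2 = inr K A A"

lemma T2_algebra: "k_algebra K T2" by (simp add: T2_def)
lemma T2_carrier: "carrier T2 = carrier (tensor_space K A A)" by (simp add: T2_def)
lemma v1_hom: "v1 \<in> algebra_hom K A T2" and v2_hom: "v2 \<in> algebra_hom K A T2"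
  by (simp_all add: T2_def v1_def v2_def inl_algebra_hom inr_algebra_hom)
lemmas v1_linear = algebra_homD(1)[OF v1_hom] and v2_linear = algebra_homD(1)[OF v2_hom]
lemma v_closed [simp]: "a \<in> carrier A \<Longrightarrow> v1 a \<in> carrier T2" "a \<in> carrier A \<Longrightarrow> v2 a \<in> carrier T2"
  by (rule linear_closed[OF v1_linear] linear_closed[OF v2_linear]; assumption)+
lemma v_tens: "\<lbrakk>x \<in> carrier A; y \<in> carrier A\<rbrakk> \<Longrightarrow> tens K A A x y = v1 x \<otimes>\<^bsub>T2\<^esub> v2 y"
  by (simp add: T2_def v1_def v2_def inl_inr)
lemma v_commute: "\<lbrakk>x \<in> carrier A; y \<in> carrier A\<rbrakk> \<Longrightarrow> v2 y \<otimes>\<^bsub>T2\<^esub> v1 x = v1 x \<otimes>\<^bsub>T2\<^esub> v2 y"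
  by (simp add: T2_def v1_def v2_def inl_inr inr_inl)

sublocale AT: convolution K A T2 by (rule convolution_AI[OF T2_algebra])
sublocale HT: convolution K H T2 by (rule convolution_HI[OF T2_algebra])

lemma comult_hom_T2: "comult A \<in> algebra_hom K A T2"
  using A.comult_hom by (simp add: T2_def)
lemmas comult_linear_T2 = algebra_homD(1)[OF comult_hom_T2]

lemma comult_v: "a \<in> carrier A \<Longrightarrow> comult A a = conv K A T2 v1 v2 a"
  by (simp only: T2_def v1_def v2_def A.comult_conv)

lemma Q_linear_T2: "Q \<in> linear_hom K T2 T2"
  using Q_linear by (simp add: T2_def)

lemma Q_v: "\<lbrakk>x \<in> carrier A; y \<in> carrier A\<rbrakk> \<Longrightarrow> Q (v1 x \<otimes>\<^bsub>T2\<^esub> v2 y) = v1 (proj x) \<otimes>\<^bsub>T2\<^esub> v2 y"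
  using Q_tens by (simp add: v_tens)

lemma Q_conv_T2:
  assumes "bialgebra K C" "F \<in> linear_hom K C T2" "G \<in> linear_hom K C H"
    "\<And>c. c \<in> carrier C \<Longrightarrow> counit H (G c) = counit C c" "c \<in> carrier C"
  shows "Q (conv K C T2 F (\<lambda>c. v1 (j (G c))) c) = Q (F c)"
  using Q_conv[OF assms(1) _ assms(3-5), of F] assms(2) by (simp add: T2_def v1_def)

lemma linear_ext_T2:
  assumes f: "f \<in> linear_hom K T2 X" and g: "g \<in> linear_hom K T2 X"
    and eq: "\<And>x y. \<lbrakk>x \<in> carrier A; y \<in> carrier A\<rbrakk> \<Longrightarrow> f (v1 x \<otimes>\<^bsub>T2\<^esub> v2 y) = g (v1 x \<otimes>\<^bsub>T2\<^esub> v2 y)"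
    and t: "t \<in> carrier T2"
  shows "f t = g t"
  by (rule linear_ext_tensor[OF A.A_module A.A_module f[unfolded T2_def tensor_algebra_normalize]
        g[unfolded T2_def tensor_algebra_normalize] _ t[unfolded T2_carrier]])
    (simp add: v_tens eq)

lemma tlift_T2_linear:
  assumes "bilinear K A A X F" "module K X"
  shows "tlift K X F \<in> linear_hom K T2 X"
  using tlift_linear[OF A.A_module A.A_module assms(2,1)] by (simp add: T2_def)

lemma tlift_T2:
  assumes "bilinear K A A X F" "module K X" "x \<in> carrier A" "y \<in> carrier A"
  shows "tlift K X F (v1 x \<otimes>\<^bsub>T2\<^esub> v2 y) = F x y"
  using tlift_tens[OF A.A_module A.A_module assms(2,1,3,4)] assms by (simp add: v_tens)

lemma comult_closed_T2: "a \<in> carrier A \<Longrightarrow> comult A a \<in> carrier T2"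
  by (simp add: T2_carrier)

lemma Q_conv_v:
  assumes C: "bialgebra K C" and f: "f \<in> linear_hom K C A" and g: "g \<in> linear_hom K C A" and c: "c \<in> carrier C"
  shows "Q (conv K C T2 (\<lambda>c. v1 (f c)) (\<lambda>c. v2 (g c)) c) = conv K C T2 (\<lambda>c. v1 (proj (f c))) (\<lambda>c. v2 (g c)) c"
proof -
  interpret CT: convolution K C T2 using C T2_algebra by (simp add: convolution_def)
  show ?thesis
    unfolding CT.conv_apply[OF c]
    by (rule CT.embed_tlift[OF AT.B_module CT.C.A_module CT.C.A_module Q_linear_T2 CT.C.comult_closed[OF c]])
      (simp_all add: Q_v linear_closed[OF f] linear_closed[OF g] AT.B.m_closed)
qed

lemma Q_comult: "a \<in> carrier A \<Longrightarrow> Q (comult A a) = conv K A T2 (\<lambda>a. v1 (proj a)) v2 a"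
  using Q_conv_v[OF A.bialgebra_axioms linear_id linear_id, of a] by (simp add: comult_v)

text \<open>The antipode reverses the legs of \<open>comult A (j (S h))\<close>, so the second leg
  closes up to \<open>ad h y\<close> and a factor \<open>v1 (j (S h))\<close> is left at the end.
  \<open>Q\<close> absorbs it, and \<open>proj_j_mult\<close> turns the first leg into the action on
  \<open>proj x\<close>.\<close>

lemma Q_comult_ad:
  assumes h: "h \<in> carrier H" and a: "a \<in> carrier A"
  shows "Q (comult A (ad h a)) = tlift K T2 (\<lambda>x y. conv K H T2 (\<lambda>h. v1 (ad h (proj x))) (\<lambda>h. v2 (ad h y)) h) (comult A a)"
proof -
  note vj = linear_comp[OF v1_linear j_linear] linear_comp[OF v2_linear j_linear]
    linear_comp[OF v1_linear jS_linear] linear_comp[OF v2_linear jS_linear]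
  note \<Delta>j = linear_comp[OF comult_linear_T2 j_linear] and \<Delta>jS = linear_comp[OF comult_linear_T2 jS_linear]
  \<comment> \<open>With \<open>comult A a\<close> replaced by a variable \<open>t\<close> both
    sides are linear in \<open>t\<close>, and the identity is checked on pure tensors.\<close>
  define N where "N = (\<lambda>t. conv K H T2 (\<lambda>h. comult A (j h)) (conv K H T2 (cunit K H T2 t) (\<lambda>h. comult A (j (S h)))) h)"
  define G where "G = (\<lambda>x y. conv K H T2 (\<lambda>h. v1 (ad h (proj x))) (\<lambda>h. v2 (ad h y)) h)"
  have N: "N \<in> linear_hom K T2 T2" unfolding N_def by (rule HT.conv_cunit_linear[OF \<Delta>j \<Delta>jS h])
  have G: "bilinear K A A T2 G"
    unfolding G_def HT.conv_apply[OF h]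
    by (rule bilinearI; rule linear_tlift_param[OF H.A_module H.A_module AT.B_module A.A_module H.comult_closed[OF h]];
      intro linear_mult_left[OF T2_algebra] linear_mult_right[OF T2_algebra] linear_comp[OF v1_linear linear_comp[OF ad_linear proj_linear]]
        linear_comp[OF v2_linear ad_linear] v_closed ad_closed proj_closed)
  have \<Delta>j_eq: "comult A (j x) = conv K H T2 (\<lambda>h. v1 (j h)) (\<lambda>h. v2 (j h)) x" if "x \<in> carrier H" for x
    using conv_precomp[OF j_hom T2_algebra v1_linear v2_linear that] that by (simp add: comult_v)
  have \<Delta>jS_eq: "comult A (j (S x)) = conv K H T2 (\<lambda>h. v2 (j (S h))) (\<lambda>h. v1 (j (S h))) x" if "x \<in> carrier H" for x
    by (rule H.antipode_conv[OF T2_algebra algebra_hom_comp[OF comult_hom_T2 j_algebra_hom]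
          algebra_hom_comp[OF v1_hom j_algebra_hom] algebra_hom_comp[OF v2_hom j_algebra_hom] \<Delta>j_eq that])
  have "Q (N t) = tlift K T2 G t" if t: "t \<in> carrier T2" for t
  proof (rule linear_ext_T2[OF linear_comp[OF Q_linear_T2 N] tlift_T2_linear[OF G AT.B_module] _ t])
    fix x y assume x: "x \<in> carrier A" and y: "y \<in> carrier A"
    let ?t = "v1 x \<otimes>\<^bsub>T2\<^esub> v2 y" and ?cx = "cunit K H T2 (v1 x)" and ?cy = "cunit K H T2 (v2 y)"
    have tc: "?t \<in> carrier T2" using x y by (simp add: AT.B.m_closed)
    note cu = HT.cunit_linear[OF tc] HT.cunit_linear[OF v_closed(1)[OF x]] HT.cunit_linear[OF v_closed(2)[OF y]]
    have q: "conv K H T2 (cunit K H T2 ?t) (\<lambda>h. comult A (j (S h)))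
      = conv K H T2 (conv K H T2 ?cx ?cy) (conv K H T2 (\<lambda>h. v2 (j (S h))) (\<lambda>h. v1 (j (S h))))"
      unfolding HT.cunit_mult[OF v_closed(1)[OF x] v_closed(2)[OF y]]
      by (rule HT.conv_cong[OF cu(1) \<Delta>jS]) (simp_all only: \<Delta>jS_eq)
    have com: "conv K H T2 (\<lambda>h. v2 (j h)) ?cx = conv K H T2 ?cx (\<lambda>h. v2 (j h))"
      by (rule HT.cunit_commute[OF vj(2) v_closed(1)[OF x]]) (simp add: v_commute x)
    have W: "conv K H T2 (\<lambda>h. v2 (j h)) (conv K H T2 ?cy (\<lambda>h. v2 (j (S h)))) = restrict (\<lambda>h. v2 (ad h y)) (carrier H)"
    proof
      show "conv K H T2 (\<lambda>h. v2 (j h)) (conv K H T2 ?cy (\<lambda>h. v2 (j (S h)))) h = restrict (\<lambda>h. v2 (ad h y)) (carrier H) h" for h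
        by (cases "h \<in> carrier H") (simp only: hom_ad[OF T2_algebra v2_hom _ y] restrict_apply', simp add: conv_def)
    qed
    have V: "conv K H T2 (\<lambda>h. v1 (j h)) ?cx = restrict (\<lambda>h. v1 (j h \<otimes>\<^bsub>A\<^esub> x)) (carrier H)"
      unfolding HT.conv_cunit_right[OF vj(1) v_closed(1)[OF x]]
      by (rule restrict_ext) (simp add: algebra_homD(3)[OF v1_hom] x)
    have V': "conv K H T2 (\<lambda>h. v1 (j h)) (conv K H T2 ?cx (\<lambda>h. v2 (ad h y)))
      = conv K H T2 (\<lambda>h. v1 (j h \<otimes>\<^bsub>A\<^esub> x)) (\<lambda>h. v2 (ad h y))"
      unfolding HT.conv_assoc[OF vj(1) cu(2) linear_comp[OF v2_linear ad_linear_left[OF y]], symmetric] V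
      by (rule HT.conv_restrict(1)[OF linear_comp[OF v1_linear linear_mult_left[OF A.A_algebra j_linear x]]
            linear_comp[OF v2_linear ad_linear_left[OF y]]])
    have "conv K H T2 (\<lambda>h. comult A (j h)) (conv K H T2 (cunit K H T2 ?t) (\<lambda>h. comult A (j (S h))))
      = conv K H T2 (conv K H T2 (\<lambda>h. v1 (j h)) (\<lambda>h. v2 (j h))) (conv K H T2 (cunit K H T2 ?t) (\<lambda>h. comult A (j (S h))))"
      by (rule HT.conv_cong[OF \<Delta>j HT.conv_linear[OF cu(1) \<Delta>jS]]) (simp_all only: \<Delta>j_eq)
    also have "\<dots> = conv K H T2 (\<lambda>h. v1 (j h)) (conv K H T2 (conv K H T2 (\<lambda>h. v2 (j h)) ?cx)
       (conv K H T2 ?cy (conv K H T2 (\<lambda>h. v2 (j (S h))) (\<lambda>h. v1 (j (S h))))))"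
      unfolding q by (simp only: HT.conv_assoc HT.conv_linear vj cu)
    also have "\<dots> = conv K H T2 (conv K H T2 (\<lambda>h. v1 (j h)) (conv K H T2 ?cx
       (conv K H T2 (\<lambda>h. v2 (j h)) (conv K H T2 ?cy (\<lambda>h. v2 (j (S h))))))) (\<lambda>h. v1 (j (S h)))"
      unfolding com by (simp only: HT.conv_assoc HT.conv_linear vj cu)
    also have "\<dots> = conv K H T2 (conv K H T2 (\<lambda>h. v1 (j h)) (conv K H T2 ?cx (\<lambda>h. v2 (ad h y)))) (\<lambda>h. v1 (j (S h)))"
      unfolding W by (simp only: HT.conv_restrict cu linear_comp[OF v2_linear ad_linear_left[OF y]])
    also have "\<dots> = conv K H T2 (conv K H T2 (\<lambda>h. v1 (j h \<otimes>\<^bsub>A\<^esub> x)) (\<lambda>h. v2 (ad h y))) (\<lambda>h. v1 (j (S h)))"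
      unfolding V' ..
    finally have "Q (N ?t) = Q (conv K H T2 (conv K H T2 (\<lambda>h. v1 (j h \<otimes>\<^bsub>A\<^esub> x)) (\<lambda>h. v2 (ad h y))) (\<lambda>h. v1 (j (S h))) h)"
      unfolding N_def by (simp only:)
    also have "\<dots> = Q (conv K H T2 (\<lambda>h. v1 (j h \<otimes>\<^bsub>A\<^esub> x)) (\<lambda>h. v2 (ad h y)) h)"
      by (rule Q_conv_T2[OF H.bialgebra_axioms HT.conv_linear[OF linear_comp[OF v1_linear linear_mult_left[OF A.A_algebra j_linear x]]
            linear_comp[OF v2_linear ad_linear_left[OF y]]] H.antipode_linear H.antipode_counit h])
    also have "\<dots> = conv K H T2 (\<lambda>h. v1 (proj (j h \<otimes>\<^bsub>A\<^esub> x))) (\<lambda>h. v2 (ad h y)) h"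
      by (rule Q_conv_v[OF H.bialgebra_axioms linear_mult_left[OF A.A_algebra j_linear x] ad_linear_left[OF y] h])
    also have "conv K H T2 (\<lambda>h. v1 (proj (j h \<otimes>\<^bsub>A\<^esub> x))) (\<lambda>h. v2 (ad h y))
      = conv K H T2 (\<lambda>h. v1 (ad h (proj x))) (\<lambda>h. v2 (ad h y))"
      by (rule HT.conv_cong[OF linear_comp[OF v1_linear linear_comp[OF proj_linear linear_mult_left[OF A.A_algebra j_linear x]]]
            linear_comp[OF v2_linear ad_linear_left[OF y]]]) (simp_all add: proj_j_mult x)
    also have "conv K H T2 (\<lambda>h. v1 (ad h (proj x))) (\<lambda>h. v2 (ad h y)) h = G x y" by (simp only: G_def)
    finally show "Q (N ?t) = tlift K T2 G ?t"
      unfolding tlift_T2[OF G AT.B_module x y] .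
  qed
  from this[OF comult_closed_T2[OF a]] show ?thesis
    unfolding N_def G_def hom_ad[OF T2_algebra comult_hom_T2 h a] .
qed

text \<open>The projection of \<open>x y\<close> is
  \<open>x\<^sub>1 proj(y) j(S(\<pi>(x\<^sub>2)))\<close>. Inserting the unit as
  \<open>j \<circ> S \<circ> \<pi>\<close> convolved with \<open>j \<circ> \<pi>\<close> after
  \<open>x\<^sub>1\<close> splits it into \<open>proj x\<^sub>1\<close> and the action of
  \<open>\<pi>(x\<^sub>2)\<close> on \<open>proj y\<close>, which is the shape of the braided
  product.\<close>

lemma Q_comult_mult:
  assumes a: "a \<in> carrier A" and b: "b \<in> carrier A"
  shows "Q (comult A (a \<otimes>\<^bsub>A\<^esub> b)) = conv K A T2 (\<lambda>a. v1 (proj a))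
    (\<lambda>x. tlift K T2 (\<lambda>y z. conv K A T2 (\<lambda>a. v1 (ad (\<pi> a) (proj y))) v2 x \<otimes>\<^bsub>T2\<^esub> v2 z) (comult A b)) a"
    (is "_ = conv K A T2 _ (\<lambda>x. ?Z x (comult A b)) a")
proof -
  note vp = linear_comp[OF v1_linear proj_linear] and vjS\<pi> = linear_comp[OF v1_linear jS\<pi>_linear]
    and vj\<pi> = linear_comp[OF v1_linear j\<pi>_linear]
  have vad: "(\<lambda>a. v1 (ad (\<pi> a) y)) \<in> linear_hom K A T2" if "y \<in> carrier A" for y
    by (rule linear_comp[OF v1_linear linear_comp[OF ad_linear_left[OF that] \<pi>_linear]])
  \<comment> \<open>\<open>W y x\<close> is the braiding of \<open>x\<close> past
    \<open>proj y\<close>, seen in \<open>T2\<close>.\<close>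
  define W where "W = (\<lambda>y x. conv K A T2 (\<lambda>a. v1 (ad (\<pi> a) (proj y))) v2 x)"
  have Wr: "W y \<in> linear_hom K A T2" if "y \<in> carrier A" for y
    unfolding W_def by (rule AT.conv_linear[OF vad v2_linear]) (simp add: that)
  have Wl: "(\<lambda>y. W y x) \<in> linear_hom K A T2" if x: "x \<in> carrier A" for x
    unfolding W_def AT.conv_apply[OF x]
    by (rule linear_tlift_param[OF A.A_module A.A_module AT.B_module A.A_module A.comult_closed[OF x]])
      (intro linear_mult_left[OF T2_algebra] linear_comp[OF v1_linear linear_comp[OF ad_linear proj_linear]] v_closed \<pi>_simps; assumption)
  note Wc = linear_closed[OF Wr]
  have F: "bilinear K A A T2 (\<lambda>y z. W y x \<otimes>\<^bsub>T2\<^esub> v2 z)" if "x \<in> carrier A" for x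
    by (rule bilinear_mult[OF T2_algebra Wl[OF that] v2_linear])
  have Zr: "(\<lambda>t. tlift K T2 (\<lambda>y z. W y x \<otimes>\<^bsub>T2\<^esub> v2 z) t) \<in> linear_hom K T2 T2" if "x \<in> carrier A" for x
    by (rule tlift_T2_linear[OF F[OF that] AT.B_module])
  have Zl: "(\<lambda>x. tlift K T2 (\<lambda>y z. W y x \<otimes>\<^bsub>T2\<^esub> v2 z) t) \<in> linear_hom K A T2" if "t \<in> carrier T2" for t
    by (rule linear_tlift_param[OF A.A_module A.A_module AT.B_module A.A_module that[unfolded T2_carrier]])
      (rule linear_mult_left[OF T2_algebra Wr v_closed(2)])
  have L: "(\<lambda>t. Q (comult A a \<otimes>\<^bsub>T2\<^esub> t)) \<in> linear_hom K T2 T2"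
    by (rule linear_comp[OF Q_linear_T2 linear_mult_right[OF T2_algebra linear_id comult_closed_T2[OF a]]])
  have R: "(\<lambda>t. conv K A T2 (\<lambda>a. v1 (proj a)) (\<lambda>x. tlift K T2 (\<lambda>y z. W y x \<otimes>\<^bsub>T2\<^esub> v2 z) t) a) \<in> linear_hom K T2 T2"
    unfolding AT.conv_apply[OF a]
    by (rule linear_tlift_param[OF A.A_module A.A_module AT.B_module AT.B_module A.comult_closed[OF a]])
      (intro linear_mult_right[OF T2_algebra] Zr v_closed proj_closed; assumption)
  have "Q (comult A a \<otimes>\<^bsub>T2\<^esub> t) = conv K A T2 (\<lambda>a. v1 (proj a)) (\<lambda>x. tlift K T2 (\<lambda>y z. W y x \<otimes>\<^bsub>T2\<^esub> v2 z) t) a"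
    if t: "t \<in> carrier T2" for t
  proof (rule linear_ext_T2[OF L R _ t])
    fix y z assume y: "y \<in> carrier A" and z: "z \<in> carrier A"
    let ?t = "v1 y \<otimes>\<^bsub>T2\<^esub> v2 z" and ?c = "cunit K A T2 (v1 (proj y))"
    have tc: "?t \<in> carrier T2" using y z by (simp add: AT.B.m_closed)
    note py = proj_closed[OF y]
    note cu = AT.cunit_linear[OF v_closed(1)[OF py]]
    have xy: "(\<lambda>x. proj (x \<otimes>\<^bsub>A\<^esub> y)) \<in> linear_hom K A A"
      by (rule linear_comp[OF proj_linear linear_mult_left[OF A.A_algebra linear_id y]])
    have m: "v1 x1 \<otimes>\<^bsub>T2\<^esub> v2 x2 \<otimes>\<^bsub>T2\<^esub> ?t = v1 (x1 \<otimes>\<^bsub>A\<^esub> y) \<otimes>\<^bsub>T2\<^esub> v2 (x2 \<otimes>\<^bsub>A\<^esub> z)"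
      if "x1 \<in> carrier A" "x2 \<in> carrier A" for x1 x2
      using that y z by (simp add: T2_def v1_def v2_def inl_inr)
    have Qm: "Q (v1 x1 \<otimes>\<^bsub>T2\<^esub> v2 x2 \<otimes>\<^bsub>T2\<^esub> ?t) = v1 (proj (x1 \<otimes>\<^bsub>A\<^esub> y)) \<otimes>\<^bsub>T2\<^esub> (v2 x2 \<otimes>\<^bsub>T2\<^esub> v2 z)"
      if "x1 \<in> carrier A" "x2 \<in> carrier A" for x1 x2
      using that y z by (simp only: m Q_v A.m_closed algebra_homD(3)[OF v2_hom, symmetric])
    have ca: "comult A a = tlift K T2 (\<lambda>x y. v1 x \<otimes>\<^bsub>T2\<^esub> v2 y) (comult A a)"
      by (rule trans[OF comult_v[OF a] AT.conv_apply[OF a]])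
    have "Q (comult A a \<otimes>\<^bsub>T2\<^esub> ?t) = Q (tlift K T2 (\<lambda>x y. v1 x \<otimes>\<^bsub>T2\<^esub> v2 y) (comult A a) \<otimes>\<^bsub>T2\<^esub> ?t)"
      by (subst (1) ca) (rule refl)
    also have "\<dots> = conv K A T2 (\<lambda>x. v1 (proj (x \<otimes>\<^bsub>A\<^esub> y))) (\<lambda>x. v2 x \<otimes>\<^bsub>T2\<^esub> v2 z) a"
      unfolding AT.conv_apply[OF a]
      by (rule AT.embed_tlift[OF AT.B_module A.A_module A.A_module
            linear_comp[OF Q_linear_T2 linear_mult_left[OF T2_algebra linear_id tc]] A.comult_closed[OF a]])
        (simp_all add: Qm AT.B.m_closed)
    also have "\<dots> = conv K A T2 (\<lambda>x. v1 (proj (x \<otimes>\<^bsub>A\<^esub> y))) v2 a \<otimes>\<^bsub>T2\<^esub> v2 z"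
      by (rule AT.conv_right[OF linear_comp[OF v1_linear xy] v2_linear v_closed(2)[OF z] a])
    finally have 1: "Q (comult A a \<otimes>\<^bsub>T2\<^esub> ?t) = conv K A T2 (\<lambda>x. v1 (proj (x \<otimes>\<^bsub>A\<^esub> y))) v2 a \<otimes>\<^bsub>T2\<^esub> v2 z" .
    have vpxy: "v1 (proj (x \<otimes>\<^bsub>A\<^esub> y)) = conv K A T2 v1 (conv K A T2 ?c (\<lambda>a. v1 (j (S (\<pi> a))))) x" if x: "x \<in> carrier A" for x
    proof -
      note cp = AA.cunit_linear[OF py]
      have "v1 (proj (x \<otimes>\<^bsub>A\<^esub> y)) = conv K A T2 (\<lambda>x. v1 x) (\<lambda>x. v1 (conv K A A (cunit K A A (proj y)) (\<lambda>a. j (S (\<pi> a))) x)) x"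
        unfolding proj_mult[OF x y]
        by (rule AA.conv_hom[OF T2_algebra v1_hom linear_id AA.conv_linear[OF cp jS\<pi>_linear] x])
      also have "conv K A T2 (\<lambda>x. v1 x) (\<lambda>x. v1 (conv K A A (cunit K A A (proj y)) (\<lambda>a. j (S (\<pi> a))) x))
        = conv K A T2 v1 (conv K A T2 (\<lambda>x. v1 (cunit K A A (proj y) x)) (\<lambda>a. v1 (j (S (\<pi> a)))))"
        by (rule AT.conv_cong[OF v1_linear linear_comp[OF v1_linear AA.conv_linear[OF cp jS\<pi>_linear]]])
          (simp_all add: AA.conv_hom[OF T2_algebra v1_hom cp jS\<pi>_linear])
      also have "conv K A T2 (\<lambda>x. v1 (cunit K A A (proj y) x)) (\<lambda>a. v1 (j (S (\<pi> a)))) = conv K A T2 ?c (\<lambda>a. v1 (j (S (\<pi> a))))"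
        by (rule AT.conv_cong[OF linear_comp[OF v1_linear cp] vjS\<pi>]) (simp_all add: AA.cunit_hom[OF v1_hom py])
      finally show ?thesis .
    qed
    have "conv K A T2 (\<lambda>x. v1 (proj (x \<otimes>\<^bsub>A\<^esub> y))) v2 = conv K A T2 (conv K A T2 v1 (conv K A T2 ?c (\<lambda>a. v1 (j (S (\<pi> a)))))) v2"
      by (rule AT.conv_cong[OF linear_comp[OF v1_linear xy] v2_linear]) (simp_all only: vpxy)
    also have "\<dots> = conv K A T2 v1 (conv K A T2 ?c (conv K A T2 (\<lambda>a. v1 (j (S (\<pi> a)))) v2))"
      by (simp only: AT.conv_assoc AT.conv_linear v1_linear v2_linear vjS\<pi> cu)
    finally have l: "conv K A T2 (\<lambda>x. v1 (proj (x \<otimes>\<^bsub>A\<^esub> y))) v2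
      = conv K A T2 v1 (conv K A T2 ?c (conv K A T2 (\<lambda>a. v1 (j (S (\<pi> a)))) v2))" .
    have va: "v1 (ad (\<pi> x) (proj y)) = conv K A T2 (\<lambda>a. v1 (j (\<pi> a))) (conv K A T2 ?c (\<lambda>a. v1 (j (S (\<pi> a))))) x"
      if x: "x \<in> carrier A" for x
    proof -
      note cH = HT.cunit_linear[OF v_closed(1)[OF py]]
      note vj = linear_comp[OF v1_linear j_linear] linear_comp[OF v1_linear jS_linear]
      have "v1 (ad (\<pi> x) (proj y)) = conv K H T2 (\<lambda>h. v1 (j h)) (conv K H T2 (cunit K H T2 (v1 (proj y))) (\<lambda>h. v1 (j (S h)))) (\<pi> x)"
        by (rule hom_ad[OF T2_algebra v1_hom _ py]) (simp add: x)
      also have "\<dots> = conv K A T2 (\<lambda>a. v1 (j (\<pi> a))) (\<lambda>a. conv K H T2 (cunit K H T2 (v1 (proj y))) (\<lambda>h. v1 (j (S h))) (\<pi> a)) x"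
        by (rule conv_precomp[OF \<pi>_hom T2_algebra vj(1) HT.conv_linear[OF cH vj(2)] x])
      also have "conv K A T2 (\<lambda>a. v1 (j (\<pi> a))) (\<lambda>a. conv K H T2 (cunit K H T2 (v1 (proj y))) (\<lambda>h. v1 (j (S h))) (\<pi> a))
        = conv K A T2 (\<lambda>a. v1 (j (\<pi> a))) (conv K A T2 (\<lambda>a. cunit K H T2 (v1 (proj y)) (\<pi> a)) (\<lambda>a. v1 (j (S (\<pi> a)))))"
        by (rule AT.conv_cong[OF vj\<pi> linear_comp[OF HT.conv_linear[OF cH vj(2)] \<pi>_linear]])
          (simp_all add: conv_precomp[OF \<pi>_hom T2_algebra cH vj(2)])
      also have "conv K A T2 (\<lambda>a. cunit K H T2 (v1 (proj y)) (\<pi> a)) (\<lambda>a. v1 (j (S (\<pi> a)))) = conv K A T2 ?c (\<lambda>a. v1 (j (S (\<pi> a))))"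
        by (rule AT.conv_cong[OF linear_comp[OF cH \<pi>_linear] vjS\<pi>]) (simp_all add: cunit_precomp[OF \<pi>_hom])
      finally show ?thesis .
    qed
    have Wy: "W y = conv K A T2 (conv K A T2 (\<lambda>a. v1 (j (\<pi> a))) (conv K A T2 ?c (\<lambda>a. v1 (j (S (\<pi> a)))))) v2"
      unfolding W_def
      by (rule AT.conv_cong[OF vad[OF py] v2_linear]) (simp_all only: va)
    have Wy': "W y = conv K A T2 (\<lambda>a. v1 (j (\<pi> a))) (conv K A T2 ?c (conv K A T2 (\<lambda>a. v1 (j (S (\<pi> a)))) v2))"
      unfolding Wy by (simp only: AT.conv_assoc AT.conv_linear v2_linear vj\<pi> vjS\<pi> cu)
    note cv = AT.conv_linear[OF cu AT.conv_linear[OF vjS\<pi> v2_linear]]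
    have can: "conv K A T2 (\<lambda>a. v1 (j (S (\<pi> a)))) (W y) = restrict (conv K A T2 ?c (conv K A T2 (\<lambda>a. v1 (j (S (\<pi> a)))) v2)) (carrier A)"
      unfolding Wy'
      by (rule AT.conv_cancel_left[OF vjS\<pi> vj\<pi> cv conv_\<pi>_inverse(2)[OF T2_algebra algebra_hom_comp[OF v1_hom j_algebra_hom]]])
    have "conv K A T2 (\<lambda>a. v1 (proj a)) (W y) = conv K A T2 (conv K A T2 v1 (\<lambda>a. v1 (j (S (\<pi> a))))) (W y)"
      by (rule AT.conv_cong[OF vp Wr[OF y]]) (simp_all add: hom_proj[OF T2_algebra v1_hom])
    also have "\<dots> = conv K A T2 v1 (conv K A T2 (\<lambda>a. v1 (j (S (\<pi> a)))) (W y))"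
      by (rule AT.conv_assoc[OF v1_linear vjS\<pi> Wr[OF y]])
    also have "\<dots> = conv K A T2 v1 (conv K A T2 ?c (conv K A T2 (\<lambda>a. v1 (j (S (\<pi> a)))) v2))"
      unfolding can by (rule AT.conv_restrict(2)[OF v1_linear cv])
    finally have r: "conv K A T2 (\<lambda>a. v1 (proj a)) (W y) = conv K A T2 (\<lambda>x. v1 (proj (x \<otimes>\<^bsub>A\<^esub> y))) v2"
      unfolding l .
    have "conv K A T2 (\<lambda>a. v1 (proj a)) (\<lambda>x. tlift K T2 (\<lambda>y z. W y x \<otimes>\<^bsub>T2\<^esub> v2 z) ?t) 
      = conv K A T2 (\<lambda>a. v1 (proj a)) (\<lambda>x. W y x \<otimes>\<^bsub>T2\<^esub> v2 z)"
      by (rule AT.conv_cong[OF vp Zl[OF tc]]) (simp_all add: tlift_T2[OF F AT.B_module y z])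
    moreover have "conv K A T2 (\<lambda>a. v1 (proj a)) (\<lambda>x. W y x \<otimes>\<^bsub>T2\<^esub> v2 z) a = conv K A T2 (\<lambda>a. v1 (proj a)) (W y) a \<otimes>\<^bsub>T2\<^esub> v2 z"
      by (rule AT.conv_right[OF vp Wr[OF y] v_closed(2)[OF z] a])
    ultimately show "Q (comult A a \<otimes>\<^bsub>T2\<^esub> ?t) = conv K A T2 (\<lambda>a. v1 (proj a)) (\<lambda>x. tlift K T2 (\<lambda>y z. W y x \<otimes>\<^bsub>T2\<^esub> v2 z) ?t) a"
      unfolding 1 by (simp only: r)
  qed
  from this[OF comult_closed_T2[OF b]] show ?thesis
    unfolding W_def algebra_homD(3)[OF comult_hom_T2 a b] .
qed

end

section \<open>The coproduct and counit of R as morphisms and algebra maps\<close>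

context hopf_projection_yd
begin

text \<open>Reduces identities for the coproduct of \<open>R\<close> to identities for
  \<open>Q\<close> in \<open>T2\<close>.\<close>

lemma embed_RR_T2:
  obtains E where "E \<in> linear_hom K (tensor_space K R R) T2" "inj_on E (carrier (tensor_space K R R))"
    "\<forall>r\<in>coinv. \<forall>s\<in>coinv. E (tens K R R r s) = v1 r \<otimes>\<^bsub>T2\<^esub> v2 s"
    "\<forall>r\<in>coinv. E (yd_comult R r) = Q (comult A r)"
proof -
  obtain E P where e: "E \<in> linear_hom K (tensor_space K R R) (tensor_algebra K A A)"
    "inj_on E (carrier (tensor_space K R R))"
    "\<forall>r\<in>coinv. \<forall>s\<in>coinv. E (tens K R R r s) = inl K A A r \<otimes>\<^bsub>tensor_algebra K A A\<^esub> inr K A A s"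
    "P \<in> linear_hom K (tensor_algebra K A A) (tensor_space K R R)"
    "\<forall>t\<in>carrier (tensor_space K R R). P (E t) = t"
    by (rule embed_RR)
  note E = e(1)[folded T2_def] and Et = e(3)[folded T2_def v1_def v2_def]
  have "E (yd_comult R r) = Q (comult A r)" if r: "r \<in> coinv" for r
    using embed_comultR[OF T2_algebra RR_module E r v1_linear v2_linear, of "tens K R R"] Et r
      tlift_self[OF R_module R_module comultR_closed[OF r]] by (simp add: Q_comult)
  then show ?thesis using that[OF E e(2) Et] by simp
qed

lemma comultR_act:
  assumes h: "h \<in> carrier H" and m: "m \<in> coinv"
  shows "yd_comult R (act R h m) = act (yd_tensor K H R R) h (yd_comult R m)"
proof -
  let ?T = "tensor_space K R R"
  have mc: "m \<in> carrier A" using m by simp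
  obtain E where e: "E \<in> linear_hom K ?T T2" "inj_on E (carrier ?T)"
    "\<forall>r\<in>coinv. \<forall>s\<in>coinv. E (tens K R R r s) = v1 r \<otimes>\<^bsub>T2\<^esub> v2 s"
    "\<forall>r\<in>coinv. E (yd_comult R r) = Q (comult A r)"
    by (rule embed_RR_T2)
  define G where "G = (\<lambda>x y. conv K H T2 (\<lambda>h. v1 (ad h x)) (\<lambda>h. v2 (ad h y)) h)"
  have G: "bilinear K A A T2 G"
    unfolding G_def HT.conv_apply[OF h]
    by (rule bilinearI; rule linear_tlift_param[OF H.A_module H.A_module AT.B_module A.A_module H.comult_closed[OF h]];
      intro linear_mult_left[OF T2_algebra] linear_mult_right[OF T2_algebra] linear_comp[OF v1_linear ad_linear]
        linear_comp[OF v2_linear ad_linear] v_closed ad_closed; assumption)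
  have cl: "tlift K ?T (\<lambda>h1 h2. tens K R R (act R h1 x) (act R h2 y)) (comult H h) \<in> carrier ?T"
    if "x \<in> coinv" "y \<in> coinv" for x y
    using that h by (intro comultH_tlift_closed RR_module) (simp_all add: ad_coinv)
  have "E (act (yd_tensor K H R R) h (yd_comult R m)) = tlift K T2 (\<lambda>x y. G (proj x) y) (comult A m)"
    unfolding yd_tensor_act
  proof (rule embed_comultR_bilinear[OF T2_algebra RR_module e(1) m G cl])
    fix x y assume xy: "x \<in> coinv" "y \<in> coinv"
    show "E (tlift K ?T (\<lambda>h1 h2. tens K R R (act R h1 x) (act R h2 y)) (comult H h)) = G x y"
      unfolding G_def
      by (rule HT.embed_comult[OF RR_module e(1) h]) (use xy e(3) in \<open>simp_all add: ad_coinv\<close>)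
  qed
  also have "\<dots> = Q (comult A (ad h m))" unfolding G_def by (rule Q_comult_ad[OF h mc, symmetric])
  also have "\<dots> = E (yd_comult R (act R h m))" using e(4) h m by (simp add: ad_coinv)
  finally have "E (yd_comult R (act R h m)) = E (act (yd_tensor K H R R) h (yd_comult R m))" by simp
  moreover have "act (yd_tensor K H R R) h (yd_comult R m) \<in> carrier ?T"
    unfolding yd_tensor_act by (rule comultR_tlift_closed[OF m RR_module cl])
  ultimately show ?thesis using inj_onD[OF e(2)] h m by (simp add: ad_coinv)
qed

text \<open>Expanding \<open>\<delta>1 (proj a)\<close> produces a last factor from
  \<open>u \<circ> S \<circ> \<pi>\<close>, which cancels against the factor
  \<open>u \<circ> \<pi>\<close> that opens \<open>\<delta>2\<close>. The factors from
  \<open>p\<close> that remain combine to \<open>p \<circ> proj\<close>.\<close>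

lemma comultR_coact:
  assumes m: "m \<in> coinv"
  shows "coact (yd_tensor K H R R) (yd_comult R m)
    = tlift K (tensor_space K H (tensor_space K R R)) (\<lambda>m1 m0. tens K H (tensor_space K R R) m1 (yd_comult R m0)) (coact R m)"
    (is "?l = ?r")
proof -
  let ?T = "tensor_space K R R"
  let ?X = "tensor_space K H ?T"
  note X = HRR_module
  have mc: "m \<in> carrier A" using m by simp
  obtain B :: "('k, ('k, 'h, ('k, 'a, 'a) tensor) tensor) module" and u p q E where e:
    "k_algebra K B" "u \<in> algebra_hom K H B" "p \<in> algebra_hom K A B" "q \<in> algebra_hom K A B"
    "\<forall>h\<in>carrier H. \<forall>a\<in>carrier A. p a \<otimes>\<^bsub>B\<^esub> u h = u h \<otimes>\<^bsub>B\<^esub> p a"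
    "\<forall>h\<in>carrier H. \<forall>a\<in>carrier A. q a \<otimes>\<^bsub>B\<^esub> u h = u h \<otimes>\<^bsub>B\<^esub> q a"
    "\<forall>x\<in>carrier A. \<forall>y\<in>carrier A. q x \<otimes>\<^bsub>B\<^esub> p y = p y \<otimes>\<^bsub>B\<^esub> q x"
    "E \<in> linear_hom K ?X B" "inj_on E (carrier ?X)"
    "\<forall>x\<in>carrier H. \<forall>r\<in>coinv. \<forall>s\<in>coinv.
      E (tens K H ?T x (tens K R R r s)) = u x \<otimes>\<^bsub>B\<^esub> (p r \<otimes>\<^bsub>B\<^esub> q s)"
    by (rule embed_V_RR[OF H.A_module H.A_algebra linear_id linear_id]) simp_all
  note B = e(1) and E = e(8)
  interpret AB: convolution K A B by (rule convolution_AI[OF B])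
  interpret HB: convolution K H B by (rule convolution_HI[OF B])
  note l = algebra_homD(1)[OF e(2)] algebra_homD(1)[OF e(3)] algebra_homD(1)[OF e(4)]
  note cl = algebra_homD(4)[OF e(2)] algebra_homD(4)[OF e(3)] algebra_homD(4)[OF e(4)]
  note u\<pi> = linear_comp[OF l(1) \<pi>_linear] and uS\<pi> = linear_comp[OF l(1) S\<pi>_linear]
    and pp = linear_comp[OF l(2) proj_linear] and pj = linear_comp[OF l(2) jS\<pi>_linear]
  define \<delta>1 where "\<delta>1 = conv K A B (\<lambda>a. u (\<pi> a)) p"
  define \<delta>2 where "\<delta>2 = conv K A B (\<lambda>a. u (\<pi> a)) q"
  have \<delta>l: "\<delta>1 \<in> linear_hom K A B" "\<delta>2 \<in> linear_hom K A B"
    unfolding \<delta>1_def \<delta>2_def by (rule AB.conv_linear[OF u\<pi> l(2)] AB.conv_linear[OF u\<pi> l(3)])+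
  note \<delta> = coact_hom[OF e(1-3) e(5)[rule_format], folded \<delta>1_def]
  have 1: "E ?l = conv K A B (\<lambda>a. \<delta>1 (proj a)) \<delta>2 m"
    unfolding yd_tensor_coact
  proof (rule embed_comultR[OF B X E m \<delta>l codiag_closed])
    fix r s assume rs: "r \<in> coinv" "s \<in> coinv"
    show "E (tlift K ?X (\<lambda>m1 m0. tlift K ?X (\<lambda>n1 n0.
        tens K H ?T (m1 \<otimes>\<^bsub>H\<^esub> n1) (tens K R R m0 n0)) (coact R s)) (coact R r)) = \<delta>1 r \<otimes>\<^bsub>B\<^esub> \<delta>2 s"
      unfolding \<delta>1_def \<delta>2_def
      by (rule codiag_embed[OF e(1-4) e(5)[rule_format] E _ rs]) (simp_all add: e(10))
  qed
  have 2: "E ?r = conv K A B (\<lambda>a. u (\<pi> a)) (conv K A B (\<lambda>a. p (proj a)) q) m"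
  proof (rule embed_coact[OF B X E m l(1) AB.conv_linear[OF pp l(3)]])
    fix x s assume xs: "x \<in> carrier H" "s \<in> coinv"
    then show "tens K H ?T x (yd_comult R s) \<in> carrier ?X" by simp
    have ux: "u x \<in> carrier B" using xs cl by simp
    have L: "(\<lambda>t. E (tens K H ?T x t)) \<in> linear_hom K ?T B"
      by (rule linear_comp[OF E linear_tens_right[OF H.A_module RR_module linear_id xs(1)]])
    \<comment> \<open>The coproduct of \<open>s\<close> is written as a sum of its own pure tensors
      so that \<open>embed_comultR\<close> applies.\<close>
    have "E (tens K H ?T x (tlift K ?T (tens K R R) (yd_comult R s)))
      = conv K A B (\<lambda>a. u x \<otimes>\<^bsub>B\<^esub> p (proj a)) q s"
      by (rule embed_comultR[OF B RR_module L xs(2) linear_mult_right[OF B l(2) ux] l(3)])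
        (use xs cl e(10) in \<open>simp_all add: AB.B.m_assoc\<close>)
    also have "\<dots> = u x \<otimes>\<^bsub>B\<^esub> conv K A B (\<lambda>a. p (proj a)) q s"
      by (rule AB.conv_left[OF pp l(3) ux]) (use xs in simp)
    finally show "E (tens K H ?T x (yd_comult R s)) = u x \<otimes>\<^bsub>B\<^esub> conv K A B (\<lambda>a. p (proj a)) q s"
      by (simp only: tlift_self[OF R_module R_module comultR_closed[OF xs(2)]])
  qed
  have jS: "\<delta>1 (j (S (\<pi> a))) = conv K A B (\<lambda>a. p (j (S (\<pi> a)))) (\<lambda>a. u (S (\<pi> a))) a" if a: "a \<in> carrier A" for a
    using \<delta>(3)[of "\<pi> a"] a
      conv_precomp[OF \<pi>_hom B linear_comp[OF l(2) jS_linear] linear_comp[OF l(1) H.antipode_linear] a] by simp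
  note lj = linear_comp[OF \<delta>l(1) jS\<pi>_linear]
  have q1: "conv K A B \<delta>1 (\<lambda>a. \<delta>1 (j (S (\<pi> a))))
    = conv K A B \<delta>1 (conv K A B (\<lambda>a. p (j (S (\<pi> a)))) (\<lambda>a. u (S (\<pi> a))))"
    by (rule AB.conv_cong[OF \<delta>l(1) lj]) (simp_all only: jS)
  have can: "conv K A B (\<lambda>a. u (S (\<pi> a))) \<delta>2 = restrict q (carrier A)"
    unfolding \<delta>2_def
    by (rule AB.conv_cancel_left[OF uS\<pi> u\<pi> l(3) conv_\<pi>_inverse(2)[OF B e(2)]])
  have pr: "conv K A B p (\<lambda>a. p (j (S (\<pi> a)))) = restrict (\<lambda>a. p (proj a)) (carrier A)"
  proof
    show "conv K A B p (\<lambda>a. p (j (S (\<pi> a)))) a = restrict (\<lambda>a. p (proj a)) (carrier A) a" for a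
      by (cases "a \<in> carrier A") (simp only: hom_proj[OF B e(3)] restrict_apply', simp add: conv_def)
  qed
  have "conv K A B (\<lambda>a. \<delta>1 (proj a)) \<delta>2 = conv K A B (conv K A B \<delta>1 (\<lambda>a. \<delta>1 (j (S (\<pi> a))))) \<delta>2"
    by (rule AB.conv_cong[OF linear_comp[OF \<delta>l(1) proj_linear] \<delta>l(2)]) (simp_all add: hom_proj[OF B \<delta>(1)])
  also have "\<dots> = conv K A B \<delta>1 (conv K A B (\<lambda>a. p (j (S (\<pi> a)))) (conv K A B (\<lambda>a. u (S (\<pi> a))) \<delta>2))"
    unfolding q1 by (simp only: AB.conv_assoc AB.conv_linear \<delta>l pj uS\<pi>)
  also have "\<dots> = conv K A B \<delta>1 (conv K A B (\<lambda>a. p (j (S (\<pi> a)))) q)"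
    unfolding can AB.conv_restrict(2)[OF pj l(3)] ..
  also have "\<dots> = conv K A B (\<lambda>a. u (\<pi> a)) (conv K A B (conv K A B p (\<lambda>a. p (j (S (\<pi> a))))) q)"
    unfolding \<delta>1_def by (simp only: AB.conv_assoc AB.conv_linear u\<pi> l pj)
  also have "\<dots> = conv K A B (\<lambda>a. u (\<pi> a)) (conv K A B (\<lambda>a. p (proj a)) q)"
    unfolding pr AB.conv_restrict(1)[OF pp l(3)] ..
  finally have "E ?l = E ?r" by (simp only: 1 2)
  moreover have "?l \<in> carrier ?X" unfolding yd_tensor_coact
    by (intro comultR_tlift_closed[OF m X] codiag_closed)
  moreover have "?r \<in> carrier ?X" using m by (intro coact_tlift_closed X) simp_all
  ultimately show ?thesis using inj_onD[OF e(9)] by blast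
qed

text \<open>The counit turns the coaction of \<open>m\<close> into
  \<open>\<pi> m \<otimes> 1\<close>, and \<open>\<pi>_coinv\<close> makes \<open>\<pi> m\<close> a
  multiple of the unit, whose scalar moves to the other factor.\<close>

lemma R_counit_yd_hom: "yd_counit R \<in> yd_hom K H R (yd_unit K H)"
proof -
  note S = module_self
  have HS: "module K (tensor_space K H (self_module K))" using S by simp
  have l: "counit A \<in> linear_hom K A (self_module K)" by (rule A.counit_linear)
  have b: "bilinear K H A (tensor_space K H (self_module K)) (\<lambda>m1 m0. tens K H (self_module K) m1 (counit A m0))"
    by (rule bilinear_tens[OF H.A_module S linear_id l])
  have p1: "(\<lambda>a. tens K H (self_module K) (\<pi> a) \<one>\<^bsub>K\<^esub>) \<in> linear_hom K A (tensor_space K H (self_module K))"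
    by (rule linear_tens_left[OF H.A_module S \<pi>_linear]) simp
  note sl = linear_smult[OF bilinear_left[OF tens_bilinear[OF H.A_module S]]]
    and sr = linear_smult[OF bilinear_right[OF tens_bilinear[OF H.A_module S]]]
  have "tens K H (self_module K) \<one>\<^bsub>H\<^esub> (counit A m)
    = tlift K (tensor_space K H (self_module K)) (\<lambda>m1 m0. tens K H (self_module K) m1 (counit A m0)) (coact R m)"
    if m: "m \<in> coinv" for m
  proof -
    have mc: "m \<in> carrier A" using m by simp
    have s: "tens K H (self_module K) x c = c \<odot>\<^bsub>tensor_space K H (self_module K)\<^esub> tens K H (self_module K) x \<one>\<^bsub>K\<^esub>"
      if "x \<in> carrier H" "c \<in> carrier K" for x c
      using sr[of x c "\<one>\<^bsub>K\<^esub>"] that by simp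
    have "tlift K (tensor_space K H (self_module K)) (\<lambda>m1 m0. tens K H (self_module K) m1 (counit A m0)) (coact R m)
      = tlift K (tensor_space K H (self_module K)) (\<lambda>a1 a2. tens K H (self_module K) (\<pi> a1) (counit A a2)) (comult A m)"
      by (rule coact_tlift[OF m HS b])
    also have "\<dots> = tlift K (tensor_space K H (self_module K))
        (\<lambda>a1 a2. counit A a2 \<odot>\<^bsub>tensor_space K H (self_module K)\<^esub> tens K H (self_module K) (\<pi> a1) \<one>\<^bsub>K\<^esub>) (comult A m)"
      by (rule tlift_cong[OF A.A_module A.A_module HS A.comult_closed[OF mc]])
        (simp add: tens_closed[OF H.A_module S], rule s, simp_all)
    also have "\<dots> = tens K H (self_module K) (\<pi> m) \<one>\<^bsub>K\<^esub>"
      by (rule A.counit_right_linear[OF HS p1 mc])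
    also have "\<dots> = tens K H (self_module K) \<one>\<^bsub>H\<^esub> (counit A m)"
      using sl[of "\<one>\<^bsub>K\<^esub>" "counit A m" "\<one>\<^bsub>H\<^esub>"] s[of "\<one>\<^bsub>H\<^esub>" "counit A m"] mc by (simp add: \<pi>_coinv[OF m])
    finally show ?thesis by simp
  qed
  then show ?thesis unfolding yd_hom_def
    using linear_from_R[OF l] by (simp add: counit_ad)
qed

lemma R_yd_coalgebra: "yd_coalgebra K H S R"
proof (intro yd_coalgebra.intro yd_coalgebra_axioms.intro R_yd_module R_coalgebra R_counit_yd_hom)
  show "yd_comult R \<in> yd_hom K H R (yd_tensor K H R R)"
    unfolding yd_hom_def using comultR_linear comultR_act comultR_coact by simp
qed

text \<open>The twist in the braided product is the factor found in \<open>Q_comult_mult\<close>: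
  after embedding into \<open>T2\<close> both sides are the same sum over the coproducts of
  \<open>a\<close> and \<open>b\<close> in \<open>A\<close>.\<close>

lemma comultR_mult:
  assumes a: "a \<in> coinv" and b: "b \<in> coinv"
  shows "yd_comult R (a \<otimes>\<^bsub>A\<^esub> b) = yd_comult R a \<otimes>\<^bsub>yd_tensor K H R R\<^esub> yd_comult R b"
proof -
  let ?T = "tensor_space K R R"
  have ac: "a \<in> carrier A" and bc: "b \<in> carrier A" using a b by simp_all
  obtain E where e: "E \<in> linear_hom K ?T T2" "inj_on E (carrier ?T)"
    "\<forall>r\<in>coinv. \<forall>s\<in>coinv. E (tens K R R r s) = v1 r \<otimes>\<^bsub>T2\<^esub> v2 s"
    "\<forall>r\<in>coinv. E (yd_comult R r) = Q (comult A r)"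
    by (rule embed_RR_T2)
  note E = e(1)
  have vad: "(\<lambda>a. v1 (ad (\<pi> a) y)) \<in> linear_hom K A T2" if "y \<in> carrier A" for y
    by (rule linear_comp[OF v1_linear linear_comp[OF ad_linear_left[OF that] \<pi>_linear]])
  \<comment> \<open>The braiding of \<open>x\<close> past \<open>y\<close>, here without
    \<open>proj\<close>: the projection enters with the sum over the coproduct of
    \<open>b\<close>.\<close>
  define W where "W = (\<lambda>y x. conv K A T2 (\<lambda>a. v1 (ad (\<pi> a) y)) v2 x)"
  have Wr: "W y \<in> linear_hom K A T2" if "y \<in> carrier A" for y
    unfolding W_def by (rule AT.conv_linear[OF vad[OF that] v2_linear])
  have Wl: "(\<lambda>y. W y x) \<in> linear_hom K A T2" if x: "x \<in> carrier A" for x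
    unfolding W_def AT.conv_apply[OF x]
    by (rule linear_tlift_param[OF A.A_module A.A_module AT.B_module A.A_module A.comult_closed[OF x]])
      (intro linear_mult_left[OF T2_algebra] linear_comp[OF v1_linear ad_linear] v_closed \<pi>_simps; assumption)
  note Wc = linear_closed[OF Wr]
  let ?f = "\<lambda>a1 a2 b1 b2. tlift K ?T (\<lambda>x y. tens K R R (a1 \<otimes>\<^bsub>A\<^esub> act R x b1) (y \<otimes>\<^bsub>A\<^esub> b2)) (coact R a2)"
  have f_closed: "?f a1 a2 b1 b2 \<in> carrier ?T" if "a1 \<in> coinv" "a2 \<in> coinv" "b1 \<in> coinv" "b2 \<in> coinv" for a1 a2 b1 b2
    using that by (intro coact_tlift_closed RR_module) (simp_all add: ad_coinv coinv_mult)
  have f: "E (?f a1 a2 b1 b2) = v1 a1 \<otimes>\<^bsub>T2\<^esub> (W b1 a2 \<otimes>\<^bsub>T2\<^esub> v2 b2)"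
    if c: "a1 \<in> coinv" "a2 \<in> coinv" "b1 \<in> coinv" "b2 \<in> coinv" for a1 a2 b1 b2
  proof -
    have cc: "a1 \<in> carrier A" "a2 \<in> carrier A" "b1 \<in> carrier A" "b2 \<in> carrier A" using c by simp_all
    have "E (?f a1 a2 b1 b2) = conv K A T2 (\<lambda>a. v1 a1 \<otimes>\<^bsub>T2\<^esub> v1 (ad (\<pi> a) b1)) (\<lambda>a. v2 a \<otimes>\<^bsub>T2\<^esub> v2 b2) a2"
      by (rule embed_coact[OF T2_algebra RR_module E c(2)
            linear_mult_right[OF T2_algebra linear_comp[OF v1_linear ad_linear_left[OF cc(3)]] v_closed(1)[OF cc(1)]]
            linear_mult_left[OF T2_algebra v2_linear v_closed(2)[OF cc(4)]]])
        (use c e(3) in \<open>simp_all add: ad_coinv coinv_mult algebra_homD(3)[OF v1_hom] algebra_homD(3)[OF v2_hom]\<close>)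
    also have "\<dots> = v1 a1 \<otimes>\<^bsub>T2\<^esub> conv K A T2 (\<lambda>a. v1 (ad (\<pi> a) b1)) (\<lambda>a. v2 a \<otimes>\<^bsub>T2\<^esub> v2 b2) a2"
      by (rule AT.conv_left[OF vad[OF cc(3)] linear_mult_left[OF T2_algebra v2_linear v_closed(2)[OF cc(4)]] v_closed(1)[OF cc(1)] cc(2)])
    also have "conv K A T2 (\<lambda>a. v1 (ad (\<pi> a) b1)) (\<lambda>a. v2 a \<otimes>\<^bsub>T2\<^esub> v2 b2) a2 = W b1 a2 \<otimes>\<^bsub>T2\<^esub> v2 b2"
      unfolding W_def by (rule AT.conv_right[OF vad[OF cc(3)] v2_linear v_closed(2)[OF cc(4)] cc(2)])
    finally show ?thesis .
  qed
  define Z where "Z = (\<lambda>x. tlift K T2 (\<lambda>y z. W (proj y) x \<otimes>\<^bsub>T2\<^esub> v2 z) (comult A b))"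
  have Z: "Z \<in> linear_hom K A T2" unfolding Z_def
    by (rule linear_tlift_param[OF A.A_module A.A_module AT.B_module A.A_module A.comult_closed[OF bc]])
      (rule linear_mult_left[OF T2_algebra Wr[OF proj_closed] v_closed(2)])
  have g_closed: "tlift K ?T (\<lambda>b1 b2. ?f a1 a2 b1 b2) (yd_comult R b) \<in> carrier ?T" if "a1 \<in> coinv" "a2 \<in> coinv" for a1 a2
    using that by (intro comultR_tlift_closed[OF b RR_module] f_closed)
  have g: "E (tlift K ?T (\<lambda>b1 b2. ?f a1 a2 b1 b2) (yd_comult R b)) = v1 a1 \<otimes>\<^bsub>T2\<^esub> Z a2"
    if c: "a1 \<in> coinv" "a2 \<in> coinv" for a1 a2
  proof -
    have cc: "a1 \<in> carrier A" "a2 \<in> carrier A" using c by simp_all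
    have bl: "bilinear K A A T2 (\<lambda>y z. v1 a1 \<otimes>\<^bsub>T2\<^esub> (W y a2 \<otimes>\<^bsub>T2\<^esub> v2 z))"
      by (rule linear_bilinear[OF bilinear_mult[OF T2_algebra Wl[OF cc(2)] v2_linear]
            linear_mult_right[OF T2_algebra linear_id v_closed(1)[OF cc(1)]]])
    have "E (tlift K ?T (\<lambda>b1 b2. ?f a1 a2 b1 b2) (yd_comult R b))
      = tlift K T2 (\<lambda>y z. v1 a1 \<otimes>\<^bsub>T2\<^esub> (W (proj y) a2 \<otimes>\<^bsub>T2\<^esub> v2 z)) (comult A b)"
      by (rule embed_comultR_bilinear[OF T2_algebra RR_module E b bl f_closed[OF c] f[OF c]])
    also have "\<dots> = v1 a1 \<otimes>\<^bsub>T2\<^esub> Z a2" unfolding Z_def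
      by (rule AT.embed_tlift[OF AT.B_module A.A_module A.A_module
            linear_mult_right[OF T2_algebra linear_id v_closed(1)[OF cc(1)]] A.comult_closed[OF bc], symmetric])
        (simp_all add: Wc cc AT.B.m_closed)
    finally show ?thesis .
  qed
  have m: "yd_comult R a \<otimes>\<^bsub>yd_tensor K H R R\<^esub> yd_comult R b
    = tlift K ?T (\<lambda>a1 a2. tlift K ?T (\<lambda>b1 b2. ?f a1 a2 b1 b2) (yd_comult R b)) (yd_comult R a)"
    by (simp add: yd_tensor_mult)
  have "E (yd_comult R a \<otimes>\<^bsub>yd_tensor K H R R\<^esub> yd_comult R b) = conv K A T2 (\<lambda>a. v1 (proj a)) Z a"
    unfolding m by (rule embed_comultR[OF T2_algebra RR_module E a v1_linear Z g_closed g])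
  also have "\<dots> = Q (comult A (a \<otimes>\<^bsub>A\<^esub> b))"
    unfolding Z_def W_def by (rule Q_comult_mult[OF ac bc, symmetric])
  also have "\<dots> = E (yd_comult R (a \<otimes>\<^bsub>A\<^esub> b))" using e(4) a b by (simp add: coinv_mult)
  finally have "E (yd_comult R (a \<otimes>\<^bsub>A\<^esub> b)) = E (yd_comult R a \<otimes>\<^bsub>yd_tensor K H R R\<^esub> yd_comult R b)" by simp
  moreover have "yd_comult R a \<otimes>\<^bsub>yd_tensor K H R R\<^esub> yd_comult R b \<in> carrier ?T"
    unfolding m by (rule comultR_tlift_closed[OF a RR_module g_closed])
  moreover have "yd_comult R (a \<otimes>\<^bsub>A\<^esub> b) \<in> carrier ?T" by (rule comultR_closed[OF coinv_mult[OF a b]])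
  ultimately show ?thesis using inj_onD[OF e(2)] by blast
qed

lemma comultR_one: "yd_comult R \<one>\<^bsub>A\<^esub> = tens K R R \<one>\<^bsub>A\<^esub> \<one>\<^bsub>A\<^esub>"
proof -
  let ?T = "tensor_space K R R"
  obtain E where e: "E \<in> linear_hom K ?T T2" "inj_on E (carrier ?T)"
    "\<forall>r\<in>coinv. \<forall>s\<in>coinv. E (tens K R R r s) = v1 r \<otimes>\<^bsub>T2\<^esub> v2 s"
    "\<forall>r\<in>coinv. E (yd_comult R r) = Q (comult A r)"
    by (rule embed_RR_T2)
  have "E (yd_comult R \<one>\<^bsub>A\<^esub>) = E (tens K R R \<one>\<^bsub>A\<^esub> \<one>\<^bsub>A\<^esub>)"
    using e(3,4) coinv_one by (simp add: A.comult_one Q_v proj_coinv_id[OF coinv_one] v_tens)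
  moreover have "tens K R R \<one>\<^bsub>A\<^esub> \<one>\<^bsub>A\<^esub> \<in> carrier ?T" by (simp add: coinv_one)
  ultimately show ?thesis using inj_onD[OF e(2)] comultR_closed[OF coinv_one] by blast
qed

lemma R_yd_bialgebra: "yd_bialgebra K H S R"
proof (intro yd_bialgebra.intro yd_bialgebra_axioms.intro R_yd_algebra R_yd_coalgebra)
  show "yd_comult R \<in> algebra_hom K R (yd_tensor K H R R)"
    by (rule algebra_homI) (use comultR_linear comultR_mult comultR_one in simp_all)
  show "yd_counit R \<in> algebra_hom K R (yd_unit K H)"
    by (rule algebra_homI) (use linear_from_R[OF A.counit_linear] in \<open>simp_all add: A.counit_one A.counit_mult\<close>)
qed

end

section \<open>The bi-product and the canonical map\<close>

text \<open>Every bialgebra axiom of \<open>X\<close> is checked after the injective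
  \<open>f\<close> or rewritten as a sum over the coproduct of \<open>A\<close>. For the bi-product
  it is then enough that its operations correspond to those of \<open>A\<close>.\<close>

lemma bialgebra_transport:
  fixes A :: "('k, 'a, 'y) bialg_scheme" and X :: "('k, 'c, 'z) bialg_scheme"
  assumes A: "bialgebra K A" and X: "module K X"
    and f: "f \<in> linear_hom K X A" and g: "g \<in> linear_hom K A X"
    and gf: "\<And>x. x \<in> carrier X \<Longrightarrow> g (f x) = x" and fg: "\<And>a. a \<in> carrier A \<Longrightarrow> f (g a) = a"
    and m: "\<And>x y. \<lbrakk>x \<in> carrier X; y \<in> carrier X\<rbrakk> \<Longrightarrow> x \<otimes>\<^bsub>X\<^esub> y \<in> carrier X"
      "\<And>x y. \<lbrakk>x \<in> carrier X; y \<in> carrier X\<rbrakk> \<Longrightarrow> f (x \<otimes>\<^bsub>X\<^esub> y) = f x \<otimes>\<^bsub>A\<^esub> f y"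
    and o: "\<one>\<^bsub>X\<^esub> \<in> carrier X" "f \<one>\<^bsub>X\<^esub> = \<one>\<^bsub>A\<^esub>"
    and d: "\<And>x. x \<in> carrier X
      \<Longrightarrow> comult X x = tlift K (tensor_space K X X) (\<lambda>a b. tens K X X (g a) (g b)) (comult A (f x))"
    and e: "\<And>x. x \<in> carrier X \<Longrightarrow> counit X x = counit A (f x)"
  shows "f \<in> bialgebra_iso K X A"
proof -
  interpret A: bialgebra K A by fact
  interpret X: module K X by fact
  note fc [simp] = linear_closed[OF f] and gc [simp] = linear_closed[OF g]
  have inj: "x = y" if "f x = f y" "x \<in> carrier X" "y \<in> carrier X" for x y
    using gf that by metis
  have ring: "ring X"
  proof (rule ringI)
    show "abelian_group X" by (rule X.abelian_group_axioms)
    show "monoid X"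
      by (rule monoidI; (rule inj)?) (simp_all add: m o A.m_assoc)
  qed (rule inj; simp add: m linear_add[OF f] A.l_distr A.r_distr)+
  have XA: "k_algebra K X"
    by (intro k_algebra.intro k_algebra_axioms.intro A.field_axioms X ring; rule inj)
      (simp_all add: m linear_smult[OF f] A.smult_mult_left A.smult_mult_right)
  have gh: "g \<in> algebra_hom K A X"
    by (rule algebra_homI[OF g]; rule inj) (simp_all add: m o fg)
  have fh: "f \<in> algebra_hom K X A"
    by (rule algebra_homI[OF f o(2) m(2)])
  have XX: "module K (tensor_space K X X)" using X by simp
  have XXX: "module K (tensor_space K X (tensor_space K X X))" using X by simp
  note Am = A.A_module
  \<comment> \<open>\<open>?P\<close> is \<open>g \<otimes> g\<close>. It is multiplicative on
    products of coproducts, which makes the transported coproduct an algebra map.\<close>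
  let ?P = "tlift K (tensor_space K X X) (\<lambda>a b. tens K X X (g a) (g b))"
  have P: "?P \<in> linear_hom K (tensor_space K A A) (tensor_space K X X)"
    by (rule A.tlift_linear[OF Am Am XX A.bilinear_tens[OF X X g g]])
  have "tlift K (tensor_algebra K X X) (\<lambda>a b. inl K X X (g a) \<otimes>\<^bsub>tensor_algebra K X X\<^esub> inr K X X (g b))
      \<in> algebra_hom K (tensor_algebra K A A) (tensor_algebra K X X)"
    by (rule A.tlift_algebra_hom[OF A.A_algebra A.A_algebra A.tensor_k_algebra[OF XA XA]
          algebra_hom_comp[OF A.inl_algebra_hom[OF XA XA] gh] algebra_hom_comp[OF A.inr_algebra_hom[OF XA XA] gh]])
      (simp add: A.inl_inr[OF XA XA] A.inr_inl[OF XA XA])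
  note Qh = algebra_homD(3)[OF this]
  \<comment> \<open>\<open>tlift_algebra_hom\<close> speaks of products of the two inclusions; these
    products are the pure tensors in \<open>?P\<close>.\<close>
  have PQ: "tlift K (tensor_algebra K X X) (\<lambda>a b. inl K X X (g a) \<otimes>\<^bsub>tensor_algebra K X X\<^esub> inr K X X (g b)) t = ?P t"
    if "t \<in> carrier (tensor_space K A A)" for t
    unfolding tensor_algebra_normalize
    by (rule A.tlift_cong[OF Am Am XX that]) (simp_all add: A.inl_inr[OF XA XA] X)
  have Ph: "?P (comult A a \<otimes>\<^bsub>tensor_algebra K A A\<^esub> comult A b) = ?P (comult A a) \<otimes>\<^bsub>tensor_algebra K X X\<^esub> ?P (comult A b)"
    if "a \<in> carrier A" "b \<in> carrier A" for a b
  proof -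
    have "comult A a \<otimes>\<^bsub>tensor_algebra K A A\<^esub> comult A b \<in> carrier (tensor_space K A A)"
      using that A.comult_closed[of "a \<otimes>\<^bsub>A\<^esub> b"] by (simp add: A.comult_mult)
    then show ?thesis using that Qh[of "comult A a" "comult A b"] by (simp add: PQ del: tensor_algebra_normalize)
  qed
  \<comment> \<open>Sums over the coproduct of \<open>X\<close> are sums over that of
    \<open>A\<close> with \<open>g\<close> in both legs; the coalgebra axioms are reduced to those
    of \<open>A\<close> in this way.\<close>
  have tl: "tlift K Y F (comult X x) = tlift K Y (\<lambda>a b. F (g a) (g b)) (comult A (f x))"
    if "module K Y" "bilinear K X X Y F" "x \<in> carrier X" for Y :: "('k, 'q, 'r) module_scheme" and F x
    unfolding d[OF that(3)]
    by (rule A.tlift_tlift_tens[OF X X Am Am that(1,2) g g A.comult_closed]) (simp add: that)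
  have dl: "comult X \<in> linear_hom K X (tensor_space K X X)"
    by (rule linear_homI)
      (simp_all add: d linear_closed[OF P] linear_add[OF f] linear_smult[OF f] linear_add[OF A.comult_linear]
        linear_smult[OF A.comult_linear] linear_add[OF P] linear_smult[OF P])
  have el: "counit X \<in> linear_hom K X (self_module K)"
    by (rule linear_homI) (simp_all add: e linear_add[OF linear_comp[OF A.counit_linear f], simplified]
        linear_smult[OF linear_comp[OF A.counit_linear f], simplified])
  have coassoc: "tlift K (tensor_space K X (tensor_space K X X)) (\<lambda>x c3.
        tlift K (tensor_space K X (tensor_space K X X)) (\<lambda>c1 c2.
          tens K X (tensor_space K X X) c1 (tens K X X c2 c3)) (comult X x)) (comult X c) =
      tlift K (tensor_space K X (tensor_space K X X)) (\<lambda>c1 x.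
        tlift K (tensor_space K X (tensor_space K X X)) (\<lambda>c2 c3.
          tens K X (tensor_space K X X) c1 (tens K X X c2 c3)) (comult X x)) (comult X c)"
    if c: "c \<in> carrier X" for c
  proof -
    let ?X3 = "tensor_space K X (tensor_space K X X)"
    let ?t = "\<lambda>c1 c2 c3. tens K X (tensor_space K X X) c1 (tens K X X c2 c3)"
    have b12: "bilinear K X X ?X3 (\<lambda>c1 c2. ?t c1 c2 c3)" if "c3 \<in> carrier X" for c3
      by (rule A.bilinear_tens[OF X XX linear_id A.linear_tens_left[OF X X linear_id that]])
    have b23: "bilinear K X X ?X3 (?t c1)" if "c1 \<in> carrier X" for c1
      by (rule A.linear_bilinear[OF A.bilinear_tens[OF X X linear_id linear_id] A.linear_tens_right[OF X XX linear_id that]])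
    have l1: "(\<lambda>c1. ?t c1 c2 c3) \<in> linear_hom K X ?X3" if "c2 \<in> carrier X" "c3 \<in> carrier X" for c2 c3
      using that X by (intro A.linear_tens_left[OF X XX linear_id]) simp
    have l3: "(\<lambda>c3. ?t c1 c2 c3) \<in> linear_hom K X ?X3" if "c1 \<in> carrier X" "c2 \<in> carrier X" for c1 c2
      by (rule bilinear_right[OF b23 that(2)]) (rule that(1))
    have xc: "comult X x \<in> carrier (tensor_space K X X)" if "x \<in> carrier X" for x
      by (rule linear_closed[OF dl that])
    have bl: "bilinear K X X ?X3 (\<lambda>x c3. tlift K ?X3 (\<lambda>c1 c2. ?t c1 c2 c3) (comult X x))"
      by (rule bilinearI, rule A.linear_tlift_arg[OF X X XXX b12 dl], assumption,
          rule A.linear_tlift_param[OF X X XXX X xc l3])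
    have br: "bilinear K X X ?X3 (\<lambda>c1 x. tlift K ?X3 (\<lambda>c2 c3. ?t c1 c2 c3) (comult X x))"
      by (rule bilinearI, rule A.linear_tlift_param[OF X X XXX X xc l1], assumption+,
          rule A.linear_tlift_arg[OF X X XXX b23 dl])
    note cc = A.comult_closed[OF fc[OF c]]
    have tc: "?t c1 c2 c3 \<in> carrier ?X3" if "c1 \<in> carrier X" "c2 \<in> carrier X" "c3 \<in> carrier X" for c1 c2 c3
      using that X by simp
    have L: "tlift K ?X3 (\<lambda>x c3. tlift K ?X3 (\<lambda>c1 c2. ?t c1 c2 c3) (comult X x)) (comult X c)
      = tlift K ?X3 (\<lambda>a a3. tlift K ?X3 (\<lambda>a1 a2. ?t (g a1) (g a2) (g a3)) (comult A a)) (comult A (f c))"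
      unfolding tl[OF XXX bl c]
      by (rule A.tlift_cong[OF Am Am XXX cc], rule bilinear_closed[OF bl gc gc], assumption+)
        (simp only: tl[OF XXX b12] gc fg)
    have R: "tlift K ?X3 (\<lambda>c1 x. tlift K ?X3 (\<lambda>c2 c3. ?t c1 c2 c3) (comult X x)) (comult X c)
      = tlift K ?X3 (\<lambda>a1 a. tlift K ?X3 (\<lambda>a2 a3. ?t (g a1) (g a2) (g a3)) (comult A a)) (comult A (f c))"
      unfolding tl[OF XXX br c]
      by (rule A.tlift_cong[OF Am Am XXX cc], rule bilinear_closed[OF br gc gc], assumption+)
        (simp only: tl[OF XXX b23] gc fg)
    show ?thesis unfolding L R
      by (rule A.coassoc_trilinear[OF XXX A.bilinear_comp[OF b23[OF gc] g g] linear_comp[OF l1[OF gc gc] g] fc[OF c]])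
  qed
  have co: "k_coalgebra K X (comult X) (counit X)"
  proof (intro k_coalgebra.intro k_coalgebra_axioms.intro A.field_axioms X dl el coassoc)
    fix c assume c: "c \<in> carrier X"
    note cc = A.comult_closed[OF fc[OF c]]
    have bs: "bilinear K X X X (\<lambda>c1 c2. counit X c1 \<odot>\<^bsub>X\<^esub> c2)" "bilinear K X X X (\<lambda>c1 c2. counit X c2 \<odot>\<^bsub>X\<^esub> c1)"
      by (rule bilinearI; rule linear_homI;
        simp add: linear_closed[OF el, simplified] linear_add[OF el, simplified] linear_smult[OF el, simplified]
          X.smult_l_distr X.smult_r_distr X.smult_assoc1[symmetric] A.m_comm)+
    have eg: "counit X (g a) = counit A a" if "a \<in> carrier A" for a using that by (simp add: e fg)
    have "tlift K X (\<lambda>c1 c2. counit X c1 \<odot>\<^bsub>X\<^esub> c2) (comult X c) = tlift K X (\<lambda>a b. counit A a \<odot>\<^bsub>X\<^esub> g b) (comult A (f c))"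
      unfolding tl[OF X bs(1) c] by (rule A.tlift_cong[OF Am Am X cc]) (simp_all add: eg)
    also have "\<dots> = g (f c)" by (rule A.counit_left_linear[OF X g fc[OF c]])
    finally show "tlift K X (\<lambda>c1 c2. counit X c1 \<odot>\<^bsub>X\<^esub> c2) (comult X c) = c" using c by (simp add: gf)
    have "tlift K X (\<lambda>c1 c2. counit X c2 \<odot>\<^bsub>X\<^esub> c1) (comult X c) = tlift K X (\<lambda>a b. counit A b \<odot>\<^bsub>X\<^esub> g a) (comult A (f c))"
      unfolding tl[OF X bs(2) c] by (rule A.tlift_cong[OF Am Am X cc]) (simp_all add: eg)
    also have "\<dots> = g (f c)" by (rule A.counit_right_linear[OF X g fc[OF c]])
    finally show "tlift K X (\<lambda>c1 c2. counit X c2 \<odot>\<^bsub>X\<^esub> c1) (comult X c) = c" using c by (simp add: gf)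
  qed
  have g1: "g \<one>\<^bsub>A\<^esub> = \<one>\<^bsub>X\<^esub>" by (rule algebra_homD(2)[OF gh])
  have ch: "comult X \<in> algebra_hom K X (tensor_algebra K X X)"
  proof (rule algebra_homI)
    show "comult X \<in> linear_hom K X (tensor_algebra K X X)" using dl by simp
    show "comult X \<one>\<^bsub>X\<^esub> = \<one>\<^bsub>tensor_algebra K X X\<^esub>"
      using A.tlift_tens[OF Am Am XX A.bilinear_tens[OF X X g g], of "\<one>\<^bsub>A\<^esub>" "\<one>\<^bsub>A\<^esub>"]
      by (simp add: d o A.comult_one g1)
    show "comult X (x \<otimes>\<^bsub>X\<^esub> y) = comult X x \<otimes>\<^bsub>tensor_algebra K X X\<^esub> comult X y"
      if "x \<in> carrier X" "y \<in> carrier X" for x y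
      using that by (simp add: d m A.comult_mult Ph)
  qed
  have eh: "counit X \<in> algebra_hom K X (self_module K)"
    by (rule algebra_homI[OF el]) (simp_all add: e o m A.counit_one A.counit_mult)
  have bX: "bialgebra K X"
    by (intro bialgebra.intro bialgebra_axioms.intro XA co ch eh)
  have fcom: "comult A (f a) = tlift K (tensor_space K A A) (\<lambda>a1 a2. tens K A A (f a1) (f a2)) (comult X a)"
    if a: "a \<in> carrier X" for a
  proof -
    have "tlift K (tensor_space K A A) (\<lambda>a1 a2. tens K A A (f a1) (f a2)) (comult X a)
      = tlift K (tensor_space K A A) (\<lambda>a1 a2. tens K A A (f (g a1)) (f (g a2))) (comult A (f a))"
      by (rule tl[OF A.tensor_module[OF Am Am] A.bilinear_tens[OF Am Am f f] a])
    also have "\<dots> = tlift K (tensor_space K A A) (tens K A A) (comult A (f a))"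
      by (rule A.tlift_cong[OF Am Am A.tensor_module[OF Am Am]]) (use a in \<open>simp_all add: fg\<close>)
    also have "\<dots> = comult A (f a)" by (rule A.tlift_self[OF Am Am]) (simp add: a)
    finally show ?thesis by simp
  qed
  have "bij_betw f (carrier X) (carrier A)"
    by (rule bij_betw_byWitness[where f' = g]) (auto simp: gf fg)
  then show ?thesis
    unfolding bialgebra_iso_def bialgebra_hom_def using fh A bX fcom e by simp
qed

section \<open>The bi-product and its canonical map to A\<close>

lemma biproduct_simps [simp]:
  "carrier (biproduct K R H) = carrier (tensor_space K R H)"
  "add (biproduct K R H) = add (tensor_space K R H)"
  "zero (biproduct K R H) = zero (tensor_space K R H)"
  "smult (biproduct K R H) = smult (tensor_space K R H)"
  "one (biproduct K R H) = tens K R H \<one>\<^bsub>R\<^esub> \<one>\<^bsub>H\<^esub>"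
  by (simp_all add: biproduct_def Let_def module.defs)

lemma biproduct_mult: "t \<otimes>\<^bsub>biproduct K R H\<^esub> u = tlift K (tensor_space K R H) (\<lambda>r h. tlift K (tensor_space K R H) (\<lambda>r' h'.
    tlift K (tensor_space K R H) (\<lambda>h1 h2. tens K R H (r \<otimes>\<^bsub>R\<^esub> act R h1 r') (h2 \<otimes>\<^bsub>H\<^esub> h')) (comult H h)) u) t"
  by (simp add: biproduct_def Let_def module.defs)

lemma biproduct_comult: "comult (biproduct K R H) t =
    (let T = tensor_space K R H; TT = tensor_space K T T in
      tlift K TT (\<lambda>r h. tlift K TT (\<lambda>r1 r2. tlift K TT (\<lambda>x y. tlift K TT (\<lambda>h1 h2.
                  tens K T T (tens K R H r1 (x \<otimes>\<^bsub>H\<^esub> h1)) (tens K R H y h2))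
                  (comult H h)) (coact R r2)) (yd_comult R r)) t)"
  by (simp add: biproduct_def Let_def module.defs)

lemma biproduct_counit: "counit (biproduct K R H) = tlift K (self_module K) (\<lambda>r h. yd_counit R r \<otimes>\<^bsub>K\<^esub> counit H h)"
  by (simp add: biproduct_def Let_def module.defs)

lemma biproduct_normalize [simp]:
  "tlift K (biproduct K' R H) = tlift K (tensor_space K' R H)"
  "linear_hom K V (biproduct K' R H) = linear_hom K V (tensor_space K' R H)"
  "linear_hom K (biproduct K' R H) V = linear_hom K (tensor_space K' R H) V"
  "tensor_space K (biproduct K' R H) (biproduct K' R H) = tensor_space K (tensor_space K' R H) (tensor_space K' R H)"
  "tens K (biproduct K' R H) (biproduct K' R H) = tens K (tensor_space K' R H) (tensor_space K' R H)"
  by (rule tlift_codomain_cong linear_hom_cong tensor_cong; simp)+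

context hopf_projection_yd
begin

abbreviation "RH \<equiv> tensor_space K R H"

lemma RH_module: "module K RH" by simp
lemma RH2_module: "module K (tensor_space K RH RH)" by simp

lemma canonical_bilinear: "bilinear K R H A (\<lambda>r h. r \<otimes>\<^bsub>A\<^esub> j h)"
  by (rule bilinear_mult[OF A.A_algebra incl_linear j_linear])

lemma canonical_linear: "canonical_map K A j \<in> linear_hom K RH A"
  unfolding canonical_map_def by (rule tlift_linear[OF R_module H.A_module A.A_module canonical_bilinear])

lemma canonical_tens: "\<lbrakk>r \<in> coinv; h \<in> carrier H\<rbrakk> \<Longrightarrow> canonical_map K A j (tens K R H r h) = r \<otimes>\<^bsub>A\<^esub> j h"
  unfolding canonical_map_def using tlift_tens[OF R_module H.A_module A.A_module canonical_bilinear] by simp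

definition "canonical_inverse a = tlift K RH (\<lambda>a1 a2. tens K R H (proj a1) (\<pi> a2)) (comult A a)"

lemma canonical_inverse_bilinear: "bilinear K A A RH (\<lambda>a1 a2. tens K R H (proj a1) (\<pi> a2))"
  by (rule bilinear_tens[OF R_module H.A_module proj_linear_R \<pi>_linear])

lemma canonical_inverse_linear: "canonical_inverse \<in> linear_hom K A RH"
  unfolding canonical_inverse_def[abs_def]
  by (rule linear_tlift_arg[OF A.A_module A.A_module RH_module canonical_inverse_bilinear A.comult_linear])

lemma canonical_right_inverse: "a \<in> carrier A \<Longrightarrow> canonical_map K A j (canonical_inverse a) = a"
  unfolding canonical_inverse_def
  using AA.embed_comult[OF RH_module canonical_linear, of a "\<lambda>a1 a2. tens K R H (proj a1) (\<pi> a2)" proj "\<lambda>a. j (\<pi> a)"]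
  by (simp add: canonical_tens proj_mem proj_j\<pi>)

text \<open>\<open>proj\<close> absorbs \<open>j(h\<^sub>1)\<close> and leaves a counit, so
  \<open>h\<close> itself survives in the second leg; then \<open>conv_coinv\<close> evaluates the
  factor \<open>\<pi>(r\<^sub>2)\<close> at 1.\<close>

lemma canonical_inverse_mult:
  assumes r: "r \<in> coinv" and h: "h \<in> carrier H"
  shows "canonical_inverse (r \<otimes>\<^bsub>A\<^esub> j h) = tens K R H r h"
proof -
  have rc: "r \<in> carrier A" using r by simp
  note b = canonical_inverse_bilinear
  have inner: "tlift K RH (\<lambda>y1 y2. tens K R H (proj (x1 \<otimes>\<^bsub>A\<^esub> y1)) (\<pi> (x2 \<otimes>\<^bsub>A\<^esub> y2))) (comult A (j h))
    = tens K R H (proj x1) (\<pi> x2 \<otimes>\<^bsub>H\<^esub> h)" if x: "x1 \<in> carrier A" "x2 \<in> carrier A" for x1 x2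
  proof -
    interpret RH: module K RH by (rule RH_module)
    have lx: "(\<lambda>y. x2 \<otimes>\<^bsub>A\<^esub> y) \<in> linear_hom K A A" "(\<lambda>y. x1 \<otimes>\<^bsub>A\<^esub> y) \<in> linear_hom K A A"
      by (rule linear_mult_right[OF A.A_algebra linear_id]; rule x)+
    have l: "(\<lambda>h2. tens K R H (proj x1) (\<pi> x2 \<otimes>\<^bsub>H\<^esub> h2)) \<in> linear_hom K H RH"
      by (rule linear_tens_right[OF R_module H.A_module linear_mult_right[OF H.A_algebra linear_id]])
        (simp_all add: x proj_mem)
    have "tlift K RH (\<lambda>y1 y2. tens K R H (proj (x1 \<otimes>\<^bsub>A\<^esub> y1)) (\<pi> (x2 \<otimes>\<^bsub>A\<^esub> y2))) (comult A (j h))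
      = tlift K RH (\<lambda>h1 h2. tens K R H (proj (x1 \<otimes>\<^bsub>A\<^esub> j h1)) (\<pi> (x2 \<otimes>\<^bsub>A\<^esub> j h2))) (comult H h)"
      by (rule tlift_comult_hom[OF j_hom RH_module bilinear_tens[OF R_module H.A_module
            linear_comp[OF proj_linear_R lx(2)] linear_comp[OF \<pi>_linear lx(1)]] h])
    also have "\<dots> = tlift K RH (\<lambda>h1 h2. counit H h1 \<odot>\<^bsub>RH\<^esub> tens K R H (proj x1) (\<pi> x2 \<otimes>\<^bsub>H\<^esub> h2)) (comult H h)"
      by (rule tlift_cong[OF H.A_module H.A_module RH_module H.comult_closed[OF h]])
        (use x linear_smult[OF bilinear_left[OF tens_bilinear[OF R_module H.A_module]]] in
          \<open>simp_all add: proj_mem proj_mult_j\<close>)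
    also have "\<dots> = tens K R H (proj x1) (\<pi> x2 \<otimes>\<^bsub>H\<^esub> h)"
      by (rule H.counit_left_linear[OF RH_module l h])
    finally show ?thesis .
  qed
  \<comment> \<open>\<open>conv_coinv\<close> is about values in an algebra, so the tensors are
    rewritten as products in the algebra \<open>R \<otimes> H\<close>.\<close>
  define B where "B = tensor_algebra K R H"
  have B: "k_algebra K B" by (simp add: B_def)
  define iR iH' where "iR = inl K R H" and "iH' = inr K R H"
  have iR: "iR \<in> algebra_hom K R B" and iH': "iH' \<in> algebra_hom K H B"
    unfolding iR_def iH'_def B_def by (simp_all add: inl_algebra_hom inr_algebra_hom)
  have ii: "iR x \<otimes>\<^bsub>B\<^esub> iH' y = tens K R H x y" if "x \<in> coinv" "y \<in> carrier H" for x y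
    using that by (simp add: iR_def iH'_def B_def inl_inr)
  have tB: "tlift K B = tlift K RH" by (simp add: B_def)
  have lF: "(\<lambda>a. iR (proj a)) \<in> linear_hom K A B" by (rule linear_comp[OF algebra_homD(1)[OF iR] proj_linear_R])
  have lG: "(\<lambda>x. iH' (x \<otimes>\<^bsub>H\<^esub> h)) \<in> linear_hom K H B"
    by (rule linear_comp[OF algebra_homD(1)[OF iH'] linear_mult_left[OF H.A_algebra linear_id h]])
  have "canonical_inverse (r \<otimes>\<^bsub>A\<^esub> j h) = tlift K RH (\<lambda>x1 x2. tlift K RH (\<lambda>y1 y2.
      tens K R H (proj (x1 \<otimes>\<^bsub>A\<^esub> y1)) (\<pi> (x2 \<otimes>\<^bsub>A\<^esub> y2))) (comult A (j h))) (comult A r)"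
    unfolding canonical_inverse_def
    by (rule A.tlift_comult_mult[OF RH_module b rc algebra_homD(4)[OF j_algebra_hom h]])
  also have "\<dots> = tlift K RH (\<lambda>x1 x2. iR (proj x1) \<otimes>\<^bsub>B\<^esub> iH' (\<pi> x2 \<otimes>\<^bsub>H\<^esub> h)) (comult A r)"
    by (rule tlift_cong[OF A.A_module A.A_module RH_module A.comult_closed[OF rc], symmetric])
      (simp_all only: inner ii proj_mem \<pi>_simps H.m_closed h tens_closed R_module H.A_module R_simps)
  also have "\<dots> = conv K A B (\<lambda>a. iR (proj a)) (\<lambda>a. iH' (\<pi> a \<otimes>\<^bsub>H\<^esub> h)) r"
    using rc by (simp add: conv_def tB)
  also have "\<dots> = iR (proj r) \<otimes>\<^bsub>B\<^esub> iH' (\<one>\<^bsub>H\<^esub> \<otimes>\<^bsub>H\<^esub> h)"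
    by (rule conv_coinv[OF r B lF lG])
  also have "\<dots> = tens K R H r h" using r h by (simp add: ii proj_coinv_id)
  finally show ?thesis .
qed

lemma canonical_left_inverse:
  assumes t: "t \<in> carrier RH"
  shows "canonical_inverse (canonical_map K A j t) = t"
  by (rule linear_ext_tensor[OF R_module H.A_module linear_comp[OF canonical_inverse_linear canonical_linear] linear_id _ t])
    (simp add: canonical_tens canonical_inverse_mult)

lemma RH_tlift_closed:
  assumes "t \<in> carrier RH" "module K X" "\<And>r h. \<lbrakk>r \<in> coinv; h \<in> carrier H\<rbrakk> \<Longrightarrow> F r h \<in> carrier X"
  shows "tlift K X F t \<in> carrier X"
  by (rule tlift_closed[OF R_module H.A_module assms(2,1)]) (use assms(3) in simp)

text \<open>The action in the product of the bi-product is what \<open>conv_ad_j\<close> produces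
  when \<open>j h\<close> moves past \<open>r'\<close>.\<close>

lemma canonical_mult:
  assumes t: "t \<in> carrier RH" and u: "u \<in> carrier RH"
  shows "t \<otimes>\<^bsub>biproduct K R H\<^esub> u \<in> carrier RH"
    and "canonical_map K A j (t \<otimes>\<^bsub>biproduct K R H\<^esub> u) = canonical_map K A j t \<otimes>\<^bsub>A\<^esub> canonical_map K A j u"
proof -
  let ?f = "canonical_map K A j"
  define X where "X = (\<lambda>r h r' h'. tlift K RH (\<lambda>h1 h2. tens K R H (r \<otimes>\<^bsub>R\<^esub> act R h1 r') (h2 \<otimes>\<^bsub>H\<^esub> h')) (comult H h))"
  have X: "X r h r' h' \<in> carrier RH" if "r \<in> coinv" "h \<in> carrier H" "r' \<in> coinv" "h' \<in> carrier H" for r h r' h'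
    unfolding X_def using that by (intro comultH_tlift_closed RH_module) (simp_all add: ad_coinv coinv_mult)
  have m: "t \<otimes>\<^bsub>biproduct K R H\<^esub> u = tlift K RH (\<lambda>r h. tlift K RH (X r h) u) t"
    unfolding biproduct_mult X_def ..
  have Y: "tlift K RH (X r h) u \<in> carrier RH" if "r \<in> coinv" "h \<in> carrier H" for r h
    by (rule RH_tlift_closed[OF u RH_module X[OF that]])
  show "t \<otimes>\<^bsub>biproduct K R H\<^esub> u \<in> carrier RH"
    unfolding m by (rule RH_tlift_closed[OF t RH_module Y])
  have fX: "?f (X r h r' h') = (r \<otimes>\<^bsub>A\<^esub> j h) \<otimes>\<^bsub>A\<^esub> (r' \<otimes>\<^bsub>A\<^esub> j h')"
    if c: "r \<in> coinv" "h \<in> carrier H" "r' \<in> coinv" "h' \<in> carrier H" for r h r' h'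
  proof -
    have cc: "r \<in> carrier A" "r' \<in> carrier A" "j h' \<in> carrier A" using c by simp_all
    note l = ad_linear_left[OF cc(2)] linear_mult_left[OF A.A_algebra j_linear cc(3)]
    have "?f (X r h r' h') = conv K H A (\<lambda>h1. r \<otimes>\<^bsub>A\<^esub> ad h1 r') (\<lambda>h2. j h2 \<otimes>\<^bsub>A\<^esub> j h') h"
      unfolding X_def
      by (rule HA.embed_comult[OF RH_module canonical_linear c(2)])
        (use c in \<open>simp_all add: ad_coinv coinv_mult canonical_tens A.m_assoc\<close>)
    also have "\<dots> = r \<otimes>\<^bsub>A\<^esub> conv K H A (\<lambda>h1. ad h1 r') (\<lambda>h2. j h2 \<otimes>\<^bsub>A\<^esub> j h') h"
      by (rule HA.conv_left[OF l cc(1) c(2)])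
    also have "conv K H A (\<lambda>h1. ad h1 r') (\<lambda>h2. j h2 \<otimes>\<^bsub>A\<^esub> j h') h = conv K H A (\<lambda>h1. ad h1 r') j h \<otimes>\<^bsub>A\<^esub> j h'"
      by (rule HA.conv_right[OF l(1) j_linear cc(3) c(2)])
    finally show ?thesis using c cc by (simp add: conv_ad_j A.m_assoc)
  qed
  have fY: "?f (tlift K RH (X r h) u) = (r \<otimes>\<^bsub>A\<^esub> j h) \<otimes>\<^bsub>A\<^esub> ?f u" if c: "r \<in> coinv" "h \<in> carrier H" for r h
  proof -
    have cc: "r \<otimes>\<^bsub>A\<^esub> j h \<in> carrier A" using c by simp
    have "?f (tlift K RH (X r h) u) = tlift K A (\<lambda>r' h'. (r \<otimes>\<^bsub>A\<^esub> j h) \<otimes>\<^bsub>A\<^esub> (r' \<otimes>\<^bsub>A\<^esub> j h')) u"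
      by (rule HA.embed_tlift[OF RH_module R_module H.A_module canonical_linear u]) (use c X fX in simp_all)
    also have "\<dots> = (r \<otimes>\<^bsub>A\<^esub> j h) \<otimes>\<^bsub>A\<^esub> ?f u"
      unfolding canonical_map_def
      by (rule linear_tlift[OF R_module H.A_module A.A_module A.A_module linear_mult_right[OF A.A_algebra linear_id cc] u, symmetric])
        simp
    finally show ?thesis .
  qed
  have "?f (t \<otimes>\<^bsub>biproduct K R H\<^esub> u) = tlift K A (\<lambda>r h. (r \<otimes>\<^bsub>A\<^esub> j h) \<otimes>\<^bsub>A\<^esub> ?f u) t"
    unfolding m
    by (rule HA.embed_tlift[OF RH_module R_module H.A_module canonical_linear t]) (use Y fY in simp_all)
  also have "\<dots> = ?f t \<otimes>\<^bsub>A\<^esub> ?f u"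
    unfolding canonical_map_def[of K A j, THEN fun_cong, of t]
    by (rule linear_tlift[OF R_module H.A_module A.A_module A.A_module
          linear_mult_left[OF A.A_algebra linear_id linear_closed[OF canonical_linear u]] t, symmetric]) simp
  finally show "?f (t \<otimes>\<^bsub>biproduct K R H\<^esub> u) = ?f t \<otimes>\<^bsub>A\<^esub> ?f u" .
qed

text \<open>Applying the canonical map to both tensor factors embeds into \<open>T2\<close>, where
  the four nested sums collapse: the inner one is \<open>comult A (j h)\<close>, and
  \<open>proj\<close> convolved with \<open>j \<circ> \<pi>\<close> restores
  \<open>comult A r\<close>.\<close>

lemma canonical_comult:
  assumes t: "t \<in> carrier RH"
  shows "comult (biproduct K R H) t = tlift K (tensor_space K RH RH)
    (\<lambda>a b. tens K RH RH (canonical_inverse a) (canonical_inverse b)) (comult A (canonical_map K A j t))"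
proof -
  let ?f = "canonical_map K A j" and ?g = canonical_inverse and ?TT = "tensor_space K RH RH"
  let ?E = "tlift K T2 (\<lambda>s t. v1 (?f s) \<otimes>\<^bsub>T2\<^esub> v2 (?f t))"
  let ?P = "tlift K ?TT (\<lambda>a b. tens K RH RH (?g a) (?g b))"
  note vf = linear_comp[OF v1_linear canonical_linear] linear_comp[OF v2_linear canonical_linear]
  note bE = bilinear_mult[OF T2_algebra vf]
  note bP = bilinear_tens[OF RH_module RH_module canonical_inverse_linear canonical_inverse_linear]
  have E: "?E \<in> linear_hom K ?TT T2" by (rule tlift_linear[OF RH_module RH_module AT.B_module bE])
  have Et: "?E (tens K RH RH s w) = v1 (?f s) \<otimes>\<^bsub>T2\<^esub> v2 (?f w)" if "s \<in> carrier RH" "w \<in> carrier RH" for s w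
    by (rule tlift_tens[OF RH_module RH_module AT.B_module bE that])
  have P: "?P \<in> linear_hom K T2 ?TT" by (rule tlift_T2_linear[OF bP RH2_module])
  have PE: "?P (?E z) = z" if z: "z \<in> carrier ?TT" for z
    by (rule linear_ext_tensor[OF RH_module RH_module linear_comp[OF P E] linear_id _ z])
      (simp only: Et tlift_T2[OF bP RH2_module] linear_closed[OF canonical_linear] canonical_left_inverse)
  let ?in = "\<lambda>h r1 x y. tlift K ?TT (\<lambda>h1 h2. tens K RH RH (tens K R H r1 (x \<otimes>\<^bsub>H\<^esub> h1)) (tens K R H y h2)) (comult H h)"
  let ?co = "\<lambda>h r1 r2. tlift K ?TT (?in h r1) (coact R r2)"
  let ?Y = "\<lambda>r h. tlift K ?TT (?co h) (yd_comult R r)"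
  have cl1: "?in h r1 x y \<in> carrier ?TT" if "h \<in> carrier H" "r1 \<in> coinv" "x \<in> carrier H" "y \<in> coinv" for h r1 x y
    using that by (intro comultH_tlift_closed RH2_module) simp_all
  have cl2: "?co h r1 r2 \<in> carrier ?TT" if "h \<in> carrier H" "r1 \<in> coinv" "r2 \<in> coinv" for h r1 r2
    using that by (intro coact_tlift_closed RH2_module cl1)
  have cl3: "?Y r h \<in> carrier ?TT" if "r \<in> coinv" "h \<in> carrier H" for r h
    using that by (intro comultR_tlift_closed RH2_module cl2)
  have c: "comult (biproduct K R H) t = tlift K ?TT ?Y t"
    by (simp add: biproduct_comult Let_def)
  note vj = linear_comp[OF v1_linear j_linear] linear_comp[OF v2_linear j_linear]
  note vj\<pi> = linear_comp[OF v1_linear j\<pi>_linear] and vp = linear_comp[OF v1_linear proj_linear]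
  have hom: "v1 (x \<otimes>\<^bsub>A\<^esub> y) = v1 x \<otimes>\<^bsub>T2\<^esub> v1 y" "v2 (x \<otimes>\<^bsub>A\<^esub> y) = v2 x \<otimes>\<^bsub>T2\<^esub> v2 y"
    if "x \<in> carrier A" "y \<in> carrier A" for x y
    using that by (simp_all add: algebra_homD(3)[OF v1_hom] algebra_homD(3)[OF v2_hom])
  have \<Delta>j: "conv K H T2 (\<lambda>h. v1 (j h)) (\<lambda>h. v2 (j h)) h = comult A (j h)" if h: "h \<in> carrier H" for h
    using conv_precomp[OF j_hom T2_algebra v1_linear v2_linear h] h by (simp add: comult_v)
  have Y1: "?E (?in h r1 x y) = v1 r1 \<otimes>\<^bsub>T2\<^esub> v1 (j x) \<otimes>\<^bsub>T2\<^esub> (v2 y \<otimes>\<^bsub>T2\<^esub> comult A (j h))"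
    if m: "h \<in> carrier H" "r1 \<in> coinv" "x \<in> carrier H" "y \<in> coinv" for h r1 x y
  proof -
    let ?c = "v1 r1 \<otimes>\<^bsub>T2\<^esub> v1 (j x) \<otimes>\<^bsub>T2\<^esub> v2 y"
    have cc: "r1 \<in> carrier A" "y \<in> carrier A" using m by simp_all
    have c: "?c \<in> carrier T2" using m cc by (simp add: AT.B.m_closed)
    have "?E (?in h r1 x y) = conv K H T2 (\<lambda>h1. ?c \<otimes>\<^bsub>T2\<^esub> v1 (j h1)) (\<lambda>h2. v2 (j h2)) h"
    proof (rule HT.embed_comult[OF RH2_module E m(1)])
      fix h1 h2 assume hh: "h1 \<in> carrier H" "h2 \<in> carrier H"
      show "tens K RH RH (tens K R H r1 (x \<otimes>\<^bsub>H\<^esub> h1)) (tens K R H y h2) \<in> carrier ?TT" using m hh by simp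
      have com: "v2 y \<otimes>\<^bsub>T2\<^esub> (v1 (j h1) \<otimes>\<^bsub>T2\<^esub> w) = v1 (j h1) \<otimes>\<^bsub>T2\<^esub> (v2 y \<otimes>\<^bsub>T2\<^esub> w)" if "w \<in> carrier T2" for w
        using that cc hh by (simp add: AT.B.m_assoc[symmetric] v_commute)
      show "?E (tens K RH RH (tens K R H r1 (x \<otimes>\<^bsub>H\<^esub> h1)) (tens K R H y h2)) = ?c \<otimes>\<^bsub>T2\<^esub> v1 (j h1) \<otimes>\<^bsub>T2\<^esub> v2 (j h2)"
        using m hh cc by (simp add: Et canonical_tens hom AT.B.m_assoc AT.B.m_closed com)
    qed
    also have "\<dots> = ?c \<otimes>\<^bsub>T2\<^esub> conv K H T2 (\<lambda>h. v1 (j h)) (\<lambda>h. v2 (j h)) h"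
      by (rule HT.conv_left[OF vj c m(1)])
    also have "\<dots> = ?c \<otimes>\<^bsub>T2\<^esub> comult A (j h)" by (simp only: \<Delta>j m)
    finally show ?thesis using m cc comult_closed_T2[of "j h"] by (simp add: AT.B.m_assoc AT.B.m_closed)
  qed
  \<comment> \<open>The coaction with \<open>j\<close> applied to its leg in \<open>H\<close>.
    Convolved with \<open>v1 \<circ> proj\<close> it gives back the coproduct of
    \<open>A\<close>.\<close>
  define V where "V = conv K A T2 (\<lambda>a. v1 (j (\<pi> a))) v2"
  have V: "V \<in> linear_hom K A T2" unfolding V_def by (rule AT.conv_linear[OF vj\<pi> v2_linear])
  have Y2: "?E (?co h r1 r2) = v1 r1 \<otimes>\<^bsub>T2\<^esub> (V r2 \<otimes>\<^bsub>T2\<^esub> comult A (j h))"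
    if m: "h \<in> carrier H" "r1 \<in> coinv" "r2 \<in> coinv" for h r1 r2
  proof -
    have cc: "v1 r1 \<in> carrier T2" "r2 \<in> carrier A" "comult A (j h) \<in> carrier T2"
      using m comult_closed_T2[of "j h"] by simp_all
    note l2 = linear_mult_left[OF T2_algebra v2_linear cc(3)]
    have "?E (?co h r1 r2) = conv K A T2 (\<lambda>a. v1 r1 \<otimes>\<^bsub>T2\<^esub> v1 (j (\<pi> a))) (\<lambda>a. v2 a \<otimes>\<^bsub>T2\<^esub> comult A (j h)) r2"
      by (rule embed_coact[OF T2_algebra RH2_module E m(3) linear_mult_right[OF T2_algebra vj(1) cc(1)] l2 cl1[OF m(1,2)] Y1[OF m(1,2)]])
    also have "\<dots> = v1 r1 \<otimes>\<^bsub>T2\<^esub> conv K A T2 (\<lambda>a. v1 (j (\<pi> a))) (\<lambda>a. v2 a \<otimes>\<^bsub>T2\<^esub> comult A (j h)) r2"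
      by (rule AT.conv_left[OF vj\<pi> l2 cc(1,2)])
    also have "conv K A T2 (\<lambda>a. v1 (j (\<pi> a))) (\<lambda>a. v2 a \<otimes>\<^bsub>T2\<^esub> comult A (j h)) r2 = V r2 \<otimes>\<^bsub>T2\<^esub> comult A (j h)"
      unfolding V_def by (rule AT.conv_right[OF vj\<pi> v2_linear cc(3,2)])
    finally show ?thesis .
  qed
  have pj: "conv K A T2 (\<lambda>a. v1 (proj a)) (\<lambda>a. v1 (j (\<pi> a))) = restrict v1 (carrier A)"
  proof
    show "conv K A T2 (\<lambda>a. v1 (proj a)) (\<lambda>a. v1 (j (\<pi> a))) a = restrict v1 (carrier A) a" for a
      using AA.conv_hom[OF T2_algebra v1_hom proj_linear j\<pi>_linear, of a]
      by (cases "a \<in> carrier A") (simp only: proj_j\<pi> restrict_apply', simp add: conv_def)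
  qed
  have "conv K A T2 (\<lambda>a. v1 (proj a)) V = conv K A T2 (conv K A T2 (\<lambda>a. v1 (proj a)) (\<lambda>a. v1 (j (\<pi> a)))) v2"
    unfolding V_def by (rule AT.conv_assoc[OF vp vj\<pi> v2_linear, symmetric])
  also have "\<dots> = conv K A T2 v1 v2" unfolding pj by (rule AT.conv_restrict(1)[OF v1_linear v2_linear])
  finally have pV: "conv K A T2 (\<lambda>a. v1 (proj a)) V = conv K A T2 v1 v2" .
  have Y3: "?E (?Y r h) = comult A (r \<otimes>\<^bsub>A\<^esub> j h)" if m: "r \<in> coinv" "h \<in> carrier H" for r h
  proof -
    have cc: "r \<in> carrier A" "j h \<in> carrier A" "comult A (j h) \<in> carrier T2"
      using m comult_closed_T2[of "j h"] by simp_all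
    have "?E (?Y r h) = conv K A T2 (\<lambda>a. v1 (proj a)) (\<lambda>a. V a \<otimes>\<^bsub>T2\<^esub> comult A (j h)) r"
      by (rule embed_comultR[OF T2_algebra RH2_module E m(1) v1_linear linear_mult_left[OF T2_algebra V cc(3)]])
        (rule cl2[OF m(2)] Y2[OF m(2)]; assumption)+
    also have "\<dots> = conv K A T2 (\<lambda>a. v1 (proj a)) V r \<otimes>\<^bsub>T2\<^esub> comult A (j h)"
      by (rule AT.conv_right[OF vp V cc(3,1)])
    also have "\<dots> = comult A r \<otimes>\<^bsub>T2\<^esub> comult A (j h)" by (simp only: pV comult_v[OF cc(1), symmetric])
    also have "\<dots> = comult A (r \<otimes>\<^bsub>A\<^esub> j h)" by (rule algebra_homD(3)[OF comult_hom_T2 cc(1,2), symmetric])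
    finally show ?thesis .
  qed
  have "?E (comult (biproduct K R H) t) = tlift K T2 (\<lambda>r h. comult A (r \<otimes>\<^bsub>A\<^esub> j h)) t"
    unfolding c by (rule HT.embed_tlift[OF RH2_module R_module H.A_module E t]) (use cl3 Y3 in simp_all)
  also have "\<dots> = comult A (?f t)"
    unfolding canonical_map_def
    by (rule linear_tlift[OF R_module H.A_module A.A_module AT.B_module comult_linear_T2 t, symmetric]) simp
  finally have e: "?E (comult (biproduct K R H) t) = comult A (?f t)" .
  have "comult (biproduct K R H) t \<in> carrier ?TT"
    unfolding c by (rule RH_tlift_closed[OF t RH2_module cl3])
  then have "?P (?E (comult (biproduct K R H) t)) = comult (biproduct K R H) t" by (rule PE)
  then show ?thesis unfolding e by (rule sym)
qed

lemma canonical_iso: "canonical_map K A j \<in> bialgebra_iso K (biproduct K R H) A"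
proof (rule bialgebra_transport[where g = canonical_inverse, OF A.bialgebra_axioms])
  show "module K (biproduct K R H)" by (rule module_cong[OF _ _ _ _ RH_module]) simp_all
  fix t assume "t \<in> carrier (biproduct K R H)"
  then have t: "t \<in> carrier RH" by simp
  show "comult (biproduct K R H) t = tlift K (tensor_space K (biproduct K R H) (biproduct K R H))
      (\<lambda>a b. tens K (biproduct K R H) (biproduct K R H) (canonical_inverse a) (canonical_inverse b))
      (comult A (canonical_map K A j t))"
    using canonical_comult[OF t] by simp
  have "counit A (canonical_map K A j t) = tlift K (self_module K) (\<lambda>r h. counit A (r \<otimes>\<^bsub>A\<^esub> j h)) t"
    unfolding canonical_map_def
    by (rule linear_tlift[OF R_module H.A_module A.A_module module_self A.counit_linear t]) simp
  also have "\<dots> = counit (biproduct K R H) t"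
    unfolding biproduct_counit
    by (rule tlift_cong[OF R_module H.A_module module_self t]) (simp_all add: A.counit_mult)
  finally show "counit (biproduct K R H) t = counit A (canonical_map K A j t)" by simp
  show "canonical_inverse (canonical_map K A j t) = t" by (rule canonical_left_inverse[OF t])
qed (simp_all add: canonical_linear canonical_inverse_linear canonical_right_inverse canonical_mult
    canonical_tens coinv_one)

end

text \<open>With \<open>F\<close> the inverse of \<open>f\<close>, the map \<open>\<phi>\<close>
  agrees with \<open>F \<circ> g\<close>. Its algebra properties are tested after the injective
  \<open>f\<close>; for the coproduct \<open>F\<close> is applied to the legs.\<close>

lemma bialgebra_iso_factor:
  assumes f: "f \<in> bialgebra_iso K Y Z" and g: "g \<in> bialgebra_iso K X Z"
    and c: "\<And>x. x \<in> carrier X \<Longrightarrow> \<phi> x \<in> carrier Y" and eq: "\<And>x. x \<in> carrier X \<Longrightarrow> f (\<phi> x) = g x"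
  shows "\<phi> \<in> bialgebra_iso K X Y"
proof -
  have fh: "f \<in> bialgebra_hom K Y Z" and bf: "bij_betw f (carrier Y) (carrier Z)"
    and gh: "g \<in> bialgebra_hom K X Z" and bg: "bij_betw g (carrier X) (carrier Z)"
    using f g by (simp_all add: bialgebra_iso_def)
  note fD = bialgebra_homD[OF fh] and gD = bialgebra_homD[OF gh]
  note fa = algebra_homD[OF fD(1)] and ga = algebra_homD[OF gD(1)]
  interpret X: bialgebra K X by (rule gD(3))
  interpret Y: bialgebra K Y by (rule fD(3))
  interpret Z: bialgebra K Z by (rule fD(4))
  define F where "F = inv_into (carrier Y) f"
  have F: "F \<in> linear_hom K Z Y" unfolding F_def by (rule linear_inv_into[OF Y.A_module fD(2) bf])
  have Ff: "F (f y) = y" if "y \<in> carrier Y" for y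
    using bf that unfolding F_def by (simp add: bij_betw_def)
  have Fg: "F (g x) = \<phi> x" if "x \<in> carrier X" for x
    using Ff[OF c[OF that]] by (simp add: eq that)
  have inj: "x = y" if "f x = f y" "x \<in> carrier Y" "y \<in> carrier Y" for x y
    using Ff that by metis
  have YY: "module K (tensor_space K Y Y)" by simp
  have bFF: "bilinear K Z Z (tensor_space K Y Y) (\<lambda>a b. tens K Y Y (F a) (F b))"
    by (rule X.bilinear_tens[OF Y.A_module Y.A_module F F])
  have "\<phi> \<in> algebra_hom K X Y"
    by (rule algebra_homI, rule linear_homI; (rule inj)?)
      (simp_all add: c eq fa(2,3) ga(2,3) linear_add[OF fD(2)] linear_add[OF gD(2)]
        linear_smult[OF fD(2)] linear_smult[OF gD(2)])
  moreover have "comult Y (\<phi> x) = tlift K (tensor_space K Y Y) (\<lambda>a b. tens K Y Y (\<phi> a) (\<phi> b)) (comult X x)"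
    if x: "x \<in> carrier X" for x
  proof -
    note xc = X.comult_closed[OF x] and yc = Y.comult_closed[OF c[OF x]]
    have "comult Y (\<phi> x) = tlift K (tensor_space K Y Y) (tens K Y Y) (comult Y (\<phi> x))"
      by (rule X.tlift_self[OF Y.A_module Y.A_module yc, symmetric])
    also have "\<dots> = tlift K (tensor_space K Y Y) (\<lambda>a b. tens K Y Y (F (f a)) (F (f b))) (comult Y (\<phi> x))"
      by (rule X.tlift_cong[OF Y.A_module Y.A_module YY yc]) (simp_all add: Ff)
    also have "\<dots> = tlift K (tensor_space K Y Y) (\<lambda>a b. tens K Y Y (F a) (F b)) (comult Z (f (\<phi> x)))"
      by (rule tlift_comult_hom[OF fh YY bFF c[OF x], symmetric])
    also have "\<dots> = tlift K (tensor_space K Y Y) (\<lambda>a b. tens K Y Y (F (g a)) (F (g b))) (comult X x)"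
      unfolding eq[OF x] by (rule tlift_comult_hom[OF gh YY bFF x])
    also have "\<dots> = tlift K (tensor_space K Y Y) (\<lambda>a b. tens K Y Y (\<phi> a) (\<phi> b)) (comult X x)"
      by (rule X.tlift_cong[OF X.A_module X.A_module YY xc]) (simp_all add: Fg c)
    finally show ?thesis .
  qed
  moreover have "counit Y (\<phi> x) = counit X x" if x: "x \<in> carrier X" for x
    using fD(6)[OF c[OF x]] gD(6)[OF x] by (simp add: eq x)
  moreover have "bij_betw \<phi> (carrier X) (carrier Y)"
  proof -
    have "bij_betw (F \<circ> g) (carrier X) (carrier Y)"
      unfolding F_def by (rule bij_betw_trans[OF bg bij_betw_inv_into[OF bf]])
    moreover have "bij_betw (F \<circ> g) (carrier X) (carrier Y) \<longleftrightarrow> bij_betw \<phi> (carrier X) (carrier Y)"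
      by (rule bij_betw_cong) (simp add: Fg)
    ultimately show ?thesis by simp
  qed
  ultimately show ?thesis
    using fD(3) gD(3) by (simp add: bialgebra_iso_def bialgebra_hom_def)
qed

section \<open>The bialgebra associated to the opposite data\<close>

lemma (in hopf_projection) assoc_bialgebra_yd:
  "hopf_projection_yd K H S A j \<pi> (assoc_bialgebra K A H S j \<pi>)"
  by unfold_locales (simp_all add: assoc_bialgebra_def Let_def coinv_def proj_def ad_def)

lemma op_yd_simps [simp]:
  "carrier (op_yd K H S R) = carrier R" "zero (op_yd K H S R) = zero R" "add (op_yd K H S R) = add R"
  "smult (op_yd K H S R) = smult R" "one (op_yd K H S R) = one R"
  "mult (op_yd K H S R) = (\<lambda>x y. y \<otimes>\<^bsub>R\<^esub> x)" "coact (op_yd K H S R) = coact R"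
  "act (op_yd K H S R) = (\<lambda>h. act R (inv_into (carrier H) S h))" "yd_counit (op_yd K H S R) = yd_counit R"
  by (simp_all add: op_yd_def Let_def)

lemma op_yd_comult: "yd_comult (op_yd K H S R) r = tlift K (tensor_space K R R) (\<lambda>r1 r2.
    tlift K (tensor_space K R R) (\<lambda>x y. tens K R R (act R (inv_into (carrier H) S x) r1) y) (coact R r2)) (yd_comult R r)"
  by (simp add: op_yd_def Let_def)

lemma op_alg_carrier_normalize:
  "tensor_space K V ((op_alg A)\<lparr>carrier := C\<rparr>) = tensor_space K V (A\<lparr>carrier := C\<rparr>)"
  "tens K V ((op_alg A)\<lparr>carrier := C\<rparr>) = tens K V (A\<lparr>carrier := C\<rparr>)"
  "tensor_space K ((op_alg A)\<lparr>carrier := C\<rparr>) V = tensor_space K (A\<lparr>carrier := C\<rparr>) V"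
  "tens K ((op_alg A)\<lparr>carrier := C\<rparr>) V = tens K (A\<lparr>carrier := C\<rparr>) V"
  by (rule tensor_cong; simp)+

lemma op_alg_tensor_restrict:
  "tensor_restrict K (op_alg H) (op_alg A) (op_alg H) ((op_alg A)\<lparr>carrier := C\<rparr>)
    = tensor_restrict K H A H (A\<lparr>carrier := C\<rparr>)"
  "tensor_restrict K (op_alg A) (op_alg A) ((op_alg A)\<lparr>carrier := C\<rparr>) ((op_alg A)\<lparr>carrier := C\<rparr>)
    = tensor_restrict K A A (A\<lparr>carrier := C\<rparr>) (A\<lparr>carrier := C\<rparr>)"
  by (simp_all add: tensor_restrict_def[abs_def] op_alg_carrier_normalize)

locale hopf_projection_op = hopf_projection_yd +
  assumes S_bij: "bij_betw S (carrier H) (carrier H)"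
begin

abbreviation "S' \<equiv> inv_into (carrier H) S"
abbreviation "Rop \<equiv> op_yd K H S R"

lemma S'_closed [simp]: "h \<in> carrier H \<Longrightarrow> S' h \<in> carrier H" and S_S' [simp]: "h \<in> carrier H \<Longrightarrow> S (S' h) = h"
  using S_bij by (auto simp: bij_betw_def inv_into_into f_inv_into_f)

lemma S'_linear: "S' \<in> linear_hom K H H"
  by (rule linear_inv_into[OF H.A_module H.antipode_linear S_bij])

lemma op_hopf_projection: "hopf_projection K (op_alg H) S' (op_alg A) j \<pi>"
  by (intro hopf_projection.intro hopf_projection_axioms.intro field_axioms op_hopf_algebra[OF H.hopf_algebra_axioms S_bij]
      op_bialgebra A.bialgebra_axioms op_bialgebra_hom j_hom \<pi>_hom) simp

text \<open>All notions of the projection become available for the opposite data under the prefix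
  \<open>O\<close>; \<open>O.ad\<close> and \<open>O.proj\<close> are formed with the inverse
  antipode.\<close>

sublocale O: hopf_projection K "op_alg H" S' "op_alg A" j \<pi>
  by (rule op_hopf_projection)


lemma op_coinv: "O.coinv = coinv"
  unfolding O.coinv_def coinv_def coinvariants_def op_alg_normalize op_alg_simps ..

text \<open>\<open>S'\<close> is the antipode of the opposite Hopf algebra and therefore reverses
  the coproduct; the factor \<open>S (S' h1)\<close> that arises in the adjoint action is
  \<open>h1\<close>.\<close>

lemma ad_S':
  assumes h: "h \<in> carrier H" and a: "a \<in> carrier A"
  shows "ad (S' h) a = O.ad h a"
proof -
  note m = H.A_module H.A_module
  have b: "bilinear K H H A (\<lambda>h1 h2. j h1 \<otimes>\<^bsub>A\<^esub> a \<otimes>\<^bsub>A\<^esub> j (S h2))"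
    by (rule bilinear_mult[OF A.A_algebra linear_mult_left[OF A.A_algebra j_linear a] jS_linear])
  have d: "comult H (S' h) = tlift K (tensor_space K H H) (\<lambda>h1 h2. tens K H H (S' h2) (S' h1)) (comult H h)"
    using O.H.antipode_comult[of h] h by simp
  have "ad (S' h) a = tlift K A (\<lambda>h1 h2. tlift K A (\<lambda>h1 h2. j h1 \<otimes>\<^bsub>A\<^esub> a \<otimes>\<^bsub>A\<^esub> j (S h2))
      (tens K H H (S' h2) (S' h1))) (comult H h)"
    unfolding ad_def d by (rule tlift_tlift[OF m m A.A_module b _ H.comult_closed[OF h]]) simp
  also have "\<dots> = tlift K A (\<lambda>h1 h2. j (S' h2) \<otimes>\<^bsub>A\<^esub> (a \<otimes>\<^bsub>A\<^esub> j h1)) (comult H h)"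
    by (rule tlift_cong[OF m A.A_module H.comult_closed[OF h], symmetric])
      (simp_all add: a tlift_tens[OF m A.A_module b] A.m_assoc)
  also have "\<dots> = O.ad h a" by (simp add: O.ad_def)
  finally show ?thesis .
qed

lemma op_proj: "O.proj a = tlift K A (\<lambda>a1 a2. j (S' (\<pi> a2)) \<otimes>\<^bsub>A\<^esub> a1) (comult A a)"
  by (simp add: O.proj_def assoc_proj_def)

lemma jS'\<pi>_linear: "(\<lambda>a. j (S' (\<pi> a))) \<in> linear_hom K A A"
  by (rule linear_comp[OF j_linear linear_comp[OF S'_linear \<pi>_linear]])

text \<open>Rewriting the action by \<open>ad_S'\<close> gives
  \<open>j(S'(\<pi>(a\<^sub>3))) proj(a\<^sub>1) j(\<pi>(a\<^sub>2))\<close>, and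
  \<open>proj_j\<pi>\<close> joins the last two factors into one leg.\<close>

lemma tlift_ad_proj:
  assumes a: "a \<in> carrier A"
  shows "tlift K A (\<lambda>a1 a2. ad (S' (\<pi> a2)) (proj a1)) (comult A a) = O.proj a"
proof -
  note m = A.A_module A.A_module A.A_module and ac = A.comult_closed[OF a]
  let ?f = "\<lambda>c1 c2 c3. j (S' (\<pi> c3)) \<otimes>\<^bsub>A\<^esub> (proj c1 \<otimes>\<^bsub>A\<^esub> j (\<pi> c2))"
  have b23: "bilinear K A A A (?f c1)" if "c1 \<in> carrier A" for c1
    by (rule bilinearI)
      (intro linear_mult_left[OF A.A_algebra jS'\<pi>_linear] linear_mult_right[OF A.A_algebra]
          linear_mult_right[OF A.A_algebra j\<pi>_linear];
        use that in simp)+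
  have l1: "(\<lambda>c1. ?f c1 c2 c3) \<in> linear_hom K A A" if "c2 \<in> carrier A" "c3 \<in> carrier A" for c2 c3
    by (rule linear_mult_right[OF A.A_algebra linear_mult_left[OF A.A_algebra proj_linear]]) (use that in simp_all)
  have ad: "ad (S' (\<pi> a2)) (proj a1) = tlift K A (?f a1) (comult A a2)" if x: "a1 \<in> carrier A" "a2 \<in> carrier A" for a1 a2
  proof -
    have b: "bilinear K H H A (\<lambda>h1 h2. j (S' h2) \<otimes>\<^bsub>A\<^esub> (proj a1 \<otimes>\<^bsub>A\<^esub> j h1))"
      by (rule bilinearI)
        (intro linear_mult_left[OF A.A_algebra linear_comp[OF j_linear S'_linear]] linear_mult_right[OF A.A_algebra]
          linear_mult_right[OF A.A_algebra j_linear]; use x in simp)+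
    have "ad (S' (\<pi> a2)) (proj a1) = tlift K A (\<lambda>h1 h2. j (S' h2) \<otimes>\<^bsub>A\<^esub> (proj a1 \<otimes>\<^bsub>A\<^esub> j h1)) (comult H (\<pi> a2))"
      using x by (simp add: ad_S' O.ad_def)
    also have "\<dots> = tlift K A (?f a1) (comult A a2)"
      by (rule tlift_comult_hom[OF \<pi>_hom A.A_module b x(2)])
    finally show ?thesis .
  qed
  have "tlift K A (\<lambda>a1 a2. ad (S' (\<pi> a2)) (proj a1)) (comult A a)
    = tlift K A (\<lambda>a1 a2. tlift K A (?f a1) (comult A a2)) (comult A a)"
    by (rule tlift_cong[OF m ac]) (simp, rule ad)
  also have "\<dots> = tlift K A (\<lambda>x c3. tlift K A (\<lambda>c1 c2. ?f c1 c2 c3) (comult A x)) (comult A a)"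
    by (rule A.coassoc_trilinear[OF A.A_module b23 l1 a, symmetric])
  also have "\<dots> = tlift K A (\<lambda>x c3. j (S' (\<pi> c3)) \<otimes>\<^bsub>A\<^esub> x) (comult A a)"
  proof (rule tlift_cong[OF m ac, symmetric])
    fix x c3 assume x: "x \<in> carrier A" "c3 \<in> carrier A"
    then show "j (S' (\<pi> c3)) \<otimes>\<^bsub>A\<^esub> x \<in> carrier A" by simp
    have "tlift K A (\<lambda>c1 c2. ?f c1 c2 c3) (comult A x) = j (S' (\<pi> c3)) \<otimes>\<^bsub>A\<^esub> conv K A A proj (\<lambda>a. j (\<pi> a)) x"
      unfolding AA.conv_apply[OF x(1)]
      by (rule linear_tlift[OF m A.A_module linear_mult_right[OF A.A_algebra linear_id] A.comult_closed[OF x(1)], symmetric])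
        (use x in simp_all)
    then show "j (S' (\<pi> c3)) \<otimes>\<^bsub>A\<^esub> x = tlift K A (\<lambda>c1 c2. ?f c1 c2 c3) (comult A x)"
      by (simp only: proj_j\<pi>[OF x(1)])
  qed
  finally show ?thesis unfolding op_proj .
qed

lemma op_comult_closed:
  assumes r: "r \<in> coinv"
  shows "yd_comult Rop r \<in> carrier (tensor_space K R R)"
  unfolding op_yd_comult
  by (rule comultR_tlift_closed[OF r RR_module], rule coact_tlift_closed[OF _ RR_module]) (simp_all add: ad_coinv)

text \<open>Coassociativity groups the leg that acts with the leg that is acted on, so that
  \<open>tlift_ad_proj\<close> turns the pair into \<open>O.proj\<close>.\<close>

lemma op_comult:
  assumes r: "r \<in> coinv"
  shows "tlift K (tensor_space K A A) (tens K A A) (yd_comult Rop r)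
    = tlift K (tensor_space K A A) (\<lambda>r1 r2. tens K A A (O.proj r1) r2) (comult A r)"
proof -
  have T2: "tlift K (tensor_space K A A) = tlift K T2" by (simp add: T2_def)
  let ?E = "tlift K T2 (tens K A A)"
  have "bilinear K R R T2 (\<lambda>x y. tens K A A x y)"
    using bilinear_tens[OF A.A_module A.A_module incl_linear incl_linear] by (simp add: T2_def)
  note bE = this[simplified eta_contract_eq]
  note E = tlift_linear[OF R_module R_module AT.B_module bE]
  have Et: "?E (tens K R R x y) = v1 x \<otimes>\<^bsub>T2\<^esub> v2 y" if "x \<in> coinv" "y \<in> coinv" for x y
    using tlift_tens[OF R_module R_module AT.B_module bE, of x y] that by (simp add: v_tens)
  let ?g = "\<lambda>c1 c2 c3. v1 (ad (S' (\<pi> c2)) c1) \<otimes>\<^bsub>T2\<^esub> v2 c3"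
  define G where "G r1 r2 = tlift K T2 (?g r1) (comult A r2)" for r1 r2
  have adl: "(\<lambda>h. v1 (ad (S' h) x)) \<in> linear_hom K H T2" if "x \<in> carrier A" for x
    by (rule linear_comp[OF v1_linear linear_comp[OF ad_linear_left[OF that] S'_linear]])
  have b23: "bilinear K A A T2 (?g c1)" if "c1 \<in> carrier A" for c1
    by (rule bilinear_mult[OF T2_algebra linear_comp[OF adl[OF that] \<pi>_linear] v2_linear])
  have l1: "(\<lambda>c1. ?g c1 c2 c3) \<in> linear_hom K A T2" if "c2 \<in> carrier A" "c3 \<in> carrier A" for c2 c3
    by (rule linear_mult_left[OF T2_algebra linear_comp[OF v1_linear ad_linear]]) (use that in simp_all)
  have bG: "bilinear K A A T2 G" unfolding G_def[abs_def]
    by (rule bilinearI, rule linear_tlift_param[OF A.A_module A.A_module AT.B_module A.A_module], simp, rule l1, assumption+,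
        rule linear_tlift_arg[OF A.A_module A.A_module AT.B_module b23 A.comult_linear])
  have inner: "?E (tlift K (tensor_space K R R) (\<lambda>x y. tens K R R (act R (S' x) r1) y) (coact R r2)) = G r1 r2"
    if c: "r1 \<in> coinv" "r2 \<in> coinv" for r1 r2
  proof -
    have "?E (tlift K (tensor_space K R R) (\<lambda>x y. tens K R R (act R (S' x) r1) y) (coact R r2))
      = conv K A T2 (\<lambda>a. v1 (ad (S' (\<pi> a)) r1)) v2 r2"
      by (rule embed_coact[OF T2_algebra RR_module E c(2) adl v2_linear])
        (use c in \<open>simp_all add: ad_coinv Et\<close>)
    then show ?thesis using c by (simp only: G_def AT.conv_apply coinv_closed)
  qed
  have co: "tlift K (tensor_space K R R) (\<lambda>x y. tens K R R (act R (S' x) r1) y) (coact R r2) \<in> carrier (tensor_space K R R)"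
    if "r1 \<in> coinv" "r2 \<in> coinv" for r1 r2
    by (rule coact_tlift_closed[OF that(2) RR_module]) (use that in \<open>simp add: ad_coinv\<close>)
  have "?E (yd_comult Rop r) = tlift K T2 (\<lambda>a1 a2. G (proj a1) a2) (comult A r)"
    unfolding op_yd_comult
    by (rule embed_comultR_bilinear[OF T2_algebra RR_module E r bG])
      (rule co inner; assumption)+
  also have "\<dots> = tlift K T2 (\<lambda>x c3. tlift K T2 (\<lambda>c1 c2. ?g (proj c1) c2 c3) (comult A x)) (comult A r)"
    unfolding G_def
    by (rule A.coassoc_trilinear[OF AT.B_module b23[OF proj_closed] linear_comp[OF l1 proj_linear], symmetric]) (use r in simp_all)
  also have "\<dots> = tlift K T2 (\<lambda>x c3. tens K A A (O.proj x) c3) (comult A r)"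
  proof (rule tlift_cong[OF A.A_module A.A_module AT.B_module _ _ sym])
    show "comult A r \<in> carrier (tensor_space K A A)" using r by simp
    fix x c3 assume x: "x \<in> carrier A" "c3 \<in> carrier A"
    have o: "O.proj x \<in> carrier A" using O.proj_closed[of x] x by simp
    have "v1 (O.proj x) \<otimes>\<^bsub>T2\<^esub> v2 c3 = tlift K T2 (\<lambda>c1 c2. ?g (proj c1) c2 c3) (comult A x)"
      unfolding tlift_ad_proj[OF x(1), symmetric]
      by (rule linear_tlift[OF A.A_module A.A_module A.A_module AT.B_module
            linear_mult_left[OF T2_algebra v1_linear v_closed(2)[OF x(2)]] A.comult_closed[OF x(1)]])
        (simp add: proj_closed)
    then show "tens K A A (O.proj x) c3 = tlift K T2 (\<lambda>c1 c2. ?g (proj c1) c2 c3) (comult A x)"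
      by (simp only: v_tens[OF o x(2)])
    then show "tlift K T2 (\<lambda>c1 c2. ?g (proj c1) c2 c3) (comult A x) \<in> carrier T2"
      using o x by (simp add: T2_carrier flip: \<open>tens K A A (O.proj x) c3 = _\<close>)
  qed
  finally show ?thesis unfolding T2 .
qed

text \<open>As an instance over the opposite data, \<open>Rop\<close> inherits the Yetter-Drinfel'd
  bialgebra axioms and the canonical isomorphism.\<close>

lemma op_hopf_projection_yd: "hopf_projection_yd K (op_alg H) S' (op_alg A) j \<pi> Rop"
proof (intro hopf_projection_yd.intro hopf_projection_yd_axioms.intro op_hopf_projection)
  fix r assume "r \<in> O.coinv"
  then have r: "r \<in> coinv" by (simp add: op_coinv)
  show "coact Rop r = tensor_restrict K (op_alg H) (op_alg A) (op_alg H) ((op_alg A)\<lparr>carrier := O.coinv\<rparr>)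
      (tlift K (tensor_space K (op_alg H) (op_alg A)) (\<lambda>r1 r2. tens K (op_alg H) (op_alg A) (\<pi> r1) r2) (comult (op_alg A) r))"
    using R_coact[OF r] by (simp add: op_coinv op_alg_tensor_restrict)
  have "tensor_restrict K A A (A\<lparr>carrier := coinv\<rparr>) (A\<lparr>carrier := coinv\<rparr>)
      (tlift K (tensor_space K A A) (\<lambda>r1 r2. tens K A A (O.proj r1) r2) (comult A r)) = yd_comult Rop r"
    by (rule tensor_restrict_eq[OF A.A_module A.A_module restricted_module restricted_module, where p = proj and q = proj])
      (use r op_comult_closed[OF r] op_comult[OF r] in \<open>simp_all add: incl_linear proj_linear_R proj_coinv_id\<close>)
  then show "yd_comult Rop r = tensor_restrict K (op_alg A) (op_alg A) ((op_alg A)\<lparr>carrier := O.coinv\<rparr>)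
      ((op_alg A)\<lparr>carrier := O.coinv\<rparr>)
      (tlift K (tensor_space K (op_alg A) (op_alg A)) (\<lambda>r1 r2. tens K (op_alg A) (op_alg A) (O.proj r1) r2)
        (comult (op_alg A) r))"
    by (simp add: op_coinv op_alg_tensor_restrict)
next
  fix h r assume h: "h \<in> carrier (op_alg H)" and "r \<in> O.coinv"
  then have r: "r \<in> coinv" by (simp only: op_coinv)
  have h: "h \<in> carrier H" using h by simp
  show "act Rop h r = O.ad h r"
    unfolding op_yd_simps R_act[OF S'_closed[OF h] r] by (rule ad_S'[OF h coinv_closed[OF r]])
qed (simp_all only: op_yd_simps R_simps op_alg_simps op_coinv)

text \<open>Both structures satisfy the equations of \<open>hopf_projection_yd\<close> over the
  opposite data, and these determine all operations on the coinvariants.\<close>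

lemma op_same_yd_bialgebra:
  "same_yd_bialgebra K (op_alg H) (assoc_bialgebra K (op_alg A) (op_alg H) S' j \<pi>) Rop"
proof -
  note O1 = hopf_projection_yd.R_simps[OF O.assoc_bialgebra_yd] hopf_projection_yd.R_act[OF O.assoc_bialgebra_yd]
    hopf_projection_yd.R_coact[OF O.assoc_bialgebra_yd] hopf_projection_yd.R_comult[OF O.assoc_bialgebra_yd]
  note O2 = hopf_projection_yd.R_simps[OF op_hopf_projection_yd] hopf_projection_yd.R_act[OF op_hopf_projection_yd]
    hopf_projection_yd.R_coact[OF op_hopf_projection_yd] hopf_projection_yd.R_comult[OF op_hopf_projection_yd]
  show ?thesis
    unfolding same_yd_bialgebra_def same_vector_space_def O1(1-7) O2(1-7)
    by (intro conjI ballI refl; simp only: O1(8-10) O2(8-10))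
qed


section \<open>The isomorphism between the bi-products\<close>

definition "op_map = tlift K (biproduct K R H)
  (\<lambda>r h. tens K R H \<one>\<^bsub>R\<^esub> h \<otimes>\<^bsub>biproduct K R H\<^esub> tens K R H r \<one>\<^bsub>H\<^esub>)"

lemma [simp]:
  "tensor_space K Rop V = tensor_space K R V" "tens K Rop V = tens K R V"
  by (rule tensor_cong; simp)+

lemma op_map_bilinear:
  "bilinear K R H RH (\<lambda>r h. tens K R H \<one>\<^bsub>R\<^esub> h \<otimes>\<^bsub>biproduct K R H\<^esub> tens K R H r \<one>\<^bsub>H\<^esub>)"
proof -
  \<comment> \<open>\<open>canonical_iso\<close> contains that the bi-product is a bialgebra; this
    supplies the bilinearity of its product.\<close>
  interpret B: bialgebra K "biproduct K R H"
    using canonical_iso by (simp add: bialgebra_iso_def bialgebra_hom_def)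
  note n = biproduct_normalize
  show ?thesis
  proof (rule bilinearI)
    show "(\<lambda>r. tens K R H \<one>\<^bsub>R\<^esub> h \<otimes>\<^bsub>biproduct K R H\<^esub> tens K R H r \<one>\<^bsub>H\<^esub>) \<in> linear_hom K R RH" if "h \<in> carrier H" for h
      by (rule linear_mult_right[OF B.A_algebra, unfolded n, OF linear_tens_left[OF R_module H.A_module linear_id]])
        (use that coinv_one in simp_all)
    show "(\<lambda>h. tens K R H \<one>\<^bsub>R\<^esub> h \<otimes>\<^bsub>biproduct K R H\<^esub> tens K R H r \<one>\<^bsub>H\<^esub>) \<in> linear_hom K H RH" if "r \<in> carrier R" for r
      by (rule linear_mult_left[OF B.A_algebra, unfolded n, OF linear_tens_right[OF R_module H.A_module linear_id]])
        (use that coinv_one in simp_all)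
  qed
qed

lemma op_map_tens: "\<lbrakk>r \<in> coinv; h \<in> carrier H\<rbrakk>
    \<Longrightarrow> op_map (tens K R H r h) = tens K R H \<one>\<^bsub>R\<^esub> h \<otimes>\<^bsub>biproduct K R H\<^esub> tens K R H r \<one>\<^bsub>H\<^esub>"
  unfolding op_map_def biproduct_normalize
  by (rule tlift_tens[OF R_module H.A_module RH_module op_map_bilinear]) simp_all

lemma op_map_linear: "op_map \<in> linear_hom K RH RH"
  unfolding op_map_def biproduct_normalize
  by (rule tlift_linear[OF R_module H.A_module RH_module op_map_bilinear])

text \<open>On \<open>r # h\<close> both sides are the product of \<open>j h\<close> and
  \<open>r\<close> in \<open>A\<close>: the left one by multiplicativity, the right one because the
  product of \<open>op_alg A\<close> is reversed.\<close>

lemma canonical_op_map: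
  assumes t: "t \<in> carrier RH"
  shows "canonical_map K A j (op_map t) = canonical_map K (op_alg A) j t"
proof (rule linear_ext_tensor[OF R_module H.A_module linear_comp[OF canonical_linear op_map_linear] _ _ t])
  show "canonical_map K (op_alg A) j \<in> linear_hom K RH A"
    using hopf_projection_yd.canonical_linear[OF op_hopf_projection_yd] by (simp add:)
  fix r h assume c: "r \<in> carrier R" "h \<in> carrier H"
  then show "canonical_map K A j (op_map (tens K R H r h)) = canonical_map K (op_alg A) j (tens K R H r h)"
    using hopf_projection_yd.canonical_tens[OF op_hopf_projection_yd, of r h]
    by (simp add: op_map_tens canonical_mult canonical_tens op_coinv coinv_one)
qed

lemma op_map_iso: "op_map \<in> bialgebra_iso K (biproduct K Rop (op_alg H)) (op_alg (biproduct K R H))"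
  by (rule bialgebra_iso_factor[OF op_bialgebra_iso[OF canonical_iso] hopf_projection_yd.canonical_iso[OF op_hopf_projection_yd]])
    (use linear_closed[OF op_map_linear] in \<open>simp_all add: canonical_op_map\<close>)

end

theorem proposition6p1:
  fixes K :: "('k, 'x) ring_scheme" and H :: "('k, 'h) bialg" and A :: "('k, 'a) bialg"
    and S :: "'h \<Rightarrow> 'h" and j :: "'h \<Rightarrow> 'a" and \<pi> :: "'a \<Rightarrow> 'h"
    and R :: "('k, 'h, 'a) yd_bialg"
  assumes "hopf_algebra K H S"
    and "bij_betw S (carrier H) (carrier H)"
    and "bialgebra K A"
    and "j \<in> bialgebra_hom K H A"
    and "\<pi> \<in> bialgebra_hom K A H"
    and "\<forall>h\<in>carrier H. \<pi> (j h) = h"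
    and "R = assoc_bialgebra K A H S j \<pi>"
    and "S' = inv_into (carrier H) S"
    and "Rop = op_yd K H S R"
    and "\<phi> = tlift K (biproduct K R H)
      (\<lambda>r h. tens K R H \<one>\<^bsub>R\<^esub> h \<otimes>\<^bsub>biproduct K R H\<^esub> tens K R H r \<one>\<^bsub>H\<^esub>)"
    and "f = canonical_map K A j"
    and "g = canonical_map K (op_alg A) j"
  shows "(j \<in> bialgebra_hom K (op_alg H) (op_alg A) \<and>
          \<pi> \<in> bialgebra_hom K (op_alg A) (op_alg H) \<and>
          (\<forall>h\<in>carrier (op_alg H). \<pi> (j h) = h) \<and>
          same_vector_space K Rop R \<and>
          yd_bialgebra K (op_alg H) S' Rop \<and>
          same_yd_bialgebra K (op_alg H) (assoc_bialgebra K (op_alg A) (op_alg H) S' j \<pi>) Rop)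
       \<and> ((\<forall>r\<in>carrier R. \<forall>h\<in>carrier H. \<phi> (tens K Rop (op_alg H) r h) =
            tens K R H \<one>\<^bsub>R\<^esub> h \<otimes>\<^bsub>biproduct K R H\<^esub> tens K R H r \<one>\<^bsub>H\<^esub>) \<and>
          \<phi> \<in> bialgebra_iso K (biproduct K Rop (op_alg H)) (op_alg (biproduct K R H)) \<and>
          f \<in> bialgebra_iso K (op_alg (biproduct K R H)) (op_alg A) \<and>
          g \<in> bialgebra_iso K (biproduct K Rop (op_alg H)) (op_alg A) \<and>
          (\<forall>t\<in>carrier (biproduct K Rop (op_alg H)). f (\<phi> t) = g t))"
proof -
  interpret P: hopf_projection K H S A j \<pi>
    by (intro hopf_projection.intro hopf_projection_axioms.intro assms(1,3,4,5) hopf_algebra.axioms(1)[OF assms(1), THEN bialgebra.axioms(1), THEN k_algebraD(1)])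
      (use assms(6) in simp)
  \<comment> \<open>One instance carries both halves: the given data directly, the opposite data
    through the sublocale \<open>O\<close> and \<open>op_hopf_projection_yd\<close>.\<close>
  interpret D: hopf_projection_op K H S A j \<pi> R
    unfolding assms(7) by (intro hopf_projection_op.intro hopf_projection_op_axioms.intro P.assoc_bialgebra_yd assms(2))
  have \<phi>: "\<phi> = D.op_map" by (simp only: assms(10) D.op_map_def)
  show ?thesis
    unfolding \<phi> assms(8,9,11,12)
    using D.O.j_hom D.O.\<pi>_hom P.\<pi>_j hopf_projection_yd.R_yd_bialgebra[OF D.op_hopf_projection_yd] D.op_same_yd_bialgebra D.op_map_iso
      op_bialgebra_iso[OF D.canonical_iso] hopf_projection_yd.canonical_iso[OF D.op_hopf_projection_yd]
    by (simp add: same_vector_space_def D.op_map_tens D.canonical_op_map)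
qed

end
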